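(* Let $M\in\mathbb N$ and let $\varepsilon_M>0$ be such that $P^\varepsilon_N(\eta)\ge\frac\lambda2|\eta|^2$ for all $\eta\in K$, all $0<\varepsilon<\varepsilon_M$ and all $N\in\mathbb N$ with $N\le M$. Then there exists a constant $C>0$, independent of $\varepsilon$, such that for every $0<\varepsilon<\varepsilon_M$ with $K\subset Z/\varepsilon$ the following holds. Let $u^*_M$ be the unique optimal control of $(\mathrm P^*_M)$ and let $y^*_M$ be the solution of $$\sum_{k=1}^M\varepsilon^{2k-2}(-1)^k\mathbb A^*_{2k}D^{2k}y^*_M+y^*_M=f+u^*_M .$$ Let $\hat u^*_{\varepsilon,0}$ be the Bloch coefficient of order $m=0$ of the optimal control $u^*_\varepsilon$ of $(\mathrm P_\varepsilon)$ and $$\tilde y^*_\varepsilon(x)=\int_K\frac{\hat f(\eta)+\hat u^*_{\varepsilon,0}(\eta)}{1+\lambda^\varepsilon_0(\eta)}e^{2\pi i\eta\cdot x}\,d\eta .$$ Then $$\|\tilde y^*_\varepsilon-y^*_M\|_{L^2(\mathbb R^n)}\le C\varepsilon^{2M}.$$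
   Context: **Bloch waves.** Let $n\in\mathbb N$, $Y=[0,1]^n$, $Z=[-\tfrac12,\tfrac12)^n$. $A\in L^\infty(\mathbb R^n;\mathbb R^{n\times n})$ is symmetric, uniformly elliptic and $Y$-periodic; $A^\varepsilon(x)=A(x/\varepsilon)$ for $\varepsilon>0$. For $\eta\in Z$ let $0\le\lambda_0(\eta)\le\lambda_1(\eta)\le\dots$ be the eigenvalues of $-(\nabla+2\pi i\eta)\cdot(A(\nabla+2\pi i\eta))$ on $Y$-periodic functions, with eigenfunctions $\Phi_m(\cdot;\eta)\in H^1_\sharp(Y;\mathbb C)$, $m\in\mathbb N_0$, forming an orthonormal basis of $L^2_\sharp(Y;\mathbb C)$ ($\sharp$: periodic functions), chosen measurable in $\eta$ and with $\Phi_m(\cdot;-\eta)=\overline{\Phi_m(\cdot;\eta)}$ for a.e. $\eta$. For $\eta\in Z/\varepsilon$ put $\lambda^\varepsilon_m(\eta)=\varepsilon^{-2}\lambda_m(\varepsilon\eta)$ and $\omega^\varepsilon_m(x;\eta)=\Phi_m(x/\varepsilon;\varepsilon\eta)e^{2\pi i\eta\cdot x}$. The Bloch coefficients of $u\in L^2(\mathbb R^n;\mathbb C)$ are $\hat u^\varepsilon_m(\eta)=\int_{\mathbb R^n}u\,\overline{\omega^\varepsilon_m(\cdot;\eta)}\,dx$ ($L^2$ sense), so $u=\int_{Z/\varepsilon}\sum_m\hat u^\varepsilon_m(\eta)\omega^\varepsilon_m(\cdot;\eta)\,d\eta$. The Fourier transform is $\hat u(\eta)=\int u(x)e^{-2\pi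 ix\cdot\eta}dx$. $L^2(\mathbb R^n)$, $H^k(\mathbb R^n)$ denote real-valued functions. The adaption of $f\in L^2(\mathbb R^n;\mathbb C)$ is $\mathcal A^\varepsilon(f)=\int_{Z/\varepsilon}\hat f(\eta)\omega^\varepsilon_0(\cdot;\eta)\,d\eta$. **Original problem.** Fix $\mu_1,\mu_2\ge0$, $\kappa>0$. Let $E^\varepsilon(y)=\int_{\mathbb R^n}\nabla y\cdot A^\varepsilon\nabla y+|y|^2\,dx$ and $J^\varepsilon(u,y)=\frac{\mu_1}2E^\varepsilon(y-y^\varepsilon_{d,1})+\frac{\mu_2}2\int|y-y^\varepsilon_{d,2}|^2dx+\frac\kappa2\int|u|^2dx$, where $y^\varepsilon_{d,1}\in H^1(\mathbb R^n)$, $y^\varepsilon_{d,2}\in L^2(\mathbb R^n)$. Problem $(\mathrm P_\varepsilon)$: minimize $J^\varepsilon(u,y)$ over $(u,y)\in U^\varepsilon_{ad}\times H^1(\mathbb R^n)$ subject to $-\nabla\cdot(A^\varepsilon\nabla y)+y=f^\varepsilon+u$ weakly on $\mathbb R^n$, with $f^\varepsilon\in L^2(\mathbb R^n)$ and $\emptyset\ne U^\varepsilon_{ad}\subset L^2(\mathbb R^n)$. Its unique solution is $(u^*_\varepsilon,y^*_\varepsilon)$. **Assumption on data.** There are $f,y_{d,1},y_{d,2}\in L^2(\mathbb R^n)$ and a compact $K\subset\mathbb R^n$ with $-K=K$ such that $f^\varepsilon=\mathcal A^\varepsilon(f)$, $y^\varepsilon_{d,j}=\mathcal A^\varepsilon(y_{d,j})$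 ($j=1,2$), and the supports of $\hat f,\hat y_{d,1},\hat y_{d,2}$ lie in $K$. **Assumption on admissible sets.** (i) $U^\varepsilon_{ad}$ is convex and closed. (ii) There is $u_0\in L^2(\mathbb R^n)$ with $\mathcal A^\varepsilon(u_0)\in U^\varepsilon_{ad}$ for every $\varepsilon>0$. (iii) For $u\in U^\varepsilon_{ad}$ the projection $u_K=\int_K\hat u^\varepsilon_0(\eta)\omega^\varepsilon_0(\cdot;\eta)\,d\eta$ lies in $U^\varepsilon_{ad}$. **Effective problem.** $\mathbb A^*_{2k}$ ($k\ge1$) are real tensors of order $2k$ with $\lambda_0(\eta)=\sum_{k=1}^M(2\pi)^{2k}\mathbb A^*_{2k}\cdot\eta^{\otimes2k}+O(|\eta|^{2M+2})$ as $\eta\to0$ for each $M$ (Taylor expansion of the even function $\lambda_0$, analytic near $0$), where $\mathbb A^*_{2k}\cdot\eta^{\otimes2k}=\sum_{i_1,\dots,i_{2k}}(\mathbb A^*_{2k})_{i_1\dots i_{2k}}\eta_{i_1}\cdots\eta_{i_{2k}}$; $\mathbb A_2^*$ is symmetric positive definite and $\lambda>0$ satisfies $\mathbb A^*_2\cdot\eta^{\otimes2}\ge\lambda|\eta|^2$ for all $\eta$. $P^\varepsilon_N(\eta)=\sum_{k=1}^N\varepsilon^{2k-2}(2\pi)^{2k}\mathbb A^*_{2k}\cdot\eta^{\otimes2k}$. Let $\langle D^ky,D^ky\rangle_{\mathbb A^*_{2k}}=\sum(\mathbb A^*_{2k})_{i_1\dots i_{2k}}\,\partial^k_{x_{i_1}\dots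 x_{i_k}}y\;\partial^k_{x_{i_{k+1}}\dots x_{i_{2k}}}y$, $\mathbb A^*_{2k}D^{2k}=\sum(\mathbb A^*_{2k})_{i_1\dots i_{2k}}\partial^{2k}_{x_{i_1}\dots x_{i_{2k}}}$, $E^*_M(y)=\int_{\mathbb R^n}\sum_{k=1}^M\varepsilon^{2k-2}\langle D^ky,D^ky\rangle_{\mathbb A^*_{2k}}+|y|^2\,dx$, and $J^*_M(u,y)=\frac{\mu_1}2E^*_M(y-y_{d,1})+\frac{\mu_2}2\int|y-y_{d,2}|^2dx+\frac\kappa2\int|u|^2dx$. Problem $(\mathrm P^*_M)$: minimize $J^*_M(u,y)$ over $(u,y)\in U^*_{ad}\times H^{2M}(\mathbb R^n)$ subject to $\sum_{k=1}^M\varepsilon^{2k-2}(-1)^k\mathbb A^*_{2k}D^{2k}y+y=f+u$, where $U^*_{ad}=\{u=\int_K\hat u(\eta)e^{2\pi i\eta\cdot x}d\eta\;:\;\mathcal A^\varepsilon(u)\in U^\varepsilon_{ad}\}$. *)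

theory Defs
  imports "HOL-Analysis.Analysis" "HOL-Library.Landau_Symbols"
begin

text \<open>
  Elements of Lebesgue spaces are represented by Borel functions on the whole space; every notion
  below is insensitive to changes on null sets.
\<close>

section \<open>Square-integrable functions\<close>

definition L2_on :: "(real^'n) set \<Rightarrow> (real^'n \<Rightarrow> 'b::{banach,second_countable_topology}) set" where
  "L2_on S = {u. u \<in> borel_measurable lborel \<and> set_integrable lborel S (\<lambda>x. (norm (u x))\<^sup>2)}"

abbreviation L2 :: "(real^'n \<Rightarrow> 'b::{banach,second_countable_topology}) set" where
  "L2 \<equiv> L2_on UNIV"

definition L2norm :: "(real^'n \<Rightarrow> 'b::{banach,second_countable_topology}) \<Rightarrow> real" where
  "L2norm u = sqrt (LINT x|lborel. (norm (u x))\<^sup>2)"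

text \<open>Taking a constant sequence, closedness includes invariance under modification on null sets.\<close>

definition L2_closed :: "(real^'n \<Rightarrow> real) set \<Rightarrow> bool" where
  "L2_closed U \<longleftrightarrow> (\<forall>s u. (\<forall>j::nat. s j \<in> U) \<and> u \<in> L2
      \<and> (\<lambda>j. L2norm (\<lambda>x. s j x - u x)) \<longlonglongrightarrow> 0 \<longrightarrow> u \<in> U)"

definition fun_convex :: "(real^'n \<Rightarrow> real) set \<Rightarrow> bool" where
  "fun_convex U \<longleftrightarrow> (\<forall>u\<in>U. \<forall>v\<in>U. \<forall>t\<in>{0..1}. (\<lambda>x. (1 - t) * u x + t * v x) \<in> U)"

text \<open>
  Admissible controls are real functions, whereas adaptions and Bloch projections are complex-valued
  and real only almost everywhere.
\<close>

definition ae_in :: "(real^'n \<Rightarrow> complex) \<Rightarrow> (real^'n \<Rightarrow> real) set \<Rightarrow> bool" where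
  "ae_in w U \<longleftrightarrow> (\<exists>u\<in>U. AE x in lborel. complex_of_real (u x) = w x)"

section \<open>Weak derivatives and Sobolev spaces\<close>

definition part_deriv :: "'n::finite \<Rightarrow> (real^'n \<Rightarrow> real) \<Rightarrow> real^'n \<Rightarrow> real" where
  "part_deriv i \<phi> x = frechet_derivative \<phi> (at x) (axis i 1)"

primrec iter_deriv :: "'n::finite list \<Rightarrow> (real^'n \<Rightarrow> real) \<Rightarrow> real^'n \<Rightarrow> real" where
  "iter_deriv [] \<phi> = \<phi>"
| "iter_deriv (i # is) \<phi> = part_deriv i (iter_deriv is \<phi>)"

definition test_fun :: "(real^'n::finite \<Rightarrow> real) \<Rightarrow> bool" where
  "test_fun \<phi> \<longleftrightarrow> (\<forall>is x. iter_deriv is \<phi> differentiable (at x)) \<and> compact (closure {x. \<phi> x \<noteq> 0})"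

definition loc_integrable :: "(real^'n \<Rightarrow> 'b::{banach,second_countable_topology}) \<Rightarrow> bool" where
  "loc_integrable u \<longleftrightarrow> (\<forall>R. set_integrable lborel (cball 0 R) u)"

definition has_weak_deriv ::
  "'n::finite list \<Rightarrow> (real^'n \<Rightarrow> 'b::{banach,second_countable_topology}) \<Rightarrow> (real^'n \<Rightarrow> 'b) \<Rightarrow> bool" where
  "has_weak_deriv is u g \<longleftrightarrow> loc_integrable u \<and> loc_integrable g \<and>
     (\<forall>\<phi>. test_fun \<phi> \<longrightarrow>
        (LINT x|lborel. iter_deriv is \<phi> x *\<^sub>R u x) = (- 1) ^ length is *\<^sub>R (LINT x|lborel. \<phi> x *\<^sub>R g x))"

definition wderiv ::
  "'n::finite list \<Rightarrow> (real^'n \<Rightarrow> 'b::{banach,second_countable_topology}) \<Rightarrow> real^'n \<Rightarrow> 'b" where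
  "wderiv is u = (SOME g. has_weak_deriv is u g)"

definition Hk :: "nat \<Rightarrow> (real^'n::finite \<Rightarrow> real) set" where
  "Hk k = {u \<in> L2. \<forall>is. length is \<le> k \<longrightarrow> (\<exists>g\<in>L2. has_weak_deriv is u g)}"

definition wgrad :: "(real^'n::finite \<Rightarrow> real) \<Rightarrow> real^'n \<Rightarrow> real^'n" where
  "wgrad u x = (\<chi> i. wderiv [i] u x)"

section \<open>Periodic functions and the Bloch eigenvalue problem\<close>

definition Ycell :: "(real^'n) set" where
  "Ycell = {x. \<forall>i. 0 \<le> x $ i \<and> x $ i \<le> 1}"

definition Zcell :: "(real^'n) set" where
  "Zcell = {\<eta>. \<forall>i. - 1/2 \<le> \<eta> $ i \<and> \<eta> $ i < 1/2}"

definition Zscaled :: "real \<Rightarrow> (real^'n) set" where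
  "Zscaled \<epsilon> = {\<eta>. \<epsilon> *\<^sub>R \<eta> \<in> Zcell}"

definition Y_periodic :: "(real^'n::finite \<Rightarrow> 'b) \<Rightarrow> bool" where
  "Y_periodic v \<longleftrightarrow> (\<forall>i. AE x in lborel. v (x + axis i 1) = v x)"

definition L2per :: "(real^'n::finite \<Rightarrow> complex) set" where
  "L2per = {v \<in> L2_on Ycell. Y_periodic v}"

definition H1per :: "(real^'n::finite \<Rightarrow> complex) set" where
  "H1per = {v \<in> L2per. \<forall>i. \<exists>g\<in>L2per. has_weak_deriv [i] v g}"

definition inner_Y :: "(real^'n \<Rightarrow> complex) \<Rightarrow> (real^'n \<Rightarrow> complex) \<Rightarrow> complex" where
  "inner_Y v w = (LINT x:Ycell|lborel. v x * cnj (w x))"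

definition coefficient_field :: "(real^'n::finite \<Rightarrow> real^'n^'n) \<Rightarrow> bool" where
  "coefficient_field A \<longleftrightarrow> A \<in> borel_measurable lborel
     \<and> (\<exists>\<Lambda>. AE x in lborel. norm (A x) \<le> \<Lambda>)
     \<and> (AE x in lborel. transpose (A x) = A x)
     \<and> (\<exists>\<alpha>>0. AE x in lborel. \<forall>\<xi>. \<alpha> * (norm \<xi>)\<^sup>2 \<le> \<xi> \<bullet> (A x *v \<xi>))
     \<and> Y_periodic A"

definition shifted_deriv :: "real^'n::finite \<Rightarrow> (real^'n \<Rightarrow> complex) \<Rightarrow> 'n \<Rightarrow> real^'n \<Rightarrow> complex" where
  "shifted_deriv \<eta> v i x = wderiv [i] v x + 2 * complex_of_real pi * \<i> * complex_of_real (\<eta> $ i) * v x"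

definition bloch_form ::
  "(real^'n::finite \<Rightarrow> real^'n^'n) \<Rightarrow> real^'n \<Rightarrow> (real^'n \<Rightarrow> complex) \<Rightarrow> (real^'n \<Rightarrow> complex) \<Rightarrow> complex" where
  "bloch_form A \<eta> v w = (LINT x:Ycell|lborel. (\<Sum>i\<in>UNIV. \<Sum>j\<in>UNIV.
      complex_of_real (A x $ i $ j) * shifted_deriv \<eta> v j x * cnj (shifted_deriv \<eta> w i x)))"

text \<open>
  The eigenvalues are listed with multiplicity; that the list is exhaustive is the completeness of
  the eigenfunctions. The reflection \<open>-\<eta>\<close> leaves the half-open cell for \<open>\<eta>\<close> in a null set only.
\<close>

definition bloch_system ::
  "(real^'n::finite \<Rightarrow> real^'n^'n) \<Rightarrow> (nat \<Rightarrow> real^'n \<Rightarrow> real) \<Rightarrow> (nat \<Rightarrow> real^'n \<Rightarrow> real^'n \<Rightarrow> complex) \<Rightarrow> bool"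
where
  "bloch_system A lam \<Phi> \<longleftrightarrow>
     (\<forall>\<eta>\<in>Zcell. 0 \<le> lam 0 \<eta> \<and> (\<forall>m. lam m \<eta> \<le> lam (Suc m) \<eta>))
   \<and> (\<forall>\<eta>\<in>Zcell. \<forall>m. \<Phi> m \<eta> \<in> H1per
        \<and> (\<forall>w\<in>H1per. bloch_form A \<eta> (\<Phi> m \<eta>) w = complex_of_real (lam m \<eta>) * inner_Y (\<Phi> m \<eta>) w))
   \<and> (\<forall>\<eta>\<in>Zcell. \<forall>m l. inner_Y (\<Phi> m \<eta>) (\<Phi> l \<eta>) = (if m = l then 1 else 0))
   \<and> (\<forall>\<eta>\<in>Zcell. \<forall>v\<in>L2per.
        (\<lambda>N. LINT x:Ycell|lborel. (norm (v x - (\<Sum>m<N. inner_Y v (\<Phi> m \<eta>) * \<Phi> m \<eta> x)))\<^sup>2) \<longlonglongrightarrow> 0)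
   \<and> (\<forall>m. (\<lambda>(\<eta>, x). \<Phi> m \<eta> x) \<in> borel_measurable (restrict_space borel Zcell \<Otimes>\<^sub>M borel))
   \<and> (\<forall>m. AE \<eta> in lborel. \<eta> \<in> Zcell \<and> - \<eta> \<in> Zcell \<longrightarrow>
        (AE x in lborel. \<Phi> m (- \<eta>) x = cnj (\<Phi> m \<eta> x)))"

section \<open>Fourier transform, Bloch coefficients, adaption\<close>

definition plane_wave :: "real^'n \<Rightarrow> real^'n \<Rightarrow> complex" where
  "plane_wave \<eta> x = cis (2 * pi * (\<eta> \<bullet> x))"

definition bloch_eigenvalue :: "(nat \<Rightarrow> real^'n \<Rightarrow> real) \<Rightarrow> real \<Rightarrow> nat \<Rightarrow> real^'n \<Rightarrow> real" where
  "bloch_eigenvalue lam \<epsilon> m \<eta> = lam m (\<epsilon> *\<^sub>R \<eta>) / \<epsilon>\<^sup>2"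

definition bloch_wave ::
  "(nat \<Rightarrow> real^'n \<Rightarrow> real^'n \<Rightarrow> complex) \<Rightarrow> real \<Rightarrow> nat \<Rightarrow> real^'n \<Rightarrow> real^'n \<Rightarrow> complex" where
  "bloch_wave \<Phi> \<epsilon> m \<eta> x = \<Phi> m (\<epsilon> *\<^sub>R \<eta>) (x /\<^sub>R \<epsilon>) * plane_wave \<eta> x"

text \<open>
  The integral of \<open>u(x)\<close> times the conjugate of \<open>k(\<eta>, x)\<close> over \<open>x\<close>, as a function of \<open>\<eta> \<in> S\<close>, in the
  \<open>L\<^sup>2\<close> sense: the limit in \<open>L\<^sup>2(S)\<close> of the integrals over balls of radius \<open>R \<rightarrow> \<infinity>\<close>. It is determined
  almost everywhere on \<open>S\<close> and meaningless off \<open>S\<close>.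
\<close>

definition L2_transform ::
  "(real^'n) set \<Rightarrow> (real^'n \<Rightarrow> real^'n \<Rightarrow> complex) \<Rightarrow> (real^'n \<Rightarrow> complex) \<Rightarrow> real^'n \<Rightarrow> complex" where
  "L2_transform S k u = (SOME F. F \<in> L2_on S \<and>
     ((\<lambda>R. \<integral>\<^sup>+\<eta>\<in>S. ennreal ((norm (F \<eta> - (LINT x:cball 0 R|lborel. u x * cnj (k \<eta> x))))\<^sup>2) \<partial>lborel)
        \<longlongrightarrow> 0) at_top)"

definition fourier :: "(real^'n \<Rightarrow> complex) \<Rightarrow> real^'n \<Rightarrow> complex" where
  "fourier = L2_transform UNIV plane_wave"

definition bloch_coeff ::
  "(nat \<Rightarrow> real^'n \<Rightarrow> real^'n \<Rightarrow> complex) \<Rightarrow> real \<Rightarrow> nat \<Rightarrow> (real^'n \<Rightarrow> complex) \<Rightarrow> real^'n \<Rightarrow> complex" where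
  "bloch_coeff \<Phi> \<epsilon> m = L2_transform (Zscaled \<epsilon>) (bloch_wave \<Phi> \<epsilon> m)"

abbreviation cplx :: "(real^'n \<Rightarrow> real) \<Rightarrow> real^'n \<Rightarrow> complex" where
  "cplx u \<equiv> (\<lambda>x. complex_of_real (u x))"

definition adaption ::
  "(nat \<Rightarrow> real^'n \<Rightarrow> real^'n \<Rightarrow> complex) \<Rightarrow> real \<Rightarrow> (real^'n \<Rightarrow> complex) \<Rightarrow> real^'n \<Rightarrow> complex" where
  "adaption \<Phi> \<epsilon> f x = (LINT \<eta>:Zscaled \<epsilon>|lborel. fourier f \<eta> * bloch_wave \<Phi> \<epsilon> 0 \<eta> x)"

definition bloch_projection ::
  "(nat \<Rightarrow> real^'n \<Rightarrow> real^'n \<Rightarrow> complex) \<Rightarrow> real \<Rightarrow> (real^'n) set \<Rightarrow> (real^'n \<Rightarrow> complex) \<Rightarrow> real^'n \<Rightarrow> complex"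
where
  "bloch_projection \<Phi> \<epsilon> K u x = (LINT \<eta>:K|lborel. bloch_coeff \<Phi> \<epsilon> 0 u \<eta> * bloch_wave \<Phi> \<epsilon> 0 \<eta> x)"

section \<open>The original control problem\<close>

text \<open>
  Weak derivatives of \<open>H\<^sup>k\<close> functions agree almost everywhere with square-integrable ones, so the
  integrands below are integrable on the feasible sets.
\<close>

definition energy :: "(real^'n::finite \<Rightarrow> real^'n^'n) \<Rightarrow> real \<Rightarrow> (real^'n \<Rightarrow> real) \<Rightarrow> real" where
  "energy A \<epsilon> y = (LINT x|lborel. wgrad y x \<bullet> (A (x /\<^sub>R \<epsilon>) *v wgrad y x) + (y x)\<^sup>2)"

definition cost ::
  "real \<Rightarrow> real \<Rightarrow> real \<Rightarrow> ((real^'n \<Rightarrow> real) \<Rightarrow> real) \<Rightarrow> (real^'n \<Rightarrow> real) \<Rightarrow> (real^'n \<Rightarrow> real)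
    \<Rightarrow> (real^'n \<Rightarrow> real) \<times> (real^'n \<Rightarrow> real) \<Rightarrow> real" where
  "cost \<mu>1 \<mu>2 \<kappa> E yd1 yd2 = (\<lambda>(u, y).
      \<mu>1 / 2 * E (\<lambda>x. y x - yd1 x)
    + \<mu>2 / 2 * (LINT x|lborel. (y x - yd2 x)\<^sup>2)
    + \<kappa> / 2 * (LINT x|lborel. (u x)\<^sup>2))"

definition solves_state ::
  "(real^'n::finite \<Rightarrow> real^'n^'n) \<Rightarrow> real \<Rightarrow> (real^'n \<Rightarrow> real) \<Rightarrow> (real^'n \<Rightarrow> real) \<Rightarrow> bool" where
  "solves_state A \<epsilon> g y \<longleftrightarrow> y \<in> Hk 1 \<and>
     (\<forall>\<phi>\<in>Hk 1. (LINT x|lborel. wgrad \<phi> x \<bullet> (A (x /\<^sub>R \<epsilon>) *v wgrad y x) + y x * \<phi> x)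
               = (LINT x|lborel. g x * \<phi> x))"

definition optimal_original ::
  "(real^'n::finite \<Rightarrow> real^'n^'n) \<Rightarrow> real \<Rightarrow> real \<Rightarrow> real \<Rightarrow> real \<Rightarrow> (real^'n \<Rightarrow> real) \<Rightarrow> (real^'n \<Rightarrow> real)
    \<Rightarrow> (real^'n \<Rightarrow> real) \<Rightarrow> (real^'n \<Rightarrow> real) set \<Rightarrow> (real^'n \<Rightarrow> real) \<Rightarrow> (real^'n \<Rightarrow> real) \<Rightarrow> bool" where
  "optimal_original A \<mu>1 \<mu>2 \<kappa> \<epsilon> f yd1 yd2 U u y \<longleftrightarrow>
     is_arg_min (cost \<mu>1 \<mu>2 \<kappa> (energy A \<epsilon>) yd1 yd2)
       (\<lambda>(u, y). u \<in> U \<and> solves_state A \<epsilon> (\<lambda>x. f x + u x) y) (u, y)"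

section \<open>The effective control problem\<close>

text \<open>
  A real tensor of order \<open>p\<close> is given by its entries on index lists of length \<open>p\<close>; \<open>T k\<close> is the
  tensor of order \<open>2 * k\<close>.
\<close>

definition tensor_form :: "(nat \<Rightarrow> 'n::finite list \<Rightarrow> real) \<Rightarrow> nat \<Rightarrow> real^'n \<Rightarrow> real" where
  "tensor_form T k \<eta> = (\<Sum>is | length is = 2 * k. T k is * prod_list (map (\<lambda>i. \<eta> $ i) is))"

definition taylor_poly :: "(nat \<Rightarrow> 'n::finite list \<Rightarrow> real) \<Rightarrow> real \<Rightarrow> nat \<Rightarrow> real^'n \<Rightarrow> real" where
  "taylor_poly T \<epsilon> N \<eta> = (\<Sum>k=1..N. \<epsilon> ^ (2 * k - 2) * (2 * pi) ^ (2 * k) * tensor_form T k \<eta>)"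

definition tensor_deriv_form :: "(nat \<Rightarrow> 'n::finite list \<Rightarrow> real) \<Rightarrow> nat \<Rightarrow> (real^'n \<Rightarrow> real) \<Rightarrow> real^'n \<Rightarrow> real" where
  "tensor_deriv_form T k y x =
     (\<Sum>is | length is = 2 * k. T k is * wderiv (take k is) y x * wderiv (drop k is) y x)"

definition tensor_op :: "(nat \<Rightarrow> 'n::finite list \<Rightarrow> real) \<Rightarrow> nat \<Rightarrow> (real^'n \<Rightarrow> real) \<Rightarrow> real^'n \<Rightarrow> real" where
  "tensor_op T k y x = (\<Sum>is | length is = 2 * k. T k is * wderiv is y x)"

definition eff_energy :: "(nat \<Rightarrow> 'n::finite list \<Rightarrow> real) \<Rightarrow> real \<Rightarrow> nat \<Rightarrow> (real^'n \<Rightarrow> real) \<Rightarrow> real" where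
  "eff_energy T \<epsilon> M y =
     (LINT x|lborel. (\<Sum>k=1..M. \<epsilon> ^ (2 * k - 2) * tensor_deriv_form T k y x) + (y x)\<^sup>2)"

definition solves_effective ::
  "(nat \<Rightarrow> 'n::finite list \<Rightarrow> real) \<Rightarrow> real \<Rightarrow> nat \<Rightarrow> (real^'n \<Rightarrow> real) \<Rightarrow> (real^'n \<Rightarrow> real) \<Rightarrow> bool" where
  "solves_effective T \<epsilon> M g y \<longleftrightarrow> y \<in> Hk (2 * M) \<and>
     (AE x in lborel. (\<Sum>k=1..M. \<epsilon> ^ (2 * k - 2) * (- 1) ^ k * tensor_op T k y x) + y x = g x)"

definition eff_controls ::
  "(nat \<Rightarrow> real^'n \<Rightarrow> real^'n \<Rightarrow> complex) \<Rightarrow> real \<Rightarrow> (real^'n) set \<Rightarrow> (real^'n \<Rightarrow> real) set \<Rightarrow> (real^'n \<Rightarrow> real) set"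
where
  "eff_controls \<Phi> \<epsilon> K U = {u \<in> L2.
      (AE x in lborel. cplx u x = (LINT \<eta>:K|lborel. fourier (cplx u) \<eta> * plane_wave \<eta> x))
      \<and> ae_in (adaption \<Phi> \<epsilon> (cplx u)) U}"

definition optimal_effective ::
  "(nat \<Rightarrow> 'n::finite list \<Rightarrow> real) \<Rightarrow> nat \<Rightarrow> real \<Rightarrow> real \<Rightarrow> real \<Rightarrow> real \<Rightarrow> (real^'n \<Rightarrow> real) \<Rightarrow> (real^'n \<Rightarrow> real)
    \<Rightarrow> (real^'n \<Rightarrow> real) \<Rightarrow> (real^'n \<Rightarrow> real) set \<Rightarrow> (real^'n \<Rightarrow> real) \<Rightarrow> (real^'n \<Rightarrow> real) \<Rightarrow> bool" where
  "optimal_effective T M \<mu>1 \<mu>2 \<kappa> \<epsilon> f yd1 yd2 V u y \<longleftrightarrow>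
     is_arg_min (cost \<mu>1 \<mu>2 \<kappa> (eff_energy T \<epsilon> M) yd1 yd2)
       (\<lambda>(u, y). u \<in> V \<and> solves_effective T \<epsilon> M (\<lambda>x. f x + u x) y) (u, y)"

definition approx_state ::
  "(nat \<Rightarrow> real^'n \<Rightarrow> real) \<Rightarrow> (nat \<Rightarrow> real^'n \<Rightarrow> real^'n \<Rightarrow> complex) \<Rightarrow> real \<Rightarrow> (real^'n) set
    \<Rightarrow> (real^'n \<Rightarrow> real) \<Rightarrow> (real^'n \<Rightarrow> real) \<Rightarrow> real^'n \<Rightarrow> complex" where
  "approx_state lam \<Phi> \<epsilon> K f u x =
     (LINT \<eta>:K|lborel. (fourier (cplx f) \<eta> + bloch_coeff \<Phi> \<epsilon> 0 (cplx u) \<eta>)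
        / complex_of_real (1 + bloch_eigenvalue lam \<epsilon> 0 \<eta>) * plane_wave \<eta> x)"

end

theory Submission imports Defs begin

text \<open>
 In Bloch coordinates both control problems are the same problem with different multipliers. Write
 \<open>F\<close>, \<open>d1\<close>, \<open>d2\<close> for the Fourier transforms of the data on \<open>K\<close>. A control with coefficients \<open>a\<close> on \<open>K\<close>
 generates a state with coefficients \<open>q * (F + a)\<close>, where \<open>q = 1 / (1 + \<lambda>)\<close> with the rescaled lowest
 Bloch eigenvalue \<open>\<lambda>\<close> for the original problem, and \<open>p = 1 / (1 + P)\<close> with its Taylor polynomial \<open>P\<close> in
 place of \<open>q\<close> for the effective one. The first-order conditions are variational inequalities for the
 density \<open>red_grad\<close>, which is strongly monotone in \<open>a\<close>. The optimal control of each problem yields an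
 admissible competitor in the other, so adding the two inequalities bounds the distance of the
 controls, and then of the states, by \<open>sup \<bar>q - p\<bar>\<close> on \<open>K\<close> (\<open>reduced_state_stability\<close>); the
 Taylor expansion gives \<open>sup \<bar>q - p\<bar> \<le> C \<epsilon>^(2 M)\<close> (\<open>resolvent_symbol_error\<close>). A fixed competitor, the projection of
 the adaption of \<open>u0\<close>, bounds the optimal control independently of \<open>\<epsilon>\<close> (\<open>reduced_control_bound\<close>).

 For the original problem three facts reduce everything to coefficients.
 Packets \<open>synth wave b\<close> of Bloch waves depend isometrically on \<open>b\<close> (\<open>synth_isometry\<close>): the values
 of a packet at the lattice translates of a point are Fourier coefficients of a function on the dual
 cell, and Parseval's identity applies. The Bloch coefficients, defined as limits in mean, are the
 adjoint of this isometry; with the constant periodic factor 1 the same argument is Plancherel's theorem.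
 Secondly, a packet with coefficients \<open>q * c\<close> solves the state equation with the packet of \<open>c\<close> as
 right-hand side (\<open>packet_solves_state\<close>): the cell eigenvalue equation is carried to the whole space by
 periodizing test functions, and integrated over the quasimomentum. This needs a gradient of the mode
 that is measurable in both variables, obtained from Fourier series (\<open>gradient_exists\<close>).
 Thirdly, the remainders of an optimal state and control outside these packets satisfy the state
 equation among themselves, so their inner product is nonnegative and they can be discarded
 (\<open>original_optimality_condition\<close>).

 For the effective problem, weak derivatives become multiplication in Fourier variables, so that on
 band-limited controls the cost is an explicit quadratic functional (\<open>effective_optimality_condition\<close>).
\<close>

text \<open>Shorthands, mostly for integrals and null sets of Lebesgue measure on the whole space.\<close>

notation scaleR (infixr "*R" 75)

abbreviation (input) ae_lborel :: "('a::euclidean_space => bool) => bool" (binder "AEL " 10) where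
 "ae_lborel P \<equiv> almost_everywhere lborel P"

abbreviation (input) int_lborel :: "('a::euclidean_space => 'b::{banach,second_countable_topology}) => 'b" (binder "LI " [60] 60) where
 "int_lborel f \<equiv> integral\<^sup>L lborel f"

abbreviation (input) nn_lborel :: "('a::euclidean_space => ennreal) => ennreal" (binder "NI " [60] 60) where
 "nn_lborel f \<equiv> integral\<^sup>N lborel f"

abbreviation (input) intb where "intb \<equiv> integrable lborel"
abbreviation (input) BM where "BM \<equiv> borel_measurable borel"
abbreviation (input) ind where "ind \<equiv> indicator"
abbreviation (input) pw where "pw \<equiv> plane_wave"
abbreviation (input) cor where "cor \<equiv> complex_of_real"
abbreviation (input) lim_seq (infix "---->" 60) where "X ----> L \<equiv> (X \<longlongrightarrow> L) sequentially"
abbreviation (input) sum_all (binder "SU " 10) where "sum_all f \<equiv> sum f UNIV"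
lemmas slint_def = set_lebesgue_integral_def

section \<open>Square-integrable functions as an inner product space\<close>

lemma L2_iff:
 "u : L2 \<longleftrightarrow> u : BM & intb (%x. (norm (u x))^2)"
 by (simp add: L2_on_def set_integrable_def)

lemma L2_measurable [measurable_dest]: "u : L2 ==> u : BM"
 by (simp add: L2_iff)

lemma L2_integrable_sq: "u : L2 ==> intb (%x. (norm (u x))^2)"
 by (simp add: L2_iff)

lemma L2_on_iff:
 assumes S: "S : sets borel"
 shows "u : L2_on S \<longleftrightarrow> u : BM & (%x. ind S x *R u x) : L2"
proof -
 have "(%x. ind S x *R (norm (u x))^2) = (%x. (norm (ind S x *R u x))^2)"
 by (auto simp: indicator_def)
 moreover have "(%x. ind S x *R u x) : BM" if "u : BM"
 using S that by measurable
 ultimately show ?thesis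
 by (auto simp: L2_on_def set_integrable_def L2_iff[of "%x. ind S x *R u x"])
qed

lemma L2_nn_iff:
 "u : L2 \<longleftrightarrow> u : BM & (NI x. ennreal ((norm (u x))^2)) < \<infinity>"
 unfolding L2_iff by (auto simp: integrable_iff_bounded)

lemma L2norm_nonneg [simp]: "0 <= L2norm u"
 by (simp add: L2norm_def)

lemma L2norm_sq: "(L2norm u)^2 = (LI x. (norm (u x))^2)"
 by (simp add: L2norm_def)

lemma nn_L2norm: "u : L2 ==> (NI x. ennreal ((norm (u x))^2)) = ennreal ((L2norm u)^2)"
 by (subst nn_integral_eq_integral) (auto simp: L2norm_sq L2_iff)

lemma L2norm_leI:
 assumes "(NI x. ennreal ((norm (u x))^2)) <= ennreal (c^2)" "0 <= c"
 and [measurable]: "u : BM"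
 shows "u : L2 & L2norm u <= c"
proof -
 have u: "u : L2"
 using assms(1) by (auto simp: L2_nn_iff intro: le_less_trans)
 then have "ennreal ((L2norm u)^2) <= ennreal (c^2)"
 using assms(1) nn_L2norm[OF u] by simp
 then have "(L2norm u)^2 <= c^2" by simp
 with u assms(2) show ?thesis by (auto intro: power2_le_imp_le)
qed

lemma L2norm_cong_AE:
 assumes "AEL x. u x = v x" "u : BM" "v : BM"
 shows "L2norm u = L2norm v"
proof -
 have "(LI x. (norm (u x))^2) = (LI x. (norm (v x))^2)"
 using assms by (intro integral_cong_AE) (auto elim: eventually_mono)
 then show ?thesis by (simp add: L2norm_def)
qed

lemma L2_cong_AE:
 assumes "u : L2" "AEL x. u x = v x" "v : BM"
 shows "v : L2"
proof -
 have "intb (%x. (norm (v x))^2) \<longleftrightarrow> intb (%x. (norm (u x))^2)"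
 using assms by (intro integrable_cong_AE) (auto elim: eventually_mono simp: L2_iff)
 then show ?thesis using assms by (simp add: L2_iff)
qed

lemma L2norm_eq_0_iff:
 assumes "u : L2"
 shows "L2norm u = 0 \<longleftrightarrow> (AEL x. u x = 0)"
 using integral_nonneg_eq_0_iff_AE[OF L2_integrable_sq[OF assms]]
 by (simp add: L2norm_def)

lemma L2_bound:
 assumes "u : L2" "v : BM" "AEL x. norm (v x) <= c * norm (u x)"
 shows "v : L2"
proof -
 have "intb (%x. c^2 * (norm (u x))^2)"
 using assms(1) by (simp add: L2_iff)
 then have "intb (%x. (norm (v x))^2)"
 proof (rule Bochner_Integration.integrable_bound)
 show "AEL x. norm ((norm (v x))^2) <= norm (c^2 * (norm (u x))^2)"
 using assms(3)
 proof eventually_elim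
 case (elim x)
 then have "(norm (v x))^2 <= (c * norm (u x))^2" by (intro power_mono) auto
 then show ?case by (simp add: power_mult_distrib)
 qed
 qed (use assms(2) in measurable)
 with assms(2) show ?thesis by (simp add: L2_iff)
qed

lemma L2_zero [simp, intro]: "(%x. 0) : L2"
 by (simp add: L2_iff)

lemma L2_scaleR [intro]: "u : L2 ==> (%x. c *R u x) : L2"
 by (rule L2_bound[where c="\<bar>c\<bar>" and u=u]) auto

lemma L2_mult_bounded:
 fixes u :: "real^'n => 'b::{banach,second_countable_topology,real_normed_algebra}"
 assumes "u : L2" "g : BM" "!!x. norm (g x) <= c"
 shows "(%x. g x * u x) : L2"
proof (rule L2_bound[where c=c and u=u])
 show "(%x. g x * u x) : BM" using assms by measurable
 have "norm (g x * u x) <= c * norm (u x)" for x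
 using norm_mult_ineq[of "g x" "u x"] mult_right_mono[OF assms(3)[of x], of "norm (u x)"] by simp
 then show "AEL x. norm (g x * u x) <= c * norm (u x)" by simp
qed fact

lemma L2_mult_const [intro]:
 fixes u :: "real^'n => 'b::{banach,second_countable_topology,real_normed_algebra}"
 shows "u : L2 ==> (%x. c * u x) : L2"
 by (rule L2_mult_bounded) auto

lemma L2_add [intro]:
 assumes "u : L2" "v : L2"
 shows "(%x. u x + v x) : L2"
proof -
 have "intb (%x. 2 * (norm (u x))^2 + 2 * (norm (v x))^2)"
 using assms by (intro Bochner_Integration.integrable_add integrable_mult_right) (auto simp: L2_iff)
 then have "intb (%x. (norm (u x + v x))^2)"
 proof (rule Bochner_Integration.integrable_bound)
 show "AEL x. norm ((norm (u x + v x))^2) <= norm (2 * (norm (u x))^2 + 2 * (norm (v x))^2)"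
 proof (rule AE_I2)
 fix x
 have "(norm (u x + v x))^2 <= (norm (u x) + norm (v x))^2"
 by (intro power_mono norm_triangle_ineq) auto
 also have "... <= 2 * (norm (u x))^2 + 2 * (norm (v x))^2"
 using sum_squares_bound[of "norm (u x)" "norm (v x)"] by (simp add: power2_sum)
 finally show "norm ((norm (u x + v x))^2) <= norm (2 * (norm (u x))^2 + 2 * (norm (v x))^2)" by simp
 qed
 qed (use assms in measurable)
 with assms show ?thesis by (auto simp: L2_iff)
qed

lemma L2_uminus [intro]: "u : L2 ==> (%x. - u x) : L2"
 using L2_scaleR[of u "-1"] by simp

lemma L2_diff [intro]: "u : L2 ==> v : L2 ==> (%x. u x - v x) : L2"
 using L2_add[of u "%x. - v x"] by auto

lemma L2_sum [intro]: "(!!i. i : I ==> u i : L2) ==> (%x. \<Sum>i\<in>I. u i x) : L2"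
 by (induction I rule: infinite_finite_induct) auto

lemma L2_indicator [intro]:
 "u : L2 ==> S : sets borel ==> (%x. ind S x *R u x) : L2"
 by (rule L2_bound[where c=1 and u=u]) (auto simp: indicator_def)

lemma L2_norm [intro]: "u : L2 ==> (%x. norm (u x)) : L2"
 by (auto simp: L2_iff)

lemma L2_cnj [intro]:
 assumes "u : L2"
 shows "(%x. cnj (u x)) : L2"
proof (rule L2_bound[OF assms])
 have "cnj : BM"
 by (intro borel_measurable_continuous_onI continuous_intros)
 then show "(%x. cnj (u x)) : BM"
 using assms by measurable
 show "AEL x. norm (cnj (u x)) <= 1 * norm (u x)" by simp
qed

lemma L2_cplx_iff: "cplx u : L2 \<longleftrightarrow> u : L2"
proof -
 have "u : BM" if "cplx u : BM"
 proof -
 have "(%x. Re (cplx u x)) : BM" using that by measurable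
 then show ?thesis by simp
 qed
 moreover have "cplx u : BM" if "u : BM"
 using that by measurable
 ultimately have "cplx u : BM \<longleftrightarrow> u : BM" by blast
 then show ?thesis unfolding L2_iff by simp
qed

lemma L2_Re [intro]: "u : L2 ==> (%x. Re (u x)) : L2"
 by (rule L2_bound[where c=1 and u=u]) (auto simp: abs_Re_le_cmod)

lemma L2_Im [intro]: "u : L2 ==> (%x. Im (u x)) : L2"
 by (rule L2_bound[where c=1 and u=u]) (auto simp: abs_Im_le_cmod)

lemma L2norm_cplx [simp]: "L2norm (cplx u) = L2norm u"
 by (simp add: L2norm_def)

lemma L2norm_cnj [simp]: "L2norm (%x. cnj (u x)) = L2norm u"
 by (simp add: L2norm_def)

lemma L2_integrable_norm_mult:
 assumes "u : L2" "v : L2"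
 shows "intb (%x. norm (u x) * norm (v x))"
proof -
 have "intb (%x. (norm (u x))^2 + (norm (v x))^2)"
 using assms by (auto simp: L2_iff)
 then show ?thesis
 proof (rule Bochner_Integration.integrable_bound)
 show "AEL x. norm (norm (u x) * norm (v x)) <= norm ((norm (u x))^2 + (norm (v x))^2)"
 proof (rule AE_I2)
 fix x
 have "2 * (norm (u x) * norm (v x)) <= (norm (u x))^2 + (norm (v x))^2"
 using sum_squares_bound[of "norm (u x)" "norm (v x)"] by simp
 moreover have "0 <= norm (u x) * norm (v x)" by simp
 ultimately have "norm (u x) * norm (v x) <= (norm (u x))^2 + (norm (v x))^2" by linarith
 then show "norm (norm (u x) * norm (v x)) <= norm ((norm (u x))^2 + (norm (v x))^2)" by simp
 qed
 qed (use assms in measurable)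
qed

lemma L2_integrable_mult:
 fixes u v :: "real^'n => 'b::{banach,second_countable_topology,real_normed_algebra}"
 assumes "u : L2" "v : L2"
 shows "intb (%x. u x * v x)"
 by (rule Bochner_Integration.integrable_bound[OF L2_integrable_norm_mult[OF assms]])
 (use assms in "auto simp: norm_mult_ineq")

lemma L2_Cauchy_Schwarz:
 assumes "u : L2" "v : L2"
 shows "(LI x. norm (u x) * norm (v x)) <= L2norm u * L2norm v"
proof -
 let ?I = "LI x. norm (u x) * norm (v x)"
 have [measurable]: "u : BM" "v : BM" using assms by auto
 have I0: "0 <= ?I" by (rule integral_nonneg_AE) simp
 have "(NI x. ennreal (norm (u x)) * ennreal (norm (v x))) = ennreal ?I"
 using nn_integral_eq_integral[OF L2_integrable_norm_mult[OF assms]]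
 by (simp add: ennreal_mult')
 moreover have "(NI x. ennreal (norm (u x)) * ennreal (norm (v x)))^2
 <= (NI x. (ennreal (norm (u x)))^2) * (NI x. (ennreal (norm (v x)))^2)"
 by (rule Cauchy_Schwarz_nn_integral) auto
 ultimately have "ennreal (?I^2) <= ennreal ((L2norm u)^2 * (L2norm v)^2)"
 using I0 nn_L2norm[OF assms(1)] nn_L2norm[OF assms(2)]
 by (simp add: ennreal_power ennreal_mult)
 then have "?I^2 <= (L2norm u * L2norm v)^2"
 by (simp add: power_mult_distrib)
 then show ?thesis by (rule power2_le_imp_le) simp
qed

lemma L2norm_triangle:
 assumes "u : L2" "v : L2"
 shows "L2norm (%x. u x + v x) <= L2norm u + L2norm v"
proof (rule power2_le_imp_le)
 have "(LI x. (norm (u x + v x))^2)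
 <= (LI x. ((norm (u x))^2 + (norm (v x))^2) + 2 * (norm (u x) * norm (v x)))"
 proof (rule integral_mono_AE)
 show "intb (%x. (norm (u x + v x))^2)" using assms by (intro L2_integrable_sq) auto
 show "intb (%x. ((norm (u x))^2 + (norm (v x))^2) + 2 * (norm (u x) * norm (v x)))"
 using assms L2_integrable_norm_mult[OF assms] by (auto simp: L2_iff)
 show "AEL x. (norm (u x + v x))^2 <= (norm (u x))^2 + (norm (v x))^2 + 2 * (norm (u x) * norm (v x))"
 proof (rule AE_I2)
 fix x
 have "(norm (u x + v x))^2 <= (norm (u x) + norm (v x))^2"
 by (intro power_mono norm_triangle_ineq) auto
 then show "(norm (u x + v x))^2 <= (norm (u x))^2 + (norm (v x))^2 + 2 * (norm (u x) * norm (v x))"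
 by (simp add: power2_sum)
 qed
 qed
 also have "... = (L2norm u)^2 + (L2norm v)^2 + 2 * (LI x. norm (u x) * norm (v x))"
 using assms L2_integrable_norm_mult[OF assms] by (simp add: L2_iff L2norm_sq)
 also have "... <= (L2norm u + L2norm v)^2"
 using L2_Cauchy_Schwarz[OF assms] by (simp add: power2_sum)
 finally show "(L2norm (%x. u x + v x))^2 <= (L2norm u + L2norm v)^2" by (simp add: L2norm_sq)
qed simp

lemma L2norm_scale:
 "L2norm (%x. c * u x) = norm c * L2norm u" for u :: "real^'n => 'b::{banach,second_countable_topology,real_normed_div_algebra}"
 by (simp add: L2norm_def norm_mult power_mult_distrib real_sqrt_mult)

lemma L2norm_minus_commute: "L2norm (%x. u x - v x) = L2norm (%x. v x - u x)"
 by (simp add: L2norm_def norm_minus_commute)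

lemma L2norm_mono:
 assumes "v : L2" "u : L2" "AEL x. norm (u x) <= norm (v x)"
 shows "L2norm u <= L2norm v"
 unfolding L2norm_def using assms
 by (intro real_sqrt_le_mono integral_mono_AE L2_integrable_sq) (auto elim!: eventually_mono intro: power_mono)

definition ip :: "(real^'n => complex) => (real^'n => complex) => complex" where
 "ip u v = (LI x. u x * cnj (v x))"

lemma ip_integrable: "u : L2 ==> v : L2 ==> intb (%x. u x * cnj (v x))"
 by (intro L2_integrable_mult L2_cnj)

lemma ip_cong_AE:
 assumes "AEL x. u x = u' x" "AEL x. v x = v' x"
 "u : L2" "u' : L2" "v : L2" "v' : L2"
 shows "ip u v = ip u' v'"
 unfolding ip_def
proof (rule integral_cong_AE)
 show "AEL x. u x * cnj (v x) = u' x * cnj (v' x)"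
 using assms(1,2) by eventually_elim simp
qed (use ip_integrable assms in "blast dest: borel_measurable_integrable")+

lemma ip_add_left: "u : L2 ==> v : L2 ==> w : L2 ==> ip (%x. u x + v x) w = ip u w + ip v w"
 unfolding ip_def by (simp add: algebra_simps ip_integrable)

lemma ip_diff_left: "u : L2 ==> v : L2 ==> w : L2 ==> ip (%x. u x - v x) w = ip u w - ip v w"
 unfolding ip_def by (simp add: algebra_simps ip_integrable)

lemma ip_add_right: "u : L2 ==> v : L2 ==> w : L2 ==> ip w (%x. u x + v x) = ip w u + ip w v"
 unfolding ip_def by (simp add: algebra_simps ip_integrable)

lemma ip_diff_right: "u : L2 ==> v : L2 ==> w : L2 ==> ip w (%x. u x - v x) = ip w u - ip w v"
 unfolding ip_def by (simp add: algebra_simps ip_integrable)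

lemma ip_scale_left: "ip (%x. c * u x) w = c * ip u w"
 unfolding ip_def by (simp add: mult.assoc)

lemma ip_scale_right: "ip w (%x. c * u x) = cnj c * ip w u"
 unfolding ip_def by (simp add: mult.left_commute)

lemma ip_cnj: "cnj (ip u v) = ip v u"
 unfolding ip_def by (subst Bochner_Integration.integral_cnj[symmetric]) (simp add: mult.commute)

lemma ip_self: "ip u u = of_real ((L2norm u)^2)"
proof -
 have "ip u u = (LI x. of_real ((norm (u x))^2))"
 unfolding ip_def by (simp add: complex_norm_square[symmetric])
 then show ?thesis by (simp only: integral_complex_of_real L2norm_sq)
qed

lemma norm_ip_le:
 assumes "u : L2" "v : L2"
 shows "norm (ip u v) <= L2norm u * L2norm v"
proof -
 have "norm (ip u v) <= (LI x. norm (u x * cnj (v x)))"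
 unfolding ip_def by (rule integral_norm_bound)
 also have "... = (LI x. norm (u x) * norm (v x))" by (simp add: norm_mult)
 also have "... <= L2norm u * L2norm v" by (rule L2_Cauchy_Schwarz[OF assms])
 finally show ?thesis .
qed

lemma L2norm_sq_add:
 assumes "u : L2" "v : L2"
 shows "(L2norm (%x. u x + v x))^2 = (L2norm u)^2 + (L2norm v)^2 + 2 * Re (ip u v)"
proof -
 have "ip (%x. u x + v x) (%x. u x + v x) = ip u u + ip v v + (ip u v + cnj (ip u v))"
 using assms by (simp add: ip_add_left ip_add_right L2_add ip_cnj)
 then have "of_real ((L2norm (%x. u x + v x))^2) = (of_real ((L2norm u)^2 + (L2norm v)^2 + 2 * Re (ip u v)) :: complex)"
 by (simp add: ip_self complex_add_cnj)
 then show ?thesis using of_real_eq_iff by blast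
qed

lemma L2norm_sq_diff:
 assumes "u : L2" "v : L2"
 shows "(L2norm (%x. u x - v x))^2 = (L2norm u)^2 + (L2norm v)^2 - 2 * Re (ip u v)"
 using L2norm_sq_add[OF assms(1) L2_uminus[OF assms(2)]] ip_scale_right[of u "-1" v] L2norm_scale[of "-1" v]
 by simp

lemma Re_ip_cplx:
 "ip (cplx u) (cplx v) = of_real (LI x. u x * v x)"
 unfolding ip_def by (simp flip: of_real_mult)

lemma ip_polarization:
 assumes "u : L2" "v : L2" "u' : L2" "v' : L2"
 and n: "L2norm u = L2norm u'" "L2norm v = L2norm v'"
 and s: "L2norm (%x. u x + v x) = L2norm (%x. u' x + v' x)"
 and t: "L2norm (%x. u x + \<i> * v x) = L2norm (%x. u' x + \<i> * v' x)"
 shows "ip u v = ip u' v'"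
proof (rule complex_eqI)
 show "Re (ip u v) = Re (ip u' v')"
 using L2norm_sq_add[OF assms(1,2)] L2norm_sq_add[OF assms(3,4)] n s by simp
 have "Re (ip u (%x. \<i> * v x)) = Re (ip u' (%x. \<i> * v' x))"
 using L2norm_sq_add[OF assms(1) L2_mult_const[OF assms(2)], of \<i>]
 L2norm_sq_add[OF assms(3) L2_mult_const[OF assms(4)], of \<i>] n t by (simp add: L2norm_scale)
 then show "Im (ip u v) = Im (ip u' v')" by (simp add: ip_scale_right)
qed

section \<open>Translations, scalings and lattice tilings of Lebesgue measure\<close>

lemma AE_translate:
 fixes c :: "'a::euclidean_space"
 assumes "AEL x. P x"
 shows "AEL x. P (x + c)"
proof -
 have "AE x in distr lborel borel ((+) c). P x" unfolding lborel_distr_plus by (rule assms)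
 then have "AEL x. P (c + x)" by (rule AE_distrD[rotated]) simp
 then show ?thesis by (simp add: add.commute)
qed

lemma nn_integral_translate:
 fixes c :: "'a::euclidean_space"
 assumes [measurable]: "f : BM"
 shows "(NI x. f (x + c)) = (NI x. f x)"
proof -
 have "(NI x. f x) = (\<integral>\<^sup>+x. f x \<partial>distr lborel borel ((+) c))" by (simp add: lborel_distr_plus)
 also have "... = (NI x. f (c + x))" by (rule nn_integral_distr) auto
 finally show ?thesis by (simp add: add.commute)
qed

lemma integral_translate:
 fixes c :: "'a::euclidean_space" and f :: "'a => 'b::{banach,second_countable_topology}"
 assumes [measurable]: "f : BM"
 shows "(LI x. f (x + c)) = (LI x. f x)"
proof -
 have "(LI x. f x) = (LINT x|distr lborel borel ((+) c). f x)" by (simp add: lborel_distr_plus)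
 also have "... = (LI x. f (c + x))" by (rule integral_distr) auto
 finally show ?thesis by (simp add: add.commute)
qed

lemma integrable_translate:
 fixes c :: "'a::euclidean_space" and f :: "'a => 'b::{banach,second_countable_topology}"
 assumes "intb f"
 shows "intb (%x. f (x + c))"
proof -
 have "integrable (distr lborel borel ((+) c)) f" using assms by (simp add: lborel_distr_plus)
 then have "intb (%x. f (c + x))"
 by (subst (asm) integrable_distr_eq) (use assms in auto)
 then show ?thesis by (simp add: add.commute)
qed

definition lattice :: "real => (real^'n) set" where
 "lattice s = {k. \<forall>i. \<exists>m::int. k $ i = s * of_int m}"

definition cell :: "real => real => (real^'n) set" where
 "cell a s = {x. \<forall>i. a <= x $ i & x $ i < a + s}"

text \<open>
 A fundamental domain; keeping it abstract lets integrals of periodic functions be moved between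
 differently placed cells.
\<close>

definition tiles :: "real => (real^'n) set => bool" where
 "tiles s D \<longleftrightarrow> D : sets borel & (\<forall>x. \<exists>!k. k : lattice s & x + k : D)"

lemma lattice_0 [simp]: "0 : lattice s"
 by (auto simp: lattice_def intro!: exI[of _ 0])

lemma lattice_uminus: "k : lattice s ==> - k : lattice s"
 unfolding lattice_def by (auto, metis mult_minus_right of_int_minus)

lemma lattice_add: "k : lattice s ==> l : lattice s ==> k + l : lattice s"
 unfolding lattice_def by (auto, metis distrib_left of_int_add)

lemma lattice_diff: "k : lattice s ==> l : lattice s ==> k - l : lattice s"
 using lattice_add[of k s "- l"] lattice_uminus by fastforce

lemma lattice_scaleR: "k : lattice s ==> c *R k : lattice (c * s)"
 unfolding lattice_def by auto

lemma lattice_axis: "axis i s : lattice s"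
 unfolding lattice_def axis_def by (auto intro: exI[of _ 0] exI[of _ 1])

lemma lattice_eq_range: "lattice s = range (%m::int^'n. (\<chi> i. s * of_int (m $ i)) :: real^'n)"
proof (intro equalityI subsetI)
 fix k :: "real^'n" assume "k : lattice s"
 then obtain m where "!!i. k $ i = s * of_int (m i)" unfolding lattice_def by auto metis
 then have "k = (\<chi> i. s * of_int ((\<chi> i. m i) $ i))" by (simp add: vec_eq_iff)
 then show "k : range (%m::int^'n. (\<chi> i. s * of_int (m $ i)) :: real^'n)" by blast
qed (auto simp: lattice_def)

lemma countable_lattice [simp]: "countable (lattice s)"
 unfolding lattice_eq_range by (intro countable_image) auto

lemma infinite_lattice:
 assumes "s ~= 0" shows "infinite (lattice s :: (real^'n::finite) set)"
proof
 assume fin: "finite (lattice s :: (real^'n) set)"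
 have "inj (%m::int. (\<chi> i::'n. s * of_int m))"
 using assms by (auto simp: inj_def vec_eq_iff)
 then have "infinite (range (%m::int. (\<chi> i::'n. s * of_int m)))"
 using finite_imageD infinite_UNIV_int by blast
 moreover have "range (%m::int. (\<chi> i::'n. s * of_int m)) \<subseteq> lattice s" by (auto simp: lattice_def)
 ultimately show False using fin finite_subset by blast
qed

lemma finite_lattice_bounded:
 assumes s: "0 < s"
 shows "finite {k : lattice s :: (real^'n::finite) set. norm k <= R}"
proof -
 let ?A = "{m::int. \<bar>m\<bar> <= \<lceil>R / s\<rceil>}"
 have "finite ?A"
 by (rule finite_subset[of _ "{-\<lceil>R / s\<rceil>..\<lceil>R / s\<rceil>}"]) auto
 then have "finite (Pi\<^sub>E (UNIV :: 'n set) (%_. ?A))" by (intro finite_PiE) auto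
 then have "finite ((%f. (\<chi> i. s * of_int (f i)) :: real^'n) ` Pi\<^sub>E UNIV (%_. ?A))" by (rule finite_imageI)
 moreover have "{k : lattice s :: (real^'n) set. norm k <= R} \<subseteq> (%f. (\<chi> i. s * of_int (f i))) ` Pi\<^sub>E UNIV (%_. ?A)"
 proof
 fix k :: "real^'n" assume k: "k : {k : lattice s. norm k <= R}"
 then obtain m where m: "!!i. k $ i = s * of_int (m i)" unfolding lattice_def by auto metis
 have "\<bar>m i\<bar> <= \<lceil>R / s\<rceil>" for i
 proof -
 have "\<bar>k $ i\<bar> <= R" using k component_le_norm_cart[of k i] by auto
 then have "s * of_int \<bar>m i\<bar> <= R" using s by (simp add: m abs_mult)
 then have "of_int \<bar>m i\<bar> <= R / s" using s by (simp add: field_simps)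
 then show ?thesis by linarith
 qed
 then have "m : Pi\<^sub>E UNIV (%_. ?A)" by auto
 moreover have "k = (\<chi> i. s * of_int (m i))" by (simp add: vec_eq_iff m)
 ultimately show "k : (%f. (\<chi> i. s * of_int (f i))) ` Pi\<^sub>E UNIV (%_. ?A)" by blast
 qed
 ultimately show ?thesis by (rule rev_finite_subset)
qed

lemma cell_measurable [measurable]: "cell a s : sets (borel :: (real^'n::finite) measure)"
proof -
 have "cell a s = (\<Inter>i. {x::real^'n. a <= x $ i} \<inter> {x. x $ i < a + s})"
 by (auto simp: cell_def)
 also have "... : sets borel"
 by (intro sets.countable_INT' sets.Int borel_closed borel_open closed_Collect_le open_Collect_less
 continuous_intros) auto
 finally show ?thesis .
qed

lemma tiles_cell: assumes s: "0 < s" shows "tiles s (cell a s :: (real^'n::finite) set)"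
 unfolding tiles_def
proof (intro conjI allI cell_measurable)
 fix x :: "real^'n"
 let ?k = "(\<chi> i. s * of_int (- \<lfloor>(x $ i - a) / s\<rfloor>)) :: real^'n"
 show "\<exists>!k. k : lattice s & x + k : cell a s"
 proof (intro ex1I conjI)
 show "x + ?k : cell a s"
 unfolding cell_def
 proof (intro CollectI allI)
 fix i
 have "s * of_int \<lfloor>(x $ i - a) / s\<rfloor> <= s * ((x $ i - a) / s)"
 using s by (intro mult_left_mono) auto
 moreover have "s * ((x $ i - a) / s) < s * (of_int \<lfloor>(x $ i - a) / s\<rfloor> + 1)"
 using s by (intro mult_strict_left_mono floor_correct[THEN conjunct2]) auto
 ultimately have "s * of_int \<lfloor>(x $ i - a) / s\<rfloor> <= x $ i - a" "x $ i - a < s * of_int \<lfloor>(x $ i - a) / s\<rfloor> + s"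
 using s by (simp_all add: distrib_left)
 then show "a <= (x + ?k) $ i & (x + ?k) $ i < a + s" by simp
 qed
 show "?k : lattice s"
 unfolding lattice_def
 proof (intro CollectI allI)
 fix i
 have "?k $ i = s * of_int (- \<lfloor>(x $ i - a) / s\<rfloor>)" by simp
 then show "\<exists>m::int. ?k $ i = s * of_int m" by blast
 qed
 next
 fix k assume k: "k : lattice s & x + k : cell a s"
 show "k = ?k"
 unfolding vec_eq_iff
 proof
 fix i
 obtain m :: int where m: "k $ i = s * of_int m" using k by (auto simp: lattice_def)
 have "a <= x $ i + s * of_int m" "x $ i + s * of_int m < a + s"
 using k by (auto simp: cell_def m[symmetric])
 then have "of_int (- m) * s <= x $ i - a" "x $ i - a < (of_int (- m) + 1) * s"
 by (simp_all add: algebra_simps)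
 then have "of_int (- m) <= (x $ i - a) / s" "(x $ i - a) / s < of_int (- m) + 1"
 using pos_le_divide_eq[OF s] pos_divide_less_eq[OF s] by blast+
 then have "\<lfloor>(x $ i - a) / s\<rfloor> = - m" by (rule floor_unique)
 then show "k $ i = ?k $ i" by (simp add: m)
 qed
 qed
qed

lemma tiles_measurable: "tiles s D ==> D : sets borel"
 by (simp add: tiles_def)

lemma tiles_translate:
 assumes "tiles s D" shows "tiles s {x. x + y : D}"
 unfolding tiles_def
proof
 have "{x. x + y : D} = (%x. x + y) -` D \<inter> space borel" by auto
 also have "... : sets borel" by (rule measurable_sets[OF _ tiles_measurable[OF assms]]) simp
 finally show "{x. x + y : D} : sets borel" .
 show "\<forall>x. \<exists>!k. k : lattice s & x + k : {x. x + y : D}"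
 proof
 fix x
 have "\<exists>!k. k : lattice s & (x + y) + k : D" using assms by (simp add: tiles_def)
 then show "\<exists>!k. k : lattice s & x + k : {x. x + y : D}" by (simp add: ac_simps)
 qed
qed

lemma tiles_sum_indicator:
 fixes D :: "(real^'n::finite) set"
 assumes "tiles s D"
 shows "(\<integral>\<^sup>+k. ind D (x + k) \<partial>count_space (lattice s)) = 1"
proof -
 obtain k0 where k0: "k0 : lattice s" "x + k0 : D" "!!k. k : lattice s ==> x + k : D ==> k = k0"
 using assms unfolding tiles_def by metis
 have "(\<integral>\<^sup>+k. ind D (x + k) \<partial>count_space (lattice s))
 = (\<integral>\<^sup>+k. ind {k0} k \<partial>count_space (lattice s))"
 by (rule nn_integral_cong) (use k0(1,2) in "auto simp: indicator_def dest: k0(3)")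
 then show ?thesis using k0(1) by simp
qed

text \<open>Every point of the space is a lattice translate of exactly one point of the tile.\<close>

lemma nn_integral_unfold:
 fixes D :: "(real^'n::finite) set"
 assumes D: "tiles s D" and [measurable]: "h : BM"
 shows "(NI x. h x) = (NI x. (\<integral>\<^sup>+k. h (x + k) \<partial>count_space (lattice s)) * ind D x)"
proof -
 have [measurable]: "D : sets borel" using D by (rule tiles_measurable)
 have "(NI x. h x) = (NI x. (\<integral>\<^sup>+k. h x * ind D (x + k) \<partial>count_space (lattice s)))"
 by (simp add: nn_integral_cmult tiles_sum_indicator[OF D])
 also have "... = (\<integral>\<^sup>+k. (NI x. h x * ind D (x + k)) \<partial>count_space (lattice s))"
 by (rule nn_integral_count_space_nn_integral) auto
 also have "... = (\<integral>\<^sup>+k. (NI x. h (x - k) * ind D x) \<partial>count_space (lattice s))"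
 proof (rule nn_integral_cong)
 fix k :: "real^'n"
 show "(NI x. h x * ind D (x + k)) = (NI x. h (x - k) * ind D x)"
 using nn_integral_translate[of "%x. h (x - k) * ind D x" k] by simp
 qed
 also have "... = (\<integral>\<^sup>+k. (NI x. h (x + k) * ind D x) \<partial>count_space (lattice s))"
 proof (rule nn_integral_bij_count_space[of uminus, THEN trans[OF sym], symmetric, THEN sym])
 show "bij_betw uminus (lattice s) (lattice s :: (real^'n) set)"
 by (rule bij_betwI[where g=uminus]) (auto simp: lattice_uminus)
 qed simp
 also have "... = (NI x. (\<integral>\<^sup>+k. h (x + k) * ind D x \<partial>count_space (lattice s)))"
 by (rule nn_integral_count_space_nn_integral[symmetric]) auto
 also have "... = (NI x. (\<integral>\<^sup>+k. h (x + k) \<partial>count_space (lattice s)) * ind D x)"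
 by (simp add: nn_integral_multc)
 finally show ?thesis .
qed

lemma AE_unfold:
 fixes D :: "(real^'n::finite) set"
 assumes D: "tiles s D" and P: "AEL x. x : D --> (\<forall>k\<in>lattice s. P (x + k))"
 shows "AEL x. P x"
proof -
 have "AEL x. \<forall>k\<in>lattice s. x + k : D --> P x"
 proof (subst AE_ball_countable)
 show "\<forall>k\<in>lattice s. AEL x. x + k : D --> P x"
 proof
 fix k :: "real^'n" assume k: "k : lattice s"
 from AE_translate[OF P, of k] show "AEL x. x + k : D --> P x"
 proof eventually_elim
 case (elim x)
 then show ?case using lattice_uminus[OF k] by fastforce
 qed
 qed
 qed simp
 then show ?thesis
 proof eventually_elim
 case (elim x)
 obtain k where "k : lattice s" "x + k : D" using D unfolding tiles_def by metis
 then show ?case using elim by blast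
 qed
qed

text \<open>The exceptional set is common to all lattice vectors, so that values along whole orbits can be compared.\<close>

definition lper :: "real => (real^'n::finite => 'b) => bool" where
 "lper s h \<longleftrightarrow> (AEL x. \<forall>k\<in>lattice s. h (x + k) = h x)"

lemma lper_comp2: "lper s h ==> lper s g ==> lper s (%x. F (h x) (g x))"
 unfolding lper_def by (auto elim: eventually_elim2)

lemma lper_comp: "lper s h ==> lper s (%x. F (h x))"
 unfolding lper_def by (auto elim: eventually_mono)

lemma nn_integral_tiles:
 fixes D D' :: "(real^'n::finite) set"
 assumes D: "tiles s D" "tiles s D'" and h[measurable]: "h : BM" and per: "lper s h"
 shows "(NI x. h x * ind D' x) = (NI x. h x * ind D x)"
proof -
 have [measurable]: "D : sets borel" "D' : sets borel" using D by (auto simp: tiles_measurable)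
 have "(NI x. h x * ind D' x)
 = (NI x. (\<integral>\<^sup>+k. h (x + k) * ind D' (x + k) \<partial>count_space (lattice s)) * ind D x)"
 by (rule nn_integral_unfold[OF D(1)]) auto
 also have "... = (NI x. h x * ind D x)"
 proof (rule nn_integral_cong_AE)
 show "AEL x. (\<integral>\<^sup>+k. h (x + k) * ind D' (x + k) \<partial>count_space (lattice s)) * ind D x
 = h x * ind D x"
 using per[unfolded lper_def]
 proof eventually_elim
 case (elim x)
 then have "(\<integral>\<^sup>+k. h (x + k) * ind D' (x + k) \<partial>count_space (lattice s))
 = (\<integral>\<^sup>+k. h x * ind D' (x + k) \<partial>count_space (lattice s))"
 by (intro nn_integral_cong) simp
 then show ?case by (simp add: nn_integral_cmult tiles_sum_indicator[OF D(2)])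
 qed
 qed
 finally show ?thesis .
qed

lemma set_integrable_tiles:
 fixes D D' :: "(real^'n::finite) set" and h :: "_ => 'b::{banach,second_countable_topology}"
 assumes D: "tiles s D" "tiles s D'" and h[measurable]: "h : BM" and per: "lper s h"
 and i: "set_integrable lborel D h"
 shows "set_integrable lborel D' h"
proof -
 have [measurable]: "D : sets borel" "D' : sets borel" using D by (auto simp: tiles_measurable)
 have eq: "ennreal (norm (ind E x *R h x)) = ennreal (norm (h x)) * ind E x" for E x
 by (auto simp: indicator_def)
 have "(NI x. ennreal (norm (h x)) * ind D' x) = (NI x. ennreal (norm (h x)) * ind D x)"
 by (rule nn_integral_tiles[OF D _ lper_comp[OF per]]) auto
 then show ?thesis
 using i unfolding set_integrable_def integrable_iff_bounded eq by auto
qed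

lemma set_integral_tiles_real:
 fixes D D' :: "(real^'n::finite) set" and h :: "_ => real"
 assumes D: "tiles s D" "tiles s D'" and h[measurable]: "h : BM" and per: "lper s h"
 and i: "set_integrable lborel D h"
 shows "(LINT x:D'|lborel. h x) = (LINT x:D|lborel. h x)"
proof -
 have [measurable]: "D : sets borel" "D' : sets borel" using D by (auto simp: tiles_measurable)
 have i': "set_integrable lborel D' h" by (rule set_integrable_tiles) fact+
 have eq: "ennreal (ind E x * h x) = ennreal (h x) * ind E x"
 "ennreal (- (ind E x * h x)) = ennreal (- h x) * ind E x" for E x
 by (auto simp: indicator_def)
 show ?thesis
 unfolding slint_def
 using real_lebesgue_integral_def[OF i[unfolded set_integrable_def]]
 real_lebesgue_integral_def[OF i'[unfolded set_integrable_def]]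
 nn_integral_tiles[OF D _ lper_comp[OF per, of ennreal]]
 nn_integral_tiles[OF D _ lper_comp[OF per, of "%z. ennreal (- z)"]]
 by (simp add: eq)
qed

lemma set_integral_tiles:
 fixes D D' :: "(real^'n::finite) set" and h :: "_ => complex"
 assumes D: "tiles s D" "tiles s D'" and h[measurable]: "h : BM" and per: "lper s h"
 and i: "set_integrable lborel D h"
 shows "(LINT x:D'|lborel. h x) = (LINT x:D|lborel. h x)"
proof -
 have i': "set_integrable lborel D' h" by (rule set_integrable_tiles) fact+
 have p: "set_integrable lborel E (%x. Re (h x))" "set_integrable lborel E (%x. Im (h x))"
 "Re (LINT x:E|lborel. h x) = (LINT x:E|lborel. Re (h x))"
 "Im (LINT x:E|lborel. h x) = (LINT x:E|lborel. Im (h x))" if "set_integrable lborel E h" for E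
 using integrable_Re[OF that[unfolded set_integrable_def]] integrable_Im[OF that[unfolded set_integrable_def]]
 integral_Re[OF that[unfolded set_integrable_def]] integral_Im[OF that[unfolded set_integrable_def]]
 by (simp_all add: set_integrable_def slint_def)
 show ?thesis
 using p[OF i] p[OF i'] set_integral_tiles_real[OF D _ lper_comp[OF per, of Re]]
 set_integral_tiles_real[OF D _ lper_comp[OF per, of Im]]
 by (intro complex_eqI) auto
qed

lemma emeasure_cell:
 assumes s: "0 < s"
 shows "emeasure lborel (cell a s :: (real^'n::finite) set) = ennreal (s ^ CARD('n))"
proof (rule antisym)
 let ?l = "(\<chi> i. a) :: real^'n" and ?u = "(\<chi> i. a + s) :: real^'n"
 have B: "(\<Prod>b\<in>Basis. (?u - ?l) \<bullet> b) = s ^ CARD('n)"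
 proof -
 have "(?u - ?l) \<bullet> b = s" if "b : Basis" for b
 using that by (auto simp: Basis_vec_def inner_axis)
 then show ?thesis by simp
 qed
 have le: "!!b. b : Basis ==> ?l \<bullet> b <= ?u \<bullet> b" using s by (auto simp: Basis_vec_def inner_axis)
 have "emeasure lborel (cell a s :: (real^'n) set) <= emeasure lborel (cbox ?l ?u)"
 by (intro emeasure_mono) (auto simp: cell_def mem_box_cart less_imp_le)
 then show "emeasure lborel (cell a s :: (real^'n) set) <= ennreal (s ^ CARD('n))"
 using emeasure_lborel_cbox[OF le] B by simp
 have "emeasure lborel (box ?l ?u) <= emeasure lborel (cell a s :: (real^'n) set)"
 by (intro emeasure_mono) (auto simp: cell_def mem_box_cart less_imp_le)
 then show "ennreal (s ^ CARD('n)) <= emeasure lborel (cell a s :: (real^'n) set)"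
 using emeasure_lborel_box[OF le] B by simp
qed

lemma measure_cell: "0 < s ==> measure lborel (cell a s :: (real^'n::finite) set) = s ^ CARD('n)"
 by (simp add: measure_def emeasure_cell)

section \<open>Plane waves and completeness of the trigonometric system\<close>

lemma plane_wave_add_left: "pw (k + l) x = pw k x * pw l x"
 by (simp add: plane_wave_def inner_add_left algebra_simps cis_mult)

lemma plane_wave_add_right: "pw k (x + y) = pw k x * pw k y"
 by (simp add: plane_wave_def inner_add_right algebra_simps cis_mult)

lemma plane_wave_commute: "pw x y = pw y x"
 by (simp add: plane_wave_def inner_commute)

lemma norm_plane_wave [simp]: "norm (pw x y) = 1"
 by (simp add: plane_wave_def)

lemma plane_wave_0 [simp]: "pw 0 y = 1" "pw x 0 = 1"
 by (simp_all add: plane_wave_def)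

lemma cnj_plane_wave: "cnj (pw x y) = pw (- x) y"
 by (simp add: plane_wave_def cis_cnj)

lemma plane_wave_mult_cnj [simp]: "pw x y * cnj (pw x y) = 1"
 by (simp add: complex_norm_square[symmetric])

lemma plane_wave_scaleR: "pw (c *R x) y = pw x (c *R y)"
 by (simp add: plane_wave_def)

lemma continuous_plane_wave [continuous_intros]:
 "continuous_on S f ==> continuous_on S g ==> continuous_on S (%z. pw (f z) (g z))"
 unfolding plane_wave_def by (intro continuous_intros)

lemma borel_measurable_plane_wave [measurable (raw)]:
 fixes f g :: "'a => real^'n::finite"
 assumes [measurable]: "f : borel_measurable M" "g : borel_measurable M"
 shows "(%z. pw (f z) (g z)) : borel_measurable M"
proof -
 have "cis : BM" by (intro borel_measurable_continuous_onI continuous_intros)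
 then show ?thesis unfolding plane_wave_def by measurable
qed

lemma measurable_plane_wave [measurable]: "pw k : BM"
 by (rule borel_measurable_plane_wave[where f="%_. k" and g="%x. x"]) auto

lemma plane_wave_lattice:
 assumes "k : lattice s" "l : lattice (1 / s)" "s ~= 0"
 shows "pw k l = 1"
proof -
 obtain m n where m: "!!i. k $ i = s * of_int (m i)" "!!i. l $ i = 1 / s * of_int (n i)"
 using assms(1,2) unfolding lattice_def by auto metis
 have "k \<bullet> l = (SU i. of_int (m i * n i))"
 using assms(3) by (simp add: inner_vec_def m)
 then have "k \<bullet> l = of_int (SU i. m i * n i)" by simp
 then show ?thesis by (metis plane_wave_def cis_multiple_2pi Ints_of_int)
qed

lemma lper_plane_wave:
 assumes "k : lattice s" "s ~= 0"
 shows "lper (1 / s) (pw k)"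
 unfolding lper_def using plane_wave_lattice[OF assms(1) _ assms(2)]
 by (simp add: plane_wave_add_right)

text \<open>
 Translating the cell multiplies the integral of an exponential by a phase, but by periodicity
 leaves it unchanged; hence it vanishes unless the exponential is constant.
\<close>

lemma plane_wave_orthogonal:
 fixes k :: "real^'n::finite"
 assumes k: "k : lattice s" and s: "0 < s"
 shows "(LINT x:cell a (1 / s)|lborel. pw k x) = (if k = 0 then 1 / s ^ CARD('n) else 0)"
proof (cases "k = 0")
 case True
 have "(LINT x:cell a (1 / s)|lborel. pw k x) = (LINT x:(cell a (1 / s) :: (real^'n) set)|lborel. (1::complex))"
 by (simp add: True)
 also have "... = 1 / s ^ CARD('n)"
 using s by (subst set_integral_const) (auto simp: emeasure_cell measure_cell power_one_over of_real_def[symmetric])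
 finally show ?thesis using True by simp
next
 case False
 let ?C = "cell a (1 / s) :: (real^'n) set"
 have t: "tiles (1 / s) ?C" using s by (simp add: tiles_cell)
 define y where "y = (1 / (2 * (k \<bullet> k))) *R k"
 have "k \<bullet> y = 1 / 2" using False by (simp add: y_def)
 then have "2 * pi * (k \<bullet> y) = pi" by simp
 then have ky: "pw k y = - 1" unfolding plane_wave_def by (simp only: cis_pi)
 have int: "set_integrable lborel ?C (pw k)"
 unfolding set_integrable_def
 proof (rule integrableI_bounded_set_indicator[where B=1])
 show "emeasure lborel ?C < \<infinity>" using s by (simp add: emeasure_cell)
 show "pw k : borel_measurable lborel" by measurable
 qed auto
 have m: "pw k : BM" by measurable
 have "(LINT x:?C|lborel. pw k x) = (LINT x:{x. x + y : ?C}|lborel. pw k x)"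
 by (rule set_integral_tiles[OF tiles_translate[OF t] t m lper_plane_wave[OF k]])
 (use s set_integrable_tiles[OF t tiles_translate[OF t] m lper_plane_wave[OF k] int] in auto)
 also have "... = (LI x. - (ind ?C (x + y) *R pw k (x + y)))"
 unfolding slint_def
 by (intro Bochner_Integration.integral_cong) (auto simp: indicator_def plane_wave_add_right ky)
 also have "... = - (LI x. ind ?C x *R pw k x)"
 using m by (subst integral_translate[where f="%x. - (ind ?C x *R pw k x)"]) auto
 finally have "(LINT x:?C|lborel. pw k x) = - (LINT x:?C|lborel. pw k x)"
 by (simp add: slint_def)
 then show ?thesis using False by simp
qed

lemma set_integral_vanishes_on_borel:
 fixes g :: "'a => 'b::{banach,second_countable_topology}" and z :: "'a => 'c::topological_space"
 assumes g: "integrable M g" and z: "z : measurable M borel"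
 and E: "sets borel = sigma_sets UNIV E" "Int_stable E"
 and zero: "!!B. B : E ==> (LINT x:z -` B \<inter> space M|M. g x) = 0"
 and total: "(LINT x|M. g x) = 0"
 and B: "B : sets borel"
 shows "(LINT x:z -` B \<inter> space M|M. g x) = 0"
proof -
 have "E \<subseteq> Pow UNIV" by simp
 with E(2) show ?thesis using B[unfolded E(1)]
proof (induction rule: sigma_sets_induct_disjoint)
 case (basic B) then show ?case by (rule zero)
next
 case empty then show ?case by (simp add: slint_def)
next
 case (compl B)
 have m: "z -` B \<inter> space M : sets M" using compl(1) E(1) z by (auto intro: measurable_sets)
 have i: "set_integrable M (z -` B \<inter> space M) g"
 using integrable_mult_indicator[OF m g] by (simp add: set_integrable_def)
 have "(LINT x:z -` (UNIV - B) \<inter> space M|M. g x) = (LINT x|M. g x - ind (z -` B \<inter> space M) x *R g x)"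
 unfolding slint_def
 by (intro Bochner_Integration.integral_cong) (auto simp: indicator_def)
 also have "... = (LINT x|M. g x) - (LINT x:z -` B \<inter> space M|M. g x)"
 using g i unfolding slint_def set_integrable_def by (rule Bochner_Integration.integral_diff)
 finally show ?case using compl(2) total by simp
next
 case (union A)
 have m: "z -` A i \<inter> space M : sets M" for i using union(2) E(1) z by (auto intro: measurable_sets)
 have "z -` (\<Union>i. A i) \<inter> space M = (\<Union>i. z -` A i \<inter> space M)" by auto
 then have "(LINT x:z -` (\<Union>i. A i) \<inter> space M|M. g x) = (LINT x:(\<Union>i. z -` A i \<inter> space M)|M. g x)" by simp
 also have "... = (\<Sum>i. (LINT x:z -` A i \<inter> space M|M. g x))"
 proof (rule lebesgue_integral_countable_add[OF m])
 show "z -` A i \<inter> space M \<inter> (z -` A j \<inter> space M) = {}" if "i ~= j" for i j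
 using union(1) that by (auto simp: disjoint_family_on_def)
 show "set_integrable M (\<Union>i. z -` A i \<inter> space M) g"
 unfolding set_integrable_def by (intro integrable_mult_indicator sets.countable_UN g) (use m in auto)
 qed
 also have "... = 0" using union(3) by simp
 finally show ?case .
qed
qed

lemma borel_measurable_Arg [measurable]: "Arg : BM"
proof -
 have [measurable]: "\<real>\<^sub>\<le>\<^sub>0 : sets (borel :: complex measure)" by (simp add: borel_closed)
 have c[measurable]: "(%z. ind (- \<real>\<^sub>\<le>\<^sub>0) z *R Arg z) : BM"
 by (rule borel_measurable_continuous_on_indicator)
 (auto intro!: continuous_on_Arg borel_open simp: open_Compl)
 have "Arg = (%z. ind (- \<real>\<^sub>\<le>\<^sub>0) z *R Arg z + ind (\<real>\<^sub>\<le>\<^sub>0 - {0}) z *R pi)"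
 proof
 fix z
 show "Arg z = ind (- \<real>\<^sub>\<le>\<^sub>0) z *R Arg z + ind (\<real>\<^sub>\<le>\<^sub>0 - {0}) z *R pi"
 proof (cases "z : \<real>\<^sub>\<le>\<^sub>0 - {0}")
 case True
 then have "Arg z = pi" by (auto simp: Arg_eq_pi complex_nonpos_Reals_iff complex_eq_iff)
 then show ?thesis using True by (simp add: indicator_def)
 qed (auto simp: indicator_def Arg_zero)
 qed
 moreover have "(%z::complex. ind (- \<real>\<^sub>\<le>\<^sub>0) z *R Arg z + ind (\<real>\<^sub>\<le>\<^sub>0 - {0}) z *R pi) : BM"
 by (intro borel_measurable_add c) measurable
 ultimately show ?thesis by simp
qed

text \<open>Trigonometric polynomials, closed under products so that they pull back polynomials on the torus.\<close>

inductive trig :: "real => (real^'n => complex) => bool" for s where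
 wave: "k : lattice s ==> trig s (pw k)"
| add: "trig s f ==> trig s g ==> trig s (%x. f x + g x)"
| scale: "trig s f ==> trig s (%x. c * f x)"

lemma trig_mult_wave:
 assumes "trig s f" "k : lattice s" shows "trig s (%x. pw k x * f x)"
 using assms(1)
proof induction
 case (wave l)
 have "trig s (pw (k + l))" using assms(2) wave by (intro trig.wave lattice_add)
 then show ?case by (simp add: plane_wave_add_left[abs_def])
next
 case (add f g) then show ?case using trig.add[OF add.IH] by (simp add: distrib_left)
next
 case (scale f c) then show ?case using trig.scale[OF scale.IH, of c] by (simp add: mult.left_commute)
qed

lemma trig_mult:
 assumes "trig s f" "trig s g" shows "trig s (%x. f x * g x)"
 using assms(1)
proof induction
 case (wave l) then show ?case by (rule trig_mult_wave[OF assms(2)])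
next
 case (add f g) then show ?case using trig.add[OF add.IH] by (simp add: distrib_right)
next
 case (scale f c) then show ?case using trig.scale[OF scale.IH, of c] by (simp add: mult.assoc)
qed

lemma trig_const: "trig s (%x. c)"
 using trig.scale[OF trig.wave[OF lattice_0], of s c] by simp

lemma trig_sum: "(!!i. i : I ==> trig s (f i)) ==> trig s (%x. \<Sum>i\<in>I. f i x)"
 by (induction I rule: infinite_finite_induct) (auto intro: trig.add trig_const)

lemma trig_bounded: "trig s f ==> f : BM & (\<exists>B. \<forall>x. norm (f x) <= B)"
proof (induction rule: trig.induct)
 case (add f g)
 then obtain B1 B2 where "\<forall>x. norm (f x) <= B1" "\<forall>x. norm (g x) <= B2" by blast
 then have "norm (f x + g x) <= B1 + B2" for x by (meson add_mono norm_triangle_le)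
 then show ?case using add by auto
next
 case (scale f c)
 then obtain B where "\<forall>x. norm (f x) <= B" by blast
 then have "norm (c * f x) <= norm c * B" for x by (simp add: norm_mult mult_left_mono)
 then show ?case using scale by auto
qed auto

definition torus_point :: "real => real^'n => complex^'n" where
 "torus_point s x = (\<chi> i. cis (2 * pi * (s * x $ i)))"

lemma continuous_torus_point: "continuous_on A (torus_point s)"
 unfolding torus_point_def by (intro continuous_intros)

lemma trig_real_polynomial:
 fixes p :: "complex^'n::finite => real"
 assumes "real_polynomial_function p"
 shows "trig s (%x. cor (p (torus_point s x)))"
 using assms
proof induction
 case (linear f)
 interpret f: bounded_linear f by fact
 have wave: "cis (2 * pi * (s * x $ i)) = pw (axis i s) x" for i and x :: "real^'n"
 by (simp add: plane_wave_def inner_axis' )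
 have split: "axis i w = Re w *R axis i 1 + Im w *R axis i \<i>" for i :: 'n and w :: complex
 by (simp add: vec_eq_iff axis_def complex_eq_iff)
 have fz: "f z = (SU i. Re (z $ i) * f (axis i 1) + Im (z $ i) * f (axis i \<i>))" for z
 proof -
 have "z = (SU i. axis i (z $ i))"
 by (simp add: vec_eq_iff axis_def)
 then have "f z = (SU i. f (axis i (z $ i)))" using f.sum[of "%i. axis i (z $ i)" UNIV] by simp
 also have "... = (SU i. f (Re (z $ i) *R axis i 1 + Im (z $ i) *R axis i \<i>))"
 by (simp only: split[symmetric])
 finally show ?thesis by (simp add: f.add f.scaleR)
 qed
 have *: "cor (f (torus_point s x)) = (\<Sum>i\<in>UNIV.
 (of_real (f (axis i 1)) / 2 + of_real (f (axis i \<i>)) / (2 * \<i>)) * pw (axis i s) x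
 + (of_real (f (axis i 1)) / 2 - of_real (f (axis i \<i>)) / (2 * \<i>)) * pw (- axis i s) x)" for x
 proof -
 have lin: "cor (Re w * a + Im w * b) = (of_real a / 2 + of_real b / (2 * \<i>)) * w
 + (of_real a / 2 - of_real b / (2 * \<i>)) * cnj w" for w a b
 by (simp add: complex_eq_iff field_simps)
 have comp: "torus_point s x $ i = pw (axis i s) x" for i
 by (simp add: torus_point_def wave)
 show ?thesis
 by (simp only: fz[of "torus_point s x"] of_real_sum lin comp cnj_plane_wave)
 qed
 show ?case
 unfolding * by (intro trig_sum trig.add trig.scale trig.wave lattice_axis lattice_uminus)
next
 case (const c) then show ?case by (rule trig_const)
next
 case (add f g) then show ?case using trig.add[OF add.IH] by simp
next
 case (mult f g) then show ?case using trig_mult[OF mult.IH] by simp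
qed

text \<open>
 By Stone--Weierstrass on the torus, a function orthogonal to
 all exponentials is orthogonal to all continuous functions of the torus point, hence to all
 indicators of Borel sets of the torus, and these are all Borel subsets of the cell.
\<close>

lemma trig_total:
 fixes g :: "real^'n::finite => complex"
 assumes s: "0 < s" and g: "intb g" and off: "AEL x. x \<notin> cell a (1 / s) --> g x = 0"
 and orth: "!!k. k : lattice s ==> (LI x. g x * pw k x) = 0"
 shows "AEL x. g x = 0"
proof -
 let ?z = "torus_point s :: real^'n => complex^'n"
 have zm[measurable]: "?z : BM"
 by (intro borel_measurable_continuous_onI continuous_torus_point)
 have g_mult: "intb (%x. g x * f x)" if "f : BM" "!!x. norm (f x) <= B" for f B
 proof (rule Bochner_Integration.integrable_bound)
 show "intb (%x. B * norm (g x))" using g by auto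
 have "norm (g x * f x) <= norm (B * norm (g x))" for x
 proof -
 have "norm (g x) * norm (f x) <= norm (g x) * B" by (intro mult_left_mono that) auto
 then show ?thesis by (simp add: norm_mult mult.commute order_trans[OF _ abs_ge_self])
 qed
 then show "AEL x. norm (g x * f x) <= norm (B * norm (g x))" by simp
 qed (use g that in measurable)
 have trig0: "(LI x. g x * f x) = 0" if "trig s f" for f
 using that
 proof induction
 case (add f h)
 have "intb (%x. g x * f x)" "intb (%x. g x * h x)"
 using add trig_bounded g_mult by meson+
 then show ?case using add.IH by (simp add: distrib_left)
 next
 case (scale f c) then show ?case by (simp add: mult.left_commute[of _ c])
 qed (rule orth)
 let ?T = "{z::complex^'n. \<forall>i. norm (z $ i) = 1}"
 have T: "compact ?T"
 unfolding compact_eq_bounded_closed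
 proof
 have "norm z <= of_nat CARD('n)" if "z : ?T" for z
 using that by (auto simp: norm_vec_def intro: order_trans[OF L2_set_le_sum])
 then show "bounded ?T" unfolding bounded_iff by blast
 have "?T = (\<Inter>i. {z. norm (z $ i) = 1})" by auto
 also have "closed ..." by (intro closed_INT ballI closed_Collect_eq continuous_intros)
 finally show "closed ?T" .
 qed
 have zT: "?z x : ?T" for x by (simp add: torus_point_def)
 have cont0: "(LI x. g x * of_real (h (?z x))) = 0"
 if h: "continuous_on UNIV h" "!!w. \<bar>h w\<bar> <= B" for h :: "complex^'n => real" and B
 proof -
 have hm[measurable]: "h : BM" using h(1) by (rule borel_measurable_continuous_onI)
 have "norm (LI x. g x * of_real (h (?z x))) <= e * (LI x. norm (g x))" if e: "e > 0" for e
 proof -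
 obtain p where p: "real_polynomial_function p" "!!w. w : ?T ==> \<bar>h w - p w\<bar> < e"
 using Stone_Weierstrass_real_polynomial_function[OF T continuous_on_subset[OF h(1)] e] by blast
 note tp = trig_real_polynomial[OF p(1), of s]
 have ih: "intb (%x. g x * of_real (h (?z x)))"
 by (rule g_mult[of _ B]) (use h(2) in auto)
 have ip: "intb (%x. g x * of_real (p (?z x)))"
 using trig_bounded[OF tp] g_mult by meson
 have "(LI x. g x * of_real (h (?z x)))
 = (LI x. g x * of_real (h (?z x)) - g x * of_real (p (?z x)))"
 using ih ip trig0[OF tp] by simp
 also have "norm ... <= (LI x. norm (g x * of_real (h (?z x)) - g x * of_real (p (?z x))))"
 by (rule integral_norm_bound)
 also have "... <= (LI x. e * norm (g x))"
 proof (rule integral_mono)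
 fix x
 have "norm (g x * of_real (h (?z x)) - g x * of_real (p (?z x))) = norm (g x) * \<bar>h (?z x) - p (?z x)\<bar>"
 by (simp add: right_diff_distrib[symmetric] norm_mult flip: of_real_diff)
 also have "... <= norm (g x) * e" using p(2)[OF zT] by (intro mult_left_mono) (auto intro: less_imp_le)
 finally show "norm (g x * of_real (h (?z x)) - g x * of_real (p (?z x))) <= e * norm (g x)" by (simp add: mult.commute)
 qed (use ih ip g in auto)
 finally show ?thesis by simp
 qed
 note * = this
 show ?thesis
 proof (rule ccontr)
 assume nz: "(LI x. g x * of_real (h (?z x))) ~= 0"
 define I where "I = (LI x. norm (g x))"
 define J where "J = norm (LI x. g x * of_real (h (?z x)))"
 have "I >= 0" unfolding I_def by (rule integral_nonneg_AE) simp
 moreover have "J > 0" using nz by (simp add: J_def)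
 moreover have "J <= (J / (2 * (I + 1))) * I"
 using *[of "J / (2 * (I + 1))"] \<open>J > 0\<close> \<open>I >= 0\<close> unfolding I_def[symmetric] J_def[symmetric] by simp
 moreover have "(J / (2 * (I + 1))) * I < J"
 using \<open>J > 0\<close> \<open>I >= 0\<close> by (simp add: field_simps) (smt (verit) mult_nonneg_nonneg)
 ultimately show False by linarith
 qed
 qed
 have open0: "(LINT x:?z -` V \<inter> space lborel|lborel. g x) = 0" if V: "open V" for V
 proof (cases "V = UNIV")
 case True
 then show ?thesis using cont0[of "%_. 1" 1] by (simp add: slint_def)
 next
 case False
 let ?h = "%j::nat. %w. min 1 (real j * infdist w (- V))"
 have ne: "- V ~= {}" using False by auto
 have "(%j. LI x. g x * of_real (?h j (?z x))) ----> (LI x. ind (?z -` V) x *R g x)"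
 proof (rule integral_dominated_convergence[where w="%x. norm (g x)"])
 show "AEL x. (%j. g x * of_real (?h j (?z x))) ----> ind (?z -` V) x *R g x"
 proof (rule AE_I2)
 fix x
 have "(%j. ?h j (?z x)) ----> ind (?z -` V) x"
 proof (cases "?z x : V")
 case True
 then have pos: "infdist (?z x) (- V) > 0"
 using in_closed_iff_infdist_zero[of "- V" "?z x"] V ne infdist_nonneg[of "?z x" "- V"]
 by (auto simp: less_le)
 have "eventually (%j. ?h j (?z x) = 1) sequentially"
 using eventually_ge_at_top[of "nat \<lceil>1 / infdist (?z x) (- V)\<rceil>"]
 proof eventually_elim
 case (elim j)
 then have "1 / infdist (?z x) (- V) <= real j" by linarith
 then show ?case using pos by (simp add: field_simps min_def)
 qed
 then show ?thesis using True by (simp add: tendsto_eventually)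
 next
 case False
 then show ?thesis by (simp add: infdist_zero)
 qed
 then have "(%j. g x * of_real (?h j (?z x))) ----> g x * of_real (ind (?z -` V) x)"
 by (intro tendsto_intros)
 then show "(%j. g x * of_real (?h j (?z x))) ----> ind (?z -` V) x *R g x"
 by (simp add: scaleR_conv_of_real mult.commute)
 qed
 fix j
 have m: "(%w. ?h j w) : BM"
 by (intro borel_measurable_continuous_onI continuous_intros)
 show "(%x. g x * of_real (?h j (?z x))) : borel_measurable lborel"
 using g measurable_compose[OF zm m] by measurable
 show "AEL x. norm (g x * of_real (?h j (?z x))) <= norm (g x)"
 by (auto simp: norm_mult infdist_nonneg intro!: mult_left_le)
 show "(%x. ind (?z -` V) x *R g x) : borel_measurable lborel"
 using g measurable_sets[OF zm borel_open[OF V]] by (intro borel_measurable_scaleR borel_measurable_indicator) auto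
 qed (use g in auto)
 moreover have "(LI x. g x * of_real (?h j (?z x))) = 0" for j
 by (rule cont0[of _ 1]) (auto intro!: continuous_intros simp: infdist_nonneg)
 ultimately have "(LI x. ind (?z -` V) x *R g x) = 0"
 by (simp add: LIMSEQ_const_iff)
 then show ?thesis by (simp add: slint_def)
 qed
 let ?r = "%w::complex^'n. (\<chi> i. a + 1 / (2 * s) - Arg (cnj (w $ i) * cis (2 * pi * s * a + pi)) / (2 * pi * s)) :: real^'n"
 have rm[measurable]: "?r : BM"
 proof (subst borel_measurable_euclidean_space, intro ballI)
 fix b :: "real^'n" assume "b : Basis"
 then obtain i where b: "b = axis i 1" by (auto simp: Basis_vec_def)
 have [measurable]: "(%w::complex^'n. cnj (w $ i) * cis (2 * pi * s * a + pi)) : BM"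
 by (intro borel_measurable_continuous_onI continuous_intros)
 show "(%w. ?r w \<bullet> b) : BM"
 unfolding b inner_axis by simp
 qed
 have rz: "?r (?z x) = x" if "x : cell a (1 / s)" for x
 unfolding vec_eq_iff
 proof
 fix i
 let ?y = "pi - 2 * pi * s * (x $ i - a)"
 have "0 <= x $ i - a" "x $ i - a < 1 / s" using that by (auto simp: cell_def field_simps)
 then have "0 <= s * (x $ i - a)" "s * (x $ i - a) < 1" using s by (auto simp: field_simps)
 then have "?y : {-pi<..pi}" by (auto simp: mult.assoc)
 then have "Arg (cis ?y) = ?y" by (rule Arg_cis)
 moreover have "cnj (?z x $ i) * cis (2 * pi * s * a + pi) = cis ?y"
 by (simp add: torus_point_def cis_cnj cis_mult algebra_simps)
 ultimately have "?r (?z x) $ i = a + 1 / (2 * s) - ?y / (2 * pi * s)" by simp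
 then show "?r (?z x) $ i = x $ i" using s by (simp add: field_simps)
 qed
 show ?thesis
 proof (rule sigma_finite_measure.density_zero[OF sigma_finite_lborel g])
 fix A :: "(real^'n) set" assume A: "A : sets lborel"
 have rA: "?r -` A : sets borel" using measurable_sets[OF rm, of A] A by simp
 have "(LINT x:?z -` (?r -` A) \<inter> space lborel|lborel. g x) = 0"
 proof (rule set_integral_vanishes_on_borel[where E="{S. open S}"])
 show "sets borel = sigma_sets UNIV {S :: (complex^'n) set. open S}"
 by (simp add: borel_def)
 show "Int_stable {S :: (complex^'n) set. open S}" by (auto simp: Int_stable_def)
 qed (use g rA open0 open0[of UNIV] in "auto simp: slint_def")
 moreover have "(LINT x:A|lborel. g x) = (LINT x:?z -` (?r -` A) \<inter> space lborel|lborel. g x)"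
 unfolding slint_def
 proof (rule integral_cong_AE)
 show "AEL x. ind A x *R g x = ind (?z -` (?r -` A) \<inter> space lborel) x *R g x"
 using off
 proof eventually_elim
 case (elim x)
 show ?case by (cases "x : cell a (1 / s)") (use elim rz[of x] in "auto simp: indicator_def")
 qed
 qed (use A g measurable_sets[OF zm rA] in "auto intro!: borel_measurable_scaleR borel_measurable_indicator")
 ultimately show "(LINT x:A|lborel. g x) = 0" by simp
 qed
qed

section \<open>Completeness of the space of square-integrable functions and Parseval's identity\<close>

lemma L2_Riesz_Fischer:
 fixes f :: "nat => real^'n::finite => 'b::{banach,second_countable_topology}"
 assumes L2: "!!n. f n : L2"
 and Cauchy: "!!e. 0 < e ==> \<exists>N. \<forall>m\<ge>N. \<forall>n\<ge>N. L2norm (%x. f m x - f n x) < e"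
 obtains F where "F : L2" "(%n. L2norm (%x. f n x - F x)) ----> 0"
proof -
 have [measurable]: "f n : BM" for n using L2 by auto
 have "\<exists>N. \<forall>k. \<forall>m\<ge>N k. \<forall>n\<ge>N k. L2norm (%x. f m x - f n x) < (1/2)^k"
 by (intro choice allI Cauchy) simp
 then obtain N where N: "!!k m n. m >= N k ==> n >= N k ==> L2norm (%x. f m x - f n x) < (1/2)^k" by blast
 define r where "r k = Max (N ` {..k}) + k" for k :: nat
 have rN: "N k <= r j" if "k <= j" for k j
 unfolding r_def by (rule trans_le_add1, rule Max_ge) (use that in auto)
 define d where "d k x = norm (f (r (Suc k)) x - f (r k) x)" for k x
 have dL2: "d k : L2" for k
 unfolding d_def using L2 by (intro L2_norm L2_diff) auto
 have dn: "L2norm (d k) <= (1/2)^k" for k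
 using N[of k "r (Suc k)" "r k"] rN[of k k] rN[of k "Suc k"] by (simp add: d_def L2norm_def)
 have [measurable]: "d k : BM" for k using dL2 by auto
 have S: "(%x. \<Sum>k<n. d k x) : L2 & L2norm (%x. \<Sum>k<n. d k x) <= (\<Sum>k<n. (1/2)^k)" for n
 proof (induction n)
 case 0 show ?case by (simp add: L2norm_def)
 next
 case (Suc n)
 then show ?case
 using L2norm_triangle[of "%x. \<Sum>k<n. d k x" "d n"] dL2[of n] dn[of n] by (auto intro: L2_add)
 qed
 have geo: "(\<Sum>k<n. (1/2::real)^k) <= 2" for n
 by (simp add: sum_gp_strict)
 let ?S = "%n x. ennreal ((\<Sum>k<n. d k x)^2)"
 have "(NI x. (SUP n. ?S n x)) = (SUP n. \<integral>\<^sup>+x. ?S n x \<partial>lborel)"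
 proof (rule nn_integral_monotone_convergence_SUP)
 show "incseq ?S"
 by (intro incseq_SucI le_funI ennreal_leI power_mono) (auto simp: d_def intro: sum_nonneg)
 qed measurable
 also have "... <= 4"
 proof (rule SUP_least)
 fix n
 have "(NI x. ?S n x) = ennreal ((L2norm (%x. \<Sum>k<n. d k x))^2)"
 using nn_L2norm[of "%x. \<Sum>k<n. d k x"] S by simp
 also have "... <= ennreal (2^2)"
 using S[of n] geo[of n] by (intro ennreal_leI power_mono) auto
 finally show "(NI x. ?S n x) <= 4" by simp
 qed
 finally have "(NI x. (SUP n. ?S n x)) < \<infinity>"
 by (rule le_less_trans) simp
 then have fin: "AEL x. (SUP n. ?S n x) ~= \<infinity>"
 by (intro nn_integral_PInf_AE) auto
 have conv: "AEL x. convergent (%k. f (r k) x)"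
 using fin
 proof eventually_elim
 case (elim x)
 define c where "c = enn2real (SUP n. ?S n x)"
 have c: "ennreal c = (SUP n. ?S n x)" 
 unfolding c_def using elim by (intro ennreal_enn2real) (simp only: less_top infinity_ennreal_def)
 have "summable (%k. d k x)"
 proof (rule bounded_imp_summable)
 fix n
 have "?S (Suc n) x <= ennreal c" unfolding c by (rule SUP_upper) simp
 then have "(\<Sum>k<Suc n. d k x)^2 <= c" by (simp add: c_def)
 then show "(\<Sum>k\<le>n. d k x) <= sqrt c" by (simp add: real_le_rsqrt lessThan_Suc_atMost)
 qed (simp add: d_def)
 then have "summable (%k. f (r (Suc k)) x - f (r k) x)"
 unfolding d_def by (rule summable_norm_cancel)
 then have "convergent (%n. \<Sum>k<n. (f (r (Suc k)) x - f (r k) x))"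
 by (simp add: summable_iff_convergent)
 then have "convergent (%n. f (r n) x - f (r 0) x)"
 by (simp add: sum_lessThan_telescope[of "%k. f (r k) x"])
 then have "convergent (%n. (f (r n) x - f (r 0) x) + f (r 0) x)"
 by (intro convergent_add convergent_const)
 then show ?case by simp
 qed
 define F where "F x = lim (%k. f (r k) x)" for x
 have [measurable]: "F : BM" unfolding F_def by (rule borel_measurable_lim_metric) simp
 have bound: "(NI x. ennreal ((norm (f m x - F x))^2)) <= ennreal (e^2)"
 if M: "\<forall>m\<ge>M. \<forall>n\<ge>M. L2norm (%x. f m x - f n x) < e" and m: "m >= M" for e m M
 proof -
 have "(NI x. ennreal ((norm (f m x - F x))^2))
 <= (NI x. liminf (%k. ennreal ((norm (f m x - f (r k) x))^2)))"
 proof (rule nn_integral_mono_AE, use conv in eventually_elim)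
 case (elim x)
 then have "(%k. f (r k) x) ----> F x" by (simp add: F_def convergent_LIMSEQ_iff)
 then have "(%k. ennreal ((norm (f m x - f (r k) x))^2)) ----> ennreal ((norm (f m x - F x))^2)"
 by (intro tendsto_ennrealI tendsto_intros)
 from lim_imp_Liminf[OF trivial_limit_sequentially this] show ?case by (rule eq_refl[OF sym])
 qed
 also have "... <= liminf (%k. \<integral>\<^sup>+x. ennreal ((norm (f m x - f (r k) x))^2) \<partial>lborel)"
 by (rule nn_integral_liminf) measurable
 also have "... <= ennreal (e^2)"
 proof -
 have "eventually (%k. (NI x. ennreal ((norm (f m x - f (r k) x))^2)) <= ennreal (e^2)) sequentially"
 using eventually_ge_at_top[of M]
 proof eventually_elim
 case (elim k)
 have "r k >= M" using elim by (simp add: r_def)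
 then have "L2norm (%x. f m x - f (r k) x) <= e" using M m by (auto intro: less_imp_le)
 then have "(L2norm (%x. f m x - f (r k) x))^2 <= e^2" by (intro power_mono) auto
 then show ?case using L2 by (subst nn_L2norm) (auto intro: ennreal_leI)
 qed
 then have "liminf (%k. \<integral>\<^sup>+x. ennreal ((norm (f m x - f (r k) x))^2) \<partial>lborel) <= liminf (%k::nat. ennreal (e^2))"
 by (rule Liminf_mono)
 then show ?thesis by (simp add: Liminf_const)
 qed
 finally show ?thesis .
 qed
 have lim: "\<exists>M. \<forall>m\<ge>M. (%x. f m x - F x) : L2 & L2norm (%x. f m x - F x) <= e" if "0 < e" for e
 proof -
 obtain M where M: "\<forall>m\<ge>M. \<forall>n\<ge>M. L2norm (%x. f m x - f n x) < e" using Cauchy[OF \<open>0 < e\<close>] by blast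
 have "(%x. f m x - F x) : L2 & L2norm (%x. f m x - F x) <= e" if "m >= M" for m
 by (rule L2norm_leI[OF bound[OF M that]]) (use \<open>0 < e\<close> in auto)
 then show ?thesis by blast
 qed
 show ?thesis
 proof (rule that)
 obtain m where "(%x. f m x - F x) : L2" using lim[of 1] by auto
 from L2_diff[OF L2[of m] this] show "F : L2" by simp
 show "(%n. L2norm (%x. f n x - F x)) ----> 0"
 proof (rule LIMSEQ_I)
 fix e :: real assume "0 < e"
 then obtain M where "\<forall>m\<ge>M. L2norm (%x. f m x - F x) <= e / 2" using lim[of "e / 2"] by auto
 then show "\<exists>no. \<forall>n\<ge>no. norm (L2norm (%x. f n x - F x) - 0) < e"
 using \<open>0 < e\<close> by (intro exI[of _ M]) force
 qed
 qed
qed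

lemma ip_tendsto_left:
 fixes f :: "'i => real^'n::finite => complex"
 assumes "eventually (%i. f i : L2) G" "F : L2" "v : L2" and lim: "((%i. L2norm (%x. f i x - F x)) \<longlongrightarrow> 0) G"
 shows "((%i. ip (f i) v) \<longlongrightarrow> ip F v) G"
proof -
 have "((%i. ip (f i) v - ip F v) \<longlongrightarrow> 0) G"
 proof (rule Lim_null_comparison)
 show "eventually (%i. norm (ip (f i) v - ip F v) <= L2norm (%x. f i x - F x) * L2norm v) G"
 using assms(1)
 proof eventually_elim
 case (elim i)
 then show ?case using norm_ip_le[OF L2_diff[OF elim assms(2)] assms(3)] assms by (simp add: ip_diff_left)
 qed
 show "((%i. L2norm (%x. f i x - F x) * L2norm v) \<longlongrightarrow> 0) G"
 using tendsto_mult_right[OF lim, of "L2norm v"] by simp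
 qed
 then show ?thesis by (simp add: LIM_zero_iff)
qed

lemma ip_sum_left: "(!!i. i : I ==> u i : L2) ==> v : L2 ==> ip (%x. \<Sum>i\<in>I. u i x) v = (\<Sum>i\<in>I. ip (u i) v)"
 by (induction I rule: infinite_finite_induct) (auto simp: ip_add_left L2_sum, simp_all add: ip_def)

text \<open>
 By Bessel's
 inequality the partial sums converge, and the difference to their limit is orthogonal to the system.
\<close>

lemma orthonormal_total_Parseval:
 fixes e :: "nat => real^'n::finite => complex"
 assumes e: "!!j. e j : L2" and eC: "!!j x. x \<notin> C ==> e j x = 0"
 and orth: "!!i j. ip (e i) (e j) = (if i = j then 1 else 0)"
 and total: "!!g. g : L2 ==> (AEL x. x \<notin> C --> g x = 0) ==> (!!j. ip g (e j) = 0) ==> AEL x. g x = 0"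
 and g: "g : L2" "AEL x. x \<notin> C --> g x = 0"
 shows "(%j. (norm (ip g (e j)))^2) sums (L2norm g)^2"
 and "(%N. L2norm (%x. g x - (\<Sum>j<N. ip g (e j) * e j x))) ----> 0"
proof -
 define c where "c j = ip g (e j)" for j
 have part: "(%x. \<Sum>j\<in>J. c j * e j x) : L2" for J using e by (intro L2_sum L2_mult_const)
 have partn: "(L2norm (%x. \<Sum>j\<in>J. c j * e j x))^2 = (\<Sum>j\<in>J. (norm (c j))^2)" if "finite J" for J
 using that
 proof (induction J)
 case empty show ?case by (simp add: L2norm_def)
 next
 case (insert k J)
 have "ip (%x. \<Sum>j\<in>J. c j * e j x) (%x. c k * e k x) = 0"
 using insert e by (auto simp: ip_sum_left L2_mult_const ip_scale_left ip_scale_right orth intro!: sum.neutral)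
 then have z: "ip (%x. c k * e k x) (%x. \<Sum>j\<in>J. c j * e j x) = 0"
 using ip_cnj[of "%x. \<Sum>j\<in>J. c j * e j x" "%x. c k * e k x"] by simp
 have "(L2norm (e k))^2 = 1"
 using ip_self[of "e k"] orth[of k k] by (metis of_real_eq_1_iff)
 then show ?case
 using insert z L2norm_sq_add[OF L2_mult_const[OF e[of k], of "c k"] part[of J]]
 by (simp add: L2norm_scale power_mult_distrib)
 qed
 have bessel: "(L2norm (%x. g x - (\<Sum>j\<in>J. c j * e j x)))^2 = (L2norm g)^2 - (\<Sum>j\<in>J. (norm (c j))^2)" if J: "finite J" for J
 proof -
 have "ip (%x. \<Sum>j\<in>J. c j * e j x) g = (\<Sum>j\<in>J. c j * cnj (c j))"
 using e g by (simp add: ip_sum_left L2_mult_const ip_scale_left c_def ip_cnj)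
 also have "... = of_real (\<Sum>j\<in>J. (norm (c j))^2)" by (simp add: complex_norm_square[symmetric])
 finally have "ip g (%x. \<Sum>j\<in>J. c j * e j x) = of_real (\<Sum>j\<in>J. (norm (c j))^2)"
 using ip_cnj[of "%x. \<Sum>j\<in>J. c j * e j x" g] by (metis complex_cnj_complex_of_real)
 then show ?thesis
 using L2norm_sq_diff[OF g(1) part[of J]] partn[OF J] by simp
 qed
 have le: "(\<Sum>j\<in>J. (norm (c j))^2) <= (L2norm g)^2" if "finite J" for J
 using bessel[OF that] zero_le_power2[of "L2norm (%x. g x - (\<Sum>j\<in>J. c j * e j x))"] by linarith
 have summ: "summable (%j. (norm (c j))^2)"
 by (rule summableI_nonneg_bounded[where x="(L2norm g)^2"]) (auto intro: le)
 let ?S = "%N x. \<Sum>j<N. c j * e j x"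
 have diff: "(L2norm (%x. ?S m x - ?S n x))^2 = (\<Sum>j\<in>{n..<m}. (norm (c j))^2)" if "n <= m" for m n
 proof -
 have "?S m x - ?S n x = (\<Sum>j\<in>{n..<m}. c j * e j x)" for x
 using sum_diff_nat_ivl[of 0 n m "%j. c j * e j x"] that by (simp add: atLeast0LessThan)
 then show ?thesis using partn[of "{n..<m}"] by simp
 qed
 have "\<exists>N. \<forall>m\<ge>N. \<forall>n\<ge>N. L2norm (%x. ?S m x - ?S n x) < d" if d: "0 < d" for d
 proof -
 obtain N where N: "!!m n. m >= N ==> norm (\<Sum>j\<in>{m..<n}. (norm (c j))^2) < d^2"
 using summ[unfolded summable_Cauchy] d by (meson zero_less_power)
 have *: "L2norm (%x. ?S m x - ?S n x) < d" if "n >= N" "n <= m" for m n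
 proof -
 have "(L2norm (%x. ?S m x - ?S n x))^2 < d^2"
 using diff[OF that(2)] N[OF that(1), of m] by simp
 then show ?thesis using d by (meson less_imp_le power_less_imp_less_base)
 qed
 have "L2norm (%x. ?S m x - ?S n x) < d" if "n >= N" "m >= N" for m n
 proof (cases "n <= m")
 case False
 then have "L2norm (%x. ?S n x - ?S m x) < d" using that by (intro *) auto
 then show ?thesis by (rule subst[OF L2norm_minus_commute])
 qed (use that in "intro *")
 then show ?thesis by blast
 qed
 from L2_Riesz_Fischer[OF part this] obtain F
 where F: "F : L2" "(%n. L2norm (%x. ?S n x - F x)) ----> 0" by blast
 have coef: "ip F (e k) = c k" for k
 proof (rule LIMSEQ_unique)
 show "(%n. ip (?S n) (e k)) ----> ip F (e k)"
 by (rule ip_tendsto_left) (use F e part in auto)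
 have "eventually (%n. ip (?S n) (e k) = c k) sequentially"
 using eventually_gt_at_top[of k]
 proof eventually_elim
 case (elim n)
 have "ip (?S n) (e k) = (\<Sum>j<n. c j * (if j = k then 1 else 0))"
 using e by (subst ip_sum_left) (auto simp: L2_mult_const ip_scale_left orth)
 also have "... = (\<Sum>j<n. if j = k then c k else 0)" by (rule sum.cong) auto
 finally show ?case using elim by simp
 qed
 then show "(%n. ip (?S n) (e k)) ----> c k" by (rule tendsto_eventually)
 qed
 have FC: "AEL x. x \<notin> C --> F x = 0"
 proof -
 define C' where "C' = {x. \<exists>j. e j x ~= 0}"
 have [measurable]: "e j : BM" "F : BM" for j using e F by auto
 have [measurable]: "C' : sets borel" unfolding C'_def by measurable
 have H: "(%x. ind (- C') x *R F x) : L2" using F by (intro L2_indicator) auto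
 have "L2norm (%x. ind (- C') x *R F x) <= L2norm (%x. ?S n x - F x)" for n
 by (rule L2norm_mono) (use H F part in "auto simp: indicator_def C'_def")
 then have "L2norm (%x. ind (- C') x *R F x) <= 0"
 using LIMSEQ_le_const[OF F(2)] by blast
 then have "AEL x. ind (- C') x *R F x = 0"
 using L2norm_eq_0_iff[OF H] L2norm_nonneg by (metis order_antisym)
 then show ?thesis
 using eC by (auto elim!: eventually_mono simp: indicator_def C'_def split: if_splits)
 qed
 have "AEL x. g x - F x = 0"
 proof (rule total)
 show "(%x. g x - F x) : L2" using g F by auto
 show "AEL x. x \<notin> C --> g x - F x = 0" using g(2) FC by eventually_elim auto
 show "ip (%x. g x - F x) (e j) = 0" for j using g F e by (simp add: ip_diff_left coef c_def)
 qed
 then have gF: "AEL x. g x = F x" by simp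
 have "L2norm (%x. g x - ?S N x) = L2norm (%x. ?S N x - F x)" for N
 proof -
 have "L2norm (%x. g x - ?S N x) = L2norm (%x. F x - ?S N x)"
 by (rule L2norm_cong_AE) (use gF g F part[of "{..<N}"] in "auto elim: eventually_mono")
 then show ?thesis by (simp add: L2norm_minus_commute)
 qed
 then have lim: "(%N. L2norm (%x. g x - ?S N x)) ----> 0" using F(2) by simp
 then show "(%N. L2norm (%x. g x - (\<Sum>j<N. ip g (e j) * e j x))) ----> 0" by (simp add: c_def)
 have "(%N. (L2norm g)^2 - (L2norm (%x. g x - ?S N x))^2) ----> (L2norm g)^2 - 0^2"
 by (intro tendsto_intros lim)
 then show "(%j. (norm (ip g (e j)))^2) sums (L2norm g)^2"
 unfolding sums_def by (simp add: bessel c_def[symmetric])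
qed

definition cell_wave :: "real => real => real^'n::finite => real^'n => complex" where
 "cell_wave a s k x = ind (cell a (1 / s)) x *R (of_real (sqrt (s ^ CARD('n))) * cnj (pw k x))"

lemma cell_wave_L2:
 assumes s: "0 < s" shows "cell_wave a s k : L2"
proof -
 have "(%x. ind (cell a (1 / s)) x *R (1::complex)) : L2"
 proof -
 have i: "intb (ind (cell a (1 / s) :: (real^'n) set) :: _ => real)"
 using s by (intro integrable_real_indicator) (auto simp: emeasure_cell)
 have "intb (%x::real^'n. (norm (ind (cell a (1 / s)) x *R (1::complex)))^2)"
 by (rule Bochner_Integration.integrable_cong[THEN iffD1, OF refl _ i]) (auto simp: indicator_def)
 moreover have "(%x::real^'n. ind (cell a (1 / s)) x *R (1::complex)) : BM"
 by (intro borel_measurable_scaleR borel_measurable_indicator) auto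
 ultimately show ?thesis by (simp only: L2_iff)
 qed
 then have "(%x. (of_real (sqrt (s ^ CARD('n))) * pw (- k) x) * (ind (cell a (1 / s)) x *R (1::complex))) : L2"
 by (rule L2_mult_bounded[where c="sqrt (s ^ CARD('n))"]) (use s in "auto simp: norm_mult")
 then show ?thesis by (simp add: cell_wave_def[abs_def] cnj_plane_wave)
qed

lemma ip_cell_wave:
 fixes k :: "real^'n::finite"
 assumes "!!x. x \<notin> cell a (1 / s) ==> g x = 0"
 shows "ip g (cell_wave a s k) = of_real (sqrt (s ^ CARD('n))) * (LI x. g x * pw k x)"
 unfolding ip_def integral_mult_right_zero[symmetric]
 by (intro Bochner_Integration.integral_cong) (use assms in "auto simp: cell_wave_def indicator_def")

lemma cell_wave_orthonormal:
 fixes k l :: "real^'n::finite"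
 assumes s: "0 < s" and "k : lattice s" "l : lattice s"
 shows "ip (cell_wave a s k) (cell_wave a s l) = (if k = l then 1 else 0)"
proof -
 have "ip (cell_wave a s k) (cell_wave a s l)
 = of_real (sqrt (s ^ CARD('n))) * (LI x. cell_wave a s k x * pw l x)"
 by (rule ip_cell_wave) (simp add: cell_wave_def)
 also have "(%x. cell_wave a s k x * pw l x)
 = (%x. of_real (sqrt (s ^ CARD('n))) * (ind (cell a (1 / s)) x *R pw (l - k) x))"
 by (rule ext) (simp add: cell_wave_def cnj_plane_wave plane_wave_add_left[of l "- k", simplified])
 also have "(LI x. of_real (sqrt (s ^ CARD('n))) * (ind (cell a (1 / s)) x *R pw (l - k) x))
 = of_real (sqrt (s ^ CARD('n))) * (if l - k = 0 then 1 / s ^ CARD('n) else 0)"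
 using plane_wave_orthogonal[OF lattice_diff[OF assms(3,2)] s, of a]
 unfolding slint_def integral_mult_right_zero by simp
 finally show ?thesis
 using s by (auto simp: of_real_mult[symmetric] simp del: of_real_mult)
qed

lemma cell_wave_total:
 fixes g :: "real^'n::finite => complex"
 assumes s: "0 < s" and g: "g : L2" and off: "AEL x. x \<notin> cell a (1 / s) --> g x = 0"
 and orth: "!!k. k : lattice s ==> ip g (cell_wave a s k) = 0"
 shows "AEL x. g x = 0"
proof -
 let ?C = "cell a (1 / s) :: (real^'n) set"
 have sc: "sqrt (s ^ CARD('n)) ~= 0" using s by simp
 have "intb (%x. g x * cnj (cell_wave a s 0 x))" by (rule ip_integrable[OF g cell_wave_L2[OF s]])
 then have "intb (%x. of_real (1 / sqrt (s ^ CARD('n))) * (g x * cnj (cell_wave a s 0 x)))"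
 by (rule integrable_mult_right)
 moreover have "of_real (1 / sqrt (s ^ CARD('n))) * (g x * cnj (cell_wave a s 0 x)) = ind ?C x *R g x" for x
 using sc by (simp add: cell_wave_def indicator_def)
 ultimately have i: "intb (%x. ind ?C x *R g x)" by simp
 have gi: "AEL x. g x = ind ?C x *R g x" using off by eventually_elim (auto simp: indicator_def)
 have "AEL x. ind ?C x *R g x = 0"
 proof (rule trig_total[OF s i, of a])
 fix k :: "real^'n" assume k: "k : lattice s"
 have "ip g (cell_wave a s k) = ip (%x. ind ?C x *R g x) (cell_wave a s k)"
 using g cell_wave_L2[OF s] by (intro ip_cong_AE gi) auto
 then show "(LI x. ind ?C x *R g x * pw k x) = 0"
 using orth[OF k] sc by (simp add: ip_cell_wave indicator_def)
 qed (simp add: indicator_def)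
 with gi show ?thesis by eventually_elim simp
qed

lemma lattice_enumeration:
 assumes "0 < s"
 shows "bij_betw (from_nat_into (lattice s :: (real^'n::finite) set)) UNIV (lattice s)"
 using infinite_lattice[of s] assms by (intro bij_betw_from_nat_into) auto

lemma Parseval_cell:
 fixes g :: "real^'n::finite => complex"
 assumes s: "0 < s" and g: "g : L2" and off: "!!x. x \<notin> cell a (1 / s) ==> g x = 0"
 defines "e \<equiv> from_nat_into (lattice s :: (real^'n) set)"
 shows "(\<integral>\<^sup>+k. ennreal ((norm (LI x. g x * pw k x))^2) \<partial>count_space (lattice s))
 = ennreal ((L2norm g)^2 / s ^ CARD('n))"
 and "(%N. L2norm (%x. g x - (\<Sum>j<N. ip g (cell_wave a s (e j)) * cell_wave a s (e j) x))) ----> 0"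
proof -
 have bij: "bij_betw e UNIV (lattice s)" unfolding e_def by (rule lattice_enumeration[OF s])
 then have el: "e j : lattice s" for j by (auto dest: bij_betwE)
 have inj: "e i = e j \<longleftrightarrow> i = j" for i j using bij by (auto simp: bij_betw_def inj_eq)
 have tot: "AEL x. h x = 0"
 if "h : L2" "AEL x. x \<notin> cell a (1 / s) --> h x = 0" "!!j. ip h (cell_wave a s (e j)) = 0" for h
 proof (rule cell_wave_total[OF s that(1,2)])
 fix k :: "real^'n" assume "k : lattice s"
 then obtain j where "k = e j" using bij by (auto simp: bij_betw_def)
 then show "ip h (cell_wave a s k) = 0" using that(3) by simp
 qed
 note P = orthonormal_total_Parseval[where e="%j. cell_wave a s (e j)" and C="cell a (1 / s)" and g=g]
 have off': "AEL x. x \<notin> cell a (1 / s) --> g x = 0" using off by simp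
 have c0: "x \<notin> cell a (1 / s) ==> cell_wave a s k x = 0" for k x by (simp add: cell_wave_def)
 show "(%N. L2norm (%x. g x - (\<Sum>j<N. ip g (cell_wave a s (e j)) * cell_wave a s (e j) x))) ----> 0"
 by (rule P(2)) (use cell_wave_L2[OF s] c0 cell_wave_orthonormal[OF s el el] inj tot g off' in auto)
 have "(%j. (norm (ip g (cell_wave a s (e j))))^2) sums (L2norm g)^2"
 by (rule P(1)) (use cell_wave_L2[OF s] c0 cell_wave_orthonormal[OF s el el] inj tot g off' in auto)
 then have "(%j. (1 / s ^ CARD('n)) * (norm (ip g (cell_wave a s (e j))))^2) sums ((1 / s ^ CARD('n)) * (L2norm g)^2)"
 by (rule sums_mult)
 moreover have "(1 / s ^ CARD('n)) * (norm (ip g (cell_wave a s k)))^2 = (norm (LI x. g x * pw k x))^2" for k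
 using s by (simp add: ip_cell_wave[OF off] norm_mult power_mult_distrib)
 ultimately have sums: "(%j. (norm (LI x. g x * pw (e j) x))^2) sums ((L2norm g)^2 / s ^ CARD('n))"
 by simp
 have "(\<integral>\<^sup>+k. ennreal ((norm (LI x. g x * pw k x))^2) \<partial>count_space (lattice s))
 = (\<integral>\<^sup>+j. ennreal ((norm (LI x. g x * pw (e j) x))^2) \<partial>count_space UNIV)"
 by (rule nn_integral_bij_count_space[OF bij, symmetric])
 also have "... = (\<Sum>j. ennreal ((norm (LI x. g x * pw (e j) x))^2))"
 by (rule nn_integral_count_space_nat)
 also have "... = ennreal ((L2norm g)^2 / s ^ CARD('n))"
 using sums by (intro suminf_ennreal_eq) auto
 finally show "(\<integral>\<^sup>+k. ennreal ((norm (LI x. g x * pw k x))^2) \<partial>count_space (lattice s))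
 = ennreal ((L2norm g)^2 / s ^ CARD('n))" .
qed

section \<open>Wave packets over a dual cell\<close>

lemma Zscaled_eq_cell: "0 < s ==> Zscaled s = cell (- 1 / (2 * s)) (1 / s)"
 unfolding Zscaled_def Zcell_def cell_def by (auto simp: field_simps)

lemma Zscaled_measurable [measurable]: "Zscaled s : sets (borel :: (real^'n::finite) measure)"
proof -
 have "Zscaled s = (\<Inter>i. {eta::real^'n. - 1/2 <= s * eta $ i} \<inter> {eta. s * eta $ i < 1/2})"
 by (auto simp: Zscaled_def Zcell_def)
 also have "... : sets borel"
 by (intro sets.countable_INT' sets.Int borel_closed borel_open closed_Collect_le open_Collect_less
 continuous_intros) auto
 finally show ?thesis .
qed

lemma emeasure_Zscaled_finite: "0 < s ==> emeasure lborel (Zscaled s :: (real^'n::finite) set) < \<infinity>"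
 by (simp add: Zscaled_eq_cell emeasure_cell)

lemma cell_bounded:
 assumes "x : cell 0 s" "0 < s"
 shows "norm (x :: real^'n::finite) <= real CARD('n) * s"
proof -
 have "norm x <= (SU i. \<bar>x $ i\<bar>)" by (rule norm_le_l1_cart)
 also have "... <= (\<Sum>i\<in>(UNIV::'n set). s)"
 using assms by (intro sum_mono) (auto simp: cell_def abs_of_nonneg less_imp_le)
 finally show ?thesis by simp
qed

lemma Zscaled_bounded:
 assumes "0 < s"
 obtains R where "!!eta::real^'n::finite. eta : Zscaled s ==> norm eta <= R"
proof -
 have "norm eta <= CARD('n) * (1 / s)" if "eta : Zscaled s" for eta :: "real^'n"
 proof -
 have "norm eta <= (SU i. \<bar>eta $ i\<bar>)" by (rule norm_le_l1_cart)
 also have "... <= (\<Sum>i\<in>(UNIV::'n set). 1 / s)"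
 proof (rule sum_mono)
 fix i
 have "- 1/2 <= s * eta $ i" "s * eta $ i < 1/2" using that by (auto simp: Zscaled_def Zcell_def)
 then have "\<bar>s * eta $ i\<bar> <= 1" by linarith
 then show "\<bar>eta $ i\<bar> <= 1 / s" using assms by (simp add: abs_mult field_simps)
 qed
 finally show ?thesis by simp
 qed
 then show ?thesis by (rule that)
qed

lemma ball_subset_Zscaled:
 assumes "0 <= R" and "norm (eta :: real^'n::finite) <= R"
 shows "eta : Zscaled (1 / (2 * R + 1))"
 unfolding Zscaled_def Zcell_def
proof (intro CollectI allI)
 fix i
 have "\<bar>eta $ i\<bar> <= R" using component_le_norm_cart[of eta i] assms(2) by simp
 then show "- 1 / 2 <= ((1 / (2 * R + 1)) *R eta) $ i & ((1 / (2 * R + 1)) *R eta) $ i < 1 / 2"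
 using assms(1) by (auto simp: field_simps abs_le_iff)
qed

definition synth :: "(real^'n::finite => real^'n => complex) => (real^'n => complex) => real^'n => complex" where
 "synth k b x = (LI eta. b eta * k eta x)"

definition bdd_supp :: "(real^'n => 'b::zero) => bool" where
 "bdd_supp u \<longleftrightarrow> (\<exists>R. \<forall>x. R < norm x --> u x = 0)"

lemma bdd_suppE:
 assumes "bdd_supp u" obtains R where "0 <= R" "!!x. R < norm x ==> u x = 0"
proof -
 obtain R where "!!x. R < norm x ==> u x = 0" using assms by (auto simp: bdd_supp_def)
 then have "0 <= max R 0" "!!x. max R 0 < norm x ==> u x = 0" by auto
 then show ?thesis by (rule that)
qed

lemma bdd_supp_mono: "bdd_supp u ==> (!!x. u x = 0 ==> v x = 0) ==> bdd_supp v"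
 unfolding bdd_supp_def by blast

lemma bdd_supp_add: "bdd_supp u ==> bdd_supp v ==> bdd_supp (%x. u x + v x :: 'b::monoid_add)"
proof -
 assume "bdd_supp u" "bdd_supp v"
 then obtain R1 R2 where "!!x. R1 < norm x ==> u x = 0" "!!x. R2 < norm x ==> v x = 0" by (auto simp: bdd_supp_def)
 then have "!!x. max R1 R2 < norm x ==> u x + v x = 0" by auto
 then show ?thesis unfolding bdd_supp_def by blast
qed

text \<open>
 The factor \<open>\<Psi> eta\<close> of the wave is periodic with respect to the lattice of mesh \<open>s\<close>, and \<open>eta\<close>
 ranges over the cell of the dual lattice.
\<close>

locale cell_kernel =
 fixes s :: real and \<Psi> :: "real^'n::finite => real^'n => complex"
 assumes s_pos: "0 < s"
 and \<Psi>_meas: "(%(eta, x). \<Psi> eta x) : borel_measurable (borel \<Otimes>\<^sub>M borel)"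
 and \<Psi>_off: "!!eta x. eta \<notin> Zscaled s ==> \<Psi> eta x = 0"
 and \<Psi>_per: "!!eta. lper s (\<Psi> eta)"
begin

definition wave :: "real^'n => real^'n => complex" where
 "wave eta x = \<Psi> eta x * pw eta x"

definition wt :: "real^'n => ennreal" where
 "wt eta = (NI x. ennreal ((norm (\<Psi> eta x))^2) * ind (cell 0 s) x) * ennreal (1 / s ^ CARD('n))"

lemma \<Psi>_measurable [measurable (raw)]:
 assumes [measurable]: "f : borel_measurable M" "g : borel_measurable M"
 shows "(%z. \<Psi> (f z) (g z)) : borel_measurable M"
 using measurable_compose[OF measurable_Pair[OF assms] \<Psi>_meas] by simp

lemma wave_measurable [measurable (raw)]:
 assumes [measurable]: "f : borel_measurable M" "g : borel_measurable M"
 shows "(%z. wave (f z) (g z)) : borel_measurable M"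
 unfolding wave_def by measurable

lemma wt_measurable [measurable]: "wt : BM"
 unfolding wt_def[abs_def] by measurable

lemma norm_wave [simp]: "norm (wave eta x) = norm (\<Psi> eta x)"
 by (simp add: wave_def norm_mult)

lemma cball_measurable [measurable]: "cball (0::real^'n) R : sets borel" by simp

lemma local_bound:
 "\<exists>c::real. 0 <= c & (\<forall>eta. (NI x. ennreal ((norm (\<Psi> eta x))^2) * ind (cball 0 R) x) <= ennreal c * wt eta)"
proof -
 let ?C = "cell 0 s :: (real^'n) set" and ?L = "lattice s :: (real^'n) set"
 let ?F = "{k : ?L. norm k <= R + CARD('n) * s}"
 have fin: "finite ?F" by (rule finite_lattice_bounded[OF s_pos])
 have cnt: "(\<integral>\<^sup>+k. ind (cball 0 R) (x + k) \<partial>count_space ?L) <= of_nat (card ?F)" if x: "x : ?C" for x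
 proof -
 have "(\<integral>\<^sup>+k. ind (cball 0 R) (x + k) \<partial>count_space ?L) <= (\<integral>\<^sup>+k. ind ?F k \<partial>count_space ?L)"
 proof (rule nn_integral_mono)
 fix k assume "k : space (count_space ?L)"
 moreover have "norm k <= norm (x + k) + norm x" using norm_triangle_ineq4[of "x + k" x] by simp
 ultimately show "ind (cball 0 R) (x + k) <= (ind ?F k :: ennreal)"
 using cell_bounded[OF x s_pos] by (auto simp: indicator_def)
 qed
 also have "... = emeasure (count_space ?L) ?F" by (rule nn_integral_indicator) auto
 also have "... = of_nat (card ?F)" using fin by (subst emeasure_count_space_finite) auto
 finally show ?thesis .
 qed
 have "(NI x. ennreal ((norm (\<Psi> eta x))^2) * ind (cball 0 R) x)
 <= ennreal (card ?F * s ^ CARD('n)) * wt eta" for eta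
 proof -
 have "(NI x. ennreal ((norm (\<Psi> eta x))^2) * ind (cball 0 R) x)
 = (NI x. (\<integral>\<^sup>+k. ennreal ((norm (\<Psi> eta (x + k)))^2) * ind (cball 0 R) (x + k) \<partial>count_space ?L) * ind ?C x)"
 by (rule nn_integral_unfold[OF tiles_cell[OF s_pos]]) measurable
 also have "... <= (NI x. of_nat (card ?F) * (ennreal ((norm (\<Psi> eta x))^2) * ind ?C x))"
 proof (rule nn_integral_mono_AE)
 show "AEL x. (\<integral>\<^sup>+k. ennreal ((norm (\<Psi> eta (x + k)))^2) * ind (cball 0 R) (x + k) \<partial>count_space ?L) * ind ?C x
 <= of_nat (card ?F) * (ennreal ((norm (\<Psi> eta x))^2) * ind ?C x)"
 using \<Psi>_per[of eta, unfolded lper_def]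
 proof eventually_elim
 case (elim x)
 have "(\<integral>\<^sup>+k. ennreal ((norm (\<Psi> eta (x + k)))^2) * ind (cball 0 R) (x + k) \<partial>count_space ?L)
 = (\<integral>\<^sup>+k. ennreal ((norm (\<Psi> eta x))^2) * ind (cball 0 R) (x + k) \<partial>count_space ?L)"
 using elim by (intro nn_integral_cong) simp
 also have "... = ennreal ((norm (\<Psi> eta x))^2) * (\<integral>\<^sup>+k. ind (cball 0 R) (x + k) \<partial>count_space ?L)"
 by (rule nn_integral_cmult) simp
 finally show ?case
 using cnt[of x] by (cases "x : ?C") (auto simp: mult.commute intro: mult_left_mono)
 qed
 qed
 also have "... = of_nat (card ?F) * (NI x. ennreal ((norm (\<Psi> eta x))^2) * ind ?C x)"
 by (rule nn_integral_cmult) measurable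
 also have "... = ennreal (card ?F * s ^ CARD('n)) * wt eta"
 proof -
 have "ennreal (s ^ CARD('n)) * ennreal (1 / s ^ CARD('n)) = 1"
 using s_pos by (simp flip: ennreal_mult)
 then have "ennreal (s ^ CARD('n)) * (X * ennreal (1 / s ^ CARD('n))) = X" for X
 by (metis mult.commute mult.left_commute mult_1)
 then show ?thesis
 using s_pos by (simp add: wt_def ennreal_mult mult.assoc ennreal_of_nat_eq_real_of_nat)
 qed
 finally show ?thesis .
 qed
 then show ?thesis using s_pos by (intro exI[of _ "card ?F * s ^ CARD('n)"]) auto
qed

text \<open>
 For fixed \<open>x\<close> the values of the packet at the lattice translates of \<open>x\<close> are Fourier
 coefficients of the function \<open>eta \<mapsto> b eta * wave eta x\<close> on the dual cell; Parseval's identity,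
 integrated over \<open>x\<close> in a cell, gives the norm of the packet.
\<close>

theorem synth_isometry:
 assumes b[measurable]: "b : BM"
 and fin: "(NI eta. ennreal ((norm (b eta))^2) * wt eta) < \<infinity>"
 shows "AEL x. intb (%eta. b eta * wave eta x)"
 and "synth wave b : BM"
 and "(NI x. ennreal ((norm (synth wave b x))^2)) = (NI eta. ennreal ((norm (b eta))^2) * wt eta)"
proof -
 let ?C = "cell 0 s :: (real^'n) set" and ?L = "lattice s :: (real^'n) set" and ?a = "- 1 / (2 * s)"
 let ?S = "Zscaled s :: (real^'n) set"
 let ?c = "1 / s ^ CARD('n)"
 define g where "g x eta = b eta * wave eta x" for x eta
 have [measurable]: "g x : BM" for x unfolding g_def[abs_def] by measurable
 have g_off: "g x eta = 0" if "eta \<notin> ?S" for x eta using \<Psi>_off[OF that] by (simp add: g_def wave_def)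
 have swap: "(NI x. (NI eta. ennreal ((norm (g x eta))^2)) * ind ?C x) * ennreal ?c
 = (NI eta. ennreal ((norm (b eta))^2) * wt eta)"
 proof -
 have "(NI x. (NI eta. ennreal ((norm (g x eta))^2)) * ind ?C x)
 = (NI x. (NI eta. ennreal ((norm (b eta))^2) * (ennreal ((norm (\<Psi> eta x))^2) * ind ?C x)))"
 by (subst nn_integral_multc[symmetric])
 (auto simp: g_def norm_mult power_mult_distrib ennreal_mult mult.assoc intro!: nn_integral_cong)
 also have "... = (NI eta. (NI x. ennreal ((norm (b eta))^2) * (ennreal ((norm (\<Psi> eta x))^2) * ind ?C x)))"
 by (rule lborel_pair.Fubini') measurable
 also have "... = (NI eta. ennreal ((norm (b eta))^2) * (NI x. ennreal ((norm (\<Psi> eta x))^2) * ind ?C x))"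
 by (intro nn_integral_cong nn_integral_cmult) measurable
 finally have eq: "(NI x. (NI eta. ennreal ((norm (g x eta))^2)) * ind ?C x)
 = (NI eta. ennreal ((norm (b eta))^2) * (NI x. ennreal ((norm (\<Psi> eta x))^2) * ind ?C x))" .
 show ?thesis
 unfolding eq by (subst nn_integral_multc[symmetric]) (auto simp: wt_def mult.assoc)
 qed
 have fin': "(NI x. (NI eta. ennreal ((norm (g x eta))^2)) * ind ?C x) < \<infinity>"
 proof (rule ccontr)
 assume "\<not> ?thesis"
 then have "(NI x. (NI eta. ennreal ((norm (g x eta))^2)) * ind ?C x) = \<infinity>"
 by (simp only: not_less infinity_ennreal_def top_unique)
 then show False using swap fin s_pos by (simp add: ennreal_top_mult)
 qed
 have gL2: "AEL x. x : ?C --> g x : L2"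
 proof -
 have m: "(%x. (NI eta. ennreal ((norm (g x eta))^2)) * ind ?C x) : borel_measurable lborel"
 unfolding g_def by measurable
 have "AEL x. (NI eta. ennreal ((norm (g x eta))^2)) * ind ?C x ~= \<infinity>"
 by (rule nn_integral_PInf_AE[OF m]) (use fin' in auto)
 then show ?thesis
 by eventually_elim (auto simp: L2_nn_iff indicator_def less_top)
 qed
 have per: "AEL x. AEL eta. \<forall>k\<in>?L. \<Psi> eta (x + k) = \<Psi> eta x"
 proof -
 have "AEL eta. AEL x. \<forall>k\<in>?L. \<Psi> eta (x + k) = \<Psi> eta x"
 using \<Psi>_per by (simp add: lper_def)
 moreover have "{p : space (lborel \<Otimes>\<^sub>M lborel). \<forall>k\<in>?L. \<Psi> (fst p) (snd p + k) = \<Psi> (fst p) (snd p)}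
 : sets (lborel \<Otimes>\<^sub>M lborel)"
 by (rule sets.sets_Collect_countable_All'[OF _ countable_lattice]) measurable
 ultimately show ?thesis
 by (subst (asm) lborel_pair.AE_commute) (simp_all add: case_prod_beta')
 qed
 have good: "AEL x. x : ?C --> (\<forall>k\<in>?L. intb (g (x + k)))
 & (\<integral>\<^sup>+k. ennreal ((norm (synth wave b (x + k)))^2) \<partial>count_space ?L)
 = (NI eta. ennreal ((norm (g x eta))^2)) * ennreal ?c"
 using gL2 per
 proof eventually_elim
 case (elim x)
 show ?case
 proof
 assume "x : ?C"
 then have gx: "g x : L2" using elim by simp
 have AEk: "AEL eta. g (x + k) eta = g x eta * pw k eta" if "k : ?L" for k
 using elim(2)
 by eventually_elim
 (use that in "auto simp: g_def wave_def plane_wave_add_right plane_wave_commute[of k]")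
 have gi: "intb (%eta. g x eta * pw k eta)" for k
 proof -
 have i: "(%eta. ind ?S eta *R (1::complex)) : L2"
 proof -
 have "intb (ind ?S :: _ => real)"
 using emeasure_Zscaled_finite[OF s_pos] by (intro integrable_real_indicator) auto
 then have "intb (%eta. (norm (ind ?S eta *R (1::complex)))^2)"
 by (rule Bochner_Integration.integrable_cong[THEN iffD1, OF refl, rotated]) (auto simp: indicator_def)
 moreover have "(%eta::real^'n. ind ?S eta *R (1::complex)) : BM"
 by (intro borel_measurable_scaleR borel_measurable_indicator) auto
 ultimately show ?thesis by (simp only: L2_iff)
 qed
 have "intb (%eta. (pw k eta * g x eta) * (ind ?S eta *R (1::complex)))"
 by (intro L2_integrable_mult L2_mult_bounded[where c=1] gx i) auto
 moreover have "(%eta. (pw k eta * g x eta) * (ind ?S eta *R (1::complex))) = (%eta. g x eta * pw k eta)"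
 using g_off by (auto simp: indicator_def fun_eq_iff)
 ultimately show ?thesis by simp
 qed
 have 1: "intb (g (x + k))" if "k : ?L" for k
 by (rule integrable_cong_AE[THEN iffD2, OF _ _ AEk[OF that] gi]) auto
 have 2: "synth wave b (x + k) = (LI eta. g x eta * pw k eta)" if "k : ?L" for k
 unfolding synth_def g_def[symmetric] by (rule integral_cong_AE[OF _ _ AEk[OF that]]) auto
 have "(\<integral>\<^sup>+k. ennreal ((norm (synth wave b (x + k)))^2) \<partial>count_space ?L)
 = (\<integral>\<^sup>+k. ennreal ((norm (LI eta. g x eta * pw k eta))^2) \<partial>count_space ?L)"
 by (rule nn_integral_cong) (simp add: 2)
 also have "... = ennreal ((L2norm (g x))^2 / s ^ CARD('n))"
 by (rule Parseval_cell(1)[OF s_pos gx, of ?a]) (use g_off Zscaled_eq_cell[OF s_pos] in auto)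
 also have "... = (NI eta. ennreal ((norm (g x eta))^2)) * ennreal ?c"
 using s_pos by (simp add: nn_L2norm[OF gx] flip: ennreal_mult)
 finally show "(\<forall>k\<in>?L. intb (g (x + k)))
 & (\<integral>\<^sup>+k. ennreal ((norm (synth wave b (x + k)))^2) \<partial>count_space ?L)
 = (NI eta. ennreal ((norm (g x eta))^2)) * ennreal ?c" using 1 by blast
 qed
 qed
 have "AEL x. intb (g x)"
 by (rule AE_unfold[OF tiles_cell[OF s_pos, of 0]]) (use good in "auto elim: eventually_mono")
 then show "AEL x. intb (%eta. b eta * wave eta x)" by (simp add: g_def[abs_def])
 show m: "synth wave b : BM"
 unfolding synth_def[abs_def] by measurable
 have "(NI x. ennreal ((norm (synth wave b x))^2))
 = (NI x. (\<integral>\<^sup>+k. ennreal ((norm (synth wave b (x + k)))^2) \<partial>count_space ?L) * ind ?C x)"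
 by (rule nn_integral_unfold[OF tiles_cell[OF s_pos]]) (use m in measurable)
 also have "... = (NI x. (NI eta. ennreal ((norm (g x eta))^2)) * ind ?C x * ennreal ?c)"
 proof (rule nn_integral_cong_AE)
 show "AEL x. (\<integral>\<^sup>+k. ennreal ((norm (synth wave b (x + k)))^2) \<partial>count_space ?L) * ind ?C x
 = (NI eta. ennreal ((norm (g x eta))^2)) * ind ?C x * ennreal ?c"
 using good by eventually_elim (auto simp: indicator_def)
 qed
 also have "... = (NI x. (NI eta. ennreal ((norm (g x eta))^2)) * ind ?C x) * ennreal ?c"
 unfolding g_def by (rule nn_integral_multc) measurable
 finally show "(NI x. ennreal ((norm (synth wave b x))^2)) = (NI eta. ennreal ((norm (b eta))^2) * wt eta)"
 by (simp only: swap)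
qed

lemma synth_L2:
 assumes "b : BM" "(NI eta. ennreal ((norm (b eta))^2) * wt eta) < \<infinity>"
 shows "synth wave b : L2"
 using synth_isometry[OF assms] assms(2) by (simp add: L2_nn_iff)

lemma Fubini_wave:
 fixes u :: "real^'n => complex"
 assumes b[measurable]: "b : BM"
 and fin: "(NI eta. ennreal ((norm (b eta))^2) * wt eta) < \<infinity>"
 and u: "u : L2" "bdd_supp u"
 shows "intb (%eta. b eta * (LI x. u x * wave eta x))"
 and "(LI eta. b eta * (LI x. u x * wave eta x)) = (LI x. u x * synth wave b x)"
proof -
 obtain R where R: "!!x. R < norm x ==> u x = 0" using u(2) by (auto simp: bdd_supp_def)
 obtain c where c: "0 <= c" "!!eta. (NI x. ennreal ((norm (\<Psi> eta x))^2) * ind (cball 0 R) x) <= ennreal c * wt eta"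
 using local_bound by blast
 have [measurable]: "u : BM" using u by auto
 let ?S = "Zscaled s :: (real^'n) set"
 let ?f = "%(eta, x). b eta * (u x * wave eta x)"
 have pt: "ennreal (norm (b eta * (u x * wave eta x)))
 <= ennreal ((norm (b eta))^2) * (ennreal ((norm (\<Psi> eta x))^2) * ind (cball 0 R) x)
 + ennreal ((norm (u x))^2) * ind ?S eta" for eta x
 proof (cases "eta : ?S & norm x <= R")
 case True
 have "norm (b eta * (u x * wave eta x)) = (norm (b eta) * norm (\<Psi> eta x)) * norm (u x)" by (simp add: norm_mult)
 also have "... <= (norm (b eta) * norm (\<Psi> eta x))^2 + (norm (u x))^2"
 using sum_squares_bound[of "norm (b eta) * norm (\<Psi> eta x)" "norm (u x)"]
 mult_nonneg_nonneg[OF mult_nonneg_nonneg[OF norm_ge_zero[of "b eta"] norm_ge_zero[of "\<Psi> eta x"]] norm_ge_zero[of "u x"]] by linarith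
 finally show ?thesis using True
 by (simp add: power_mult_distrib ennreal_mult[symmetric] ennreal_plus[symmetric] del: ennreal_plus)
 next
 case False
 then show ?thesis using R[of x] \<Psi>_off[of eta x] by (cases "eta : ?S") (auto simp: wave_def not_le)
 qed
 have int: "integrable (lborel \<Otimes>\<^sub>M lborel) ?f"
 unfolding integrable_iff_bounded
 proof
 show "?f : borel_measurable (lborel \<Otimes>\<^sub>M lborel)" by measurable
 have "(\<integral>\<^sup>+p. ennreal (norm (?f p)) \<partial>(lborel \<Otimes>\<^sub>M lborel)) = (NI eta. \<integral>\<^sup>+x. ennreal (norm (?f (eta, x))) \<partial>lborel)"
 by (rule lborel.nn_integral_fst[symmetric]) measurable
 also have "... <= (NI eta. \<integral>\<^sup>+x. ennreal ((norm (b eta))^2) * (ennreal ((norm (\<Psi> eta x))^2) * ind (cball 0 R) x)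
 + ennreal ((norm (u x))^2) * ind ?S eta \<partial>lborel)"
 by (intro nn_integral_mono) (use pt in auto)
 also have "... = (NI eta. ennreal ((norm (b eta))^2) * (NI x. ennreal ((norm (\<Psi> eta x))^2) * ind (cball 0 R) x)
 + (NI x. ennreal ((norm (u x))^2)) * ind ?S eta)"
 by (intro nn_integral_cong) (simp add: nn_integral_add nn_integral_cmult nn_integral_multc)
 also have "... <= (NI eta. ennreal c * (ennreal ((norm (b eta))^2) * wt eta)
 + (NI x. ennreal ((norm (u x))^2)) * ind ?S eta)"
 proof (intro nn_integral_mono add_right_mono)
 fix eta
 show "ennreal ((norm (b eta))^2) * (NI x. ennreal ((norm (\<Psi> eta x))^2) * ind (cball 0 R) x)
 <= ennreal c * (ennreal ((norm (b eta))^2) * wt eta)"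
 using mult_left_mono[OF c(2)[of eta], of "ennreal ((norm (b eta))^2)"] by (simp add: mult.left_commute)
 qed
 also have "... = ennreal c * (NI eta. ennreal ((norm (b eta))^2) * wt eta)
 + (NI x. ennreal ((norm (u x))^2)) * emeasure lborel ?S"
 by (simp add: nn_integral_add nn_integral_cmult nn_integral_cmult_indicator)
 also have "... < \<infinity>"
 proof -
 have "emeasure lborel ?S < \<infinity>" by (rule emeasure_Zscaled_finite[OF s_pos])
 then show ?thesis using fin u by (simp add: L2_nn_iff ennreal_mult_less_top)
 qed
 finally show "(\<integral>\<^sup>+p. ennreal (norm (?f p)) \<partial>(lborel \<Otimes>\<^sub>M lborel)) < \<infinity>" .
 qed
 have "intb (%eta. LI x. b eta * (u x * wave eta x))"
 using lborel_pair.integrable_fst[OF int] by simp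
 then show "intb (%eta. b eta * (LI x. u x * wave eta x))" by simp
 have inner: "(LI eta. b eta * (u x * wave eta x)) = u x * synth wave b x" for x
 unfolding synth_def integral_mult_right_zero[symmetric] by (simp only: mult.left_commute)
 have "(LI eta. LI x. b eta * (u x * wave eta x)) = (LI x. LI eta. b eta * (u x * wave eta x))"
 using lborel_pair.Fubini_integral[OF int] by simp
 then show "(LI eta. b eta * (LI x. u x * wave eta x)) = (LI x. u x * synth wave b x)"
 by (simp only: inner integral_mult_right_zero)
qed

lemma wave_local_L2:
 assumes "wt eta < \<infinity>" shows "(%x. ind (cball 0 R) x *R wave eta x) : L2"
proof -
 obtain c where c: "!!eta. (NI x. ennreal ((norm (\<Psi> eta x))^2) * ind (cball 0 R) x) <= ennreal c * wt eta"
 using local_bound by blast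
 have "(NI x. ennreal ((norm (ind (cball 0 R) x *R wave eta x))^2))
 = (NI x. ennreal ((norm (\<Psi> eta x))^2) * ind (cball 0 R) x)"
 by (intro nn_integral_cong) (auto simp: indicator_def)
 also have "... < \<infinity>" using c[of eta] assms by (auto intro: le_less_trans simp: ennreal_mult_less_top)
 finally show ?thesis unfolding L2_nn_iff by (auto intro!: borel_measurable_scaleR borel_measurable_indicator simp del: norm_scaleR)
qed

lemma wave_integrable_mult:
 assumes "wt eta < \<infinity>" "u : L2" "bdd_supp u"
 shows "intb (%x. u x * wave eta x)"
proof -
 obtain R where R: "!!x. R < norm x ==> u x = 0" using assms(3) by (auto simp: bdd_supp_def)
 have "intb (%x. u x * (ind (cball 0 R) x *R wave eta x))"
 by (intro L2_integrable_mult assms wave_local_L2)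
 moreover have "(%x. u x * (ind (cball 0 R) x *R wave eta x)) = (%x. u x * wave eta x)"
 using R by (auto simp: fun_eq_iff indicator_def not_le)
 ultimately show ?thesis by simp
qed

end

section \<open>Integral transforms defined as limits in mean\<close>

lemma L2_Fatou:
 fixes f :: "nat => real^'n::finite => 'b::{banach,second_countable_topology}"
 assumes f: "!!n. f n : L2" "!!n. L2norm (f n) <= c" and F[measurable]: "F : BM"
 and lim: "AEL x. (%n. f n x) ----> F x" and c: "0 <= c"
 shows "F : L2" "L2norm F <= c"
proof -
 have [measurable]: "f n : BM" for n using f by auto
 have "(NI x. ennreal ((norm (F x))^2)) <= (NI x. liminf (%n. ennreal ((norm (f n x))^2)))"
 proof (rule nn_integral_mono_AE, use lim in eventually_elim)
 case (elim x)
 then have "(%n. ennreal ((norm (f n x))^2)) ----> ennreal ((norm (F x))^2)"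
 by (intro tendsto_ennrealI tendsto_intros)
 from lim_imp_Liminf[OF trivial_limit_sequentially this] show ?case by (rule eq_refl[OF sym])
 qed
 also have "... <= liminf (%n. \<integral>\<^sup>+x. ennreal ((norm (f n x))^2) \<partial>lborel)"
 by (rule nn_integral_liminf) measurable
 also have "... <= liminf (%n::nat. ennreal (c^2))"
 by (intro Liminf_mono always_eventually allI) (simp add: nn_L2norm f power_mono)
 finally have "(NI x. ennreal ((norm (F x))^2)) <= ennreal (c^2)" by (simp add: Liminf_const)
 from L2norm_leI[OF this c F] show "F : L2" "L2norm F <= c" by auto
qed

lemma L2_indicator_bounded:
 assumes "A : sets borel" "!!x::real^'n::finite. x : A ==> norm x <= R"
 shows "(%x. ind A x *R (c::'b::{banach,second_countable_topology})) : L2"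
proof -
 have "emeasure lborel A <= emeasure lborel (cball (0::real^'n) R)"
 using assms by (intro emeasure_mono) auto
 also have "... < \<infinity>" by (rule emeasure_lborel_cball_finite)
 finally have "intb (%x. (norm c)^2 * ind A x :: real)"
 using assms by (intro integrable_mult_right integrable_real_indicator) auto
 then have "intb (%x. (norm (ind A x *R c))^2)"
 by (rule Bochner_Integration.integrable_cong[THEN iffD1, OF refl, rotated]) (auto simp: indicator_def)
 moreover have "(%x. ind A x *R c) : BM"
 using assms by (intro borel_measurable_scaleR borel_measurable_indicator) auto
 ultimately show ?thesis by (simp only: L2_iff)
qed

lemma L2_bounded_bdd_supp:
 fixes f :: "real^'n::finite => 'b::{banach,second_countable_topology}"
 assumes f: "f : BM" "!!x. norm (f x) <= B" "bdd_supp f"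
 shows "f : L2"
proof -
 obtain R where R: "!!x. R < norm x ==> f x = 0" using f(3) by (auto simp: bdd_supp_def)
 have "(%x::real^'n. ind (cball 0 R) x *R (1::real)) : L2"
 by (rule L2_indicator_bounded[where R=R]) auto
 then show ?thesis
 proof (rule L2_bound[where c="\<bar>B\<bar>"])
 show "AEL x. norm (f x) <= \<bar>B\<bar> * norm (ind (cball 0 R) x *R (1::real))"
 proof (rule AE_I2)
 fix x
 show "norm (f x) <= \<bar>B\<bar> * norm (ind (cball 0 R) x *R (1::real))"
 using R[of x] f(2)[of x] by (cases "norm x <= R") auto
 qed
 qed (rule f)
qed

definition trunc :: "real => (real^'n => 'b::real_vector) => real^'n => 'b" where
 "trunc R u x = ind (cball 0 R) x *R u x"

lemma trunc_L2 [intro]: "u : L2 ==> trunc R u : L2"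
 unfolding trunc_def[abs_def] by (rule L2_indicator) auto

lemma trunc_bdd_supp [intro]: "bdd_supp (trunc R u)"
 unfolding bdd_supp_def trunc_def by (intro exI[of _ R]) (auto simp: indicator_def)

lemma L2norm_trunc_le: "u : L2 ==> L2norm (trunc R u) <= L2norm u"
 by (rule L2norm_mono) (auto simp: trunc_def indicator_def)

lemma trunc_tendsto:
 fixes u :: "real^'n::finite => 'b::{banach,second_countable_topology}"
 assumes u: "u : L2"
 shows "((%R. L2norm (%x. u x - trunc R u x)) \<longlongrightarrow> 0) at_top"
proof -
 have [measurable]: "u : BM" using u by auto
 have "((%R. LI x. (norm (u x - trunc R u x))^2) \<longlongrightarrow> (LINT x|(lborel :: (real^'n) measure). (0::real))) at_top"
 proof (rule integral_dominated_convergence_at_top[where w="%x. (norm (u x))^2"])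
 show "AEL x. ((%R. (norm (u x - trunc R u x))^2) \<longlongrightarrow> 0) at_top"
 proof (rule AE_I2)
 fix x
 have "eventually (%R. (norm (u x - trunc R u x))^2 = 0) at_top"
 using eventually_ge_at_top[of "norm x"] by eventually_elim (simp add: trunc_def)
 then show "((%R. (norm (u x - trunc R u x))^2) \<longlongrightarrow> 0) at_top" by (rule tendsto_eventually)
 qed
 show "\<forall>\<^sub>F R in at_top. AEL x. norm ((norm (u x - trunc R u x))^2) <= (norm (u x))^2"
 by (auto simp: trunc_def indicator_def)
 show "(%x. (norm (u x - trunc R u x))^2) : borel_measurable lborel" for R
 using L2_diff[OF u trunc_L2[OF u, of R]] by (auto simp: L2_iff)
 qed (use u in "auto simp: L2_iff")
 then have "((%R. sqrt (LI x. (norm (u x - trunc R u x))^2)) \<longlongrightarrow> sqrt 0) at_top"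
 by (intro tendsto_real_sqrt) simp
 then show ?thesis by (simp add: L2norm_def)
qed

definition good :: "(real^'n) set => (real^'n => complex) => bool" where
 "good S b \<longleftrightarrow> b : L2 & (\<forall>eta. eta \<notin> S --> b eta = 0) & bdd_supp b"

lemma good_L2 [dest]: "good S b ==> b : L2" by (simp add: good_def)

lemma good_mult:
 assumes "good S b" "g : BM" "!!x. norm (g x) <= c"
 shows "good S (%eta. g eta * b eta)"
 using assms L2_mult_bounded[of b g c] unfolding good_def by (auto intro: bdd_supp_mono[of b])

lemma good_add: "good S b ==> good S b' ==> good S (%eta. b eta + b' eta)"
 unfolding good_def by (auto intro: bdd_supp_add)

lemma good_scale: "good S b ==> good S (%eta. c * b eta)"
 by (rule good_mult[where c="norm c"]) auto

lemma good_diff: "good S b ==> good S b' ==> good S (%eta. b eta - b' eta)"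
 using good_add[of S b "%eta. (-1) * b' eta"] good_scale[of S b' "-1"] by simp

lemma good_trunc_indicator:
 "f : L2 ==> S : sets borel ==> good S (trunc R (%eta. ind S eta *R f eta))"
 unfolding good_def by (auto simp: trunc_def intro!: trunc_L2[unfolded trunc_def[abs_def]] trunc_bdd_supp[unfolded trunc_def[abs_def]])

lemma L2_transform_cong:
 assumes "!!eta. eta : S ==> k eta = k' eta"
 shows "L2_transform S k u = L2_transform S k' u"
proof -
 have "(\<integral>\<^sup>+eta\<in>S. ennreal ((norm (F eta - (LINT x:cball 0 R|lborel. u x * cnj (k eta x))))^2) \<partial>lborel)
 = (\<integral>\<^sup>+eta\<in>S. ennreal ((norm (F eta - (LINT x:cball 0 R|lborel. u x * cnj (k' eta x))))^2) \<partial>lborel)" for F R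
 by (intro nn_integral_cong) (auto simp: indicator_def assms)
 then show ?thesis unfolding L2_transform_def by simp
qed

text \<open>
 A family of waves whose packets with coefficients supported in \<open>S\<close> depend isometrically on the
 coefficients. The analysis transform is then the adjoint of this isometry.
\<close>

locale wave_transform =
 fixes S :: "(real^'n::finite) set" and k :: "real^'n => real^'n => complex"
 assumes S_meas [measurable]: "S : sets borel"
 and k_meas: "(%(eta, x). k eta x) : borel_measurable (borel \<Otimes>\<^sub>M borel)"
 and packet_integrable: "!!b. good S b ==> AEL x. intb (%eta. b eta * k eta x)"
 and packet_isometry: "!!b. good S b ==> synth k b : L2 & L2norm (synth k b) = L2norm b"
 and analysis_integrable: "!!eta u. eta : S ==> u : L2 ==> bdd_supp u ==> intb (%x. u x * cnj (k eta x))"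
 and adjoint: "!!b u. good S b ==> u : L2 ==> bdd_supp u ==>
 ip (%eta. LI x. u x * cnj (k eta x)) b = ip u (synth k b)"
begin

definition analysis :: "(real^'n => complex) => real^'n => complex" where
 "analysis u eta = ind S eta *R (LI x. u x * cnj (k eta x))"

definition coef :: "(real^'n => complex) => real^'n => complex" where
 "coef u eta = ind S eta *R L2_transform S k u eta"

lemma k_measurable [measurable (raw)]:
 assumes [measurable]: "f : borel_measurable M" "g : borel_measurable M"
 shows "(%z. k (f z) (g z)) : borel_measurable M"
 using measurable_compose[OF measurable_Pair[OF assms] k_meas] by simp

lemma cnj_measurable [measurable]: "cnj : BM"
 by (intro borel_measurable_continuous_onI continuous_intros)

lemma synth_add:
 assumes "good S b" "good S b'"
 shows "AEL x. synth k (%eta. b eta + b' eta) x = synth k b x + synth k b' x"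
 using packet_integrable[OF assms(1)] packet_integrable[OF assms(2)]
 by eventually_elim (simp add: synth_def distrib_right)

lemma synth_scale: "synth k (%eta. c * b eta) x = c * synth k b x"
 by (simp add: synth_def mult.assoc)

lemma synth_diff:
 assumes "good S b" "good S b'"
 shows "AEL x. synth k (%eta. b eta - b' eta) x = synth k b x - synth k b' x"
 using packet_integrable[OF assms(1)] packet_integrable[OF assms(2)]
 by eventually_elim (simp add: synth_def left_diff_distrib)

lemma synth_in_L2 [intro]: "good S b ==> synth k b : L2"
 using packet_isometry by blast

lemma synth_cong_AE:
 assumes "AEL eta. b eta = b' eta" "b : BM" "b' : BM"
 shows "synth k b x = synth k b' x"
proof -
 have [measurable]: "b : BM" "b' : BM" by fact+
 show ?thesis unfolding synth_def
 by (rule integral_cong_AE) (use assms(1) in "auto elim: eventually_mono")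
qed

lemma ip_synth:
 assumes b: "good S b" "good S b'"
 shows "ip (synth k b) (synth k b') = ip b b'"
proof (rule ip_polarization)
 have iso: "L2norm (%x. synth k b x + synth k c x) = L2norm (%x. b x + c x)" if c: "good S c" for c
 proof -
 have "L2norm (%x. synth k b x + synth k c x) = L2norm (synth k (%eta. b eta + c eta))"
 using synth_add[OF b(1) c] synth_in_L2[OF b(1)] synth_in_L2[OF c] synth_in_L2[OF good_add[OF b(1) c]]
 by (intro L2norm_cong_AE) (auto elim: eventually_mono)
 then show ?thesis using packet_isometry[OF good_add[OF b(1) c]] by simp
 qed
 show "L2norm (%x. synth k b x + synth k b' x) = L2norm (%x. b x + b' x)" by (rule iso[OF b(2)])
 show "L2norm (%x. synth k b x + \<i> * synth k b' x) = L2norm (%x. b x + \<i> * b' x)"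
 using iso[OF good_scale[OF b(2), of \<i>]] by (simp add: synth_scale)
qed (use b packet_isometry in auto)

lemma analysis_measurable: "u : L2 ==> analysis u : BM"
proof -
 assume "u : L2"
 then have [measurable]: "u : BM" by auto
 show ?thesis unfolding analysis_def[abs_def] by measurable
qed

lemma ip_analysis:
 assumes "good S b" "u : L2" "bdd_supp u"
 shows "ip (analysis u) b = ip u (synth k b)"
proof -
 have "ip (analysis u) b = ip (%eta. LI x. u x * cnj (k eta x)) b"
 unfolding ip_def by (rule Bochner_Integration.integral_cong) (use assms(1) in "auto simp: analysis_def good_def indicator_def")
 then show ?thesis by (simp add: adjoint[OF assms])
qed

text \<open>The analysis of \<open>u\<close> is tested with its own truncations.\<close>

lemma analysis_bound:
 assumes u: "u : L2" "bdd_supp u"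
 shows "analysis u : L2 & L2norm (analysis u) <= L2norm u"
proof -
 have [measurable]: "analysis u : BM" by (rule analysis_measurable[OF u(1)])
 define A where "A n = {eta. norm (analysis u eta) <= real n & norm eta <= real n}" for n :: nat
 have [measurable]: "A n : sets borel" for n unfolding A_def by measurable
 define b where "b n eta = ind (A n) eta *R analysis u eta" for n eta
 have bL2: "b n : L2" for n
 proof (rule L2_bounded_bdd_supp)
 show "b n : BM" unfolding b_def[abs_def] by measurable
 show "norm (b n eta) <= real n" for eta by (auto simp: b_def A_def indicator_def)
 show "bdd_supp (b n)" unfolding bdd_supp_def by (intro exI[of _ "real n"]) (auto simp: b_def A_def indicator_def)
 qed
 have bg: "good S (b n)" for n
 unfolding good_def
 proof (intro conjI bL2)
 show "\<forall>eta. eta \<notin> S --> b n eta = 0" by (simp add: b_def analysis_def)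
 show "bdd_supp (b n)" unfolding bdd_supp_def by (intro exI[of _ "real n"]) (auto simp: b_def A_def indicator_def)
 qed
 have le: "L2norm (b n) <= L2norm u" for n
 proof -
 have "ip (b n) (b n) = ip (analysis u) (b n)"
 unfolding ip_def by (rule Bochner_Integration.integral_cong) (auto simp: b_def indicator_def)
 also have "... = ip u (synth k (b n))" by (rule ip_analysis[OF bg u])
 finally have "(L2norm (b n))^2 = norm (ip u (synth k (b n)))" unfolding ip_self by (metis norm_of_real abs_power2)
 also have "... <= L2norm u * L2norm (b n)"
 using norm_ip_le[OF u(1) synth_in_L2[OF bg]] packet_isometry[OF bg] by simp
 finally have "L2norm (b n) * L2norm (b n) <= L2norm u * L2norm (b n)" by (simp add: power2_eq_square)
 then show ?thesis using L2norm_nonneg[of "b n"] L2norm_nonneg[of u]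
 by (cases "L2norm (b n) = 0") (simp_all add: mult_le_cancel_right less_le)
 qed
 have lim: "AEL eta. (%n. b n eta) ----> analysis u eta"
 proof (rule AE_I2)
 fix eta
 have "eventually (%n. b n eta = analysis u eta) sequentially"
 using eventually_ge_at_top[of "nat \<lceil>max (norm (analysis u eta)) (norm eta)\<rceil>"]
 proof eventually_elim
 case (elim n)
 then have "max (norm (analysis u eta)) (norm eta) <= real n" by linarith
 then show ?case by (simp add: b_def A_def)
 qed
 then show "(%n. b n eta) ----> analysis u eta" by (rule tendsto_eventually)
 qed
 show ?thesis using L2_Fatou[OF bL2 le _ lim] by simp
qed

lemma analysis_diff:
 assumes "u : L2" "bdd_supp u" "v : L2" "bdd_supp v"
 shows "analysis (%x. u x - v x) eta = analysis u eta - analysis v eta"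
 using analysis_integrable[OF _ assms(1,2)] analysis_integrable[OF _ assms(3,4)]
 by (cases "eta : S") (simp_all add: analysis_def left_diff_distrib)

lemma analysis_trunc: "ind S eta *R (LINT x:cball 0 R|lborel. u x * cnj (k eta x)) = analysis (trunc R u) eta"
 by (simp add: analysis_def trunc_def slint_def)

lemma analysis_limit_exists:
 assumes u: "u : L2"
 obtains F where "F : L2" "!!R. L2norm (%eta. F eta - analysis (trunc R u) eta) <= L2norm (%x. u x - trunc R u x)"
proof -
 have aL2: "analysis (trunc R u) : L2" for R using analysis_bound[OF trunc_L2[OF u] trunc_bdd_supp] by blast
 have tL2: "(%x. u x - trunc R u x) : L2" for R using u by auto
 have d: "L2norm (%eta. analysis (trunc R u) eta - analysis (trunc R' u) eta)
 <= L2norm (%x. u x - trunc R u x) + L2norm (%x. u x - trunc R' u x)" for R R'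
 proof -
 have "bdd_supp (%x. trunc R u x - trunc R' u x)"
 using bdd_supp_add[OF trunc_bdd_supp[of R u] bdd_supp_mono[OF trunc_bdd_supp[of R' u], of "%x. - trunc R' u x"]] by simp
 moreover have "(%eta. analysis (trunc R u) eta - analysis (trunc R' u) eta) = analysis (%x. trunc R u x - trunc R' u x)"
 by (rule ext) (simp add: analysis_diff trunc_L2[OF u] trunc_bdd_supp)
 ultimately have "L2norm (%eta. analysis (trunc R u) eta - analysis (trunc R' u) eta) <= L2norm (%x. trunc R u x - trunc R' u x)"
 using analysis_bound[OF L2_diff[OF trunc_L2[OF u, of R] trunc_L2[OF u, of R']]] by simp
 also have "L2norm (%x. trunc R u x - trunc R' u x) = L2norm (%x. (u x - trunc R' u x) + (- 1) * (u x - trunc R u x))"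
 by (simp add: algebra_simps)
 also have "... <= L2norm (%x. u x - trunc R' u x) + L2norm (%x. (- 1) * (u x - trunc R u x))"
 by (intro L2norm_triangle tL2 L2_mult_const)
 also have "L2norm (%x. (- 1) * (u x - trunc R u x)) = L2norm (%x. u x - trunc R u x)"
 by (subst L2norm_scale) simp
 finally show ?thesis by simp
 qed
 have tl: "(%n. L2norm (%x. u x - trunc (real n) u x)) ----> 0"
 by (rule filterlim_compose[OF trunc_tendsto[OF u] filterlim_real_sequentially])
 have cauchy: "\<exists>N. \<forall>m\<ge>N. \<forall>n\<ge>N. L2norm (%eta. analysis (trunc (real m) u) eta - analysis (trunc (real n) u) eta) < e"
 if e: "0 < e" for e
 proof -
 obtain N where N: "!!n. n >= N ==> L2norm (%x. u x - trunc (real n) u x) < e / 2"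
 using LIMSEQ_D[OF tl, of "e / 2"] e by auto
 show ?thesis
 proof (intro exI[of _ N] allI impI)
 fix m n assume "N <= m" "N <= n"
 from N[OF this(1)] N[OF this(2)] d[of "real m" "real n"]
 show "L2norm (%eta. analysis (trunc (real m) u) eta - analysis (trunc (real n) u) eta) < e" by linarith
 qed
 qed
 obtain F where F: "F : L2" "(%n. L2norm (%eta. analysis (trunc (real n) u) eta - F eta)) ----> 0"
 using L2_Riesz_Fischer[of "%n. analysis (trunc (real n) u)", OF aL2 cauchy] by blast
 show ?thesis
 proof (rule that[OF F(1)])
 fix R
 have le: "L2norm (%eta. F eta - analysis (trunc R u) eta)
 <= L2norm (%eta. analysis (trunc (real n) u) eta - F eta)
 + (L2norm (%x. u x - trunc (real n) u x) + L2norm (%x. u x - trunc R u x))" for n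
 proof -
 have "L2norm (%eta. F eta - analysis (trunc R u) eta)
 = L2norm (%eta. (F eta - analysis (trunc (real n) u) eta) + (analysis (trunc (real n) u) eta - analysis (trunc R u) eta))"
 by simp
 also have "... <= L2norm (%eta. F eta - analysis (trunc (real n) u) eta)
 + L2norm (%eta. analysis (trunc (real n) u) eta - analysis (trunc R u) eta)"
 by (intro L2norm_triangle L2_diff F aL2)
 finally show ?thesis using d[of "real n" R] L2norm_minus_commute[of F "analysis (trunc (real n) u)"] by linarith
 qed
 have "(%n. L2norm (%eta. analysis (trunc (real n) u) eta - F eta)
 + (L2norm (%x. u x - trunc (real n) u x) + L2norm (%x. u x - trunc R u x)))
 ----> 0 + (0 + L2norm (%x. u x - trunc R u x))"
 by (intro tendsto_intros F tl)
 then show "L2norm (%eta. F eta - analysis (trunc R u) eta) <= L2norm (%x. u x - trunc R u x)"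
 using LIMSEQ_le_const[of _ _ "L2norm (%eta. F eta - analysis (trunc R u) eta)"] le by auto
 qed
qed

lemma coef_limit:
 assumes u: "u : L2"
 shows "coef u : L2" "L2_transform S k u : L2_on S"
 "((%R. L2norm (%eta. coef u eta - analysis (trunc R u) eta)) \<longlongrightarrow> 0) at_top"
proof -
 let ?P = "%F. F : L2_on S & ((%R. \<integral>\<^sup>+eta\<in>S. ennreal ((norm (F eta - (LINT x:cball 0 R|lborel. u x * cnj (k eta x))))^2) \<partial>lborel) \<longlongrightarrow> 0) at_top"
 have aL2: "analysis (trunc R u) : L2" for R using analysis_bound[OF trunc_L2[OF u] trunc_bdd_supp] by blast
 have eq: "(\<integral>\<^sup>+eta\<in>S. ennreal ((norm (F eta - (LINT x:cball 0 R|lborel. u x * cnj (k eta x))))^2) \<partial>lborel)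
 = ennreal ((L2norm (%eta. ind S eta *R F eta - analysis (trunc R u) eta))^2)" if F: "F : L2_on S" for F R
 proof -
 have "(%eta. ind S eta *R F eta - analysis (trunc R u) eta) : L2"
 by (rule L2_diff[OF L2_on_iff[OF S_meas, THEN iffD1, OF F, THEN conjunct2] aL2])
 from nn_L2norm[OF this]
 have "ennreal ((L2norm (%eta. ind S eta *R F eta - analysis (trunc R u) eta))^2)
 = (NI eta. ennreal ((norm (ind S eta *R F eta - analysis (trunc R u) eta))^2))" by simp
 also have "... = (\<integral>\<^sup>+eta\<in>S. ennreal ((norm (F eta - (LINT x:cball 0 R|lborel. u x * cnj (k eta x))))^2) \<partial>lborel)"
 by (intro nn_integral_cong) (auto simp: analysis_trunc[symmetric] indicator_def)
 finally show ?thesis by (rule sym)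
 qed
 obtain F where F: "F : L2" "!!R. L2norm (%eta. F eta - analysis (trunc R u) eta) <= L2norm (%x. u x - trunc R u x)"
 using analysis_limit_exists[OF u] by blast
 have FS: "F : L2_on S"
 by (rule L2_on_iff[OF S_meas, THEN iffD2, OF conjI[OF L2_measurable[OF F(1)] L2_indicator[OF F(1) S_meas]]])
 have le: "L2norm (%eta. ind S eta *R F eta - analysis (trunc R u) eta) <= L2norm (%x. u x - trunc R u x)" for R
 proof -
 have "L2norm (%eta. ind S eta *R F eta - analysis (trunc R u) eta) <= L2norm (%eta. F eta - analysis (trunc R u) eta)"
 proof (rule L2norm_mono)
 show "(%eta. F eta - analysis (trunc R u) eta) : L2" by (intro L2_diff F aL2)
 show "(%eta. ind S eta *R F eta - analysis (trunc R u) eta) : L2"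
 by (intro L2_diff L2_indicator F aL2 S_meas)
 qed (auto simp: indicator_def analysis_def)
 then show ?thesis using F(2)[of R] by linarith
 qed
 have lim: "((%R. L2norm (%eta. ind S eta *R F eta - analysis (trunc R u) eta)) \<longlongrightarrow> 0) at_top"
 by (rule tendsto_sandwich[OF _ _ tendsto_const trunc_tendsto[OF u]]) (use le in auto)
 have "?P F"
 using tendsto_ennrealI[OF tendsto_power[OF lim, of 2]] FS by (simp add: eq[OF FS])
 then have P: "?P (L2_transform S k u)" unfolding L2_transform_def by (rule someI[of ?P])
 then show S: "L2_transform S k u : L2_on S" by blast
 show "coef u : L2"
 unfolding coef_def[abs_def] by (rule L2_on_iff[OF S_meas, THEN iffD1, OF S, THEN conjunct2])
 have "((%R. ennreal ((L2norm (%eta. coef u eta - analysis (trunc R u) eta))^2)) \<longlongrightarrow> ennreal 0) at_top"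
 using P eq[OF S] by (simp add: coef_def)
 then have "((%R. (L2norm (%eta. coef u eta - analysis (trunc R u) eta))^2) \<longlongrightarrow> 0) at_top"
 by (rule tendsto_ennrealD) auto
 from tendsto_real_sqrt[OF this]
 show "((%R. L2norm (%eta. coef u eta - analysis (trunc R u) eta)) \<longlongrightarrow> 0) at_top" by simp
qed

lemma ip_coef:
 assumes u: "u : L2" and b: "good S b"
 shows "ip (coef u) b = ip u (synth k b)"
proof (rule tendsto_unique[OF _ _ _])
 have aL2: "analysis (trunc R u) : L2" for R using analysis_bound[OF trunc_L2[OF u] trunc_bdd_supp] by blast
 show "((%R. ip (analysis (trunc R u)) b) \<longlongrightarrow> ip (coef u) b) (at_top :: real filter)"
 using coef_limit[OF u] aL2 b
 by (intro ip_tendsto_left) (auto simp: L2norm_minus_commute[of "analysis _"])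
 have "((%R. ip (trunc R u) (synth k b)) \<longlongrightarrow> ip u (synth k b)) (at_top :: real filter)"
 using trunc_tendsto[OF u] u b
 by (intro ip_tendsto_left always_eventually allI) (auto simp: L2norm_minus_commute[of "trunc _ _"])
 then show "((%R. ip (analysis (trunc R u)) b) \<longlongrightarrow> ip u (synth k b)) (at_top :: real filter)"
 by (simp add: ip_analysis[OF b trunc_L2[OF u] trunc_bdd_supp])
qed simp

lemma coef_L2 [intro]: "u : L2 ==> coef u : L2"
 by (rule coef_limit)

lemma coef_off: "eta \<notin> S ==> coef u eta = 0"
 by (simp add: coef_def)

lemma L2norm_coef_le:
 assumes u: "u : L2" shows "L2norm (coef u) <= L2norm u"
proof -
 have le: "L2norm (coef u) <= L2norm (%eta. coef u eta - analysis (trunc R u) eta) + L2norm u" for R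
 proof -
 have a: "analysis (trunc R u) : L2" "L2norm (analysis (trunc R u)) <= L2norm (trunc R u)"
 using analysis_bound[OF trunc_L2[OF u] trunc_bdd_supp] by auto
 have "L2norm (coef u) = L2norm (%eta. (coef u eta - analysis (trunc R u) eta) + analysis (trunc R u) eta)" by simp
 also have "... <= L2norm (%eta. coef u eta - analysis (trunc R u) eta) + L2norm (analysis (trunc R u))"
 by (intro L2norm_triangle L2_diff coef_L2 u a)
 finally show ?thesis using a(2) L2norm_trunc_le[OF u, of R] by linarith
 qed
 have "((%R. L2norm (%eta. coef u eta - analysis (trunc R u) eta) + L2norm u) \<longlongrightarrow> 0 + L2norm u) at_top"
 by (intro tendsto_intros coef_limit u)
 from tendsto_lowerbound[OF this always_eventually] le show ?thesis by simp
qed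

lemma coef_unique:
 assumes u: "u : L2" and G: "G : L2" and test: "!!b. good S b ==> ip G b = ip u (synth k b)"
 shows "AEL eta. eta : S --> coef u eta = G eta"
proof -
 define D where "D eta = ind S eta *R (coef u eta - G eta)" for eta
 have D: "D : L2" unfolding D_def[abs_def] using u G by (intro L2_indicator L2_diff coef_L2) auto
 have "AEL eta. trunc (real n) D eta = 0" for n
 proof -
 have g: "good S (trunc (real n) D)"
 using good_trunc_indicator[OF L2_diff[OF coef_L2[OF u] G] S_meas] by (simp add: D_def[abs_def])
 have "ip (trunc (real n) D) (trunc (real n) D) = ip (%eta. coef u eta - G eta) (trunc (real n) D)"
 unfolding ip_def by (rule Bochner_Integration.integral_cong) (auto simp: trunc_def D_def indicator_def)
 also have "... = 0"
 using ip_diff_left[OF coef_L2[OF u] G good_L2[OF g]] ip_coef[OF u g] test[OF g] by simp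
 finally have "L2norm (trunc (real n) D) = 0" by (simp add: ip_self)
 then show ?thesis using L2norm_eq_0_iff[OF trunc_L2[OF D]] by simp
 qed
 then have "AEL eta. \<forall>n. trunc (real n) D eta = 0" by (simp add: AE_all_countable)
 then show ?thesis
 proof eventually_elim
 case (elim eta)
 obtain n :: nat where "norm eta <= real n" using real_arch_simple by blast
 then have "D eta = 0" using elim[rule_format, of n] by (simp add: trunc_def)
 then show ?case by (auto simp: D_def)
 qed
qed

lemma coef_synth:
 assumes b: "good S b"
 shows "AEL eta. coef (synth k b) eta = b eta"
proof -
 have "AEL eta. eta : S --> coef (synth k b) eta = b eta"
 by (rule coef_unique) (use b ip_synth in "auto")
 then show ?thesis
 by eventually_elim (use b coef_off in "auto simp: good_def")
qed

lemma coef_cong_AE: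
 assumes "u : L2" "v : L2" "AEL x. u x = v x"
 shows "AEL eta. coef u eta = coef v eta"
proof -
 have "AEL eta. eta : S --> coef u eta = coef v eta"
 proof (rule coef_unique)
 fix b assume b: "good S b"
 show "ip (coef v) b = ip u (synth k b)"
 unfolding ip_coef[OF assms(2) b] using assms b by (intro ip_cong_AE) (auto elim: eventually_mono)
 qed (use assms in auto)
 then show ?thesis by eventually_elim (auto simp: coef_off)
qed

lemma coef_lin:
 assumes "u : L2" "v : L2"
 shows "AEL eta. coef (%x. u x + c * v x) eta = coef u eta + c * coef v eta"
proof -
 have "AEL eta. eta : S --> coef (%x. u x + c * v x) eta = coef u eta + c * coef v eta"
 proof (rule coef_unique)
 fix b assume b: "good S b"
 show "ip (%eta. coef u eta + c * coef v eta) b = ip (%x. u x + c * v x) (synth k b)"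
 using assms b by (simp add: ip_add_left ip_scale_left ip_coef L2_mult_const coef_L2 synth_in_L2 good_L2)
 qed (use assms in "auto intro!: L2_add L2_mult_const coef_L2")
 then show ?thesis by eventually_elim (auto simp: coef_off)
qed

end

section \<open>The Bloch transform of one band and the Fourier transform\<close>

locale unit_cell_kernel = cell_kernel s \<Psi>
 for s :: real and \<Psi> :: "real^'n::finite => real^'n => complex" +
 assumes wt_one: "!!eta. eta : Zscaled s ==> wt eta = 1"
begin

lemma wt_fin:
 assumes "good (Zscaled s) b"
 shows "(NI eta. ennreal ((norm (b eta))^2) * wt eta) = ennreal ((L2norm b)^2)"
proof -
 have "(NI eta. ennreal ((norm (b eta))^2) * wt eta) = (NI eta. ennreal ((norm (b eta))^2))"
 proof (rule nn_integral_cong)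
 fix eta
 show "ennreal ((norm (b eta))^2) * wt eta = ennreal ((norm (b eta))^2)"
 by (cases "eta : Zscaled s") (use assms wt_one in "auto simp: good_def")
 qed
 then show ?thesis using assms by (simp add: nn_L2norm good_L2)
qed

sublocale wave_transform "Zscaled s" wave
proof
 show "(%(eta, x). wave eta x) : borel_measurable (borel \<Otimes>\<^sub>M borel)" by measurable
next
 fix b :: "real^'n => complex" assume b: "good (Zscaled s) b"
 have bm: "b : BM" using b by auto
 have fin: "(NI eta. ennreal ((norm (b eta))^2) * wt eta) < \<infinity>" by (simp add: wt_fin[OF b])
 show "AEL x. intb (%eta. b eta * wave eta x)" by (rule synth_isometry(1)[OF bm fin])
 have "synth wave b : L2" by (rule synth_L2[OF bm fin])
 moreover have "ennreal ((L2norm (synth wave b))^2) = ennreal ((L2norm b)^2)"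
 using synth_isometry(3)[OF bm fin] by (simp add: nn_L2norm calculation wt_fin[OF b])
 ultimately show "synth wave b : L2 & L2norm (synth wave b) = L2norm b" by simp
next
 fix eta :: "real^'n" and u :: "real^'n => complex"
 assume eta: "eta : Zscaled s" and u: "u : L2" "bdd_supp u"
 have "intb (%x. cnj (u x) * wave eta x)"
 by (rule wave_integrable_mult) (use eta u wt_one in "auto intro: bdd_supp_mono")
 then have "intb (%x. cnj (cnj (u x) * wave eta x))" by (rule integrable_cnj)
 then show "intb (%x. u x * cnj (wave eta x))" by simp
next
 fix b u :: "real^'n => complex" assume b: "good (Zscaled s) b" and u: "u : L2" "bdd_supp u"
 have bm: "b : BM" using b by auto
 have fin: "(NI eta. ennreal ((norm (b eta))^2) * wt eta) < \<infinity>" by (simp add: wt_fin[OF b])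
 have inner: "(LI x. u x * cnj (wave eta x)) = cnj (LI x. cnj (u x) * wave eta x)" for eta
 by (subst Bochner_Integration.integral_cnj[symmetric]) simp
 have "ip (%eta. LI x. u x * cnj (wave eta x)) b
 = cnj (LI eta. b eta * (LI x. cnj (u x) * wave eta x))"
 unfolding ip_def inner by (subst Bochner_Integration.integral_cnj[symmetric]) (simp add: mult.commute)
 also have "... = cnj (LI x. cnj (u x) * synth wave b x)"
 by (subst Fubini_wave(2)[OF bm fin]) (use u in "auto intro: bdd_supp_mono")
 also have "... = ip u (synth wave b)"
 unfolding ip_def by (subst Bochner_Integration.integral_cnj[symmetric]) simp
 finally show "ip (%eta. LI x. u x * cnj (wave eta x)) b = ip u (synth wave b)" .
qed simp

end

lemma unit_cell_kernel_one:
 assumes s: "0 < s"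
 shows "unit_cell_kernel s (%eta (x::real^'n::finite). if eta : Zscaled s then 1 else 0)"
proof -
 interpret cell_kernel s "%eta (x::real^'n). if eta : Zscaled s then 1 else 0"
 proof
 show "(%(eta, x::real^'n). if eta : Zscaled s then 1 else 0::complex) : borel_measurable (borel \<Otimes>\<^sub>M borel)"
 by measurable
 qed (use s in "auto simp: lper_def")
 show ?thesis
 proof
 fix eta :: "real^'n" assume "eta : Zscaled s"
 then have "wt eta = emeasure lborel (cell 0 s :: (real^'n) set) * ennreal (1 / s ^ CARD('n))" by (simp add: wt_def)
 also have "... = 1" using s by (simp add: emeasure_cell flip: ennreal_mult)
 finally show "wt eta = 1" .
 qed
qed

lemma good_in_Zscaled:
 assumes "good UNIV (b :: real^'n::finite => complex)"
 obtains s where "0 < s" "good (Zscaled s) b"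
proof -
 obtain R where R: "0 <= R" "!!eta. R < norm eta ==> b eta = 0" using assms by (auto simp: good_def elim: bdd_suppE)
 have "good (Zscaled (1 / (2 * R + 1))) b"
 unfolding good_def
 proof (intro conjI allI impI)
 fix eta :: "real^'n" assume "eta \<notin> Zscaled (1 / (2 * R + 1))"
 then have "R < norm eta" using ball_subset_Zscaled[OF R(1), of eta] by (auto simp: not_le[symmetric])
 then show "b eta = 0" by (rule R(2))
 qed (use assms in "auto simp: good_def")
 then show ?thesis using R(1) by (intro that[of "1 / (2 * R + 1)"]) auto
qed

interpretation fourier: wave_transform UNIV "pw :: real^'n::finite => real^'n => complex"
proof
 show "(%(eta, x :: real^'n). pw eta x) : borel_measurable (borel \<Otimes>\<^sub>M borel)" by measurable
next
 fix b :: "real^'n => complex" assume b: "good UNIV b"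
 obtain s where s: "0 < s" "good (Zscaled s) b" using good_in_Zscaled[OF b] by blast
 interpret K: unit_cell_kernel s "%eta (x::real^'n). if eta : Zscaled s then 1 else 0"
 by (rule unit_cell_kernel_one[OF s(1)])
 have eq: "b eta * K.wave eta x = b eta * pw eta x" for eta x
 using s(2) by (auto simp: good_def K.wave_def)
 then have syn: "synth pw b = synth K.wave b" unfolding synth_def fun_eq_iff by (simp only: eq) simp
 show "AEL x. intb (%eta. b eta * pw eta x)"
 using K.packet_integrable[OF s(2)] by (simp add: eq)
 show "synth pw b : L2 & L2norm (synth pw b) = L2norm b"
 using K.packet_isometry[OF s(2)] by (simp add: syn)
 fix u :: "real^'n => complex" assume u: "u : L2" "bdd_supp u"
 have "ip (%eta. LI x. u x * cnj (pw eta x)) b = ip (%eta. LI x. u x * cnj (K.wave eta x)) b"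
 unfolding ip_def by (rule Bochner_Integration.integral_cong) (use s(2) in "auto simp: good_def K.wave_def")
 then show "ip (%eta. LI x. u x * cnj (pw eta x)) b = ip u (synth pw b)"
 by (simp add: K.adjoint[OF s(2) u] syn)
next
 fix eta :: "real^'n" and u :: "real^'n => complex" assume u: "u : L2" "bdd_supp u"
 obtain R where R: "!!x. R < norm x ==> u x = 0" using u(2) by (auto simp: bdd_supp_def)
 have "(%x::real^'n. ind (cball 0 R) x *R (1::complex)) : L2" by (rule L2_indicator_bounded[where R=R]) auto
 then have "intb (%x. (cnj (pw eta x) * u x) * (ind (cball 0 R) x *R 1))"
 by (intro L2_integrable_mult L2_mult_bounded[where c=1] u) (auto simp: cnj_plane_wave)
 moreover have "(%x. (cnj (pw eta x) * u x) * (ind (cball 0 R) x *R 1)) = (%x. u x * cnj (pw eta x))"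
 using R by (auto simp: fun_eq_iff indicator_def not_le)
 ultimately show "intb (%x. u x * cnj (pw eta x))" by simp
qed simp

lemma fourier_coef: "fourier.coef u = fourier u"
 by (simp add: fourier.coef_def fourier_def fun_eq_iff)

lemma fourier_L2 [intro]: "u : L2 ==> fourier u : L2"
 using fourier.coef_L2[of u] by (simp add: fourier_coef)

text \<open>
 Plancherel: the kernel is symmetric, so the transform of a function of bounded support is itself,
 up to conjugation, a wave packet, and packets have the norm of their coefficients.
\<close>

lemma L2norm_fourier:
 fixes u :: "real^'n::finite => complex"
 assumes u: "u : L2"
 shows "L2norm (fourier u) = L2norm u"
proof -
 have a: "fourier.analysis v : L2 & L2norm (fourier.analysis v) = L2norm v" if v: "v : L2" "bdd_supp v" for v :: "real^'n => complex"
 proof -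
 have g: "good UNIV (%x. cnj (v x))" using v by (auto simp: good_def intro: bdd_supp_mono)
 have "fourier.analysis v = (%eta. cnj (synth pw (%x. cnj (v x)) eta))"
 unfolding synth_def fourier.analysis_def
 by (subst Bochner_Integration.integral_cnj[symmetric]) (simp add: plane_wave_commute)
 then show ?thesis using fourier.packet_isometry[OF g] by auto
 qed
 have t: "fourier.analysis (trunc R u) : L2" "L2norm (fourier.analysis (trunc R u)) = L2norm (trunc R u)" for R
 using a[OF trunc_L2[OF u] trunc_bdd_supp] by auto
 have le: "L2norm u <= L2norm (%x. u x - trunc R u x) + (L2norm (%eta. fourier u eta - fourier.analysis (trunc R u) eta) + L2norm (fourier u))" for R
 proof -
 have "L2norm u = L2norm (%x. (u x - trunc R u x) + trunc R u x)" by simp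
 also have "... <= L2norm (%x. u x - trunc R u x) + L2norm (trunc R u)"
 by (intro L2norm_triangle L2_diff u trunc_L2)
 also have "L2norm (trunc R u) = L2norm (%eta. (fourier.analysis (trunc R u) eta - fourier u eta) + fourier u eta)"
 by (simp add: t)
 also have "... <= L2norm (%eta. fourier.analysis (trunc R u) eta - fourier u eta) + L2norm (fourier u)"
 by (intro L2norm_triangle L2_diff t fourier_L2 u)
 finally show ?thesis using L2norm_minus_commute[of "fourier.analysis (trunc R u)" "fourier u"] by linarith
 qed
 have "((%R. L2norm (%x. u x - trunc R u x) + (L2norm (%eta. fourier u eta - fourier.analysis (trunc R u) eta) + L2norm (fourier u)))
 \<longlongrightarrow> 0 + (0 + L2norm (fourier u))) at_top"
 using fourier.coef_limit(3)[OF u] by (intro tendsto_intros trunc_tendsto u) (simp add: fourier_coef)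
 from tendsto_lowerbound[OF this always_eventually] le have "L2norm u <= L2norm (fourier u)" by simp
 moreover have "L2norm (fourier u) <= L2norm u" using fourier.L2norm_coef_le[OF u] by (simp add: fourier_coef)
 ultimately show ?thesis by simp
qed

lemma fourier_lin:
 assumes "u : L2" "v : L2"
 shows "AEL eta. fourier (%x. u x + c * v x) eta = fourier u eta + c * fourier v eta"
 using fourier.coef_lin[OF assms] by (simp add: fourier_coef)

lemma fourier_cong_AE:
 "u : L2 ==> v : L2 ==> AEL x. u x = v x ==> AEL eta. fourier u eta = fourier v eta"
 using fourier.coef_cong_AE[of u v] by (simp add: fourier_coef)

lemma fourier_inj:
 assumes "u : L2" "v : L2" "AEL eta. fourier u eta = fourier v eta"
 shows "AEL x. u x = v x"
proof -
 have d: "(%x. u x + (- 1) * v x) : L2" using assms by (intro L2_add L2_mult_const)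
 have "AEL eta. fourier (%x. u x + (- 1) * v x) eta = 0"
 using fourier_lin[OF assms(1,2), of "-1"] assms(3) by eventually_elim simp
 then have "L2norm (fourier (%x. u x + (- 1) * v x)) = 0" using L2norm_eq_0_iff[OF fourier_L2[OF d]] by simp
 then have "L2norm (%x. u x + (- 1) * v x) = 0" using L2norm_fourier[OF d] by simp
 then have "AEL x. u x + (- 1) * v x = 0" using L2norm_eq_0_iff[OF d] by simp
 then show ?thesis by eventually_elim simp
qed

lemma fourier_synth: "good UNIV b ==> AEL eta. fourier (synth pw b) eta = b eta"
 using fourier.coef_synth[of b] by (simp add: fourier_coef)

lemma fourier_inversion:
 assumes "u : L2" "good UNIV b" "AEL eta. fourier u eta = b eta"
 shows "AEL x. u x = synth pw b x"
proof (rule fourier_inj)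
 show "AEL eta. fourier u eta = fourier (synth pw b) eta"
 using assms(3) fourier_synth[OF assms(2)] by eventually_elim simp
qed (use assms fourier.synth_in_L2 in auto)

section \<open>Test functions\<close>

text \<open>
 The functions \<open>t \<mapsto> t\<^sup>-\<^sup>m exp (- 1 / t)\<close>, extended by zero to \<open>t \<le> 0\<close>; the family is closed
 under differentiation up to linear combinations, which makes its members smooth.
\<close>

definition bump :: "nat => real => real" where
 "bump m t = (if t <= 0 then 0 else inverse t ^ m * exp (- inverse t))"

lemma bump_tendsto_0: "(bump m \<longlongrightarrow> 0) (at 0)"
proof -
 have "((%t. inverse t ^ m / exp (inverse t)) \<longlongrightarrow> (0::real)) (at_right 0)"
 by (rule filterlim_compose[OF tendsto_power_div_exp_0 filterlim_inverse_at_top_right])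
 moreover have "eventually (%t. inverse t ^ m / exp (inverse t) = bump m t) (at_right 0)"
 unfolding eventually_at_right_field by (intro exI[of _ 1]) (auto simp: bump_def exp_minus field_simps)
 ultimately have r: "(bump m \<longlongrightarrow> 0) (at_right 0)" by (rule Lim_transform_eventually)
 have "eventually (%t. 0 = bump m t) (at_left 0)"
 unfolding eventually_at_left_field by (intro exI[of _ "-1"]) (auto simp: bump_def)
 with tendsto_const have l: "(bump m \<longlongrightarrow> 0) (at_left 0)" by (rule Lim_transform_eventually)
 from l r show ?thesis by (simp add: filterlim_split_at)
qed

lemma bump_deriv: "(bump m has_real_derivative (bump (m + 2) t - real m * bump (m + 1) t)) (at t)"
proof (cases t "0::real" rule: linorder_cases)
 case less
 have "((%_. 0) has_real_derivative 0) (at t)" by simp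
 then have "(bump m has_real_derivative 0) (at t)"
 by (rule has_field_derivative_transform_within_open[of _ _ _ "{..<0}"]) (use less in "auto simp: bump_def")
 then show ?thesis using less by (simp add: bump_def)
next
 case equal
 have "((%h. (bump m (0 + h) - bump m 0) / h) \<longlongrightarrow> 0) (at 0)"
 proof (rule Lim_transform_eventually[OF bump_tendsto_0[of "Suc m"]])
 show "eventually (%h. bump (Suc m) h = (bump m (0 + h) - bump m 0) / h) (at 0)"
 by (auto simp: eventually_at_filter bump_def field_simps)
 qed
 then have "(bump m has_real_derivative 0) (at 0)" by (simp add: DERIV_def)
 then show ?thesis using equal by (simp add: bump_def)
next
 case greater
 have "((%t. inverse t ^ m * exp (- inverse t)) has_real_derivative
 (bump (m + 2) t - real m * bump (m + 1) t)) (at t)"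
 using greater
 by (auto intro!: derivative_eq_intros simp: bump_def field_simps power2_eq_square power_diff split: nat_diff_split)
 then show ?thesis
 by (rule has_field_derivative_transform_within_open[of _ _ _ "{0<..}"]) (use greater in "auto simp: bump_def")
qed

lemma bump_0_bounds: "0 <= bump 0 t" "bump 0 t <= 1"
 by (auto simp: bump_def)

lemma part_deriv_eq: "(f has_derivative f') (at x) ==> part_deriv i f x = f' (axis i 1)"
 by (simp add: part_deriv_def frechet_derivative_at[symmetric])

lemma part_deriv_const: "part_deriv i (%x. c) = (%x. 0)"
 by (rule ext) (rule part_deriv_eq[OF has_derivative_const])

lemma iter_deriv_snoc: "iter_deriv (is @ [i]) phi = iter_deriv is (part_deriv i phi)"
 by (induction "is") auto

text \<open>
 An algebra of functions all of whose members are differentiable with partial derivatives in the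
 algebra; hence all of them are smooth.
\<close>

inductive smooth_alg :: "(real^'n::finite => real) => bool" where
 base: "(!!is x. iter_deriv is phi differentiable (at x)) ==> smooth_alg phi"
| const: "smooth_alg (%x. c)"
| bump: "smooth_alg (%x. bump m (c * x $ i + d))"
| cosine: "smooth_alg (%x. cos (v \<bullet> x + d))"
| add: "smooth_alg f ==> smooth_alg g ==> smooth_alg (%x. f x + g x)"
| mult: "smooth_alg f ==> smooth_alg g ==> smooth_alg (%x. f x * g x)"

lemma frechet_part: "f differentiable (at x) ==> (f has_derivative frechet_derivative f (at x)) (at x)"
 by (simp add: frechet_derivative_works)

lemma part_deriv_mult:
 "f differentiable (at x) ==> g differentiable (at x) ==>
 part_deriv i (%x. f x * g x) x = part_deriv i f x * g x + f x * part_deriv i g x"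
 using part_deriv_eq[OF has_derivative_mult[OF frechet_part[of f x] frechet_part[of g x]], of i]
 by (simp add: part_deriv_def)

lemma part_deriv_add:
 "f differentiable (at x) ==> g differentiable (at x) ==>
 part_deriv i (%x. f x + g x) x = part_deriv i f x + part_deriv i g x"
 using part_deriv_eq[OF has_derivative_add[OF frechet_part[of f x] frechet_part[of g x]], of i]
 by (simp add: part_deriv_def)

lemma smooth_alg_step:
 "smooth_alg f ==> (\<forall>x. f differentiable (at x)) & (\<forall>i. smooth_alg (part_deriv i f))"
proof (induction rule: smooth_alg.induct)
 case (base phi)
 have "smooth_alg (part_deriv i phi)" for i
 by (rule smooth_alg.base) (use base[of "_ @ [i]"] in "simp add: iter_deriv_snoc")
 then show ?case using base[of "[]"] by auto
next
 case (const c)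
 show ?case by (simp add: part_deriv_const smooth_alg.const)
next
 case (bump m c i d)
 have D: "((%x. bump m (c * x $ i + d)) has_derivative
 (%h. (bump (m + 2) (c * x $ i + d) - real m * bump (m + 1) (c * x $ i + d)) * (c * h $ i))) (at x)" for x
 by (rule has_derivative_compose[OF _ bump_deriv[unfolded has_field_derivative_def], THEN has_derivative_eq_rhs])
 (auto intro!: derivative_eq_intros bounded_linear_imp_has_derivative)
 have P: "part_deriv j (%x. bump m (c * x $ i + d)) = (%x. (bump (m + 2) (c * x $ i + d) + (- real m) * bump (m + 1) (c * x $ i + d)) * (c * axis j 1 $ i))" for j
 by (rule ext) (subst part_deriv_eq[OF D], simp)
 show ?case
 proof (intro conjI allI)
 show "(%x. bump m (c * x $ i + d)) differentiable (at x)" for x using D by (auto simp: differentiable_def)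
 show "smooth_alg (part_deriv j (%x. bump m (c * x $ i + d)))" for j
 unfolding P by (intro smooth_alg.intros(2-))
 qed
next
 case (cosine v d)
 have D: "((%x. cos (v \<bullet> x + d)) has_derivative (%h. cos (v \<bullet> x + (d + pi / 2)) * (v \<bullet> h))) (at x)" for x
 proof -
 have "((%x. cos (v \<bullet> x + d)) has_derivative (%h. - sin (v \<bullet> x + d) * (v \<bullet> h))) (at x)"
 by (auto intro!: derivative_eq_intros)
 moreover have "- sin t = cos (t + pi / 2)" for t :: real by (simp add: cos_add)
 ultimately show ?thesis by (simp add: add.assoc)
 qed
 have P: "part_deriv j (%x. cos (v \<bullet> x + d)) = (%x. cos (v \<bullet> x + (d + pi / 2)) * (v \<bullet> axis j 1))" for j
 by (rule ext) (rule part_deriv_eq[OF D])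
 show ?case
 proof (intro conjI allI)
 show "(%x. cos (v \<bullet> x + d)) differentiable (at x)" for x using D by (auto simp: differentiable_def)
 show "smooth_alg (part_deriv j (%x. cos (v \<bullet> x + d)))" for j
 unfolding P by (intro smooth_alg.intros(2-))
 qed
next
 case (add f g)
 then have P: "part_deriv i (%x. f x + g x) = (%x. part_deriv i f x + part_deriv i g x)" for i
 by (intro ext part_deriv_add) auto
 show ?case unfolding P using add by (auto intro!: smooth_alg.add differentiable_add)
next
 case (mult f g)
 then have P: "part_deriv i (%x. f x * g x) = (%x. part_deriv i f x * g x + f x * part_deriv i g x)" for i
 by (intro ext part_deriv_mult) auto
 show ?case unfolding P using mult by (auto intro!: smooth_alg.add smooth_alg.mult differentiable_mult)
qed

lemma smooth_alg_iter: "smooth_alg f ==> smooth_alg (iter_deriv is f)"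
 by (induction "is") (use smooth_alg_step in auto)

lemma smooth_alg_differentiable: "smooth_alg f ==> f differentiable (at x)"
 using smooth_alg_step by blast

lemma smooth_alg_part: "smooth_alg f ==> smooth_alg (part_deriv i f)"
 using smooth_alg_step by blast

lemma smooth_alg_prod: "(!!i. i : I ==> smooth_alg (f i)) ==> smooth_alg (%x. \<Prod>i\<in>I. f i x)"
 by (induction I rule: infinite_finite_induct) (auto intro: smooth_alg.const smooth_alg.mult)

lemma smooth_alg_continuous: "smooth_alg f ==> continuous_on S f"
 by (intro differentiable_imp_continuous_on) (simp add: differentiable_on_def differentiable_at_withinI smooth_alg_differentiable)

lemma smooth_alg_measurable: "smooth_alg f ==> f : BM"
 by (intro borel_measurable_continuous_onI smooth_alg_continuous)

lemma compact_closure_supp_iff: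
 fixes phi :: "real^'n::finite => real"
 shows "compact (closure {x. phi x ~= 0}) \<longleftrightarrow> bdd_supp phi"
proof -
 have "compact (closure {x. phi x ~= 0}) \<longleftrightarrow> bounded {x. phi x ~= 0}"
 unfolding compact_eq_bounded_closed using bounded_closure bounded_subset[OF _ closure_subset] by auto
 also have "... \<longleftrightarrow> bdd_supp phi"
 unfolding bounded_iff bdd_supp_def by (auto simp: not_le[symmetric])
 finally show ?thesis .
qed

lemma test_fun_iff: "test_fun phi \<longleftrightarrow> smooth_alg phi & bdd_supp phi"
 unfolding test_fun_def compact_closure_supp_iff
 using smooth_alg.base[of phi] smooth_alg_differentiable[OF smooth_alg_iter[of phi]] by blast

lemma test_fun_smooth: "test_fun phi ==> smooth_alg phi"
 by (simp add: test_fun_iff)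

lemma test_fun_measurable [measurable_dest]: "test_fun phi ==> phi : BM"
 by (simp add: test_fun_iff smooth_alg_measurable)

lemma test_fun_part:
 assumes "test_fun phi" shows "test_fun (part_deriv i phi)"
proof -
 obtain R where R: "!!x. R < norm x ==> phi x = 0" using assms by (auto simp: test_fun_iff bdd_supp_def)
 have "part_deriv i phi x = 0" if x: "R < norm x" for x
 proof -
 have o: "open {x::real^'n. R < norm x}" by (intro open_Collect_less continuous_intros)
 have "((%_. 0) has_derivative (%_. 0)) (at x)" by simp
 then have "(phi has_derivative (%_. 0)) (at x)"
 by (rule has_derivative_transform_within_open[OF _ o]) (use x R in auto)
 then show ?thesis by (simp add: part_deriv_eq)
 qed
 then show ?thesis using assms by (auto simp: test_fun_iff bdd_supp_def intro: smooth_alg_part)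
qed

lemma test_fun_iter: "test_fun phi ==> test_fun (iter_deriv is phi)"
 by (induction "is") (auto intro: test_fun_part)

lemma test_fun_mult: "test_fun phi ==> smooth_alg c ==> test_fun (%x. phi x * c x)"
 unfolding test_fun_iff by (auto intro: smooth_alg.mult bdd_supp_mono)

lemma test_fun_bounded:
 assumes "test_fun phi" obtains B where "0 <= B" "!!x. \<bar>phi x\<bar> <= B"
proof -
 obtain R where R: "!!x. R < norm x ==> phi x = 0" using assms by (auto simp: test_fun_iff bdd_supp_def)
 have "compact (phi ` cball 0 R)"
 using assms by (intro compact_continuous_image smooth_alg_continuous) (auto simp: test_fun_iff)
 then obtain B where B: "!!x. x : cball 0 R ==> norm (phi x) <= B"
 using compact_imp_bounded[of "phi ` cball 0 R"] unfolding bounded_iff by blast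
 have "\<bar>phi x\<bar> <= max B 0" for x
 using R[of x] B[of x] by (cases "norm x <= R") (auto simp: not_le)
 then show ?thesis by (intro that[of "max B 0"]) auto
qed

lemma test_fun_L2: "test_fun phi ==> phi : L2"
proof -
 assume t: "test_fun phi"
 obtain B where "!!x. \<bar>phi x\<bar> <= B" using test_fun_bounded[OF t] by blast
 then show "phi : L2" using t by (intro L2_bounded_bdd_supp[of phi B]) (auto simp: test_fun_iff smooth_alg_measurable)
qed

lemma test_fun_integrable:
 fixes phi :: "real^'n::finite => real"
 assumes "test_fun phi" shows "intb phi"
proof -
 obtain R where R: "!!x. R < norm x ==> phi x = 0" using assms by (auto simp: test_fun_iff bdd_supp_def)
 have "(%x::real^'n. ind (cball 0 R) x *R (1::real)) : L2"
 by (rule L2_indicator_bounded[where R=R]) auto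
 from L2_integrable_mult[OF test_fun_L2[OF assms] this]
 have "intb (%x. phi x * (ind (cball 0 R) x *R 1))" .
 moreover have "(%x. phi x * (ind (cball 0 R) x *R 1)) = phi"
 using R by (auto simp: fun_eq_iff indicator_def not_le)
 ultimately show ?thesis by simp
qed

lemma smooth_alg_affine:
 fixes phi :: "real^'n::finite => real"
 assumes "smooth_alg phi"
 shows "smooth_alg (%x. phi (c *R x + a))"
 and "part_deriv i (%x. phi (c *R x + a)) x = c * part_deriv i phi (c *R x + a)"
proof -
 have D: "((%x. psi (c *R x + a)) has_derivative (%h. frechet_derivative psi (at (c *R x + a)) (c *R h))) (at x)"
 if "smooth_alg psi" for psi :: "real^'n => real" and x
 by (rule has_derivative_compose[OF _ frechet_part[OF smooth_alg_differentiable[OF that]]])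
 (auto intro!: derivative_eq_intros)
 have P: "part_deriv i (%x. psi (c *R x + a)) x = c * part_deriv i psi (c *R x + a)"
 if "smooth_alg psi" for psi :: "real^'n => real" and i x
 proof -
 have "linear (frechet_derivative psi (at (c *R x + a)))"
 using frechet_part[OF smooth_alg_differentiable[OF that]] has_derivative_linear by blast
 then show ?thesis
 by (subst part_deriv_eq[OF D[OF that]]) (simp add: part_deriv_def linear_cmul)
 qed
 then show "part_deriv i (%x. phi (c *R x + a)) x = c * part_deriv i phi (c *R x + a)" using assms by blast
 have I: "iter_deriv is (%x. phi (c *R x + a)) = (%x. c ^ length is * iter_deriv is phi (c *R x + a))" for "is"
 proof (induction "is")
 case (Cons i "is")
 have "part_deriv i (%x. c ^ length is * iter_deriv is phi (c *R x + a)) x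
 = c ^ length is * (c * part_deriv i (iter_deriv is phi) (c *R x + a))" for x
 proof -
 have s: "smooth_alg (iter_deriv is phi)" using assms by (rule smooth_alg_iter)
 have d: "(%x. iter_deriv is phi (c *R x + a)) differentiable (at x)" using D[OF s] by (auto simp: differentiable_def)
 show ?thesis using part_deriv_mult[OF _ d, of "%x. c ^ length is" i] P[OF s] by (simp add: part_deriv_const)
 qed
 then show ?case by (simp add: Cons fun_eq_iff)
 qed simp
 show "smooth_alg (%x. phi (c *R x + a))"
 proof (rule smooth_alg.base)
 fix "is" x
 have s: "smooth_alg (iter_deriv is phi)" using assms by (rule smooth_alg_iter)
 have "(%x. iter_deriv is phi (c *R x + a)) differentiable (at x)" using D[OF s] by (auto simp: differentiable_def)
 then show "iter_deriv is (%x. phi (c *R x + a)) differentiable (at x)"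
 unfolding I by (intro differentiable_mult) auto
 qed
qed

lemma test_fun_affine:
 assumes phi: "test_fun phi" and c: "c ~= 0"
 shows "test_fun (%x. phi (c *R x + a))"
proof -
 obtain R where R: "!!x. R < norm x ==> phi x = 0" using phi by (auto simp: test_fun_iff bdd_supp_def)
 have "phi (c *R x + a) = 0" if "(R + norm a) / \<bar>c\<bar> < norm x" for x
 proof (rule R)
 have "R + norm a < norm (c *R x)" using that c by (simp add: field_simps)
 then show "R < norm (c *R x + a)" using norm_triangle_ineq4[of "c *R x + a" a] by simp
 qed
 then show ?thesis using phi smooth_alg_affine(1) by (auto simp: test_fun_iff bdd_supp_def)
qed

text \<open>Difference quotients have integral zero by translation invariance, and converge boundedly.\<close>

lemma integral_part_deriv_test:
 fixes phi :: "real^'n::finite => real"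
 assumes phi: "test_fun phi"
 shows "(LI x. part_deriv i phi x) = 0"
proof -
 let ?e = "axis i 1 :: real^'n"
 obtain R where R: "!!x. R < norm x ==> phi x = 0" using phi by (auto simp: test_fun_iff bdd_supp_def)
 obtain B where B: "0 <= B" "!!x. \<bar>part_deriv i phi x\<bar> <= B" using test_fun_bounded[OF test_fun_part[OF phi]] by blast
 have D: "((%t. phi (x + t *R ?e)) has_real_derivative part_deriv i phi (x + t *R ?e)) (at t)" for x t
 proof -
 have "((%t. phi (x + t *R ?e)) has_derivative (%h. frechet_derivative phi (at (x + t *R ?e)) (h *R ?e))) (at t)"
 by (rule has_derivative_compose[OF _ frechet_part[OF smooth_alg_differentiable[OF test_fun_smooth[OF phi]]]])
 (auto intro!: derivative_eq_intros)
 moreover have "linear (frechet_derivative phi (at (x + t *R ?e)))"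
 using frechet_part[OF smooth_alg_differentiable[OF test_fun_smooth[OF phi]]] has_derivative_linear by blast
 ultimately show ?thesis
 by (simp add: has_field_derivative_def part_deriv_def linear_cmul mult.commute[of _ "frechet_derivative _ _ _"])
 qed
 let ?f = "%n x. real (Suc n) * (phi (x + (1 / real (Suc n)) *R ?e) - phi x)"
 have "(%n. LI x. ?f n x) ----> (LI x. part_deriv i phi x)"
 proof (rule integral_dominated_convergence[where w="%x. B * ind (cball 0 (R + 1)) x"])
 show "part_deriv i phi : borel_measurable lborel" using test_fun_part[OF phi] by measurable
 have [measurable]: "phi : BM" using phi by (rule test_fun_measurable)
 show "?f n : borel_measurable lborel" for n by measurable
 show "intb (%x::real^'n. B * ind (cball 0 (R + 1)) x)"
 by (intro integrable_mult_right integrable_real_indicator emeasure_lborel_cball_finite) auto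
 show "AEL x. (%n. ?f n x) ----> part_deriv i phi x"
 proof (rule AE_I2)
 fix x
 have "((%h. (phi (x + (0 + h) *R ?e) - phi (x + 0 *R ?e)) / h) \<longlongrightarrow> part_deriv i phi (x + 0 *R ?e)) (at 0)"
 using D[of x 0] unfolding DERIV_def .
 moreover have "filterlim (%n. 1 / real (Suc n)) (at 0) sequentially"
 unfolding filterlim_at using LIMSEQ_Suc[OF lim_1_over_n[where 'a=real]] by auto
 ultimately have "(%n. (phi (x + (0 + 1 / real (Suc n)) *R ?e) - phi (x + 0 *R ?e)) / (1 / real (Suc n))) ----> part_deriv i phi (x + 0 *R ?e)"
 by (rule filterlim_compose)
 then show "(%n. ?f n x) ----> part_deriv i phi x" by (simp add: mult.commute)
 qed
 fix n
 show "AEL x. norm (?f n x) <= B * ind (cball 0 (R + 1)) x"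
 proof (rule AE_I2)
 fix x
 show "norm (?f n x) <= B * ind (cball 0 (R + 1)) x"
 proof (cases "norm x <= R + 1")
 case True
 obtain z where "phi (x + (1 / real (Suc n)) *R ?e) - phi (x + 0 *R ?e) = (1 / real (Suc n) - 0) * part_deriv i phi (x + z *R ?e)"
 using MVT2[of 0 "1 / real (Suc n)" "%t. phi (x + t *R ?e)" "%t. part_deriv i phi (x + t *R ?e)"] D by auto
 then have "?f n x = part_deriv i phi (x + z *R ?e)" by simp
 then show ?thesis using B True by simp
 next
 case False
 have "norm ((1 / real (Suc n)) *R ?e) <= 1" by simp
 then have "R < norm (x + (1 / real (Suc n)) *R ?e)"
 using False norm_triangle_ineq4[of "x + (1 / real (Suc n)) *R ?e" "(1 / real (Suc n)) *R ?e"]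
 unfolding add_diff_cancel_right' by linarith
 then have "phi (x + (1 / real (Suc n)) *R ?e) = 0" "phi x = 0" using R False by auto
 then show ?thesis using False by simp
 qed
 qed
 qed
 moreover have "(LI x. ?f n x) = 0" for n
 proof -
 have i: "intb phi" "intb (%x. phi (x + (1 / real (Suc n)) *R ?e))"
 using test_fun_integrable[OF phi] integrable_translate by auto
 have "(LI x. ?f n x) = real (Suc n) * ((LI x. phi (x + (1 / real (Suc n)) *R ?e)) - (LI x. phi x))"
 using i by simp
 then show ?thesis using integral_translate[of phi "(1 / real (Suc n)) *R ?e"] phi by (simp add: test_fun_measurable)
 qed
 ultimately show ?thesis by (simp add: LIMSEQ_const_iff)
qed

text \<open>Smooth functions of the box approximate its indicator boundedly, since \<open>bump 0 (j * t) \<longlonglongrightarrow> 1\<close> for \<open>0 < t\<close>.\<close>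

lemma box_approximation:
 fixes a b :: "real^'n::finite"
 obtains phi :: "nat => real^'n => real"
 where "!!j. test_fun (phi j)" "!!j x. \<bar>phi j x\<bar> <= ind (box a b) x"
 "!!x. (%j. phi j x) ----> ind (box a b) x"
proof -
 define phi where "phi j x = (\<Prod>i\<in>UNIV. bump 0 (real (Suc j) * x $ i + - (real (Suc j) * a $ i))
 * bump 0 (- real (Suc j) * x $ i + real (Suc j) * b $ i))" for j :: nat and x :: "real^'n"
 have phi_alt: "phi j x = (\<Prod>i\<in>UNIV. bump 0 (real (Suc j) * (x $ i - a $ i)) * bump 0 (real (Suc j) * (b $ i - x $ i)))" for j x
 unfolding phi_def by (simp add: algebra_simps)
 have smooth: "smooth_alg (phi j)" for j
 unfolding phi_def by (intro smooth_alg_prod smooth_alg.mult smooth_alg.bump)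
 have zero: "phi j x = 0" if xn: "x \<notin> box a b" for j x
 proof -
 obtain i where "x $ i <= a $ i \<or> b $ i <= x $ i" using xn unfolding mem_box_cart by (meson not_le)
 then have "bump 0 (real (Suc j) * (x $ i - a $ i)) * bump 0 (real (Suc j) * (b $ i - x $ i)) = 0"
 by (auto simp: bump_def mult_le_0_iff)
 then show ?thesis unfolding phi_alt by (intro prod_zero) auto
 qed
 have "bounded (box a b)" by simp
 then obtain R where R: "!!x. x : box a b ==> norm x <= R" by (auto simp: bounded_iff)
 have supp: "bdd_supp (phi j)" for j
 unfolding bdd_supp_def using zero R by (meson not_le)
 have le: "\<bar>phi j x\<bar> <= 1" for j x
 proof -
 have "\<bar>phi j x\<bar> = (\<Prod>i\<in>UNIV. \<bar>bump 0 (real (Suc j) * (x $ i - a $ i)) * bump 0 (real (Suc j) * (b $ i - x $ i))\<bar>)"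
 unfolding phi_alt abs_prod ..
 also have "... <= 1"
 by (intro prod_le_1) (auto simp: abs_mult bump_0_bounds intro!: mult_le_one)
 finally show ?thesis .
 qed
 have lim: "(%j. bump 0 (real (Suc j) * t)) ----> 1" if "0 < t" for t :: real
 proof -
 have "(%j. exp (- ((1 / real (Suc j)) * (1 / t)))) ----> exp (- (0 * (1 / t)))"
 by (intro tendsto_intros LIMSEQ_Suc[OF lim_1_over_n])
 then show ?thesis using that by (simp add: bump_def inverse_eq_divide mult_le_0_iff)
 qed
 show ?thesis
 proof (rule that[of phi])
 show "test_fun (phi j)" for j using smooth supp by (simp add: test_fun_iff)
 show "\<bar>phi j x\<bar> <= ind (box a b) x" for j x using le zero by (auto simp: indicator_def)
 show "(%j. phi j x) ----> ind (box a b) x" for x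
 proof (cases "x : box a b")
 case True
 have "(%j. phi j x) ----> (\<Prod>i\<in>(UNIV::'n set). 1 * 1)"
 unfolding phi_alt using True by (intro tendsto_prod tendsto_mult lim) (auto simp: mem_box_cart)
 then show ?thesis using True by simp
 qed (simp add: zero)
 qed
qed

text \<open>Dilates of a fixed test function with value 1 at the origin.\<close>

lemma cutoff_exists:
 obtains zt :: "nat => real^'n::finite => real" and C :: real
 where "!!r. test_fun (zt r)" "!!r x. \<bar>zt r x\<bar> <= C" "!!r i x. \<bar>part_deriv i (zt r) x\<bar> <= C / Suc r"
 "!!x. (%r. zt r x) ----> 1"
proof -
 define th where "th x = (\<Prod>i\<in>UNIV. bump 0 (1 * x $ i + 1) * bump 0 ((- 1) * x $ i + 1) * exp 2)" for x :: "real^'n"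
 have smooth: "smooth_alg th"
 unfolding th_def by (intro smooth_alg_prod smooth_alg.mult smooth_alg.bump smooth_alg.const)
 have "th x = 0" if "CARD('n) < norm x" for x
 proof -
 have "\<exists>i. 1 <= \<bar>x $ i\<bar>"
 proof (rule ccontr)
 assume "\<not> ?thesis"
 then have "(SU i. \<bar>x $ i\<bar>) <= (\<Sum>i\<in>(UNIV::'n set). 1)" by (intro sum_mono) (auto simp: not_le less_imp_le)
 then show False using norm_le_l1_cart[of x] that by simp
 qed
 then obtain i where "1 <= \<bar>x $ i\<bar>" by blast
 then have "bump 0 (1 * x $ i + 1) * bump 0 ((- 1) * x $ i + 1) * exp 2 = 0"
 by (cases "x $ i >= 0") (auto simp: bump_def)
 then show ?thesis unfolding th_def by (intro prod_zero) auto
 qed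
 then have test: "test_fun th" using smooth by (auto simp: test_fun_iff bdd_supp_def)
 have "th 0 = 1" by (simp add: th_def bump_def flip: exp_add)
 obtain B where B: "0 <= B" "!!x. \<bar>th x\<bar> <= B" using test_fun_bounded[OF test] by blast
 have "\<exists>B'. \<forall>i x. \<bar>part_deriv i th x\<bar> <= B' i" 
 by (intro choice allI) (meson test_fun_bounded[OF test_fun_part[OF test]])
 then obtain B' where B': "!!i x. \<bar>part_deriv i th x\<bar> <= B' i" by blast
 define C where "C = B + (SU i. \<bar>B' i\<bar>)"
 have C: "B <= C" "B' i <= C" for i
 using member_le_sum[of i UNIV "%i. \<bar>B' i\<bar>"] sum_nonneg[of UNIV "%i. \<bar>B' i\<bar>"] B(1)
 by (auto simp: C_def intro: order_trans[OF abs_ge_self])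
 let ?zt = "%r x. th ((1 / real (Suc r)) *R x + 0)"
 show ?thesis
 proof (rule that[of ?zt C])
 show "test_fun (?zt r)" for r by (rule test_fun_affine[OF test]) simp
 show "\<bar>?zt r x\<bar> <= C" for r x using B(2)[of "(1 / real (Suc r)) *R x + 0"] C(1) by linarith
 show "\<bar>part_deriv i (?zt r) x\<bar> <= C / Suc r" for i r x
 unfolding smooth_alg_affine(2)[OF smooth]
 using order_trans[OF B'[of i "(1 / real (Suc r)) *R x + 0"] C(2)] by (simp add: abs_mult divide_right_mono)
 show "(%r. ?zt r x) ----> 1" for x
 proof -
 have "(%r. (1 / real (Suc r)) *R x + 0) ----> 0 *R x + 0"
 by (intro tendsto_intros LIMSEQ_Suc[OF lim_1_over_n])
 moreover have "isCont th (0 *R x + 0)"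
 using smooth_alg_continuous[OF smooth, of UNIV] by (simp add: continuous_on_eq_continuous_at)
 ultimately have "(%r. ?zt r x) ----> th (0 *R x + 0)" by (rule isCont_tendsto_compose[rotated])
 then show ?thesis using \<open>th 0 = 1\<close> by simp
 qed
 qed
qed

section \<open>Weak derivatives\<close>

lemma loc_integrable_measurable:
 assumes "loc_integrable u" shows "u : BM"
proof (rule borel_measurable_LIMSEQ_metric[where f="%n x. ind (cball 0 (real n)) x *R u x"])
 show "(%x. ind (cball 0 (real n)) x *R u x) : BM" for n
 proof -
 have "intb (%x. ind (cball 0 (real n)) x *R u x)"
 using assms unfolding loc_integrable_def set_integrable_def by blast
 from borel_measurable_integrable[OF this] show ?thesis by simp
 qed
 show "(%n. ind (cball 0 (real n)) x *R u x) ----> u x" for x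
 proof (rule tendsto_eventually)
 show "eventually (%n. ind (cball 0 (real n)) x *R u x = u x) sequentially"
 using eventually_ge_at_top[of "nat \<lceil>norm x\<rceil>"]
 proof eventually_elim
 case (elim n)
 then have "norm x <= real n" by linarith
 then show ?case by simp
 qed
 qed
qed

lemma L2_loc_integrable:
 fixes u :: "real^'n::finite => 'b::{banach,second_countable_topology}"
 assumes "u : L2" shows "loc_integrable u"
 unfolding loc_integrable_def set_integrable_def
proof
 fix R
 have i: "(%x::real^'n. ind (cball 0 R) x *R (1::real)) : L2"
 by (rule L2_indicator_bounded[where R=R]) auto
 show "intb (%x. ind (cball 0 R) x *R u x)"
 by (rule Bochner_Integration.integrable_bound[OF L2_integrable_norm_mult[OF i assms]])
 (use assms in "auto intro!: borel_measurable_scaleR borel_measurable_indicator")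
qed

lemma loc_integrable_mult:
 fixes u :: "real^'n::finite => 'b::{banach,second_countable_topology}"
 assumes u: "loc_integrable u" and c: "continuous_on UNIV (c :: _ => real)"
 shows "loc_integrable (%x. c x *R u x)"
 unfolding loc_integrable_def set_integrable_def
proof
 fix R
 have [measurable]: "u : BM" using u by (rule loc_integrable_measurable)
 have [measurable]: "c : BM" using c by (rule borel_measurable_continuous_onI)
 have "compact (c ` cball 0 R)" using c by (intro compact_continuous_image) (auto intro: continuous_on_subset)
 then obtain B where B: "!!x. x : cball 0 R ==> norm (c x) <= B"
 using compact_imp_bounded[of "c ` cball 0 R"] unfolding bounded_iff by blast
 have "intb (%x. B *R (ind (cball 0 R) x *R u x))"
 using u unfolding loc_integrable_def set_integrable_def by (intro integrable_scaleR_right) auto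
 then show "intb (%x. ind (cball 0 R) x *R c x *R u x)"
 proof (rule Bochner_Integration.integrable_bound)
 show "AEL x. norm (ind (cball 0 R) x *R c x *R u x) <= norm (B *R (ind (cball 0 R) x *R u x))"
 proof (rule AE_I2)
 fix x
 show "norm (ind (cball 0 R) x *R c x *R u x) <= norm (B *R (ind (cball 0 R) x *R u x))"
 using B[of x] by (cases "x : cball 0 R") (auto intro!: mult_right_mono)
 qed
 next
 show "(%x. ind (cball 0 R) x *R c x *R u x) : borel_measurable lborel"
 unfolding measurable_lborel1 by (intro borel_measurable_scaleR borel_measurable_indicator) (simp_all)
 qed
qed

lemma loc_integrable_add: "loc_integrable u ==> loc_integrable v ==> loc_integrable (%x. u x + v x)"
 unfolding loc_integrable_def by (simp add: set_integral_add)

lemma loc_integrable_bounded_linear: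
 assumes "bounded_linear T" "loc_integrable u"
 shows "loc_integrable (%x. T (u x))"
proof -
 interpret bounded_linear T by fact
 show ?thesis
 unfolding loc_integrable_def set_integrable_def
 proof
 fix R
 have "intb (%x. T (ind (cball 0 R) x *R u x))"
 using assms(2) unfolding loc_integrable_def set_integrable_def
 by (intro integrable_bounded_linear[OF assms(1)]) blast
 then show "intb (%x. ind (cball 0 R) x *R T (u x))" by (simp only: scaleR)
 qed
qed

lemma test_fun_integrable_scaleR:
 fixes u :: "real^'n::finite => 'b::{banach,second_countable_topology}"
 assumes phi: "test_fun phi" and u: "loc_integrable u"
 shows "intb (%x. phi x *R u x)"
proof -
 obtain R where R: "!!x. R < norm x ==> phi x = 0" using phi by (auto simp: test_fun_iff bdd_supp_def)
 have "intb (%x. ind (cball 0 R) x *R phi x *R u x)"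
 using loc_integrable_mult[OF u smooth_alg_continuous[OF test_fun_smooth[OF phi]]]
 unfolding loc_integrable_def set_integrable_def by blast
 moreover have "(%x. ind (cball 0 R) x *R phi x *R u x) = (%x. phi x *R u x)"
 proof
 fix x
 show "ind (cball 0 R) x *R phi x *R u x = phi x *R u x"
 using R[of x] by (cases "norm x <= R") auto
 qed
 ultimately show ?thesis by simp
qed

text \<open>
 Test functions converge boundedly to indicators of boxes, and a locally integrable function whose
 integrals over all boxes vanish is zero.
\<close>

lemma test_fun_separating:
 fixes g :: "real^'n::finite => 'b::{banach,second_countable_topology}"
 assumes g: "loc_integrable g" and zero: "!!phi. test_fun phi ==> (LI x. phi x *R g x) = 0"
 shows "AEL x. g x = 0"
proof -
 have [measurable]: "g : BM" using g by (rule loc_integrable_measurable)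
 have box0: "(LI x. ind (box a b) x *R g x) = 0" and box_int: "intb (%x. ind (box a b) x *R g x)" for a b :: "real^'n"
 proof -
 have "bounded (box a b)" by simp
 then obtain R where R: "!!x. x : box a b ==> norm x <= R" by (auto simp: bounded_iff)
 have "intb (%x. ind (cball 0 R) x *R g x)"
 using g unfolding loc_integrable_def set_integrable_def by blast
 then show i: "intb (%x. ind (box a b) x *R g x)"
 proof (rule Bochner_Integration.integrable_bound)
 show "AEL x. norm (ind (box a b) x *R g x) <= norm (ind (cball 0 R) x *R g x)"
 using R by (auto simp: indicator_def)
 qed measurable
 obtain phi where phi: "!!j::nat. test_fun (phi j)" "!!j x. \<bar>phi j x\<bar> <= ind (box a b) x"
 "!!x. (%j. phi j x) ----> ind (box a b) x" using box_approximation by blast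
 have [measurable]: "phi j : BM" for j using phi(1) by auto
 have "(%j. LI x. phi j x *R g x) ----> (LI x. ind (box a b) x *R g x)"
 proof (rule integral_dominated_convergence[where w="%x. norm (ind (box a b) x *R g x)"])
 show "AEL x. (%j. phi j x *R g x) ----> ind (box a b) x *R g x"
 by (intro AE_I2 tendsto_intros phi)
 show "AEL x. norm (phi j x *R g x) <= norm (ind (box a b) x *R g x)" for j
 using mult_right_mono[OF phi(2)[of j] norm_ge_zero] by (intro AE_I2) simp
 show "intb (%x. norm (ind (box a b) x *R g x))" by (rule integrable_norm[OF i])
 qed (auto intro!: borel_measurable_scaleR borel_measurable_indicator)
 then show "(LI x. ind (box a b) x *R g x) = 0"
 by (simp add: zero[OF phi(1)] LIMSEQ_const_iff)
 qed
 let ?B = "%n::nat. box (- (real n *R One)) (real n *R One) :: (real^'n) set"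
 have "AEL x. ind (?B n) x *R g x = 0" for n
 proof (rule sigma_finite_measure.density_zero[OF sigma_finite_lborel box_int])
 fix A :: "(real^'n) set" assume A: "A : sets lborel"
 have "(LINT x:(%x. x) -` A \<inter> space lborel|lborel. ind (?B n) x *R g x) = 0"
 proof (rule set_integral_vanishes_on_borel[where E="range (%(a, b). box a b)"])
 show "sets borel = sigma_sets UNIV (range (%(a, b). box a b :: (real^'n) set))"
 by (subst borel_eq_box) (simp add: sets_measure_of)
 show "Int_stable (range (%(a, b). box a b :: (real^'n) set))"
 unfolding Int_stable_def by (auto simp: box_Int_box)
 show "(LINT x:(%x. x) -` B \<inter> space lborel|lborel. ind (?B n) x *R g x) = 0"
 if "B : range (%(a, b). box a b :: (real^'n) set)" for B
 proof -
 obtain a b where "B = box a b" using \<open>B : range (%(a, b). box a b)\<close> by auto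
 then obtain c d where cd: "B \<inter> ?B n = box c d" by (auto simp: box_Int_box)
 have "(LINT x:(%x. x) -` B \<inter> space lborel|lborel. ind (?B n) x *R g x) = (LI x. ind (B \<inter> ?B n) x *R g x)"
 unfolding slint_def
 by (intro Bochner_Integration.integral_cong) (auto simp: indicator_def)
 then show ?thesis by (simp add: cd box0)
 qed
 qed (use box_int box0 A in auto)
 then show "(LINT x:A|lborel. ind (?B n) x *R g x) = 0" by simp
 qed
 then have "AEL x. \<forall>n. ind (?B n) x *R g x = 0" by (simp only: AE_all_countable) blast
 then show ?thesis
 proof eventually_elim
 case (elim x)
 obtain n where "x : ?B n" using UN_box_eq_UNIV[where 'a="real^'n"] by blast
 then show ?case using elim[rule_format, of n] by simp
 qed
qed

lemma has_weak_deriv_unique: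
 fixes u u' g g' :: "real^'n::finite => 'b::{banach,second_countable_topology}"
 assumes "has_weak_deriv is u g" "has_weak_deriv is u' g'" "AEL x. u x = u' x"
 shows "AEL x. g x = g' x"
proof -
 have l: "loc_integrable u" "loc_integrable u'" "loc_integrable g" "loc_integrable g'" using assms by (auto simp: has_weak_deriv_def)
 have [measurable]: "u : BM" "u' : BM" using l by (auto intro: loc_integrable_measurable)
 have "loc_integrable (%x. g x + (- 1) *R g' x)"
 by (intro loc_integrable_add loc_integrable_mult l continuous_intros)
 then have "AEL x. g x + (- 1) *R g' x = 0"
 proof (rule test_fun_separating)
 fix phi :: "real^'n => real" assume phi: "test_fun phi"
 have [measurable]: "iter_deriv is phi : BM" using test_fun_iter[OF phi] by auto
 have "(LI x. iter_deriv is phi x *R u x) = (LI x. iter_deriv is phi x *R u' x)"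
 by (rule integral_cong_AE) (use assms(3) in "auto elim: eventually_mono")
 then have "(- 1) ^ length is *R (LI x. phi x *R g x) = (- 1) ^ length is *R (LI x. phi x *R g' x)"
 using assms phi by (simp add: has_weak_deriv_def)
 then have "(LI x. phi x *R g x) = (LI x. phi x *R g' x)" by simp
 then show "(LI x. phi x *R (g x + (- 1) *R g' x)) = 0"
 using test_fun_integrable_scaleR[OF phi l(3)] test_fun_integrable_scaleR[OF phi l(4)]
 by (simp add: scaleR_diff_right)
 qed
 then show ?thesis by eventually_elim simp
qed

lemma has_weak_deriv_cong_AE:
 fixes u u' g g' :: "real^'n::finite => 'b::{banach,second_countable_topology}"
 assumes "has_weak_deriv is u g" "AEL x. u x = u' x" "AEL x. g x = g' x"
 and [measurable]: "u' : BM" "g' : BM"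
 shows "has_weak_deriv is u' g'"
proof -
 have l: "loc_integrable u" "loc_integrable g" using assms by (auto simp: has_weak_deriv_def)
 have [measurable]: "u : BM" "g : BM" using l by (auto intro: loc_integrable_measurable)
 have loc: "loc_integrable v'" if "loc_integrable v" "AEL x. v x = v' x"
 and [measurable]: "v' : BM" "v : BM" for v v' :: "real^'n => 'b"
 unfolding loc_integrable_def set_integrable_def
 proof
 fix R
 show "intb (%x. ind (cball 0 R) x *R v' x)"
 by (rule integrable_cong_AE[THEN iffD1, of "%x. ind (cball 0 R) x *R v x"])
 (use that in "auto simp: loc_integrable_def set_integrable_def elim: eventually_mono intro!: borel_measurable_scaleR borel_measurable_indicator")
 qed
 have int: "(LI x. phi x *R v x) = (LI x. phi x *R v' x)" if "AEL x. v x = v' x" "test_fun phi"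
 and [measurable]: "v' : BM" "v : BM" for phi and v v' :: "real^'n => 'b"
 proof -
 have [measurable]: "phi : BM" using that by auto
 show ?thesis by (rule integral_cong_AE) (use that(1) in "auto elim: eventually_mono")
 qed
 show ?thesis
 unfolding has_weak_deriv_def
 proof (intro conjI allI impI)
 show "loc_integrable u'" using loc[OF l(1) assms(2)] by simp
 show "loc_integrable g'" using loc[OF l(2) assms(3)] by simp
 fix phi :: "real^'n => real" assume phi: "test_fun phi"
 show "(LI x. iter_deriv is phi x *R u' x) = (- 1) ^ length is *R (LI x. phi x *R g' x)"
 using int[OF assms(2) test_fun_iter[OF phi, of "is"]] int[OF assms(3) phi] assms(1) phi by (simp add: has_weak_deriv_def)
 qed
qed

lemma has_weak_deriv_wderiv: "has_weak_deriv is u g ==> has_weak_deriv is u (wderiv is u)"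
 unfolding wderiv_def by (rule someI[where P="has_weak_deriv is u"])

lemma wderiv_AE: "has_weak_deriv is u g ==> AEL x. wderiv is u x = g x"
 by (rule has_weak_deriv_unique[OF has_weak_deriv_wderiv]) auto

lemma has_weak_deriv_measurable: "has_weak_deriv is u g ==> u : BM & g : BM"
 by (auto simp: has_weak_deriv_def intro: loc_integrable_measurable)

lemma wderiv_measurable: "has_weak_deriv is u g ==> wderiv is u : BM"
 using has_weak_deriv_measurable[OF has_weak_deriv_wderiv] by blast

lemma wderiv_L2: "has_weak_deriv is u g ==> g : L2 ==> wderiv is u : L2"
 by (rule L2_cong_AE[of g]) (auto elim: eventually_mono dest: wderiv_AE simp: wderiv_measurable)

lemma has_weak_deriv_add:
 fixes u v g h :: "real^'n::finite => 'b::{banach,second_countable_topology}"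
 assumes "has_weak_deriv is u g" "has_weak_deriv is v h"
 shows "has_weak_deriv is (%x. u x + v x) (%x. g x + h x)"
 unfolding has_weak_deriv_def
proof (intro conjI allI impI)
 have l: "loc_integrable u" "loc_integrable v" "loc_integrable g" "loc_integrable h" using assms by (auto simp: has_weak_deriv_def)
 show "loc_integrable (%x. u x + v x)" "loc_integrable (%x. g x + h x)" using l by (auto intro: loc_integrable_add)
 fix phi :: "real^'n => real" assume phi: "test_fun phi"
 show "(LI x. iter_deriv is phi x *R (u x + v x)) = (- 1) ^ length is *R (LI x. phi x *R (g x + h x))"
 proof -
 note ti = test_fun_integrable_scaleR[OF test_fun_iter[OF phi], of _ "is"] test_fun_integrable_scaleR[OF phi]
 have "(LI x. iter_deriv is phi x *R (u x + v x))
 = (LI x. iter_deriv is phi x *R u x) + (LI x. iter_deriv is phi x *R v x)"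
 unfolding scaleR_add_right by (rule Bochner_Integration.integral_add[OF ti(1)[OF l(1)] ti(1)[OF l(2)]])
 moreover have "(LI x. phi x *R (g x + h x)) = (LI x. phi x *R g x) + (LI x. phi x *R h x)"
 unfolding scaleR_add_right by (rule Bochner_Integration.integral_add[OF ti(2)[OF l(3)] ti(2)[OF l(4)]])
 ultimately show ?thesis using assms phi by (simp add: has_weak_deriv_def scaleR_add_right)
 qed
qed

lemma has_weak_deriv_bounded_linear:
 fixes u g :: "real^'n::finite => 'b::{banach,second_countable_topology}" and T :: "'b => 'c::{banach,second_countable_topology}"
 assumes T: "bounded_linear T" and u: "has_weak_deriv is u g"
 shows "has_weak_deriv is (%x. T (u x)) (%x. T (g x))"
 unfolding has_weak_deriv_def
proof (intro conjI allI impI)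
 interpret bounded_linear T by fact
 have l: "loc_integrable u" "loc_integrable g" using u by (auto simp: has_weak_deriv_def)
 show "loc_integrable (%x. T (u x))" "loc_integrable (%x. T (g x))" using l by (auto intro: loc_integrable_bounded_linear[OF T])
 fix phi :: "real^'n => real" assume phi: "test_fun phi"
 have "(LI x. iter_deriv is phi x *R T (u x)) = T (LI x. iter_deriv is phi x *R u x)"
 using integral_bounded_linear[OF T test_fun_integrable_scaleR[OF test_fun_iter[OF phi] l(1)]] by (simp add: scaleR)
 also have "... = T ((- 1) ^ length is *R (LI x. phi x *R g x))"
 using u phi by (simp add: has_weak_deriv_def)
 also have "... = (- 1) ^ length is *R (LI x. phi x *R T (g x))"
 using integral_bounded_linear[OF T test_fun_integrable_scaleR[OF phi l(2)]] by (simp add: scaleR)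
 finally show "(LI x. iter_deriv is phi x *R T (u x)) = (- 1) ^ length is *R (LI x. phi x *R T (g x))" .
qed

lemma has_weak_deriv_smooth_mult:
 fixes u g :: "real^'n::finite => 'b::{banach,second_countable_topology}"
 assumes u: "has_weak_deriv [i] u g" and c: "smooth_alg c"
 shows "has_weak_deriv [i] (%x. c x *R u x) (%x. c x *R g x + part_deriv i c x *R u x)"
 unfolding has_weak_deriv_def
proof (intro conjI allI impI)
 have l: "loc_integrable u" "loc_integrable g" using u by (auto simp: has_weak_deriv_def)
 have l': "loc_integrable (%x. c x *R u x)" "loc_integrable (%x. c x *R g x)" "loc_integrable (%x. part_deriv i c x *R u x)"
 using l c smooth_alg_part[OF c] by (auto intro: loc_integrable_mult smooth_alg_continuous)
 show "loc_integrable (%x. c x *R u x)" "loc_integrable (%x. c x *R g x + part_deriv i c x *R u x)"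
 using l' by (auto intro: loc_integrable_add)
 fix phi :: "real^'n => real" assume phi: "test_fun phi"
 have pd: "part_deriv i (%x. phi x * c x) x = part_deriv i phi x * c x + phi x * part_deriv i c x" for x
 using phi c by (intro part_deriv_mult smooth_alg_differentiable) (auto simp: test_fun_iff)
 have "(LI x. part_deriv i (%x. phi x * c x) x *R u x) = - (LI x. (phi x * c x) *R g x)"
 using u test_fun_mult[OF phi c] by (simp add: has_weak_deriv_def)
 then have "(LI x. part_deriv i phi x *R c x *R u x) + (LI x. phi x *R part_deriv i c x *R u x)
 = - (LI x. phi x *R c x *R g x)"
 using test_fun_integrable_scaleR[OF test_fun_part[OF phi] l'(1)] test_fun_integrable_scaleR[OF phi l'(3)]
 by (simp add: pd scaleR_add_left)
 then have A: "(LI x. part_deriv i phi x *R c x *R u x)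
 = - (LI x. phi x *R c x *R g x) - (LI x. phi x *R part_deriv i c x *R u x)"
 by (simp only: eq_diff_eq)
 have B: "(LI x. phi x *R (c x *R g x + part_deriv i c x *R u x))
 = (LI x. phi x *R c x *R g x) + (LI x. phi x *R part_deriv i c x *R u x)"
 unfolding scaleR_add_right
 by (rule Bochner_Integration.integral_add[OF test_fun_integrable_scaleR[OF phi l'(2)] test_fun_integrable_scaleR[OF phi l'(3)]])
 show "(LI x. iter_deriv [i] phi x *R c x *R u x)
 = (- 1) ^ length [i] *R (LI x. phi x *R (c x *R g x + part_deriv i c x *R u x))"
 unfolding B iter_deriv.simps A by simp
qed

lemma has_weak_deriv_snoc:
 fixes u g h :: "real^'n::finite => 'b::{banach,second_countable_topology}"
 assumes "has_weak_deriv is u g" "has_weak_deriv (is @ [i]) u h"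
 shows "has_weak_deriv [i] g h"
 unfolding has_weak_deriv_def
proof (intro conjI allI impI)
 fix phi :: "real^'n => real" assume phi: "test_fun phi"
 have "(- 1) ^ length is *R (LI x. part_deriv i phi x *R g x) = (LI x. iter_deriv is (part_deriv i phi) x *R u x)"
 using assms(1) test_fun_part[OF phi] by (simp add: has_weak_deriv_def)
 also have "... = (LI x. iter_deriv (is @ [i]) phi x *R u x)" by (simp add: iter_deriv_snoc)
 also have "... = (- 1) ^ length (is @ [i]) *R (LI x. phi x *R h x)"
 using assms(2) phi by (simp add: has_weak_deriv_def)
 finally have "(- 1) ^ length is *R (LI x. part_deriv i phi x *R g x) = (- 1) ^ length is *R (- (LI x. phi x *R h x))" by simp
 then have "(LI x. part_deriv i phi x *R g x) = - (LI x. phi x *R h x)"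
 by (subst (asm) scaleR_cancel_left) simp
 then show "(LI x. iter_deriv [i] phi x *R g x) = (- 1) ^ length [i] *R (LI x. phi x *R h x)" by simp
qed (use assms in "auto simp: has_weak_deriv_def")

lemma has_weak_deriv_Cons:
 fixes u g h :: "real^'n::finite => 'b::{banach,second_countable_topology}"
 assumes "has_weak_deriv [i] u g" "has_weak_deriv is g h"
 shows "has_weak_deriv (i # is) u h"
 unfolding has_weak_deriv_def
proof (intro conjI allI impI)
 fix phi :: "real^'n => real" assume phi: "test_fun phi"
 have "(LI x. iter_deriv [i] (iter_deriv is phi) x *R u x) = (- 1) ^ length [i] *R (LI x. iter_deriv is phi x *R g x)"
 using assms(1) test_fun_iter[OF phi] unfolding has_weak_deriv_def by blast
 moreover have "(LI x. iter_deriv is phi x *R g x) = (- 1) ^ length is *R (LI x. phi x *R h x)"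
 using assms(2) phi unfolding has_weak_deriv_def by blast
 ultimately show "(LI x. iter_deriv (i # is) phi x *R u x) = (- 1) ^ length (i # is) *R (LI x. phi x *R h x)"
 by simp
qed (use assms in "auto simp: has_weak_deriv_def")

lemma has_weak_deriv_Nil: "loc_integrable u ==> has_weak_deriv [] u u"
 by (simp add: has_weak_deriv_def)

lemma has_weak_deriv_zero: "has_weak_deriv is (%x. 0) (%x. 0)"
 by (simp add: has_weak_deriv_def loc_integrable_def set_integrable_def)

lemma has_weak_deriv_one: "has_weak_deriv [i] (%x::real^'n::finite. 1::complex) (%x. 0)"
 unfolding has_weak_deriv_def
proof (intro conjI allI impI)
 show "loc_integrable (%x::real^'n. 1::complex)"
 unfolding loc_integrable_def set_integrable_def
 proof
 fix R
 have "(%x::real^'n. ind (cball 0 R) x *R (1::complex)) : L2"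
 by (rule L2_indicator_bounded[where R=R]) auto
 from L2_integrable_mult[OF this this]
 have "intb (%x::real^'n. (ind (cball 0 R) x *R (1::complex)) * (ind (cball 0 R) x *R 1))" .
 moreover have "(%x::real^'n. (ind (cball 0 R) x *R (1::complex)) * (ind (cball 0 R) x *R 1)) = (%x. ind (cball 0 R) x *R 1)"
 by (auto simp: indicator_def fun_eq_iff)
 ultimately show "intb (%x::real^'n. ind (cball 0 R) x *R (1::complex))" by simp
 qed
 show "loc_integrable (%x::real^'n. 0::complex)" by (simp add: loc_integrable_def set_integrable_def)
 fix phi :: "real^'n => real" assume phi: "test_fun phi"
 have "(LI x. part_deriv i phi x *R (1::complex)) = (LI x. part_deriv i phi x) *R 1"
 by (rule integral_scaleR_left) (use test_fun_integrable[OF test_fun_part[OF phi]] in auto)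
 then show "(LI x. iter_deriv [i] phi x *R (1::complex)) = (- 1) ^ length [i] *R (LI x. phi x *R 0)"
 by (simp add: integral_part_deriv_test[OF phi])
qed

definition Dmult :: "'n::finite => real^'n => complex" where
 "Dmult i eta = 2 * cor pi * \<i> * cor (eta $ i)"

lemma cnj_Dmult: "cnj (Dmult i eta) = - Dmult i eta"
 by (simp add: Dmult_def)

lemma Dmult_uminus: "Dmult i (- eta) = - Dmult i eta"
 by (simp add: Dmult_def)

lemma Dmult_measurable [measurable]: "Dmult i : BM"
 unfolding Dmult_def[abs_def] by (intro borel_measurable_continuous_onI continuous_intros)

lemma norm_Dmult_le: "norm (Dmult i eta) <= 2 * pi * norm eta"
 using component_le_norm_cart[of eta i] by (simp add: Dmult_def norm_mult)

lemma has_weak_deriv_plane_wave_mult: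
 fixes u :: "real^'n::finite => complex"
 assumes u: "has_weak_deriv [i] u g"
 shows "has_weak_deriv [i] (%x. u x * pw th x) (%x. (g x + Dmult i th * u x) * pw th x)"
proof -
 let ?v = "(2 * pi) *R th"
 let ?c = "%x. cos (?v \<bullet> x + 0)" and ?s = "%x. cos (?v \<bullet> x + (- pi / 2))"
 have D: "part_deriv i (%x. cos (?v \<bullet> x + d)) x = - sin (?v \<bullet> x + d) * (?v \<bullet> axis i 1)" for d x
 by (rule part_deriv_eq) (auto intro!: derivative_eq_intros)
 have T: "bounded_linear (%z::complex. \<i> * z)" by (rule bounded_linear_mult_right)
 have "has_weak_deriv [i] (%x. ?c x *R u x + \<i> * (?s x *R u x))
 (%x. (?c x *R g x + part_deriv i ?c x *R u x) + \<i> * (?s x *R g x + part_deriv i ?s x *R u x))"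
 by (intro has_weak_deriv_add has_weak_deriv_bounded_linear[OF T] has_weak_deriv_smooth_mult u smooth_alg.cosine)
 moreover have "?c x *R u x + \<i> * (?s x *R u x) = u x * pw th x" for x
 by (simp add: plane_wave_def cos_diff cis.ctr complex_eq_iff algebra_simps)
 moreover have "(?c x *R g x + part_deriv i ?c x *R u x) + \<i> * (?s x *R g x + part_deriv i ?s x *R u x)
 = (g x + Dmult i th * u x) * pw th x" for x
 unfolding D by (simp add: plane_wave_def cos_diff sin_diff cis.ctr complex_eq_iff algebra_simps Dmult_def inner_axis)
 ultimately show ?thesis by simp
qed

lemma integral_scale:
 fixes f :: "real^'n::finite => 'b::{banach,second_countable_topology}"
 assumes c: "0 < c" and [measurable]: "f : BM"
 shows "(LI x. f x) = c ^ CARD('n) *R (LI x. f (c *R x))"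
proof -
 have "(LI x. f x) = (LINT x|density (distr lborel borel (%x. 0 + c *R x)) (%_. \<bar>c\<bar> ^ DIM(real^'n)). f x)"
 using lborel_affine[of c "0 :: real^'n"] c by simp
 also have "... = (LINT x|distr lborel borel (%x. 0 + c *R x). (c ^ CARD('n)) *R f x)"
 using c by (subst integral_density) auto
 also have "... = (LI x. (c ^ CARD('n)) *R f (0 + c *R x))"
 by (rule integral_distr) auto
 finally show ?thesis by simp
qed

lemma nn_integral_scale:
 fixes f :: "real^'n::finite => ennreal"
 assumes c: "0 < c" and [measurable]: "f : BM"
 shows "(NI x. f x) = ennreal (c ^ CARD('n)) * (NI x. f (c *R x))"
proof -
 have "(NI x. f x) = (\<integral>\<^sup>+x. f x \<partial>density (distr lborel borel (%x. 0 + c *R x)) (%_. ennreal (\<bar>c\<bar> ^ DIM(real^'n))))"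
 using lborel_affine[of c "0 :: real^'n"] c by simp
 also have "... = (\<integral>\<^sup>+x. ennreal (c ^ CARD('n)) * f x \<partial>distr lborel borel (%x. 0 + c *R x))"
 using c by (subst nn_integral_density) auto
 also have "... = (NI x. ennreal (c ^ CARD('n)) * f (0 + c *R x))"
 by (rule nn_integral_distr) auto
 finally show ?thesis by (simp add: nn_integral_cmult)
qed

lemma integrable_scale:
 fixes f :: "real^'n::finite => 'b::{banach,second_countable_topology}"
 assumes c: "0 < c" and f: "intb f"
 shows "intb (%x. f (c *R x))"
proof -
 have [measurable]: "f : BM" using f by auto
 have "(NI x. ennreal (norm (f x))) = ennreal (c ^ CARD('n)) * (NI x. ennreal (norm (f (c *R x))))"
 by (rule nn_integral_scale[OF c]) auto
 then have "ennreal (c ^ CARD('n)) * (NI x. ennreal (norm (f (c *R x)))) < \<infinity>"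
 using f by (simp add: integrable_iff_bounded)
 then have "(NI x. ennreal (norm (f (c *R x)))) < \<infinity>"
 using c by (auto simp: ennreal_mult_less_top)
 then show ?thesis by (simp add: integrable_iff_bounded)
qed

lemma AE_scale:
 fixes P :: "real^'n::finite => bool"
 assumes c: "0 < c" and P: "AEL x. P x"
 shows "AEL x. P (c *R x)"
proof -
 obtain N where N: "N : null_sets lborel" "{x. \<not> P x} \<subseteq> N" using P by (auto elim!: AE_E simp: null_sets_def)
 have [measurable]: "N : sets borel" using N by auto
 have "0 = ennreal (c ^ CARD('n)) * (NI x. ind N (c *R x))"
 using nn_integral_scale[OF c, of "ind N"] N by (simp add: null_sets_def)
 then have "(NI x. ind N (c *R x)) = 0" using c by (auto simp: zero_less_power)
 then have "AEL x. ind N (c *R x) = (0::ennreal)"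
 by (subst (asm) nn_integral_0_iff_AE) measurable
 then show ?thesis
 proof eventually_elim
 case (elim x)
 then show ?case using N(2) by (auto simp: indicator_def split: if_splits)
 qed
qed

lemma loc_integrable_affine:
 fixes u :: "real^'n::finite => 'b::{banach,second_countable_topology}"
 assumes u: "loc_integrable u" and c: "0 < c"
 shows "loc_integrable (%x. u (c *R x + a))"
 unfolding loc_integrable_def set_integrable_def
proof
 fix R
 have [measurable]: "u : BM" using u by (rule loc_integrable_measurable)
 let ?g = "%x. ind (cball 0 (c * R + norm a)) x *R u x"
 have "intb ?g" using u unfolding loc_integrable_def set_integrable_def by blast
 from integrable_scale[OF c integrable_translate[OF this, of a]]
 have "intb (%x. ?g (c *R x + a))" .
 then show "intb (%x. ind (cball 0 R) x *R u (c *R x + a))"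
 proof (rule Bochner_Integration.integrable_bound)
 show "AEL x. norm (ind (cball 0 R) x *R u (c *R x + a)) <= norm (?g (c *R x + a))"
 proof (rule AE_I2)
 fix x
 have "norm (c *R x + a) <= c * R + norm a" if "norm x <= R"
 proof -
 have "c * norm x <= c * R" using that c by (intro mult_left_mono) auto
 moreover have "norm (c *R x) = c * norm x" using c by simp
 ultimately show ?thesis using norm_triangle_ineq[of "c *R x" a] by linarith
 qed
 then show "norm (ind (cball 0 R) x *R u (c *R x + a)) <= norm (?g (c *R x + a))"
 by (cases "norm x <= R") auto
 qed
 next
 have "(%x. u (c *R x + a)) : BM" by measurable
 then show "(%x. ind (cball 0 R) x *R u (c *R x + a)) : borel_measurable lborel"
 unfolding measurable_lborel1 by (intro borel_measurable_scaleR borel_measurable_indicator) (simp_all)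
 qed
qed

lemma has_weak_deriv_affine:
 fixes u :: "real^'n::finite => 'b::{banach,second_countable_topology}"
 assumes u: "has_weak_deriv [i] u g" and c: "0 < c"
 shows "has_weak_deriv [i] (%x. u (c *R x + a)) (%x. c *R g (c *R x + a))"
 unfolding has_weak_deriv_def
proof (intro conjI allI impI)
 have l: "loc_integrable u" "loc_integrable g" using u by (auto simp: has_weak_deriv_def)
 have [measurable]: "u : BM" "g : BM" using l by (auto intro: loc_integrable_measurable)
 show "loc_integrable (%x. u (c *R x + a))" by (rule loc_integrable_affine[OF l(1) c])
 show "loc_integrable (%x. c *R g (c *R x + a))"
 by (intro loc_integrable_mult loc_integrable_affine[OF l(2) c] continuous_intros)
 fix phi :: "real^'n => real" assume phi: "test_fun phi"
 define psi where "psi x = phi ((1 / c) *R x + (- (1 / c) *R a))" for x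
 have psi: "test_fun psi" unfolding psi_def using c by (intro test_fun_affine[OF phi]) auto
 have [measurable]: "phi : BM" "psi : BM"
 "part_deriv i phi : BM" "part_deriv i psi : BM"
 using test_fun_measurable phi psi test_fun_part by blast+
 have v: "psi (c *R x + a) = phi x" for x using c by (simp add: psi_def algebra_simps)
 have d: "part_deriv i psi (c *R x + a) = (1 / c) * part_deriv i phi x" for x
 unfolding psi_def smooth_alg_affine(2)[OF test_fun_smooth[OF phi]] using c by (simp add: algebra_simps)
 have sub: "(LI x. h x) = c ^ CARD('n) *R (LI x. h (c *R x + a))"
 if [measurable]: "h : BM" for h :: "real^'n => 'b"
 using integral_translate[of h a] integral_scale[OF c, of "%x. h (x + a)"] by simp
 have "(LI x. part_deriv i psi x *R u x) = - (LI x. psi x *R g x)"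
 using u psi by (simp add: has_weak_deriv_def)
 then have "c ^ CARD('n) *R (LI x. part_deriv i psi (c *R x + a) *R u (c *R x + a))
 = - (c ^ CARD('n) *R (LI x. psi (c *R x + a) *R g (c *R x + a)))"
 using sub[of "%x. part_deriv i psi x *R u x"] sub[of "%x. psi x *R g x"] by simp
 then have "c ^ CARD('n) *R (LI x. part_deriv i psi (c *R x + a) *R u (c *R x + a))
 = c ^ CARD('n) *R (- (LI x. psi (c *R x + a) *R g (c *R x + a)))" by simp
 then have "(LI x. part_deriv i psi (c *R x + a) *R u (c *R x + a)) = - (LI x. psi (c *R x + a) *R g (c *R x + a))"
 using c by (subst (asm) scaleR_cancel_left) simp
 then have e: "(1 / c) *R (LI x. part_deriv i phi x *R u (c *R x + a)) = - (LI x. phi x *R g (c *R x + a))"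
 by (simp only: d v scaleR_scaleR[symmetric] integral_scaleR_right)
 have "A = - (c *R B)" if "(1 / c) *R A = - B" for A B :: 'b
 proof -
 have "A = c *R (1 / c) *R A" using c by simp
 then show ?thesis unfolding that by simp
 qed
 from this[OF e] have "(LI x. part_deriv i phi x *R u (c *R x + a)) = - (c *R (LI x. phi x *R g (c *R x + a)))" .
 then show "(LI x. iter_deriv [i] phi x *R u (c *R x + a)) = (- 1) ^ length [i] *R (LI x. phi x *R c *R g (c *R x + a))"
 by (simp add: mult.commute[of c] flip: integral_scaleR_right)
qed

section \<open>The Fourier transform of weak derivatives\<close>

lemma good_mult_local:
 assumes b: "good S b" and g: "g : BM" and bd: "!!R. \<exists>c. \<forall>eta. norm eta <= R --> norm (g eta) <= c"
 shows "good S (%eta. g eta * b eta)"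
proof -
 obtain R where R: "!!eta. R < norm eta ==> b eta = 0" using b by (auto simp: good_def bdd_supp_def)
 obtain c where c: "!!eta. norm eta <= R ==> norm (g eta) <= c" using bd by blast
 have "good S (%eta. (ind (cball 0 R) eta *R g eta) * b eta)"
 proof (rule good_mult[OF b, where c="max c 0"])
 show "(%eta. ind (cball 0 R) eta *R g eta) : BM"
 using g by (intro borel_measurable_scaleR borel_measurable_indicator) auto
 show "norm (ind (cball 0 R) eta *R g eta) <= max c 0" for eta
 using c[of eta] by (cases "norm eta <= R") auto
 qed
 moreover have "(%eta. (ind (cball 0 R) eta *R g eta) * b eta) = (%eta. g eta * b eta)"
 proof
 fix eta
 show "(ind (cball 0 R) eta *R g eta) * b eta = g eta * b eta" using R[of eta] by (cases "norm eta <= R") auto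
 qed
 ultimately show ?thesis by simp
qed

lemma good_Dmult: "good S b ==> good S (%eta. Dmult i eta * b eta)"
proof (rule good_mult_local)
 fix R
 have "norm (Dmult i eta) <= 2 * pi * R" if "norm eta <= R" for eta :: "real^'a"
 using norm_Dmult_le[of i eta] that by (meson mult_left_mono order_trans pi_ge_zero zero_le_numeral mult_nonneg_nonneg)
 then show "\<exists>c. \<forall>eta. norm eta <= R --> norm (Dmult i eta) <= c" by blast
qed auto

definition Dlist :: "'n::finite list => real^'n => complex" where
 "Dlist is eta = prod_list (map (%i. Dmult i eta) is)"

lemma good_Dlist: "good S b ==> good S (%eta. Dlist is eta * b eta)"
 by (induction "is") (auto simp: Dlist_def mult.assoc dest: good_Dmult)

lemma Dlist_eq: "Dlist is eta = (2 * cor pi * \<i>) ^ length is * cor (prod_list (map (%i. eta $ i) is))"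
 by (induction "is") (auto simp: Dlist_def Dmult_def)

lemma weak_deriv_fourier_kernel:
 fixes y g :: "real^'n::finite => complex"
 assumes y: "has_weak_deriv [i] y g" and phi: "test_fun phi"
 shows "(LI x. part_deriv i phi x *R (y x * cnj (pw eta x)))
 = Dmult i eta * (LI x. phi x *R (y x * cnj (pw eta x))) - (LI x. phi x *R (g x * cnj (pw eta x)))"
proof -
 have h: "has_weak_deriv [i] (%x. y x * cnj (pw eta x)) (%x. (g x - Dmult i eta * y x) * cnj (pw eta x))"
 using has_weak_deriv_plane_wave_mult[OF y, of "- eta"] by (simp add: cnj_plane_wave Dmult_uminus)
 have c: "has_weak_deriv [i] (%x. y x * cnj (pw eta x)) (%x. (g x - Dmult i eta * y x) * cnj (pw eta x))
 ==> loc_integrable (%x. y x * cnj (pw eta x))" by (simp add: has_weak_deriv_def)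
 have i1: "intb (%x. phi x *R (y x * cnj (pw eta x)))"
 by (rule test_fun_integrable_scaleR[OF phi c[OF h]])
 have i2: "intb (%x. phi x *R ((g x - Dmult i eta * y x) * cnj (pw eta x)))"
 using h by (intro test_fun_integrable_scaleR[OF phi]) (simp add: has_weak_deriv_def)
 have "(LI x. part_deriv i phi x *R (y x * cnj (pw eta x)))
 = - (LI x. phi x *R ((g x - Dmult i eta * y x) * cnj (pw eta x)))"
 using h phi by (simp add: has_weak_deriv_def)
 also have "(LI x. phi x *R (g x * cnj (pw eta x)))
 = (LI x. phi x *R ((g x - Dmult i eta * y x) * cnj (pw eta x)) + Dmult i eta * (phi x *R (y x * cnj (pw eta x))))"
 by (intro Bochner_Integration.integral_cong refl) (simp add: algebra_simps scaleR_conv_of_real)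
 then have "(LI x. phi x *R ((g x - Dmult i eta * y x) * cnj (pw eta x)))
 = (LI x. phi x *R (g x * cnj (pw eta x))) - Dmult i eta * (LI x. phi x *R (y x * cnj (pw eta x)))"
 unfolding Bochner_Integration.integral_add[OF i2 integrable_mult_right[OF i1]] integral_mult_right_zero by simp
 finally show ?thesis by simp
qed

lemma cutoff_tendsto:
 fixes u :: "real^'n::finite => 'b::{banach,second_countable_topology}"
 assumes u: "u : L2" and zt: "!!r. test_fun (zt r)" "!!r x. \<bar>zt r x\<bar> <= C" "!!x. (%r. zt r x) ----> 1"
 shows "(%r::nat. L2norm (%x. zt r x *R u x - u x)) ----> 0" "(%x. zt r x *R u x) : L2"
proof -
 have [measurable]: "u : BM" "zt r : BM" for r using u zt(1) by auto
 show "(%x. zt r x *R u x) : L2" for r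
 by (rule L2_bound[OF u, where c=C]) (use mult_right_mono[OF zt(2) norm_ge_zero] in auto)
 have "(%r. LI x. (norm (zt r x *R u x - u x))^2) ----> (LINT x|(lborel :: (real^'n) measure). (0::real))"
 proof (rule integral_dominated_convergence[where w="%x. (C + 1)^2 * (norm (u x))^2"])
 show "AEL x. (%r. (norm (zt r x *R u x - u x))^2) ----> 0"
 proof (rule AE_I2)
 fix x
 have "(%r. (norm (zt r x *R u x - u x))^2) ----> (norm (1 *R u x - u x))^2" by (intro tendsto_intros zt)
 then show "(%r. (norm (zt r x *R u x - u x))^2) ----> 0" by simp
 qed
 show "AEL x. norm ((norm (zt r x *R u x - u x))^2) <= (C + 1)^2 * (norm (u x))^2" for r
 proof (rule AE_I2)
 fix x
 have "norm (zt r x *R u x - u x) <= \<bar>zt r x\<bar> * norm (u x) + norm (u x)"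
 using norm_triangle_ineq4[of "zt r x *R u x" "u x"] by simp
 also have "... <= (C + 1) * norm (u x)" using mult_right_mono[OF zt(2)[of r x] norm_ge_zero[of "u x"]] by (simp add: algebra_simps)
 finally have "(norm (zt r x *R u x - u x))^2 <= ((C + 1) * norm (u x))^2" by (intro power_mono) auto
 then show "norm ((norm (zt r x *R u x - u x))^2) <= (C + 1)^2 * (norm (u x))^2" by (simp add: power_mult_distrib)
 qed
 show "intb (%x. (C + 1)^2 * (norm (u x))^2)" using u by (intro integrable_mult_right) (simp add: L2_iff)
 qed auto
 then have "(%r. sqrt (LI x. (norm (zt r x *R u x - u x))^2)) ----> sqrt 0" by (intro tendsto_real_sqrt) simp
 then show "(%r. L2norm (%x. zt r x *R u x - u x)) ----> 0" by (simp add: L2norm_def)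
qed

text \<open>
 A cutoff of \<open>y\<close> is integrated by parts against the plane waves; the term with the derivative of the
 cutoff disappears in the limit.
\<close>

lemma ip_weak_deriv_packet:
 fixes y g :: "real^'n::finite => complex"
 assumes y: "y : L2" "g : L2" "has_weak_deriv [i] y g" and b: "good UNIV b"
 shows "ip g (synth pw b) = - ip y (synth pw (%eta. Dmult i eta * b eta))"
proof -
 obtain zt :: "nat => real^'n => real" and C where zt: "!!r. test_fun (zt r)" "!!r x. \<bar>zt r x\<bar> <= C"
 "!!r i x. \<bar>part_deriv i (zt r) x\<bar> <= C / Suc r" "!!x. (%r. zt r x) ----> 1"
 using cutoff_exists by blast
 let ?b = "%eta. Dmult i eta * b eta"
 let ?W = "synth pw"
 have gb: "good UNIV ?b" by (rule good_Dmult[OF b])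
 have [measurable]: "y : BM" "g : BM" using y by auto
 have supp: "bdd_supp (%x. psi x *R u x)" if "test_fun psi" for psi and u :: "real^'n => complex"
 using that by (auto simp: test_fun_iff intro: bdd_supp_mono)
 have dL2: "(%x. part_deriv i (zt r) x *R y x) : L2" "L2norm (%x. part_deriv i (zt r) x *R y x) <= (C / Suc r) * L2norm y" for r
 proof -
 have [measurable]: "part_deriv i (zt r) : BM" using test_fun_part[OF zt(1)] by auto
 have le: "norm (part_deriv i (zt r) x *R y x) <= (C / Suc r) * norm (y x)" for x
 using mult_right_mono[OF zt(3)[of i r x] norm_ge_zero[of "y x"]] by simp
 show m: "(%x. part_deriv i (zt r) x *R y x) : L2"
 by (rule L2_bound[OF y(1), where c="C / Suc r"]) (use le in auto)
 have C0: "0 <= C / Suc r" using zt(3)[of i r 0] abs_ge_zero order_trans by blast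
 define c where "c = C / Suc r"
 have "L2norm (%x. part_deriv i (zt r) x *R y x) <= L2norm (%x. cor c * y x)"
 proof (rule L2norm_mono[OF _ m])
 show "AEL x. norm (part_deriv i (zt r) x *R y x) <= norm (cor c * y x)"
 using le C0 unfolding c_def[symmetric] by (intro AE_I2) (simp add: norm_mult)
 qed (use y in auto)
 also have "... = c * L2norm y" using C0 unfolding c_def[symmetric] by (simp add: L2norm_scale)
 finally show "L2norm (%x. part_deriv i (zt r) x *R y x) <= (C / Suc r) * L2norm y" unfolding c_def .
 qed
 have eq: "ip (%x. zt r x *R g x) (?W b) = - ip (%x. zt r x *R y x) (?W ?b) - ip (%x. part_deriv i (zt r) x *R y x) (?W b)" for r
 proof -
 note z = cutoff_tendsto(2)[OF y(1) zt(1,2,4)] cutoff_tendsto(2)[OF y(2) zt(1,2,4)]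
 have a: "fourier.analysis (%x. part_deriv i (zt r) x *R y x) eta
 = Dmult i eta * fourier.analysis (%x. zt r x *R y x) eta - fourier.analysis (%x. zt r x *R g x) eta" for eta
 using weak_deriv_fourier_kernel[OF y(3) zt(1), of r eta] by (simp add: fourier.analysis_def)
 have aL2: "fourier.analysis (%x. zt r x *R g x) : L2" "fourier.analysis (%x. zt r x *R y x) : L2"
 "fourier.analysis (%x. part_deriv i (zt r) x *R y x) : L2"
 using fourier.analysis_bound[OF z(2) supp[OF zt(1)]] fourier.analysis_bound[OF z(1) supp[OF zt(1)]]
 fourier.analysis_bound[OF dL2(1) supp[OF test_fun_part[OF zt(1)]]] by simp_all
 have "ip (fourier.analysis (%x. zt r x *R y x)) ?b = - (LI eta. (fourier.analysis (%x. part_deriv i (zt r) x *R y x) eta + fourier.analysis (%x. zt r x *R g x) eta) * cnj (b eta))"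
 unfolding ip_def integral_minus[symmetric]
 by (intro Bochner_Integration.integral_cong refl) (simp add: a cnj_Dmult algebra_simps)
 also have "... = - (ip (fourier.analysis (%x. part_deriv i (zt r) x *R y x)) b + ip (fourier.analysis (%x. zt r x *R g x)) b)"
 using ip_add_left[OF aL2(3,1) good_L2[OF b]] by (simp add: ip_def)
 finally have "ip (%x. zt r x *R y x) (?W ?b) = - (ip (%x. part_deriv i (zt r) x *R y x) (?W b) + ip (%x. zt r x *R g x) (?W b))"
 using fourier.ip_analysis[OF gb z(1)] fourier.ip_analysis[OF b z(2)] fourier.ip_analysis[OF b dL2(1)]
 supp[OF zt(1)] supp[OF test_fun_part[OF zt(1)]] by simp
 moreover have "c' = - a' - b'" if "a' = - (b' + c')" for a' b' c' :: complex using that by simp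
 ultimately show ?thesis by blast
 qed
 have l1: "(%r. ip (%x. zt r x *R g x) (?W b)) ----> ip g (?W b)"
 by (rule ip_tendsto_left) (use cutoff_tendsto[OF y(2) zt(1,2,4)] y b in auto)
 have l2: "(%r. ip (%x. zt r x *R y x) (?W ?b)) ----> ip y (?W ?b)"
 by (rule ip_tendsto_left) (use cutoff_tendsto[OF y(1) zt(1,2,4)] y gb in auto)
 have l3: "(%r. ip (%x. part_deriv i (zt r) x *R y x) (?W b)) ----> 0"
 proof (rule Lim_null_comparison)
 show "eventually (%r. norm (ip (%x. part_deriv i (zt r) x *R y x) (?W b)) <= (1 / Suc r) * (C * L2norm y * L2norm (?W b))) sequentially"
 proof (rule always_eventually, rule allI)
 fix r
 have "norm (ip (%x. part_deriv i (zt r) x *R y x) (?W b)) <= L2norm (%x. part_deriv i (zt r) x *R y x) * L2norm (?W b)"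
 by (rule norm_ip_le) (use dL2 b in auto)
 also have "... <= ((C / Suc r) * L2norm y) * L2norm (?W b)" by (intro mult_right_mono dL2) auto
 finally show "norm (ip (%x. part_deriv i (zt r) x *R y x) (?W b)) <= (1 / Suc r) * (C * L2norm y * L2norm (?W b))"
 by (simp add: field_simps)
 qed
 have "(%r. (1 / Suc r) * (C * L2norm y * L2norm (?W b))) ----> 0 * (C * L2norm y * L2norm (?W b))"
 by (intro tendsto_mult_right LIMSEQ_Suc[OF lim_1_over_n])
 then show "(%r. (1 / Suc r) * (C * L2norm y * L2norm (?W b))) ----> 0" by simp
 qed
 have "(%r. - ip (%x. zt r x *R y x) (?W ?b) - ip (%x. part_deriv i (zt r) x *R y x) (?W b)) ----> - ip y (?W ?b) - 0"
 by (intro tendsto_intros l2 l3)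
 with l1 show ?thesis unfolding eq using LIMSEQ_unique by fastforce
qed

lemma fourier_weak_deriv:
 fixes y g :: "real^'n::finite => complex"
 assumes y: "y : L2" "g : L2" "has_weak_deriv [i] y g"
 shows "AEL eta. fourier g eta = Dmult i eta * fourier y eta"
proof -
 define E where "E eta = fourier g eta - Dmult i eta * fourier y eta" for eta
 have F: "fourier g : L2" "fourier y : L2" using y by auto
 have [measurable]: "fourier g : BM" "fourier y : BM" using F by auto
 have "AEL eta. trunc (real n) E eta = 0" for n
 proof -
 have t: "good UNIV (trunc (real n) (fourier y))" "good UNIV (trunc (real n) (fourier g))"
 using F by (auto simp: good_def)
 have eq: "trunc (real n) E eta = trunc (real n) (fourier g) eta - Dmult i eta * trunc (real n) (fourier y) eta" for eta
 by (simp add: E_def trunc_def algebra_simps)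
 have g: "good UNIV (trunc (real n) E)"
 using good_diff[OF t(2) good_Dmult[OF t(1), of i]] by (simp add: eq[symmetric] flip: fun_eq_iff)
 have gD: "good UNIV (%eta. Dmult i eta * trunc (real n) E eta)" by (rule good_Dmult[OF g])
 have "ip (trunc (real n) E) (trunc (real n) E) = (LI eta. fourier g eta * cnj (trunc (real n) E eta) + fourier y eta * cnj (Dmult i eta * trunc (real n) E eta))"
 unfolding ip_def by (intro Bochner_Integration.integral_cong refl) (auto simp: trunc_def E_def indicator_def cnj_Dmult algebra_simps)
 also have "... = ip (fourier g) (trunc (real n) E) + ip (fourier y) (%eta. Dmult i eta * trunc (real n) E eta)"
 unfolding ip_def using ip_integrable[OF F(1) good_L2[OF g]] ip_integrable[OF F(2) good_L2[OF gD]]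
 by (rule Bochner_Integration.integral_add)
 also have "... = 0"
 using fourier.ip_coef[OF y(2) g] fourier.ip_coef[OF y(1) gD] ip_weak_deriv_packet[OF y g] by (simp add: fourier_coef)
 finally have "L2norm (trunc (real n) E) = 0" by (simp add: ip_self)
 then show ?thesis using L2norm_eq_0_iff[OF good_L2[OF g]] by simp
 qed
 then have "AEL eta. \<forall>n. trunc (real n) E eta = 0" by (simp add: AE_all_countable)
 then show ?thesis
 proof eventually_elim
 case (elim eta)
 obtain n :: nat where "norm eta <= real n" using real_arch_simple by blast
 then have "E eta = 0" using elim[rule_format, of n] by (simp add: trunc_def)
 then show ?case by (simp add: E_def)
 qed
qed

lemma has_weak_deriv_cplx: "has_weak_deriv is u g ==> has_weak_deriv is (cplx u) (cplx g)"
 by (rule has_weak_deriv_bounded_linear[OF bounded_linear_of_real])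

lemma Hk_wderiv:
 assumes "u : Hk k" "length is <= k"
 shows "has_weak_deriv is u (wderiv is u)" "wderiv is u : L2"
 using assms unfolding Hk_def by (auto dest: has_weak_deriv_wderiv wderiv_L2)

lemma fourier_wderiv:
 assumes u: "u : Hk k"
 shows "length is <= k ==> AEL eta. fourier (cplx (wderiv is u)) eta = Dlist is eta * fourier (cplx u) eta"
proof (induction "is" rule: rev_induct)
 case Nil
 have uL2: "u : L2" using u by (simp add: Hk_def)
 have "AEL x. wderiv [] u x = u x"
 by (rule wderiv_AE[OF has_weak_deriv_Nil[OF L2_loc_integrable[OF uL2]]])
 then have "AEL x. cplx (wderiv [] u) x = cplx u x" by eventually_elim simp
 from fourier_cong_AE[OF _ _ this] show ?case using Hk_wderiv(2)[OF u, of "[]"] uL2 by (simp add: L2_cplx_iff Dlist_def)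
next
 case (snoc i "is")
 have "has_weak_deriv [i] (wderiv is u) (wderiv (is @ [i]) u)"
 using Hk_wderiv(1)[OF u, of "is"] Hk_wderiv(1)[OF u, of "is @ [i]"] snoc.prems by (intro has_weak_deriv_snoc) auto
 from fourier_weak_deriv[OF _ _ has_weak_deriv_cplx[OF this]]
 have "AEL eta. fourier (cplx (wderiv (is @ [i]) u)) eta = Dmult i eta * fourier (cplx (wderiv is u)) eta"
 using Hk_wderiv(2)[OF u, of "is"] Hk_wderiv(2)[OF u, of "is @ [i]"] snoc.prems by (simp add: L2_cplx_iff)
 moreover have "AEL eta. fourier (cplx (wderiv is u)) eta = Dlist is eta * fourier (cplx u) eta"
 using snoc by simp
 ultimately show ?case by eventually_elim (simp add: Dlist_def mult_ac)
qed

lemma synth_weak_deriv: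
 assumes b: "good UNIV b"
 shows "has_weak_deriv [i] (synth pw b) (synth pw (%eta. Dmult i eta * b eta))"
 unfolding has_weak_deriv_def
proof (intro conjI allI impI)
 let ?b = "%eta. Dmult i eta * b eta"
 have gb: "good UNIV ?b" by (rule good_Dmult[OF b])
 show "loc_integrable (synth pw b)" "loc_integrable (synth pw ?b)"
 using fourier.synth_in_L2 b gb by (auto intro: L2_loc_integrable)
 fix phi :: "real^'a => real" assume phi: "test_fun phi"
 have W: "(LI x. psi x *R synth pw c x) = cnj (ip (fourier.analysis (cplx psi)) c)" if "test_fun psi" "good UNIV c" for psi c
 proof -
 have "cplx psi : L2" "bdd_supp (cplx psi)"
 using that test_fun_L2 by (auto simp: L2_cplx_iff test_fun_iff intro: bdd_supp_mono)
 from fourier.ip_analysis[OF that(2) this] have "cnj (ip (fourier.analysis (cplx psi)) c) = ip (synth pw c) (cplx psi)" by (simp add: ip_cnj)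
 then show ?thesis by (simp add: ip_def scaleR_conv_of_real mult.commute)
 qed
 have a: "fourier.analysis (cplx (part_deriv i phi)) eta = Dmult i eta * fourier.analysis (cplx phi) eta" for eta
 using weak_deriv_fourier_kernel[OF has_weak_deriv_one phi, of i eta]
 by (simp add: fourier.analysis_def scaleR_conv_of_real)
 have "ip (fourier.analysis (cplx (part_deriv i phi))) b = - ip (fourier.analysis (cplx phi)) ?b"
 unfolding ip_def a integral_minus[symmetric] by (intro Bochner_Integration.integral_cong refl) (simp add: cnj_Dmult algebra_simps)
 then show "(LI x. iter_deriv [i] phi x *R synth pw b x) = (- 1) ^ length [i] *R (LI x. phi x *R synth pw ?b x)"
 using W[OF test_fun_part[OF phi, of i] b] W[OF phi gb] by simp
qed

lemma synth_iterated_weak_deriv: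
 "good UNIV b ==> has_weak_deriv is (synth pw b) (synth pw (%eta. Dlist is eta * b eta))"
proof (induction "is" arbitrary: b)
 case Nil
 then show ?case using has_weak_deriv_Nil[OF L2_loc_integrable[OF fourier.synth_in_L2]] by (simp add: Dlist_def)
next
 case (Cons i "is")
 have "has_weak_deriv is (synth pw (%eta. Dmult i eta * b eta)) (synth pw (%eta. Dlist is eta * (Dmult i eta * b eta)))"
 by (rule Cons.IH[OF good_Dmult[OF Cons.prems]])
 from has_weak_deriv_Cons[OF synth_weak_deriv[OF Cons.prems] this]
 show ?case by (simp add: Dlist_def mult_ac)
qed

text \<open>Real band-limited functions: the imaginary part of the derivative is a weak derivative of zero.\<close>

lemma bandlimited_wderiv:
 assumes b: "good UNIV b" and w: "w : L2" "AEL x. cplx w x = synth pw b x"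
 shows "has_weak_deriv is w (wderiv is w)" "wderiv is w : L2"
 "AEL x. cplx (wderiv is w) x = synth pw (%eta. Dlist is eta * b eta) x"
proof -
 let ?s = "synth pw (%eta. Dlist is eta * b eta)"
 have sL2: "?s : L2" by (rule fourier.synth_in_L2[OF good_Dlist[OF b]])
 have "cplx w : BM" using w(1) by auto
 then have h: "has_weak_deriv is (cplx w) ?s"
 using w(2) sL2 by (intro has_weak_deriv_cong_AE[OF synth_iterated_weak_deriv[OF b, of "is"]]) (auto elim: eventually_mono)
 have r: "has_weak_deriv is w (%x. Re (?s x))" using has_weak_deriv_bounded_linear[OF bounded_linear_Re h] by simp
 have i: "has_weak_deriv is (%x. 0) (%x. Im (?s x))" using has_weak_deriv_bounded_linear[OF bounded_linear_Im h] by simp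
 have "AEL x. Im (?s x) = 0" by (rule has_weak_deriv_unique[OF i has_weak_deriv_zero]) simp
 with wderiv_AE[OF r] show "AEL x. cplx (wderiv is w) x = ?s x" by eventually_elim (simp add: complex_eq_iff)
 show "has_weak_deriv is w (wderiv is w)" by (rule has_weak_deriv_wderiv[OF r])
 show "wderiv is w : L2" by (rule wderiv_L2[OF r]) (use sL2 in auto)
qed

section \<open>The effective problem in Fourier variables\<close>

lemma fourier_sum:
 fixes u :: "'i => real^'n::finite => complex"
 assumes "finite I" "!!i. i : I ==> u i : L2"
 shows "AEL eta. fourier (%x. \<Sum>i\<in>I. c i * u i x) eta = (\<Sum>i\<in>I. c i * fourier (u i) eta)"
 using assms
proof (induction I)
 case empty
 have "L2norm (fourier (%x::real^'n. 0)) = 0" by (subst L2norm_fourier) (auto simp: L2norm_def)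
 then have "AEL eta. fourier (%x::real^'n. 0) eta = 0" using L2norm_eq_0_iff[of "fourier (%x::real^'n. 0)"] fourier_L2[OF L2_zero] by simp
 then show ?case by simp
next
 case (insert j I)
 have s: "(%x. \<Sum>i\<in>I. c i * u i x) : L2" using insert by (intro L2_sum L2_mult_const) auto
 have "AEL eta. fourier (%x. (\<Sum>i\<in>I. c i * u i x) + c j * u j x) eta = fourier (%x. \<Sum>i\<in>I. c i * u i x) eta + c j * fourier (u j) eta"
 by (rule fourier_lin[OF s]) (use insert in auto)
 moreover have "AEL eta. fourier (%x. \<Sum>i\<in>I. c i * u i x) eta = (\<Sum>i\<in>I. c i * fourier (u i) eta)"
 using insert by auto
 ultimately show ?case by eventually_elim (use insert.hyps in "simp add: add.commute")
qed

lemma synth_sum: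
 assumes "finite I" "!!i. i : I ==> good UNIV (b i)"
 shows "AEL x. synth pw (%eta. \<Sum>i\<in>I. c i * b i eta) x = (\<Sum>i\<in>I. c i * synth pw (b i) x)"
proof -
 have "AEL x. \<forall>i\<in>I. intb (%eta. b i eta * pw eta x)"
 using assms by (intro AE_finite_allI fourier.packet_integrable) auto
 then show ?thesis
 proof eventually_elim
 case (elim x)
 have "synth pw (%eta. \<Sum>i\<in>I. c i * b i eta) x = (LI eta. (\<Sum>i\<in>I. c i * (b i eta * pw eta x)))"
 unfolding synth_def by (simp add: sum_distrib_right mult.assoc)
 also have "... = (\<Sum>i\<in>I. (LI eta. c i * (b i eta * pw eta x)))"
 by (rule Bochner_Integration.integral_sum) (use elim in auto)
 finally show ?case by (simp add: synth_def)
 qed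
qed

lemma good_mult_continuous:
 assumes "good S b" "continuous_on UNIV g" shows "good S (%eta. g eta * b eta)"
proof (rule good_mult_local[OF assms(1)])
 show "g : BM" by (rule borel_measurable_continuous_onI[OF assms(2)])
 fix R
 have "compact (g ` cball 0 R)" using assms(2) by (intro compact_continuous_image) (auto intro: continuous_on_subset)
 then obtain c where "!!eta. eta : cball 0 R ==> norm (g eta) <= c"
 using compact_imp_bounded[of "g ` cball 0 R"] unfolding bounded_iff by blast
 then show "\<exists>c. \<forall>eta. norm eta <= R --> norm (g eta) <= c" by auto
qed

lemma good_sum: "(!!i. i : I ==> good S (b i)) ==> good S (%eta. \<Sum>i\<in>I. b i eta)"
proof (induction I rule: infinite_finite_induct)
 case (insert i I) then show ?case by (simp add: good_add)
qed (auto simp: good_def bdd_supp_def)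

lemma good_mono: "good S b ==> S \<subseteq> S' ==> good S' b"
 by (auto simp: good_def)

lemma good_off: "good S b ==> eta \<notin> S ==> b eta = 0"
 by (simp add: good_def)

lemma finite_index_lists [simp]: "finite {is :: 'n::finite list. length is = m}"
 using finite_lists_length_eq[of "UNIV :: 'n set" m] by simp

lemma continuous_prod_list: "continuous_on A (%eta::real^'n::finite. prod_list (map (%i. eta $ i) is))"
 by (induction "is") (auto intro!: continuous_intros)

lemma continuous_tensor_form: "continuous_on A (tensor_form T k)"
 unfolding tensor_form_def by (intro continuous_intros continuous_prod_list)

lemma continuous_taylor_poly: "continuous_on A (taylor_poly T eps M)"
 unfolding taylor_poly_def by (intro continuous_intros continuous_tensor_form)

lemma taylor_poly_measurable [measurable]: "taylor_poly T eps M : BM"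
 by (rule borel_measurable_continuous_onI[OF continuous_taylor_poly])

lemma taylor_poly_symbol:
 "(\<Sum>k=1..M. cor (eps ^ (2 * k - 2) * (- 1) ^ k) * (\<Sum>is | length is = 2 * k. cor (T k is) * Dlist is eta))
 = cor (taylor_poly T eps M eta)"
proof -
 have "(\<Sum>is | length is = 2 * k. cor (T k is) * Dlist is eta) = cor ((- 1) ^ k * (2 * pi) ^ (2 * k) * tensor_form T k eta)" for k
 proof -
 have "(2 * cor pi * \<i>) ^ (2 * k) = cor ((- 1) ^ k * (2 * pi) ^ (2 * k))"
 proof -
 have "\<i> ^ (2 * k) = (- 1) ^ k" by (simp only: power_mult power2_i)
 then show ?thesis by (simp add: power_mult_distrib)
 qed
 then have "Dlist is eta = cor ((- 1) ^ k * (2 * pi) ^ (2 * k)) * cor (prod_list (map (%i. eta $ i) is))" if "length is = 2 * k" for "is"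
 using that by (simp add: Dlist_eq)
 then show ?thesis
 by (simp add: tensor_form_def sum_distrib_left mult_ac)
 qed
 then have "(\<Sum>k=1..M. cor (eps ^ (2 * k - 2) * (- 1) ^ k) * (\<Sum>is | length is = 2 * k. cor (T k is) * Dlist is eta))
 = (\<Sum>k=1..M. cor ((eps ^ (2 * k - 2) * (- 1) ^ k) * ((- 1) ^ k * (2 * pi) ^ (2 * k) * tensor_form T k eta)))"
 by (simp only: of_real_mult)
 also have "... = (\<Sum>k=1..M. cor (eps ^ (2 * k - 2) * (2 * pi) ^ (2 * k) * tensor_form T k eta))"
 proof (rule sum.cong[OF refl])
 fix k
 have "(- 1::real) ^ k * (- 1) ^ k = 1" by (simp flip: power_mult_distrib)
 moreover have "(e * s) * (s * c * t) = (s * s) * (e * c * t)" for e s c t :: real by (simp only: mult_ac)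
 ultimately have "(eps ^ (2 * k - 2) * (- 1) ^ k) * ((- 1) ^ k * (2 * pi) ^ (2 * k) * tensor_form T k eta)
 = eps ^ (2 * k - 2) * (2 * pi) ^ (2 * k) * tensor_form T k eta"
 by (metis mult_1)
 then show "cor ((eps ^ (2 * k - 2) * (- 1) ^ k) * ((- 1) ^ k * (2 * pi) ^ (2 * k) * tensor_form T k eta))
 = cor (eps ^ (2 * k - 2) * (2 * pi) ^ (2 * k) * tensor_form T k eta)" by simp
 qed
 finally show ?thesis by (simp add: taylor_poly_def)
qed

lemma tensor_form_scaleR: "tensor_form T k (t *R eta) = t ^ (2 * k) * tensor_form T k eta"
proof -
 have "prod_list (map (%i. (t *R eta) $ i) is) = t ^ length is * prod_list (map (%i. eta $ i) is)" for "is"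
 by (induction "is") auto
 then show ?thesis unfolding tensor_form_def sum_distrib_left
 by (intro sum.cong refl) (simp only: mem_Collect_eq mult.left_commute)
qed

text \<open>On every ray through the origin \<open>1 + P\<close> is a polynomial in one variable with value 1 at the origin,
 so it has finitely many zeros there; averaging over dilations shows that the zero set is null.\<close>

lemma taylor_poly_ray_finite: "finite {t. 1 + taylor_poly T eps M (t *R eta) = 0}"
proof -
 define p where "p = [:1:] + (\<Sum>k=1..M. monom (eps ^ (2 * k - 2) * (2 * pi) ^ (2 * k) * tensor_form T k eta) (2 * k))"
 have ev: "poly p t = 1 + taylor_poly T eps M (t *R eta)" for t
 by (simp add: p_def poly_sum poly_monom taylor_poly_def tensor_form_scaleR mult_ac)
 have "poly p 0 = 1" by (simp add: p_def poly_sum poly_monom) (intro sum.neutral, auto)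
 then have "p ~= 0" by auto
 then have "finite {t. poly p t = 0}" by (rule poly_roots_finite)
 then show ?thesis by (simp add: ev)
qed

lemma taylor_poly_zeros_null:
 fixes T :: "nat => 'n::finite list => real"
 shows "AEL eta. 1 + taylor_poly T eps M eta ~= 0"
proof -
 define Z where "Z = {eta :: real^'n. 1 + taylor_poly T eps M eta = 0}"
 have [measurable]: "Z : sets borel" unfolding Z_def by measurable
 have "(\<integral>\<^sup>+t. (NI eta. ind Z (t *R eta)) \<partial>(lborel :: real measure))
 = (\<integral>\<^sup>+eta. (NI t. ind Z (t *R eta)) \<partial>(lborel :: (real^'n) measure))"
 by (rule lborel_pair.Fubini') measurable
 also have "... = (\<integral>\<^sup>+eta. 0 \<partial>(lborel :: (real^'n) measure))"
 proof (rule nn_integral_cong)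
 fix eta :: "real^'n"
 have "(NI t. ind Z (t *R eta)) = (NI t. ind {t. 1 + taylor_poly T eps M (t *R eta) = 0} t)"
 by (intro nn_integral_cong) (simp add: Z_def indicator_def)
 also have "... = emeasure lborel {t. 1 + taylor_poly T eps M (t *R eta) = 0}"
 using taylor_poly_ray_finite[of T eps M eta] by (intro nn_integral_indicator) (auto intro: finite_imp_closed borel_closed)
 also have "... = 0" by (rule emeasure_lborel_countable) (rule countable_finite[OF taylor_poly_ray_finite])
 finally show "(NI t. ind Z (t *R eta)) = 0" .
 qed
 finally have "(\<integral>\<^sup>+t. (NI eta. ind Z (t *R eta)) \<partial>(lborel :: real measure)) = 0" by simp
 then have AEt: "AE t in (lborel :: real measure). (NI eta. ind Z (t *R eta)) = 0"
 by (subst (asm) nn_integral_0_iff_AE) measurable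
 have "\<exists>t>0. (NI eta. ind Z (t *R eta)) = 0"
 proof (rule ccontr)
 assume "\<not> ?thesis"
 then have "AE t in (lborel :: real measure). t \<notin> {0<..<1}" using AEt by (auto elim!: eventually_mono)
 then have "emeasure lborel {t::real. \<not> t \<notin> {0<..<1}} = 0" by (subst (asm) AE_iff_measurable[OF _ refl]) auto
 moreover have "{t::real. \<not> t \<notin> {0<..<1}} = {0<..<1}" by auto
 moreover have "emeasure lborel {0<..<1::real} = 1" using emeasure_lborel_Ioo[of 0 "1::real"] by simp
 ultimately show False by simp
 qed
 then obtain t where t: "0 < t" "(NI eta. ind Z (t *R eta)) = 0" by blast
 have "emeasure lborel Z = 0" using nn_integral_scale[OF t(1), of "ind Z"] t(2) by simp
 then have "AEL eta. eta \<notin> Z" by (subst AE_iff_measurable[OF _ refl]) auto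
 then show ?thesis by (simp add: Z_def)
qed

lemma solves_effective_fourier:
 assumes y: "solves_effective T eps M g y" and g: "g : L2"
 shows "y : L2" "AEL eta. cor (1 + taylor_poly T eps M eta) * fourier (cplx y) eta = fourier (cplx g) eta"
proof -
 have yH: "y : Hk (2 * M)" using y by (simp add: solves_effective_def)
 then show yL2: "y : L2" by (simp add: Hk_def)
 have wL2: "cplx (wderiv is y) : L2" if "length is <= 2 * M" for "is" using Hk_wderiv(2)[OF yH that] by (simp add: L2_cplx_iff)
 define v where "v k x = (\<Sum>is | length is = 2 * k. cor (T k is) * cplx (wderiv is y) x)" for k x
 have vL2: "v k : L2" if "k : {1..M}" for k
 unfolding v_def[abs_def] using that by (intro L2_sum L2_mult_const wL2) auto
 have vF: "AEL eta. fourier (v k) eta = (\<Sum>is | length is = 2 * k. cor (T k is) * Dlist is eta) * fourier (cplx y) eta"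
 if k: "k : {1..M}" for k
 proof -
 have 1: "AEL eta. fourier (v k) eta = (\<Sum>is | length is = 2 * k. cor (T k is) * fourier (cplx (wderiv is y)) eta)"
 unfolding v_def[abs_def] using k by (intro fourier_sum wL2) auto
 have 2: "AEL eta. \<forall>is\<in>{is. length is = 2 * k}. fourier (cplx (wderiv is y)) eta = Dlist is eta * fourier (cplx y) eta"
 using k by (intro AE_finite_allI fourier_wderiv[OF yH]) auto
 from 1 2 show ?thesis by eventually_elim (simp add: sum_distrib_right mult.assoc)
 qed
 define c where "c k = cor (eps ^ (2 * k - 2) * (- 1) ^ k)" for k :: nat
 let ?s = "%x. \<Sum>k=1..M. c k * v k x"
 have sL2: "?s : L2" by (intro L2_sum L2_mult_const vL2)
 have eq: "AEL x. ?s x + 1 * cplx y x = cplx g x"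
 proof -
 have "AEL x. (\<Sum>k=1..M. eps ^ (2 * k - 2) * (- 1) ^ k * tensor_op T k y x) + y x = g x"
 using y by (simp add: solves_effective_def)
 then show ?thesis
 proof eventually_elim
 case (elim x)
 have "?s x + 1 * cplx y x = cor ((\<Sum>k=1..M. eps ^ (2 * k - 2) * (- 1) ^ k * tensor_op T k y x) + y x)"
 by (simp add: c_def v_def tensor_op_def)
 then show ?case by (simp only: elim)
 qed
 qed
 have F1: "AEL eta. fourier (%x. ?s x + 1 * cplx y x) eta = fourier ?s eta + 1 * fourier (cplx y) eta"
 by (rule fourier_lin[OF sL2]) (simp add: L2_cplx_iff yL2)
 have F2: "AEL eta. fourier ?s eta = (\<Sum>k=1..M. c k * fourier (v k) eta)"
 by (rule fourier_sum) (auto intro: vL2)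
 have F3: "AEL eta. fourier (%x. ?s x + 1 * cplx y x) eta = fourier (cplx g) eta"
 by (rule fourier_cong_AE[OF _ _ eq]) (use sL2 yL2 g in "auto intro!: L2_add simp: L2_cplx_iff")
 have F4: "AEL eta. \<forall>k\<in>{1..M}. fourier (v k) eta = (\<Sum>is | length is = 2 * k. cor (T k is) * Dlist is eta) * fourier (cplx y) eta"
 by (intro AE_finite_allI vF) auto
 from F1 F2 F3 F4 show "AEL eta. cor (1 + taylor_poly T eps M eta) * fourier (cplx y) eta = fourier (cplx g) eta"
 proof eventually_elim
 case (elim eta)
 have "(\<Sum>k=1..M. c k * fourier (v k) eta) = (\<Sum>k=1..M. c k * (\<Sum>is | length is = 2 * k. cor (T k is) * Dlist is eta)) * fourier (cplx y) eta"
 unfolding sum_distrib_right using elim(4) by (intro sum.cong) (auto simp: mult.assoc)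
 also have "... = cor (taylor_poly T eps M eta) * fourier (cplx y) eta"
 unfolding c_def taylor_poly_symbol ..
 finally show ?case using elim by (simp add: algebra_simps)
 qed
qed

lemma solves_effective_synth:
 fixes g :: "real^'n::finite => real"
 assumes b: "good UNIV b"
 and g: "AEL x. cplx g x = synth pw (%eta. cor (1 + taylor_poly T eps M eta) * b eta) x"
 shows "solves_effective T eps M g (%x. Re (synth pw b x))"
proof -
 let ?w = "%x. Re (synth pw b x)" and ?D = "%is. synth pw (%eta. Dlist is eta * b eta)"
 have hw: "has_weak_deriv is ?w (%x. Re (?D is x))" for "is"
 by (rule has_weak_deriv_bounded_linear[OF bounded_linear_Re synth_iterated_weak_deriv[OF b]])
 have DL2: "(%x. Re (?D is x)) : L2" for "is" by (intro L2_Re fourier.synth_in_L2 good_Dlist b)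
 have wL2: "?w : L2" by (intro L2_Re fourier.synth_in_L2 b)
 have "?w : Hk (2 * M)" unfolding Hk_def using wL2 hw DL2 by auto
 moreover have "AEL x. (\<Sum>k=1..M. eps ^ (2 * k - 2) * (- 1) ^ k * tensor_op T k ?w x) + ?w x = g x"
 proof -
 let ?v = "%k eta. \<Sum>is | length is = 2 * k. cor (T k is) * (Dlist is eta * b eta)"
 let ?c = "%k::nat. cor (eps ^ (2 * k - 2) * (- 1) ^ k)"
 have gv: "good UNIV (?v k)" for k by (intro good_sum good_scale good_Dlist b)
 have gs: "good UNIV (%eta. \<Sum>k=1..M. ?c k * ?v k eta)" by (intro good_sum good_scale gv)
 have 1: "AEL x. \<forall>k\<in>{1..M}. synth pw (?v k) x = (\<Sum>is | length is = 2 * k. cor (T k is) * ?D is x)"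
 by (intro AE_finite_allI synth_sum good_Dlist b) auto
 have 2: "AEL x. synth pw (%eta. \<Sum>k=1..M. ?c k * ?v k eta) x = (\<Sum>k=1..M. ?c k * synth pw (?v k) x)"
 by (intro synth_sum gv) auto
 have 3: "AEL x. synth pw (%eta. (\<Sum>k=1..M. ?c k * ?v k eta) + b eta) x = synth pw (%eta. \<Sum>k=1..M. ?c k * ?v k eta) x + synth pw b x"
 by (rule fourier.synth_add[OF gs b])
 have sym: "(\<Sum>k=1..M. ?c k * ?v k eta) + b eta = cor (1 + taylor_poly T eps M eta) * b eta" for eta
 proof -
 have "(\<Sum>k=1..M. ?c k * ?v k eta) = (\<Sum>k=1..M. ?c k * (\<Sum>is | length is = 2 * k. cor (T k is) * Dlist is eta)) * b eta"
 by (simp add: sum_distrib_right sum_distrib_left mult_ac)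
 then show ?thesis unfolding taylor_poly_symbol by (simp add: algebra_simps)
 qed
 have 4: "AEL x. \<forall>k\<in>{1..M}. \<forall>is\<in>{is. length is = 2 * k}. wderiv is ?w x = Re (?D is x)"
 by (intro AE_finite_allI wderiv_AE[OF hw]) auto
 from 1 2 3 4 g show ?thesis
 proof eventually_elim
 case (elim x)
 have t: "tensor_op T k ?w x = Re (synth pw (?v k) x)" if "k : {1..M}" for k
 using elim(1) elim(4) that by (simp add: tensor_op_def)
 have "g x = Re (synth pw (%eta. (\<Sum>k=1..M. ?c k * ?v k eta) + b eta) x)"
 unfolding sym using elim(5) by (metis Re_complex_of_real)
 also have "... = (\<Sum>k=1..M. Re (?c k * synth pw (?v k) x)) + ?w x" by (simp only: elim(3) elim(2) plus_complex.sel Re_sum)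
 also have "(\<Sum>k=1..M. Re (?c k * synth pw (?v k) x)) = (\<Sum>k=1..M. eps ^ (2 * k - 2) * (- 1) ^ k * tensor_op T k ?w x)"
 by (intro sum.cong refl) (simp only: t times_complex.sel Re_complex_of_real Im_complex_of_real mult_zero_left diff_zero)
 finally show ?case ..
 qed
 qed
 ultimately show ?thesis by (simp add: solves_effective_def)
qed

text \<open>Plancherel turns each pair of derivatives into the product of their multipliers, and these sum to
 the Taylor polynomial.\<close>

lemma eff_energy_synth:
 fixes w :: "real^'n::finite => real"
 assumes b: "good UNIV b" and w: "w : L2" "AEL x. cplx w x = synth pw b x"
 shows "eff_energy T eps M w = (LI eta. (1 + taylor_poly T eps M eta) * (norm (b eta))^2)"
proof -
 note bw = bandlimited_wderiv[OF b w]
 let ?pl = "%is (eta :: real^'n). prod_list (map (%i. eta $ i) is)"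
 have iw: "intb (%x. wderiv is w x * wderiv js w x)" for "is" js
 by (rule L2_integrable_mult[OF bw(2) bw(2)])
 have iF: "intb (%eta. Dlist is eta * b eta * cnj (Dlist js eta * b eta))" for "is" js
 by (rule ip_integrable[OF good_L2[OF good_Dlist[OF b]] good_L2[OF good_Dlist[OF b]]])
 have Dk: "Dlist (take k is) eta * b eta * cnj (Dlist (drop k is) eta * b eta)
 = cor ((2 * pi) ^ (2 * k) * ?pl is eta * (norm (b eta))^2)" if "length is = 2 * k" for k "is" and eta :: "real^'n"
 proof -
 have p: "?pl is eta = ?pl (take k is) eta * ?pl (drop k is) eta"
 by (metis append_take_drop_id map_append prod_list.append)
 have "(2 * cor pi * \<i>) ^ k * cnj ((2 * cor pi * \<i>) ^ k) = cor ((2 * pi) ^ (2 * k))"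
 proof -
 have "(2 * cor pi * \<i>) * cnj (2 * cor pi * \<i>) = cor ((2 * pi)^2)"
 by (simp add: complex_eq_iff power2_eq_square)
 then show ?thesis by (metis complex_cnj_power of_real_power power_mult power_mult_distrib)
 qed
 moreover have "b eta * cnj (b eta) = cor ((norm (b eta))^2)" by (rule complex_norm_square[symmetric])
 moreover have "A * x * bt * (A' * y * bt') = (A * A') * (x * y) * (bt * bt')" for A x bt A' y bt' :: complex by (simp add: mult_ac)
 moreover have "Dlist (take k is) eta = (2 * cor pi * \<i>) ^ k * cor (?pl (take k is) eta)"
 "Dlist (drop k is) eta = (2 * cor pi * \<i>) ^ k * cor (?pl (drop k is) eta)"
 using that by (simp_all add: Dlist_eq)
 ultimately show ?thesis
 unfolding p by (simp only: complex_cnj_mult complex_cnj_complex_of_real of_real_mult)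
 qed
 have iT: "intb (%eta. (2 * pi) ^ (2 * k) * ?pl is eta * (norm (b eta))^2)" if "length is = 2 * k" for k "is"
 using integrable_Re[OF iF[of "take k is" "drop k is"]] by (simp only: Dk[OF that] Re_complex_of_real)
 have pw: "(LI x. wderiv (take k is) w x * wderiv (drop k is) w x)
 = (LI eta. (2 * pi) ^ (2 * k) * ?pl is eta * (norm (b eta))^2)" if "length is = 2 * k" for k "is"
 proof -
 have "cor (LI x. wderiv (take k is) w x * wderiv (drop k is) w x) = ip (cplx (wderiv (take k is) w)) (cplx (wderiv (drop k is) w))"
 by (simp add: Re_ip_cplx)
 also have "... = ip (synth pw (%eta. Dlist (take k is) eta * b eta)) (synth pw (%eta. Dlist (drop k is) eta * b eta))"
 by (intro ip_cong_AE bw(3)) (auto simp: L2_cplx_iff bw(2) intro!: fourier.synth_in_L2 good_Dlist b)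
 also have "... = ip (%eta. Dlist (take k is) eta * b eta) (%eta. Dlist (drop k is) eta * b eta)"
 by (intro fourier.ip_synth good_Dlist b)
 also have "... = cor (LI eta. (2 * pi) ^ (2 * k) * ?pl is eta * (norm (b eta))^2)"
 unfolding ip_def Dk[OF that] by (rule integral_complex_of_real)
 finally show ?thesis using of_real_eq_iff by blast
 qed
 have w2: "(LI x. (w x)^2) = (LI eta. (norm (b eta))^2)" "intb (%x. (w x)^2)"
 proof -
 have "L2norm w = L2norm (synth pw b)"
 using w fourier.synth_in_L2[OF b] by (subst L2norm_cplx[symmetric], intro L2norm_cong_AE) (auto simp: L2_cplx_iff dest: L2_measurable)
 then have "(L2norm w)^2 = (L2norm b)^2" using fourier.packet_isometry[OF b] by simp
 then show "(LI x. (w x)^2) = (LI eta. (norm (b eta))^2)" by (simp add: L2norm_sq)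
 show "intb (%x. (w x)^2)" using L2_integrable_sq[OF w(1)] by simp
 qed
 have b2: "intb (%eta. (norm (b eta))^2)" by (rule L2_integrable_sq[OF good_L2[OF b]])
 have "eff_energy T eps M w = (\<Sum>k=1..M. eps ^ (2 * k - 2) * (\<Sum>is | length is = 2 * k. T k is * (LI x. wderiv (take k is) w x * wderiv (drop k is) w x)))
 + (LI x. (w x)^2)"
 unfolding eff_energy_def tensor_deriv_form_def mult.assoc
 using iw w2(2) by (simp add: Bochner_Integration.integrable_sum)
 also have "... = (\<Sum>k=1..M. eps ^ (2 * k - 2) * (\<Sum>is | length is = 2 * k. T k is * (LI eta. (2 * pi) ^ (2 * k) * ?pl is eta * (norm (b eta))^2)))
 + (LI eta. (norm (b eta))^2)"
 by (simp add: pw w2(1))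
 also have "... = (LI eta. (\<Sum>k=1..M. eps ^ (2 * k - 2) * (\<Sum>is | length is = 2 * k. T k is * ((2 * pi) ^ (2 * k) * ?pl is eta * (norm (b eta))^2)))
 + (norm (b eta))^2)"
 proof -
 define f where "f k is eta = (2 * pi) ^ (2 * k) * ?pl is eta * (norm (b eta))^2" for k :: nat and "is" and eta
 have i1: "intb (%eta. T k is * f k is eta)" if "is : {is. length is = 2 * k}" for k "is"
 unfolding f_def using that by (intro integrable_mult_right iT) auto
 have i2: "intb (%eta. eps ^ (2 * k - 2) * (\<Sum>is | length is = 2 * k. T k is * f k is eta))" for k
 by (intro integrable_mult_right Bochner_Integration.integrable_sum i1)
 have e1: "(\<Sum>is | length is = 2 * k. T k is * (LI eta. f k is eta)) = (LI eta. (\<Sum>is | length is = 2 * k. T k is * f k is eta))" for k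
 by (subst Bochner_Integration.integral_sum[OF i1]) auto
 have "(\<Sum>k=1..M. eps ^ (2 * k - 2) * (\<Sum>is | length is = 2 * k. T k is * (LI eta. f k is eta)))
 = (\<Sum>k=1..M. (LI eta. eps ^ (2 * k - 2) * (\<Sum>is | length is = 2 * k. T k is * f k is eta)))"
 unfolding e1 by simp
 also have "... = (LI eta. (\<Sum>k=1..M. eps ^ (2 * k - 2) * (\<Sum>is | length is = 2 * k. T k is * f k is eta)))"
 by (rule Bochner_Integration.integral_sum[symmetric]) (rule i2)
 finally show ?thesis
 unfolding f_def[symmetric]
 by (subst Bochner_Integration.integral_add) (auto intro!: Bochner_Integration.integrable_sum i2 b2)
 qed
 also have "... = (LI eta. (1 + taylor_poly T eps M eta) * (norm (b eta))^2)"
 proof (intro Bochner_Integration.integral_cong refl)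
 fix eta :: "real^'n"
 have "(\<Sum>k=1..M. eps ^ (2 * k - 2) * (\<Sum>is | length is = 2 * k. T k is * ((2 * pi) ^ (2 * k) * ?pl is eta * (norm (b eta))^2)))
 = taylor_poly T eps M eta * (norm (b eta))^2"
 unfolding taylor_poly_def tensor_form_def sum_distrib_right
 by (intro sum.cong refl) (simp only: sum_distrib_left sum_distrib_right mult_ac)
 then show "(\<Sum>k=1..M. eps ^ (2 * k - 2) * (\<Sum>is | length is = 2 * k. T k is * ((2 * pi) ^ (2 * k) * ?pl is eta * (norm (b eta))^2)))
 + (norm (b eta))^2 = (1 + taylor_poly T eps M eta) * (norm (b eta))^2"
 by (simp only: distrib_right mult_1 add.commute)
 qed
 finally show ?thesis .
qed

section \<open>Stability of the reduced optimality condition\<close>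

text \<open>
 The gradient density of the reduced cost as a function of the Fourier (or Bloch) coefficients \<open>a\<close>
 of the control, when the state has coefficients \<open>q * (F + a)\<close>.
\<close>

definition red_grad ::
 "real => real => real => (real^'n => complex) => (real^'n => complex) => (real^'n => complex)
 => (real^'n => real) => (real^'n => complex) => real^'n => complex" where
 "red_grad mu1 mu2 ka F d1 d2 q a eta =
 of_real mu1 * (of_real (q eta) * (F eta + a eta) - d1 eta)
 + of_real mu2 * (of_real (q eta) * (of_real (q eta) * (F eta + a eta) - d2 eta))
 + of_real ka * a eta"

lemma L2_of_real_mult:
 fixes u :: "real^'n::finite => complex"
 assumes "u : L2" "q : BM" "!!x. 0 <= q x" "!!x. q x <= 1"
 shows "(%x. of_real (q x) * u x) : L2"
 by (rule L2_mult_bounded[where c=1]) (use assms in auto)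

lemma red_grad_L2:
 assumes "F : L2" "d1 : L2" "d2 : L2" "a : L2" "q : BM" "!!x. 0 <= q x" "!!x. q x <= 1"
 shows "red_grad mu1 mu2 ka F d1 d2 q a : L2"
 unfolding red_grad_def[abs_def] by (intro L2_add L2_diff L2_mult_const L2_of_real_mult assms)

lemma norm_red_grad_le:
 assumes "0 <= mu1" "0 <= mu2" "0 <= ka" "0 <= q eta" "q eta <= 1"
 shows "norm (red_grad mu1 mu2 ka F d1 d2 q a eta)
 <= (mu1 + mu2) * norm (F eta) + (mu1 + mu2 + ka) * norm (a eta) + mu1 * norm (d1 eta) + mu2 * norm (d2 eta)"
proof -
 have qn: "norm (of_real (q eta) * z) <= norm z" for z :: complex
 using assms(4,5) by (simp add: norm_mult mult_left_le_one_le)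
 have Fa: "norm (of_real (q eta) * (F eta + a eta)) <= norm (F eta) + norm (a eta)"
 using qn[of "F eta + a eta"] norm_triangle_ineq[of "F eta" "a eta"] by linarith
 have 1: "norm (of_real mu1 * (of_real (q eta) * (F eta + a eta) - d1 eta)) <= mu1 * (norm (F eta) + norm (a eta) + norm (d1 eta))"
 using assms(1) Fa norm_triangle_ineq4[of "of_real (q eta) * (F eta + a eta)" "d1 eta"]
 by (simp only: norm_mult[of "of_real mu1"] norm_of_real) (intro mult_mono, auto)
 have 2: "norm (of_real mu2 * (of_real (q eta) * (of_real (q eta) * (F eta + a eta) - d2 eta))) <= mu2 * (norm (F eta) + norm (a eta) + norm (d2 eta))"
 using assms(2) Fa norm_triangle_ineq4[of "of_real (q eta) * (F eta + a eta)" "d2 eta"] qn[of "of_real (q eta) * (F eta + a eta) - d2 eta"]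
 by (simp only: norm_mult[of "of_real mu2"] norm_of_real) (intro mult_mono, auto)
 have 3: "norm (of_real ka * a eta) = ka * norm (a eta)" using assms(3) by (simp add: norm_mult)
 have "norm (red_grad mu1 mu2 ka F d1 d2 q a eta) <= mu1 * (norm (F eta) + norm (a eta) + norm (d1 eta))
 + mu2 * (norm (F eta) + norm (a eta) + norm (d2 eta)) + ka * norm (a eta)"
 unfolding red_grad_def using 1 2 3 by (intro order_trans[OF norm_triangle_ineq] add_mono) auto
 then show ?thesis by (simp add: algebra_simps)
qed

text \<open>The reduced gradient is strongly monotone in \<open>a\<close>, with constant \<open>ka\<close>.\<close>

lemma reduced_control_bound:
 assumes F: "F : L2" "d1 : L2" "d2 : L2" "a : L2" "a0 : L2"
 and q: "q : BM" "!!x. 0 <= q x" "!!x. q x <= 1"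
 and w: "0 <= mu1" "0 <= mu2" "0 < ka"
 and vi: "0 <= Re (ip (red_grad mu1 mu2 ka F d1 d2 q a) (%eta. a0 eta - a eta))"
 shows "L2norm a <= L2norm a0 + ((mu1 + mu2) * L2norm F + (mu1 + mu2 + ka) * L2norm a0 + mu1 * L2norm d1 + mu2 * L2norm d2) / ka"
proof -
 let ?G = "red_grad mu1 mu2 ka F d1 d2 q"
 let ?e = "%eta. a eta - a0 eta"
 have GL2: "?G a : L2" "?G a0 : L2" by (intro red_grad_L2 F q)+
 have eL2: "?e : L2" using F by auto
 have "Re (ip (%eta. ?G a eta - ?G a0 eta) ?e) >= ka * (L2norm ?e)^2"
 proof -
 have "ka * (L2norm ?e)^2 = (LI eta. ka * (norm (?e eta))^2)" by (simp add: L2norm_sq)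
 also have "... <= (LI eta. Re ((?G a eta - ?G a0 eta) * cnj (?e eta)))"
 proof (rule integral_mono)
 show "intb (%eta. ka * (norm (?e eta))^2)" using eL2 by (intro integrable_mult_right L2_integrable_sq)
 show "intb (%eta. Re ((?G a eta - ?G a0 eta) * cnj (?e eta)))"
 by (intro integrable_Re ip_integrable L2_diff GL2 eL2)
 fix eta
 have "?G a eta - ?G a0 eta = of_real (mu1 * q eta + mu2 * (q eta)^2 + ka) * ?e eta"
 by (simp add: red_grad_def power2_eq_square algebra_simps)
 then have "(?G a eta - ?G a0 eta) * cnj (?e eta) = of_real ((mu1 * q eta + mu2 * (q eta)^2 + ka) * (norm (?e eta))^2)"
 by (simp only: of_real_mult complex_norm_square mult.assoc)
 then have "Re ((?G a eta - ?G a0 eta) * cnj (?e eta)) = (mu1 * q eta + mu2 * (q eta)^2 + ka) * (norm (?e eta))^2"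
 by (simp only: Re_complex_of_real)
 moreover have "ka <= mu1 * q eta + mu2 * (q eta)^2 + ka" using w q by simp
 ultimately show "ka * (norm (?e eta))^2 <= Re ((?G a eta - ?G a0 eta) * cnj (?e eta))"
 by (simp only:) (intro mult_right_mono, auto)
 qed
 also have "... = Re (ip (%eta. ?G a eta - ?G a0 eta) ?e)"
 unfolding ip_def by (rule integral_Re) (intro ip_integrable L2_diff GL2 eL2)
 finally show ?thesis .
 qed
 moreover have "ip (%eta. ?G a eta - ?G a0 eta) ?e = - ip (?G a) (%eta. a0 eta - a eta) - ip (?G a0) ?e"
 using F GL2 by (simp add: ip_diff_left ip_diff_right eL2)
 ultimately have "ka * (L2norm ?e)^2 <= - Re (ip (?G a0) ?e)" using vi by simp
 also have "... <= norm (ip (?G a0) ?e)" using abs_Re_le_cmod[of "ip (?G a0) ?e"] by linarith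
 also have "... <= L2norm (?G a0) * L2norm ?e" by (rule norm_ip_le[OF GL2(2) eL2])
 finally have "(ka * L2norm ?e) * L2norm ?e <= L2norm (?G a0) * L2norm ?e" by (simp add: power2_eq_square)
 then have "ka * L2norm ?e <= L2norm (?G a0)"
 using L2norm_nonneg[of ?e] L2norm_nonneg[of "?G a0"] by (cases "L2norm ?e = 0") (simp_all add: mult_le_cancel_right less_le)
 then have e: "L2norm ?e <= L2norm (?G a0) / ka" using w by (simp add: field_simps)
 have G: "L2norm (?G a0) <= (mu1 + mu2) * L2norm F + (mu1 + mu2 + ka) * L2norm a0 + mu1 * L2norm d1 + mu2 * L2norm d2"
 proof -
 have n: "L2norm (%eta. c * norm (u eta)) = c * L2norm u" if "0 <= c" for c and u :: "real^'a => complex"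
 using L2norm_scale[of c "%eta. norm (u eta)"] that by (simp add: L2norm_def)
 let ?h1 = "%eta. (mu1 + mu2) * norm (F eta)" and ?h2 = "%eta. (mu1 + mu2 + ka) * norm (a0 eta)"
 and ?h3 = "%eta. mu1 * norm (d1 eta)" and ?h4 = "%eta. mu2 * norm (d2 eta)"
 have hL2: "?h1 : L2" "?h2 : L2" "?h3 : L2" "?h4 : L2" by (intro L2_mult_const L2_norm F)+
 have "L2norm (?G a0) <= L2norm (%eta. ((?h1 eta + ?h2 eta) + ?h3 eta) + ?h4 eta)"
 proof (rule L2norm_mono)
 show "(%eta. ((?h1 eta + ?h2 eta) + ?h3 eta) + ?h4 eta) : L2" by (intro L2_add hL2)
 show "AEL eta. norm (?G a0 eta) <= norm (((?h1 eta + ?h2 eta) + ?h3 eta) + ?h4 eta)"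
 using norm_red_grad_le[of mu1 mu2 ka q _ F d1 d2 a0] w q by (intro AE_I2) (auto intro: order_trans[OF _ abs_ge_self])
 qed (rule GL2)
 also have "... <= ((L2norm ?h1 + L2norm ?h2) + L2norm ?h3) + L2norm ?h4"
 by (intro order_trans[OF L2norm_triangle] add_mono order_refl L2_add hL2)
 finally show ?thesis using w by (simp add: n)
 qed
 have "L2norm a = L2norm (%eta. a0 eta + ?e eta)" by simp
 also have "... <= L2norm a0 + L2norm ?e" by (intro L2norm_triangle F eL2)
 also have "... <= L2norm a0 + L2norm (?G a0) / ka" using e by simp
 finally show ?thesis using divide_right_mono[OF G, of ka] w by linarith
qed

text \<open>Add the two variational inequalities, each tested with the other control. Strong monotonicity with
 \<open>p\<close> controls \<open>b - a\<close>; replacing \<open>q\<close> by \<open>p\<close> in the gradient at \<open>a\<close> costs a multiple of \<open>de\<close>.\<close>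

lemma reduced_state_stability:
 assumes F: "F : L2" "d1 : L2" "d2 : L2" "a : L2" "b : L2"
 and q: "q : BM" "!!x. 0 <= q x" "!!x. q x <= 1"
 and p: "p : BM" "!!x. 0 <= p x" "!!x. p x <= 1"
 and pq: "AEL x. \<bar>q x - p x\<bar> <= de" "0 <= de"
 and w: "0 <= mu1" "0 <= mu2" "0 < ka"
 and va: "0 <= Re (ip (red_grad mu1 mu2 ka F d1 d2 q a) (%eta. b eta - a eta))"
 and vb: "0 <= Re (ip (red_grad mu1 mu2 ka F d1 d2 p b) (%eta. a eta - b eta))"
 shows "L2norm (%eta. of_real (q eta) * (F eta + a eta) - of_real (p eta) * (F eta + b eta))
 <= de * (L2norm (%eta. F eta + a eta) + ((mu1 + 2 * mu2) * L2norm (%eta. F eta + a eta) + mu2 * L2norm d2) / ka)"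
proof -
 let ?G = "red_grad mu1 mu2 ka F d1 d2"
 let ?e = "%eta. b eta - a eta" and ?Fa = "%eta. F eta + a eta"
 let ?h = "%eta. (mu1 + 2 * mu2) * norm (?Fa eta) + mu2 * norm (d2 eta)"
 have GL2: "?G q a : L2" "?G p b : L2" by (intro red_grad_L2 F q p)+
 have eL2: "?e : L2" and FaL2: "?Fa : L2" using F by auto
 have h1: "(%eta. (mu1 + 2 * mu2) * norm (?Fa eta)) : L2" "(%eta. mu2 * norm (d2 eta)) : L2"
 by (intro L2_mult_const L2_norm FaL2 F)+
 have hL2: "?h : L2" by (intro L2_add h1)
 have n: "L2norm (%eta. c * norm (u eta)) = c * L2norm u" if "0 <= c" for c and u :: "real^'a => complex"
 using L2norm_scale[of c "%eta. norm (u eta)"] that by (simp add: L2norm_def)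
 have hn: "L2norm ?h <= (mu1 + 2 * mu2) * L2norm ?Fa + mu2 * L2norm d2"
 using L2norm_triangle[OF h1] w by (simp add: n)
 have ihe: "intb (%eta. ?h eta * norm (?e eta))" by (intro L2_integrable_mult hL2 L2_norm eL2)
 have ie: "intb (%eta. (norm (?e eta))^2)" by (rule L2_integrable_sq[OF eL2])
 have "0 <= Re (ip (%eta. ?G q a eta - ?G p b eta) ?e)"
 proof -
 have "ip (%eta. ?G q a eta - ?G p b eta) ?e = ip (?G q a) ?e + ip (?G p b) (%eta. a eta - b eta)"
 using F GL2 by (simp add: ip_diff_left ip_diff_right eL2)
 then show ?thesis using va vb by simp
 qed
 also have "Re (ip (%eta. ?G q a eta - ?G p b eta) ?e) = (LI eta. Re ((?G q a eta - ?G p b eta) * cnj (?e eta)))"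
 unfolding ip_def by (rule integral_Re[symmetric]) (intro ip_integrable L2_diff GL2 eL2)
 also have "... <= (LI eta. de * (?h eta * norm (?e eta)) - ka * (norm (?e eta))^2)"
 proof (rule integral_mono_AE)
 show "intb (%eta. Re ((?G q a eta - ?G p b eta) * cnj (?e eta)))"
 by (intro integrable_Re ip_integrable L2_diff GL2 eL2)
 show "intb (%eta. de * (?h eta * norm (?e eta)) - ka * (norm (?e eta))^2)"
 by (intro Bochner_Integration.integrable_diff integrable_mult_right ihe ie)
 show "AEL eta. Re ((?G q a eta - ?G p b eta) * cnj (?e eta)) <= de * (?h eta * norm (?e eta)) - ka * (norm (?e eta))^2"
 using pq(1)
 proof eventually_elim
 case (elim eta)
 define X where "X = of_real (mu1 + mu2 * (q eta + p eta)) * ?Fa eta - of_real mu2 * d2 eta"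
 define m where "m = mu1 * p eta + mu2 * (p eta)^2 + ka"
 have "?G q a eta - ?G p b eta = of_real (q eta - p eta) * X - of_real m * ?e eta"
 by (simp add: red_grad_def X_def m_def power2_eq_square algebra_simps)
 then have "(?G q a eta - ?G p b eta) * cnj (?e eta) = of_real (q eta - p eta) * X * cnj (?e eta) - of_real (m * (norm (?e eta))^2)"
 by (simp only: left_diff_distrib of_real_mult complex_norm_square mult.assoc)
 then have "Re ((?G q a eta - ?G p b eta) * cnj (?e eta)) = Re (of_real (q eta - p eta) * X * cnj (?e eta)) - m * (norm (?e eta))^2"
 by (simp only: minus_complex.sel Re_complex_of_real)
 also have "Re (of_real (q eta - p eta) * X * cnj (?e eta)) <= norm (of_real (q eta - p eta) * X * cnj (?e eta))" by (rule complex_Re_le_cmod)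
 also have "... = \<bar>q eta - p eta\<bar> * (norm X * norm (?e eta))"
 by (simp only: norm_mult norm_of_real complex_mod_cnj mult.assoc)
 also have "... <= de * (?h eta * norm (?e eta))"
 proof (intro mult_mono elim mult_right_mono)
 have "norm X <= norm (of_real (mu1 + mu2 * (q eta + p eta)) * ?Fa eta) + norm (of_real mu2 * d2 eta)"
 unfolding X_def by (rule norm_triangle_ineq4)
 also have "... = (mu1 + mu2 * (q eta + p eta)) * norm (?Fa eta) + mu2 * norm (d2 eta)"
 using w q(2)[of eta] p(2)[of eta] by (simp only: norm_mult norm_of_real abs_of_nonneg add_nonneg_nonneg mult_nonneg_nonneg)
 also have "... <= ?h eta"
 proof -
 have "mu2 * (q eta + p eta) <= mu2 * 2" using w q(3)[of eta] p(3)[of eta] by (intro mult_left_mono) auto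
 then have "(mu1 + mu2 * (q eta + p eta)) * norm (?Fa eta) <= (mu1 + 2 * mu2) * norm (?Fa eta)" by (intro mult_right_mono) auto
 then show ?thesis by simp
 qed
 finally show "norm X <= ?h eta" .
 qed (use pq w in "auto intro!: add_nonneg_nonneg mult_nonneg_nonneg")
 finally have a: "Re ((?G q a eta - ?G p b eta) * cnj (?e eta)) <= de * (?h eta * norm (?e eta)) - m * (norm (?e eta))^2" by simp
 have "ka <= m" unfolding m_def using w p by simp
 then have "ka * (norm (?e eta))^2 <= m * (norm (?e eta))^2" by (intro mult_right_mono) auto
 with a show ?case by linarith
 qed
 qed
 also have "... = de * (LI eta. ?h eta * norm (?e eta)) - ka * (L2norm ?e)^2"
 using ihe ie by (simp add: L2norm_sq)
 finally have "ka * (L2norm ?e)^2 <= de * (LI eta. ?h eta * norm (?e eta))" by simp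
 also have "... <= de * (L2norm ?h * L2norm ?e)"
 proof (rule mult_left_mono[OF _ pq(2)])
 have "?h eta = norm (?h eta)" for eta using w by simp
 then have "(LI eta. ?h eta * norm (?e eta)) = (LI eta. norm (?h eta) * norm (?e eta))" by presburger
 then show "(LI eta. ?h eta * norm (?e eta)) <= L2norm ?h * L2norm ?e" using L2_Cauchy_Schwarz[OF hL2 eL2] by simp
 qed
 finally have "(ka * L2norm ?e) * L2norm ?e <= (de * L2norm ?h) * L2norm ?e" by (simp add: power2_eq_square mult.assoc)
 then have "ka * L2norm ?e <= de * L2norm ?h"
 using L2norm_nonneg[of ?e] L2norm_nonneg[of ?h] pq(2) by (cases "L2norm ?e = 0") (simp_all add: mult_le_cancel_right less_le)
 also have "... <= de * ((mu1 + 2 * mu2) * L2norm ?Fa + mu2 * L2norm d2)" by (intro mult_left_mono hn pq)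
 finally have e: "L2norm ?e <= de * (((mu1 + 2 * mu2) * L2norm ?Fa + mu2 * L2norm d2) / ka)"
 using w by (simp add: field_simps)
 have "L2norm (%eta. of_real (q eta) * (F eta + a eta) - of_real (p eta) * (F eta + b eta)) <= L2norm (%eta. de * norm (?Fa eta) + norm (?e eta))"
 proof (rule L2norm_mono)
 show "(%eta. de * norm (?Fa eta) + norm (?e eta)) : L2" by (intro L2_add L2_mult_const L2_norm FaL2 eL2)
 show "(%eta. of_real (q eta) * (F eta + a eta) - of_real (p eta) * (F eta + b eta)) : L2" by (intro L2_diff L2_of_real_mult L2_add F q p)
 show "AEL eta. norm (of_real (q eta) * (F eta + a eta) - of_real (p eta) * (F eta + b eta)) <= norm (de * norm (?Fa eta) + norm (?e eta))"
 using pq(1)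
 proof eventually_elim
 case (elim eta)
 have "of_real (q eta) * (F eta + a eta) - of_real (p eta) * (F eta + b eta) = of_real (q eta - p eta) * ?Fa eta - of_real (p eta) * ?e eta"
 by (simp add: algebra_simps)
 then have "norm (of_real (q eta) * (F eta + a eta) - of_real (p eta) * (F eta + b eta)) <= \<bar>q eta - p eta\<bar> * norm (?Fa eta) + p eta * norm (?e eta)"
 using norm_triangle_ineq4[of "of_real (q eta - p eta) * ?Fa eta" "of_real (p eta) * ?e eta"] p(2)[of eta]
 by (simp only: norm_mult norm_of_real abs_of_nonneg)
 also have "... <= de * norm (?Fa eta) + 1 * norm (?e eta)" by (intro add_mono mult_right_mono elim p) auto
 finally show ?case using pq(2) by simp
 qed
 qed
 also have "... <= de * L2norm ?Fa + L2norm ?e"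
 using L2norm_triangle[OF L2_mult_const[OF L2_norm[OF FaL2], of de] L2_norm[OF eL2]] n[OF pq(2), of ?Fa] n[of 1 ?e] by simp
 finally show ?thesis using e by (simp add: distrib_left)
qed

text \<open>
 For small \<open>eps * norm eta\<close> this is the Taylor expansion; otherwise \<open>eps\<close> is bounded below and the trivial bound
 by 1 suffices.
\<close>

lemma resolvent_symbol_error:
 fixes T :: "nat => 'n::finite list => real" and ev :: "real^'n => real"
 assumes taylor: "(%eta. ev eta - (\<Sum>k=1..M. (2 * pi) ^ (2 * k) * tensor_form T k eta)) : O[at 0](%eta. norm eta ^ (2 * M + 2))"
 and R: "0 < R"
 shows "\<exists>C\<ge>0. \<forall>eps eta. 0 < eps --> eta ~= 0 --> norm eta <= R --> 0 <= ev (eps *R eta) --> 0 <= taylor_poly T eps M eta -->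
 \<bar>1 / (1 + ev (eps *R eta) / eps^2) - 1 / (1 + taylor_poly T eps M eta)\<bar> <= C * eps ^ (2 * M)"
proof -
 obtain c where c: "0 < c" "eventually (%eta. norm (ev eta - (\<Sum>k=1..M. (2 * pi) ^ (2 * k) * tensor_form T k eta)) <= c * norm (norm eta ^ (2 * M + 2))) (at 0)"
 using landau_o.bigE[OF taylor] by blast
 then obtain d where d: "0 < d" "!!eta. eta ~= 0 ==> norm eta < d ==> \<bar>ev eta - (\<Sum>k=1..M. (2 * pi) ^ (2 * k) * tensor_form T k eta)\<bar> <= c * norm eta ^ (2 * M + 2)"
 unfolding eventually_at by (auto simp: dist_norm)
 define C where "C = max (c * R ^ (2 * M + 2)) ((R / d) ^ (2 * M))"
 have res: "\<bar>1 / (1 + x) - 1 / (1 + y)\<bar> <= \<bar>x - y\<bar>" "\<bar>1 / (1 + x) - 1 / (1 + y)\<bar> <= 1" if "0 <= x" "0 <= y" for x y :: real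
 proof -
 have "1 / (1 + x) - 1 / (1 + y) = (y - x) / ((1 + x) * (1 + y))" using that by (simp add: field_simps)
 then have "\<bar>1 / (1 + x) - 1 / (1 + y)\<bar> = \<bar>x - y\<bar> / ((1 + x) * (1 + y))" using that by (simp add: abs_mult)
 also have "... <= \<bar>x - y\<bar> / 1"
 proof (rule divide_left_mono)
 show "1 <= (1 + x) * (1 + y)" using mult_mono[of 1 "1 + x" 1 "1 + y"] that by simp
 qed (use that in auto)
 finally show "\<bar>1 / (1 + x) - 1 / (1 + y)\<bar> <= \<bar>x - y\<bar>" by simp
 have "0 <= 1 / (1 + x)" "1 / (1 + x) <= 1" "0 <= 1 / (1 + y)" "1 / (1 + y) <= 1" using that by auto
 then show "\<bar>1 / (1 + x) - 1 / (1 + y)\<bar> <= 1" by linarith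
 qed
 have "\<bar>1 / (1 + ev (eps *R eta) / eps^2) - 1 / (1 + taylor_poly T eps M eta)\<bar> <= C * eps ^ (2 * M)"
 if eps: "0 < eps" and eta: "eta ~= 0" "norm eta <= R" and pos: "0 <= ev (eps *R eta)" "0 <= taylor_poly T eps M eta" for eps eta
 proof (cases "eps * norm eta < d")
 case True
 have S: "(\<Sum>k=1..M. (2 * pi) ^ (2 * k) * tensor_form T k (eps *R eta)) = eps^2 * taylor_poly T eps M eta"
 unfolding taylor_poly_def sum_distrib_left
 proof (rule sum.cong[OF refl])
 fix k assume "k : {1..M}"
 then have "2 * k = 2 + (2 * k - 2)" by auto
 then have "eps ^ (2 * k) = eps^2 * eps ^ (2 * k - 2)" by (metis power_add)
 then show "(2 * pi) ^ (2 * k) * tensor_form T k (eps *R eta) = eps^2 * (eps ^ (2 * k - 2) * (2 * pi) ^ (2 * k) * tensor_form T k eta)"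
 by (simp add: tensor_form_scaleR)
 qed
 have "\<bar>ev (eps *R eta) - eps^2 * taylor_poly T eps M eta\<bar> <= c * (eps * norm eta) ^ (2 * M + 2)"
 using d(2)[of "eps *R eta"] eps eta True unfolding S by simp
 also have "... <= c * (eps * R) ^ (2 * M + 2)" using eps eta c by (intro mult_left_mono power_mono) auto
 also have "... = eps^2 * ((c * R ^ (2 * M + 2)) * eps ^ (2 * M))" by (simp add: power_mult_distrib power_add power2_eq_square)
 finally have le: "\<bar>ev (eps *R eta) - eps^2 * taylor_poly T eps M eta\<bar> <= eps^2 * ((c * R ^ (2 * M + 2)) * eps ^ (2 * M))" .
 have "\<bar>1 / (1 + ev (eps *R eta) / eps^2) - 1 / (1 + taylor_poly T eps M eta)\<bar> <= \<bar>ev (eps *R eta) / eps^2 - taylor_poly T eps M eta\<bar>"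
 by (rule res(1)) (use pos in auto)
 also have "... = \<bar>ev (eps *R eta) - eps^2 * taylor_poly T eps M eta\<bar> / eps^2"
 proof -
 have "ev (eps *R eta) / eps^2 - taylor_poly T eps M eta = (ev (eps *R eta) - eps^2 * taylor_poly T eps M eta) / eps^2"
 using eps by (simp add: diff_divide_distrib)
 then show ?thesis by (simp only: abs_divide abs_power2)
 qed
 also have "... <= (c * R ^ (2 * M + 2)) * eps ^ (2 * M)"
 using le eps by (simp add: pos_divide_le_eq mult.commute)
 also have "... <= C * eps ^ (2 * M)" unfolding C_def using eps by (intro mult_right_mono) auto
 finally show ?thesis .
 next
 case False
 have "\<bar>1 / (1 + ev (eps *R eta) / eps^2) - 1 / (1 + taylor_poly T eps M eta)\<bar> <= 1"
 by (rule res(2)) (use pos in auto)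
 also have "1 <= ((R / d) * eps) ^ (2 * M)"
 proof (rule one_le_power)
 have "d <= eps * R" using False eps eta(2) by (meson less_imp_le mult_left_mono not_le order_trans)
 then show "1 <= R / d * eps" using d(1) by (simp add: field_simps)
 qed
 also have "... = (R / d) ^ (2 * M) * eps ^ (2 * M)" by (rule power_mult_distrib)
 also have "... <= C * eps ^ (2 * M)" unfolding C_def using eps by (intro mult_right_mono) auto
 finally show ?thesis .
 qed
 moreover have "0 <= C" unfolding C_def using c R by (simp add: le_max_iff_disj)
 ultimately show ?thesis by blast
qed

section \<open>Optimality condition of the effective problem\<close>

lemma quadratic_first_order:
 fixes B Q :: real
 assumes "!!t. 0 < t ==> t <= 1 ==> 0 <= t * B + t^2 * Q"
 shows "0 <= B"
proof (rule ccontr)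
 assume "\<not> 0 <= B"
 define t where "t = min 1 (- B / (2 * (\<bar>Q\<bar> + 1)))"
 have t: "0 < t" "t <= 1" using \<open>\<not> 0 <= B\<close> by (auto simp: t_def divide_neg_pos)
 have "t * \<bar>Q\<bar> <= (- B / (2 * (\<bar>Q\<bar> + 1))) * (\<bar>Q\<bar> + 1)" using t by (intro mult_mono) (auto simp: t_def)
 also have "... = - B / 2" by (simp add: field_simps)
 finally have "B + t * \<bar>Q\<bar> < 0" using \<open>\<not> 0 <= B\<close> by simp
 moreover have "t * Q <= t * \<bar>Q\<bar>" using t by (intro mult_left_mono) auto
 ultimately have "B + t * Q < 0" by linarith
 then have "t * (B + t * Q) < 0" using t by (simp add: mult_less_0_iff)
 then show False using assms[OF t] by (simp add: power2_eq_square algebra_simps)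
qed

text \<open>Along a segment of controls the cost is a quadratic polynomial in \<open>t\<close> whose linear coefficient is
 the pairing with \<open>red_grad\<close>. The multiplier is cut off outside \<open>K\<close>, where \<open>1 + P\<close> may vanish.\<close>

lemma effective_optimality_condition:
 fixes T :: "nat => 'n::finite list => real" and K :: "(real^'n) set" and u v :: "real^'n => real"
 assumes K: "K : sets borel"
 and good: "good K F" "good K d1" "good K d2" "good K a" "good K b"
 and data: "f : L2" "AEL x. cplx f x = synth pw F x"
 "yd1 : L2" "AEL x. cplx yd1 x = synth pw d1 x"
 "yd2 : L2" "AEL x. cplx yd2 x = synth pw d2 x"
 and u: "u : L2" "AEL x. cplx u x = synth pw a x"
 and v: "v : L2" "AEL x. cplx v x = synth pw b x"
 and P: "!!eta. eta : K ==> 0 <= taylor_poly T eps M eta"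
 and p_def: "p = (%eta. ind K eta / (1 + taylor_poly T eps M eta))"
 and opt: "optimal_effective T M mu1 mu2 ka eps f yd1 yd2 V u y"
 and seg: "!!t. 0 <= t ==> t <= 1 ==> (%x. (1 - t) * u x + t * v x) : V"
 shows "0 <= Re (ip (red_grad mu1 mu2 ka F d1 d2 p a) (%eta. b eta - a eta))"
 and "!!z. solves_effective T eps M (%x. f x + u x) z ==>
 z : L2 & (AEL x. cplx z x = synth pw (%eta. of_real (p eta) * (F eta + a eta)) x)"
proof -
 let ?P = "taylor_poly T eps M" and ?W = "synth pw"
 have pm[measurable]: "p : BM" unfolding p_def using K by (intro borel_measurable_divide borel_measurable_indicator borel_measurable_add) auto
 have p01: "0 <= p eta" "p eta <= 1" for eta using P[of eta] by (auto simp: p_def indicator_def)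
 have pP: "(1 + ?P eta) * p eta = ind K eta" for eta
 using P[of eta] by (cases "eta : K") (auto simp: p_def)
 have gU: "good UNIV c" if "good K c" for c using good_mono[OF that] by simp
 have gp: "good K (%eta. of_real (p eta) * c eta)" if "good K c" for c
 by (rule good_mult[OF that, where c=1]) (use p01 in auto)
 define bt where "bt c eta = of_real (p eta) * (F eta + c eta)" for c eta
 have gbt: "good K (bt c)" if "good K c" for c unfolding bt_def[abs_def] by (intro gp good_add good that)
 have Pbt: "cor (1 + ?P eta) * bt c eta = F eta + c eta" if "good K c" for c eta
 proof -
 have "cor (1 + ?P eta) * bt c eta = cor ((1 + ?P eta) * p eta) * (F eta + c eta)"
 by (simp only: bt_def of_real_mult mult.assoc)
 then show ?thesis unfolding pP using good_off[OF good(1), of eta] good_off[OF that, of eta] by (cases "eta : K") auto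
 qed
 have fw: "AEL x. cplx (%x. f x + w x) x = ?W (%eta. F eta + c eta) x"
 if "good K c" "AEL x. cplx w x = ?W c x" for w c
 using fourier.synth_add[OF gU[OF good(1)] gU[OF that(1)]] data(2) that(2) by eventually_elim simp
 have state: "z : L2" "AEL x. cplx z x = ?W (bt c) x"
 if c: "good K c" and w: "w : L2" "AEL x. cplx w x = ?W c x"
 and z: "solves_effective T eps M (%x. f x + w x) z" for w c z
 proof -
 have fwL2: "(%x. f x + w x) : L2" using data(1) w(1) by (rule L2_add)
 note s = solves_effective_fourier[OF z fwL2]
 show "z : L2" by (rule s(1))
 have gF: "good UNIV (%eta. F eta + c eta)" by (intro gU good_add good c)
 have "AEL eta. fourier (cplx (%x. f x + w x)) eta = fourier (?W (%eta. F eta + c eta)) eta"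
 by (rule fourier_cong_AE[OF _ fourier.synth_in_L2[OF gF] fw[OF c w(2)]]) (use fwL2 in "simp only: L2_cplx_iff")
 with s(2) fourier_synth[OF gF] taylor_poly_zeros_null[of T eps M]
 have "AEL eta. fourier (cplx z) eta = bt c eta"
 proof eventually_elim
 case (elim eta)
 have "cor (1 + ?P eta) * fourier (cplx z) eta = cor (1 + ?P eta) * bt c eta"
 unfolding Pbt[OF c] using elim by simp
 moreover have "cor (1 + ?P eta) ~= 0" using elim(3) by (simp only: of_real_eq_0_iff) simp
 ultimately show ?case by simp
 qed
 then show "AEL x. cplx z x = ?W (bt c) x"
 using s(1) by (intro fourier_inversion gU gbt c) (simp_all add: L2_cplx_iff)
 qed
 show "z : L2 & (AEL x. cplx z x = ?W (%eta. of_real (p eta) * (F eta + a eta)) x)"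
 if "solves_effective T eps M (%x. f x + u x) z" for z
 using state[OF good(4) u that] by (simp add: bt_def[abs_def])
 have sq: "(LI x. (w x)^2) = (L2norm c)^2" if "w : L2" "good K c" "AEL x. cplx w x = ?W c x" for w c
 proof -
 have "L2norm w = L2norm (?W c)"
 unfolding L2norm_cplx[symmetric, of w]
 by (rule L2norm_cong_AE[OF that(3)]) (use that(1) fourier.synth_in_L2[OF gU[OF that(2)]] in "auto simp: L2_cplx_iff[symmetric, of w]")
 then have "L2norm w = L2norm c" using fourier.packet_isometry[OF gU[OF that(2)]] by simp
 then show ?thesis using L2norm_sq[of w] by simp
 qed
 define j where "j c eta = mu1 / 2 * ((1 + ?P eta) * (norm (bt c eta - d1 eta))^2) + mu2 / 2 * (norm (bt c eta - d2 eta))^2 + ka / 2 * (norm (c eta))^2" for c eta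
 have jint: "intb (%eta. (1 + ?P eta) * (norm (bt c eta - d1 eta))^2)" "intb (%eta. (norm (bt c eta - d2 eta))^2)" "intb (%eta. (norm (c eta))^2)"
 if c: "good K c" for c
 proof -
 have g: "good UNIV (%eta. bt c eta - d1 eta)" by (intro gU good_diff gbt good c)
 have "good UNIV (%eta. cor (1 + ?P eta) * (bt c eta - d1 eta))"
 by (rule good_mult_continuous[OF g]) (intro continuous_intros continuous_taylor_poly)
 from integrable_Re[OF ip_integrable[OF good_L2[OF this] good_L2[OF g]]]
 show "intb (%eta. (1 + ?P eta) * (norm (bt c eta - d1 eta))^2)"
 proof (rule Bochner_Integration.integrable_cong[THEN iffD1, OF refl, rotated])
 fix eta
 have "cor (1 + ?P eta) * (bt c eta - d1 eta) * cnj (bt c eta - d1 eta) = cor ((1 + ?P eta) * (norm (bt c eta - d1 eta))^2)"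
 by (simp only: of_real_mult complex_norm_square mult.assoc)
 then show "Re (cor (1 + ?P eta) * (bt c eta - d1 eta) * cnj (bt c eta - d1 eta)) = (1 + ?P eta) * (norm (bt c eta - d1 eta))^2"
 by (simp only: Re_complex_of_real)
 qed
 show "intb (%eta. (norm (bt c eta - d2 eta))^2)"
 by (rule L2_integrable_sq[OF good_L2[OF good_diff[OF gbt[OF c] good(3)]]])
 show "intb (%eta. (norm (c eta))^2)" by (rule L2_integrable_sq[OF good_L2[OF c]])
 qed
 have cost: "cost mu1 mu2 ka (eff_energy T eps M) yd1 yd2 (w, z) = (LI eta. j c eta)"
 if c: "good K c" and w: "w : L2" "AEL x. cplx w x = ?W c x"
 and z: "solves_effective T eps M (%x. f x + w x) z" for w c z
 proof -
 note st = state[OF c w z]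
 have d: "AEL x. cplx (%x. z x - yd x) x = ?W (%eta. bt c eta - d eta) x"
 if "good K d" "AEL x. cplx yd x = ?W d x" for yd d
 using fourier.synth_diff[OF gU[OF gbt[OF c]] gU[OF that(1)]] st(2) that(2) by eventually_elim simp
 have 1: "eff_energy T eps M (%x. z x - yd1 x) = (LI eta. (1 + ?P eta) * (norm (bt c eta - d1 eta))^2)"
 by (rule eff_energy_synth[OF gU[OF good_diff[OF gbt[OF c] good(2)]] L2_diff[OF st(1) data(3)] d[OF good(2) data(4)]])
 have 2: "(LI x. (z x - yd2 x)^2) = (LI eta. (norm (bt c eta - d2 eta))^2)"
 using sq[OF L2_diff[OF st(1) data(5)] good_diff[OF gbt[OF c] good(3)] d[OF good(3) data(6)]] by (simp add: L2norm_sq)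
 have 3: "(LI x. (w x)^2) = (LI eta. (norm (c eta))^2)" using sq[OF w(1) c w(2)] by (simp add: L2norm_sq)
 show ?thesis unfolding cost_def j_def using jint[OF c] by (simp add: 1 2 3)
 qed
 have ji: "intb (j c)" if "good K c" for c
 unfolding j_def[abs_def] using jint[OF that] by (intro Bochner_Integration.integrable_add integrable_mult_right)
 let ?e = "%eta. b eta - a eta"
 have ge: "good K ?e" by (intro good_diff good)
 define q where "q eta = (mu1 / 2 * p eta + mu2 / 2 * (p eta)^2 + ka / 2) * (norm (?e eta))^2" for eta
 let ?G = "red_grad mu1 mu2 ka F d1 d2 p a"
 have GL2: "?G : L2" using good by (intro red_grad_L2 p01 pm) auto
 have jexp: "j (%eta. a eta + of_real t * ?e eta) eta = j a eta + t * Re (?G eta * cnj (?e eta)) + t^2 * q eta" for t eta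
 proof -
 have nsq: "(norm (x + of_real s * y))^2 = (norm x)^2 + 2 * s * Re (x * cnj y) + s^2 * (norm y)^2" for x y :: complex and s :: real
 by (simp only: cmod_power2) (simp add: power2_eq_square algebra_simps)
 have btt: "bt (%eta. a eta + of_real t * ?e eta) eta - d eta = (bt a eta - d eta) + of_real (t * p eta) * ?e eta" for d
 by (simp add: bt_def algebra_simps)
 have ze: "?e eta = 0" if "eta \<notin> K" using good_off[OF ge that] .
 have "j (%eta. a eta + of_real t * ?e eta) eta
 = j a eta + t * (mu1 * ((1 + ?P eta) * p eta) * Re ((bt a eta - d1 eta) * cnj (?e eta)) + mu2 * p eta * Re ((bt a eta - d2 eta) * cnj (?e eta)) + ka * Re (a eta * cnj (?e eta)))
 + t^2 * ((mu1 / 2 * ((1 + ?P eta) * p eta) * p eta + mu2 / 2 * (p eta)^2 + ka / 2) * (norm (?e eta))^2)"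
 unfolding j_def btt nsq power_mult_distrib by (simp add: algebra_simps power2_eq_square)
 also have "(mu1 * ((1 + ?P eta) * p eta) * Re ((bt a eta - d1 eta) * cnj (?e eta)) + mu2 * p eta * Re ((bt a eta - d2 eta) * cnj (?e eta)) + ka * Re (a eta * cnj (?e eta)))
 = Re (?G eta * cnj (?e eta))"
 proof (cases "eta : K")
 case True
 have "?G eta * cnj (?e eta) = of_real mu1 * ((bt a eta - d1 eta) * cnj (?e eta)) + of_real (mu2 * p eta) * ((bt a eta - d2 eta) * cnj (?e eta)) + of_real ka * (a eta * cnj (?e eta))"
 by (simp add: red_grad_def bt_def algebra_simps)
 then have "Re (?G eta * cnj (?e eta)) = mu1 * Re ((bt a eta - d1 eta) * cnj (?e eta)) + mu2 * p eta * Re ((bt a eta - d2 eta) * cnj (?e eta)) + ka * Re (a eta * cnj (?e eta))"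
 by (simp only: plus_complex.sel times_complex.sel[of "of_real _"] Re_complex_of_real Im_complex_of_real mult_zero_left diff_zero)
 then show ?thesis unfolding pP using True by simp
 qed (simp add: ze)
 also have "(mu1 / 2 * ((1 + ?P eta) * p eta) * p eta + mu2 / 2 * (p eta)^2 + ka / 2) * (norm (?e eta))^2 = q eta"
 unfolding q_def pP by (cases "eta : K") (simp_all add: ze)
 finally show ?thesis .
 qed
 have qi: "intb q"
 proof -
 have "intb (%eta. (\<bar>mu1\<bar> + \<bar>mu2\<bar> + \<bar>ka\<bar>) * (norm (?e eta))^2)" by (intro integrable_mult_right L2_integrable_sq good_L2[OF ge])
 then show ?thesis
 proof (rule Bochner_Integration.integrable_bound)
 have [measurable]: "?e : BM" using good_L2[OF ge] by auto
 show "q : borel_measurable lborel" unfolding q_def[abs_def] by measurable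
 show "AEL eta. norm (q eta) <= norm ((\<bar>mu1\<bar> + \<bar>mu2\<bar> + \<bar>ka\<bar>) * (norm (?e eta))^2)"
 proof (rule AE_I2)
 fix eta
 have pp: "(p eta)^2 <= 1" using p01 by (simp add: power_le_one)
 have "\<bar>mu1 / 2 * p eta + mu2 / 2 * (p eta)^2 + ka / 2\<bar> <= \<bar>mu1 / 2 * p eta\<bar> + \<bar>mu2 / 2 * (p eta)^2\<bar> + \<bar>ka / 2\<bar>" by linarith
 also have "... <= \<bar>mu1\<bar> * 1 + \<bar>mu2\<bar> * 1 + \<bar>ka\<bar>"
 unfolding abs_mult using p01[of eta] pp by (intro add_mono mult_mono) auto
 finally show "norm (q eta) <= norm ((\<bar>mu1\<bar> + \<bar>mu2\<bar> + \<bar>ka\<bar>) * (norm (?e eta))^2)"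
 unfolding q_def by (simp add: abs_mult mult_right_mono)
 qed
 qed
 qed
 have Gi: "intb (%eta. Re (?G eta * cnj (?e eta)))" by (intro integrable_Re ip_integrable GL2 good_L2[OF ge])
 have ReG: "Re (ip ?G ?e) = (LI eta. Re (?G eta * cnj (?e eta)))"
 unfolding ip_def by (rule integral_Re[symmetric]) (intro ip_integrable GL2 good_L2[OF ge])
 have uy: "u : V" "solves_effective T eps M (%x. f x + u x) y"
 and min: "!!w z. w : V ==> solves_effective T eps M (%x. f x + w x) z ==>
 cost mu1 mu2 ka (eff_energy T eps M) yd1 yd2 (u, y) <= cost mu1 mu2 ka (eff_energy T eps M) yd1 yd2 (w, z)"
 using opt unfolding optimal_effective_def is_arg_min_def by (auto simp: not_less)
 show "0 <= Re (ip ?G ?e)"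
 proof (rule quadratic_first_order)
 fix t :: real assume t: "0 < t" "t <= 1"
 let ?ut = "%x. (1 - t) * u x + t * v x" and ?at = "%eta. a eta + of_real t * ?e eta"
 have gat: "good K ?at" by (intro good_add good_scale ge good)
 have utL2: "?ut : L2" using u v by (intro L2_add L2_mult_const)
 have utW: "AEL x. cplx ?ut x = ?W ?at x"
 using fourier.synth_add[OF gU[OF good(4)] gU[OF good_scale[OF ge, of "of_real t"]]] fourier.synth_diff[OF gU[OF good(5)] gU[OF good(4)]] u(2) v(2)
 proof eventually_elim
 case (elim x)
 have "?W ?at x = ?W a x + of_real t * (?W b x - ?W a x)" unfolding elim(1) fourier.synth_scale elim(2) ..
 then show ?case using elim(3,4) by (simp add: algebra_simps)
 qed
 define zt where "zt x = Re (?W (bt ?at) x)" for x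
 have zt: "solves_effective T eps M (%x. f x + ?ut x) zt"
 unfolding zt_def[abs_def]
 by (rule solves_effective_synth[OF gU[OF gbt[OF gat]]]) (use fw[OF gat utW] in "simp only: Pbt[OF gat]")
 have "(LI eta. j a eta) <= (LI eta. j ?at eta)"
 using min[OF seg zt] t cost[OF good(4) u uy(2)] cost[OF gat utL2 utW zt] by simp
 also have "... = (LI eta. j a eta) + t * Re (ip ?G ?e) + t^2 * (LI eta. q eta)"
 unfolding jexp ReG using ji[OF good(4)] Gi qi by simp
 finally show "0 <= t * Re (ip ?G ?e) + t^2 * (LI eta. q eta)" by simp
 qed
qed

section \<open>Periodic functions and their gradients\<close>

abbreviation Yc :: "(real^'n::finite) set" where "Yc \<equiv> cell 0 1"

abbreviation (input) int_Yc :: "(real^'n::finite => 'b::{banach,second_countable_topology}) => 'b" (binder "LY " [10] 60) where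
 "int_Yc f \<equiv> set_lebesgue_integral lborel Yc f"

lemma Y_periodic_lper:
 fixes v :: "real^'n::finite => 'b"
 assumes "Y_periodic v" shows "lper 1 v"
proof -
 define P where "P k \<longleftrightarrow> (AEL x. v (x + k) = v x)" for k
 have add: "P (k + l)" if "P k" "P l" for k l
 using AE_translate[of _ l, OF that(1)[unfolded P_def]] that(2)[unfolded P_def] unfolding P_def
 by eventually_elim (simp add: add_ac)
 have neg: "P (- k)" if "P k" for k
 using AE_translate[of _ "- k", OF that[unfolded P_def]] unfolding P_def by eventually_elim simp
 have P0: "P 0" by (simp add: P_def)
 have ax: "P (axis i 1)" for i using assms by (simp add: P_def Y_periodic_def)
 have nat: "P (axis i (real m))" for i m
 proof (induction m)
 case (Suc m)
 have "axis i (real (Suc m)) = axis i (real m) + (axis i 1 :: real^'n)" by (vector axis_def)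
 then show ?case using add[OF Suc ax] by simp
 qed (use P0 in "simp add: axis_def zero_vec_def[symmetric] cong: if_cong")
 have int: "P (axis i (of_int m))" for i m
 proof (cases "0 <= m")
 case True then show ?thesis using nat[of i "nat m"] by simp
 next
 case False
 have "axis i (of_int m) = - (axis i (real (nat (- m))) :: real^'n)" using False by (vector axis_def)
 then show ?thesis using neg[OF nat[of i "nat (- m)"]] by simp
 qed
 have "P k" if "k : lattice 1" for k
 proof -
 have "\<forall>i. \<exists>m::int. k $ i = of_int m" using that by (simp add: lattice_def)
 from choice[OF this] obtain m :: "'n => int" where m: "!!i. k $ i = of_int (m i)" by blast
 have "P (\<Sum>i\<in>I. axis i (of_int (m i)))" if "finite I" for I
 using that by (induction I) (auto intro: P0 add int)
 moreover have "(SU i. axis i (of_int (m i))) = k" by (simp add: vec_eq_iff m axis_def if_distrib cong: if_cong)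
 ultimately show ?thesis by (metis finite)
 qed
 then show ?thesis unfolding lper_def P_def by (simp add: AE_ball_countable)
qed

lemma Ycell_cbox: "Ycell = cbox 0 (1 :: real^'n::finite)"
 by (auto simp: Ycell_def mem_box_cart)

lemma Ycell_unit_cell: "AEL x. x : Ycell \<longleftrightarrow> x : (Yc :: (real^'n::finite) set)"
proof -
 note Y = Ycell_cbox[where 'n='n]
 have "emeasure lborel (cbox 0 (1 :: real^'n)) = ennreal (\<Prod>b\<in>Basis. (1 - 0 :: real^'n) \<bullet> b)"
 by (rule emeasure_lborel_cbox) (auto simp: Basis_vec_def inner_axis)
 also have "(\<Prod>b\<in>Basis. (1 - 0 :: real^'n) \<bullet> b) = 1" by (rule prod.neutral) (auto simp: Basis_vec_def inner_axis)
 finally have "emeasure lborel (Ycell - Yc :: (real^'n) set) = 0"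
 using emeasure_Diff[of lborel "Yc :: (real^'n) set" Ycell] emeasure_cell[of 1 0, where 'n='n]
 by (simp add: Y) (force simp: cell_def mem_box_cart less_imp_le)
 then have "AEL x. x \<notin> (Ycell - Yc :: (real^'n) set)"
 by (intro AE_not_in null_setsI) (auto simp: Y)
 then show ?thesis by eventually_elim (auto simp: Ycell_def cell_def less_imp_le)
qed

lemma Ycell_measurable [measurable]: "Ycell : sets (borel :: (real^'n::finite) measure)"
 unfolding Ycell_cbox by (rule borel_closed) (rule closed_cbox)

lemma indicator_Ycell: "AEL x. ind Ycell x = (ind Yc x :: 'b::zero_neq_one)"
 using Ycell_unit_cell by eventually_elim (simp add: indicator_def)

lemma set_integral_Ycell:
 fixes h :: "real^'n::finite => 'b::{banach,second_countable_topology}"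
 assumes [measurable]: "h : BM"
 shows "(LINT x:Ycell|lborel. h x) = (LY x. h x)"
 unfolding slint_def
 by (rule integral_cong_AE, measurable) (use indicator_Ycell[where 'b=real] in eventually_elim, simp)

text \<open>The space \<open>L2per\<close>, with the closed cell replaced by a half-open one that tiles the space exactly.\<close>

definition cell_L2 :: "(real^'n::finite => complex) => bool" where
 "cell_L2 v \<longleftrightarrow> v : BM & lper 1 v & (%x. ind Yc x *R v x) : L2"

lemma cell_L2_measurable [measurable_dest]: "cell_L2 v ==> v : BM"
 by (simp add: cell_L2_def)

lemma L2_on_Ycell:
 fixes v :: "real^'n::finite => complex"
 shows "v : L2_on Ycell \<longleftrightarrow> v : BM & (%x. ind Yc x *R v x) : L2"
proof -
 have "v : BM ==> (%x. ind Ycell x *R v x) : L2 \<longleftrightarrow> (%x. ind Yc x *R v x) : L2"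
 proof
 assume [measurable]: "v : BM"
 have e: "AEL x. ind Ycell x *R v x = ind Yc x *R v x"
 using indicator_Ycell[where 'b=real] by eventually_elim simp
 show "(%x. ind Yc x *R v x) : L2" if "(%x. ind Ycell x *R v x) : L2"
 by (rule L2_cong_AE[OF that e]) measurable
 show "(%x. ind Ycell x *R v x) : L2" if "(%x. ind Yc x *R v x) : L2"
 by (rule L2_cong_AE[OF that]) (use e in "auto elim: eventually_mono")
 qed
 then show ?thesis using L2_on_iff[OF Ycell_measurable, of v] by metis
qed

lemma L2per_cell_L2: "v : L2per ==> cell_L2 v"
 unfolding L2per_def cell_L2_def by (auto simp: L2_on_Ycell Y_periodic_lper)

lemma cell_L2_L2per: "cell_L2 v ==> v : L2per"
 unfolding L2per_def cell_L2_def L2_on_Ycell Y_periodic_def lper_def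
 by (auto elim!: eventually_mono) (metis lattice_axis)

lemma cell_L2_integrable:
 fixes v w :: "real^'n::finite => complex"
 assumes "cell_L2 v" "cell_L2 w"
 shows "intb (%x. ind Yc x *R (v x * w x))" "set_integrable lborel Yc v"
proof -
 have "intb (%x. (ind Yc x *R v x) * (ind Yc x *R w x))"
 using assms by (intro L2_integrable_mult) (auto simp: cell_L2_def)
 then show "intb (%x. ind Yc x *R (v x * w x))"
 by (rule Bochner_Integration.integrable_cong[THEN iffD1, rotated 2]) (auto simp: indicator_def)
 have "(%x. ind (Yc :: (real^'n) set) x *R (1::complex)) : L2"
 by (rule L2_indicator_bounded) (auto dest: cell_bounded)
 then have "intb (%x. (ind Yc x *R v x) * (ind Yc x *R 1))"
 using assms by (intro L2_integrable_mult) (auto simp: cell_L2_def)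
 then show "set_integrable lborel Yc v" unfolding set_integrable_def
 by (rule Bochner_Integration.integrable_cong[THEN iffD1, rotated 2]) (auto simp: indicator_def)
qed

lemma cell_L2_mult_bounded:
 assumes v: "cell_L2 v" and g[measurable]: "g : BM" and "lper 1 g" and b: "AEL x. norm (g x) <= c"
 shows "cell_L2 (%x. g x * v x)"
 unfolding cell_L2_def
proof (intro conjI)
 note [measurable] = v[THEN cell_L2_measurable]
 show "(%x. g x * v x) : BM" by measurable
 show "lper 1 (%x. g x * v x)" using assms by (intro lper_comp2[of 1 g v "(*)"]) (auto simp: cell_L2_def)
 show "(%x. ind Yc x *R (g x * v x)) : L2"
 proof (rule L2_bound)
 show "(%x. ind Yc x *R v x) : L2" using v by (simp add: cell_L2_def)
 show "AEL x. norm (ind Yc x *R (g x * v x)) <= c * norm (ind Yc x *R v x)"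
 using b by eventually_elim (simp add: norm_mult indicator_def mult_right_mono)
 qed measurable
qed

lemma cell_L2_add: "cell_L2 v ==> cell_L2 w ==> cell_L2 (%x. v x + w x)"
 unfolding cell_L2_def scaleR_add_right using lper_comp2[of 1 v w "(+)"] by (auto intro!: L2_add)

lemma cell_L2_scale: "cell_L2 v ==> cell_L2 (%x. c * v x)"
 unfolding cell_L2_def using lper_comp[of 1 v "(*) c"] L2_mult_const[of "%x. ind Yc x *R v x" c]
 by (auto simp: mult_scaleR_right)

lemma cell_L2_zero: "cell_L2 (%x. 0)"
 by (simp add: cell_L2_def lper_def)

lemma cell_L2_sum: "(!!i. i : I ==> cell_L2 (v i)) ==> cell_L2 (%x. \<Sum>i\<in>I. v i x)"
 by (induction I rule: infinite_finite_induct) (auto intro: cell_L2_add cell_L2_zero)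

text \<open>Fubini, together with translation invariance of the cell integral of a periodic function.\<close>

lemma average_translates:
 fixes p :: "real^'n::finite => complex"
 assumes p[measurable]: "p : BM" and per: "lper 1 p" and i: "set_integrable lborel Yc p"
 and psi: "intb (psi :: real^'n => real)"
 shows "(LINT y:Yc|lborel. LI z. psi z *R p (z + y)) = (LI z. psi z) *R (LY x. p x)"
proof -
 have [measurable]: "psi : BM" using psi by auto
 have c: "set_integrable lborel Yc (%y. h (z + y)) & (LINT y:Yc|lborel. h (z + y)) = (LINT y:Yc|lborel. h y)"
 if [measurable]: "h : BM" and h: "lper 1 h" "set_integrable lborel Yc h" for h :: "real^'n => complex" and z
 proof -
 let ?D = "{x. x + (- z) : (Yc :: (real^'n) set)}"
 note t = tiles_cell[of 1 0] tiles_translate[OF tiles_cell[of 1 0], of "- z", simplified]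
 have D[measurable]: "?D : sets borel" using tiles_measurable[OF t(2)] by simp
 have iD: "set_integrable lborel ?D h" by (rule set_integrable_tiles[OF t(1) _ _ h]) (use t in auto)
 have e: "ind ?D (y + z) *R h (y + z) = ind Yc y *R h (z + y)" for y by (simp add: indicator_def add.commute)
 show ?thesis
 using integrable_translate[OF iD[unfolded set_integrable_def], of z] integral_translate[of "%x. ind ?D x *R h x" z]
 set_integral_tiles[OF t(1) _ _ h, of ?D] t(2) unfolding e set_integrable_def slint_def by simp
 qed
 let ?f = "%(z, y). ind Yc y *R (psi z *R p (z + y))"
 have n: "lper 1 (%x. cor (norm (p x)))" "set_integrable lborel Yc (%x. cor (norm (p x)))"
 proof -
 show "lper 1 (%x. cor (norm (p x)))" using per by (rule lper_comp)
 have "complex_integrable lborel (%x. cor (ind Yc x * norm (p x)))"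
 using set_integrable_norm[OF i] unfolding set_integrable_def by (intro integrable_of_real) simp
 then show "set_integrable lborel Yc (%x. cor (norm (p x)))"
 by (simp add: set_integrable_def scaleR_conv_of_real)
 qed
 have nm: "(%x. cor (norm (p x))) : BM" by measurable
 have "integrable (lborel \<Otimes>\<^sub>M lborel) ?f"
 proof (rule lborel_pair.Fubini_integrable)
 have "(LI y. norm (?f (z, y))) = \<bar>psi z\<bar> * Re (LY x. cor (norm (p x)))" for z
 proof -
 have "(LI y. norm (?f (z, y))) = (LI y. \<bar>psi z\<bar> * Re (ind Yc y *R cor (norm (p (z + y)))))"
 by (intro Bochner_Integration.integral_cong) (auto simp: indicator_def)
 also have "... = \<bar>psi z\<bar> * Re (LINT y:Yc|lborel. cor (norm (p (z + y))))"
 by (simp only: slint_def integral_mult_right_zero integral_Re[OF c[OF nm n, THEN conjunct1, unfolded set_integrable_def]])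
 finally show ?thesis using c[OF _ n, of z] by simp
 qed
 then show "intb (%z. LI y. norm (?f (z, y)))" using psi by simp
 show "AEL z. intb (%y. ?f (z, y))"
 proof (rule AE_I2)
 fix z
 have "intb (%y. psi z *R (ind Yc y *R p (z + y)))"
 using c[OF p per i, of z] unfolding set_integrable_def by (intro integrable_scaleR_right) simp
 then show "intb (%y. ?f (z, y))" by (simp add: mult.commute)
 qed
 qed measurable
 from lborel_pair.Fubini_integral[OF this]
 have "(LI y. LI z. ?f (z, y)) = (LI z. LI y. ?f (z, y))" by simp
 also have "... = (LI z. psi z *R (LY x. p x))"
 proof (rule Bochner_Integration.integral_cong[OF refl])
 fix z
 have "(LI y. ?f (z, y)) = (LI y. psi z *R (ind Yc y *R p (z + y)))" by (simp add: mult.commute)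
 then show "(LI y. ?f (z, y)) = psi z *R (LY x. p x)"
 using c[OF p per i, of z] unfolding slint_def set_integrable_def
 by (simp only: integral_scaleR_right)
 qed
 also have "(LI y. LI z. ?f (z, y)) = (LINT y:Yc|lborel. LI z. psi z *R p (z + y))"
 unfolding slint_def by (simp only: prod.case integral_scaleR_right)
 finally show ?thesis using psi by simp
qed

text \<open>
 Testing with all translates of one test function and averaging turns the weak derivative on the
 whole space into one on the torus; in particular a periodic weak derivative has mean zero.
\<close>

lemma periodic_weak_deriv_mean:
 fixes v g :: "real^'n::finite => complex"
 assumes v: "cell_L2 v" and g: "cell_L2 g" and d: "has_weak_deriv [i] v g"
 shows "(LY x. g x) = 0"
proof -
 obtain phi :: "real^'n => real" where phi: "test_fun phi" "(LI x. phi x) ~= 0"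
 proof (rule ccontr)
 note phi = that
 assume a: "\<not> thesis"
 have "AE x::real^'n in lborel. (1::real) = 0"
 proof (rule test_fun_separating)
 show "loc_integrable (%x::real^'n. 1::real)"
 unfolding loc_integrable_def set_integrable_def by (auto intro!: integrable_real_indicator emeasure_bounded_finite)
 show "(LI x. phi x *R (1::real)) = 0" if "test_fun phi" for phi :: "real^'n => real"
 using a phi that by auto
 qed
 then have "AE x::real^'n in lborel. x \<notin> Yc" by eventually_elim simp
 then show False using AE_iff_measurable[of "Yc :: (real^'n) set" lborel] emeasure_cell[of 1 0, where 'n='n] by simp
 qed
 have t: "(LI z. part_deriv i phi z *R v (z + y)) = - (LI z. phi z *R g (z + y))" for y
 using has_weak_deriv_affine[OF d, of 1 y] phi(1) by (simp add: has_weak_deriv_def)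
 have "(LI z. phi z) *R (LY x. g x) = (LINT y:Yc|lborel. LI z. phi z *R g (z + y))"
 using average_translates[OF _ _ cell_L2_integrable(2)[OF g g] test_fun_integrable[OF phi(1)]] g by (simp add: cell_L2_def)
 also have "... = - (LINT y:Yc|lborel. LI z. part_deriv i phi z *R v (z + y))"
 unfolding t slint_def by simp
 also have "... = 0"
 using average_translates[OF _ _ cell_L2_integrable(2)[OF v v] test_fun_integrable[OF test_fun_part[OF phi(1)]]] v
 by (simp add: cell_L2_def integral_part_deriv_test[OF phi(1)])
 finally show ?thesis using phi(2) by simp
qed

lemma cell_L2_plane_wave:
 assumes "cell_L2 v" "k : lattice 1"
 shows "cell_L2 (%x. v x * pw k x)"
 using cell_L2_mult_bounded[OF assms(1) measurable_plane_wave, of k 1] lper_plane_wave[OF assms(2)] by (simp add: mult.commute)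

text \<open>A weak derivative has mean zero; apply this to the product of \<open>v\<close> with an exponential.\<close>

lemma periodic_weak_deriv_coeff:
 fixes v g :: "real^'n::finite => complex"
 assumes v: "cell_L2 v" and g: "cell_L2 g" and d: "has_weak_deriv [i] v g" and k: "k : lattice 1"
 shows "(LY x. g x * pw k x) = - Dmult i k * (LY x. v x * pw k x)"
proof -
 note vk = cell_L2_plane_wave[OF v k] and gk = cell_L2_plane_wave[OF g k]
 have e: "(g x + Dmult i k * v x) * pw k x = g x * pw k x + Dmult i k * (v x * pw k x)" for x
 by (simp add: algebra_simps)
 have "(LY x. g x * pw k x + Dmult i k * (v x * pw k x)) = 0"
 by (rule periodic_weak_deriv_mean[OF vk cell_L2_add[OF gk cell_L2_scale[OF vk]]])
 (use has_weak_deriv_plane_wave_mult[OF d, of k] in "simp only: e")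
 then have "(LY x. g x * pw k x) + Dmult i k * (LY x. v x * pw k x) = 0"
 unfolding set_integral_add(2)[OF cell_L2_integrable(2)[OF gk gk] cell_L2_integrable(2)[OF cell_L2_scale[OF vk] vk]] by simp
 then show ?thesis by (simp only: mult_minus_left eq_neg_iff_add_eq_0)
qed

text \<open>
 Choose for each parameter, measurably, the first index after which the sequence stays
 within \<open>2\<^sup>-\<^sup>j\<close>; along these indices it converges almost everywhere.
\<close>

lemma measurable_L2_limit:
 fixes F :: "nat => real^'n::finite => real^'n => complex"
 assumes F[measurable]: "!!N. (%(th, x). F N th x) : borel_measurable (borel \<Otimes>\<^sub>M borel)"
 and per: "!!N th x k. k : lattice 1 ==> F N th (x + k) = F N th x"
 and g: "!!th. cell_L2 (g th)"
 and lim: "!!th. (%N. \<integral>\<^sup>+x. ennreal ((norm (F N th x - g th x))^2) * ind Yc x \<partial>lborel) ----> 0"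
 obtains G where "(%(th, x). G th x) : borel_measurable (borel \<Otimes>\<^sub>M borel)" "!!th. AEL x. G th x = g th x"
proof -
 have F1[measurable]: "F N th : BM" for N th using measurable_Pair2[OF F[of N], of th] by simp
 have g1[measurable]: "g th : BM" for th using g by (simp add: cell_L2_def)
 define D where "D N M th = (NI x. ennreal ((norm (F N th x - F M th x))^2) * ind Yc x)" for N M th
 define e where "e N th = (NI x. ennreal ((norm (F N th x - g th x))^2) * ind Yc x)" for N th
 have Dm[measurable]: "D N M : BM" for N M unfolding D_def[abs_def] by measurable
 have sq: "ennreal ((norm (a - b))^2) <= 2 * ennreal ((norm (a - c))^2) + 2 * ennreal ((norm (b - c))^2)" for a b c :: complex
 proof -
 have "(norm (a - b))^2 <= (norm (a - c) + norm (b - c))^2"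
 using norm_triangle_ineq4[of "a - c" "b - c"] by (intro power_mono) auto
 also have "... <= 2 * (norm (a - c))^2 + 2 * (norm (b - c))^2"
 using sum_squares_bound[of "norm (a - c)" "norm (b - c)"] by (simp add: power2_sum)
 finally have "ennreal ((norm (a - b))^2) <= ennreal (2 * (norm (a - c))^2 + 2 * (norm (b - c))^2)" by (rule ennreal_leI)
 then show ?thesis by (simp add: ennreal_plus ennreal_mult)
 qed
 have int_sq: "(NI x. ennreal ((norm (a x - b x))^2) * ind Yc x)
 <= 2 * (NI x. ennreal ((norm (a x - c x))^2) * ind Yc x) + 2 * (NI x. ennreal ((norm (b x - c x))^2) * ind Yc x)"
 if [measurable]: "a : BM" "b : BM" "c : BM" for a b c :: "real^'n => complex"
 proof -
 have "(NI x. ennreal ((norm (a x - b x))^2) * ind Yc x)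
 <= (NI x. 2 * (ennreal ((norm (a x - c x))^2) * ind Yc x) + 2 * (ennreal ((norm (b x - c x))^2) * ind Yc x))"
 by (rule nn_integral_mono) (use sq in "auto simp: indicator_def")
 then show ?thesis by (simp add: nn_integral_add nn_integral_cmult)
 qed
 have four: "2 * ennreal a + 2 * ennreal a = ennreal (4 * a)" for a
 proof -
 have "2 * ennreal a + 2 * ennreal a = 4 * ennreal a" by (simp flip: distrib_right)
 then show ?thesis by (simp add: ennreal_mult' flip: ennreal_numeral)
 qed
 have tail: "\<exists>n. \<forall>M\<ge>n. e M th <= c" if "0 < c" for c th
 using order_tendstoD(2)[OF lim[of th] that] unfolding eventually_sequentially e_def by (meson less_imp_le)
 define n where "n j th = (LEAST N. \<forall>M\<ge>N. D N M th <= ennreal ((1/2)^j))" for j th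
 have nm: "n j : measurable borel (count_space UNIV)" for j
 unfolding n_def[abs_def] by (intro measurable_Least) measurable
 have n: "\<forall>M\<ge>n j th. D (n j th) M th <= ennreal ((1/2)^j)" for j th
 unfolding n_def
 proof (rule LeastI_ex)
 obtain N where N: "!!M. M >= N ==> e M th <= ennreal ((1/2)^j / 4)" using tail[of "ennreal ((1/2)^j / 4)" th] by auto
 have "D N M th <= ennreal ((1/2)^j)" if "M >= N" for M
 proof -
 have "D N M th <= 2 * e N th + 2 * e M th" unfolding D_def e_def by (rule int_sq) measurable
 also have "... <= 2 * ennreal ((1/2)^j / 4) + 2 * ennreal ((1/2)^j / 4)" using N that by (intro add_mono mult_left_mono) auto
 finally show ?thesis unfolding four by simp
 qed
 then show "\<exists>N. \<forall>M\<ge>N. D N M th <= ennreal ((1/2)^j)" by blast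
 qed
 have en: "e (n j th) th <= ennreal (4 * (1/2)^j)" for j th
 proof -
 obtain N where N: "!!M. M >= N ==> e M th <= ennreal ((1/2)^j)" using tail[of "ennreal ((1/2)^j)" th] by auto
 let ?M = "max N (n j th)"
 have "e (n j th) th <= 2 * D (n j th) ?M th + 2 * e ?M th"
 using int_sq[of "F (n j th) th" "g th" "F ?M th"] unfolding D_def e_def by (simp add: norm_minus_commute)
 also have "... <= 2 * ennreal ((1/2)^j) + 2 * ennreal ((1/2)^j)" using N n[of j th] by (intro add_mono mult_left_mono) auto
 finally show ?thesis unfolding four by simp
 qed
 define G where "G th x = lim (%j. F (n j th) th x)" for th x
 show thesis
 proof
 have "(%z. F (n j (fst z)) (fst z) (snd z)) : borel_measurable (borel \<Otimes>\<^sub>M borel)" for j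
 by (rule measurable_compose_countable[where g="%z. n j (fst z)"])
 (use F nm measurable_compose[OF measurable_fst nm] in "auto simp: case_prod_unfold")
 then show "(%(th, x). G th x) : borel_measurable (borel \<Otimes>\<^sub>M borel)"
 unfolding G_def case_prod_unfold by (intro borel_measurable_lim_metric)
 fix th
 let ?h = "%j x. ennreal ((norm (F (n j th) th x - g th x))^2)"
 have "(NI x. (\<Sum>j. ?h j x * ind Yc x)) = (\<Sum>j. e (n j th) th)"
 unfolding e_def by (rule nn_integral_suminf) measurable
 also have "... <= (\<Sum>j. ennreal (4 * (1/2)^j))" by (intro suminf_le en) auto
 also have "... < \<infinity>"
 proof -
 have "summable (%j. 4 * (1/2::real)^j)" by (intro summable_mult) simp
 then show ?thesis by (subst suminf_ennreal2) auto
 qed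
 finally have "AEL x. (\<Sum>j. ?h j x * ind Yc x) ~= \<infinity>" by (intro nn_integral_PInf_AE) auto
 moreover have "AEL x. \<forall>k\<in>lattice 1. g th (x + k) = g th x" using g[of th] by (simp add: cell_L2_def lper_def)
 ultimately have "AEL x. x : Yc --> (\<forall>k\<in>lattice 1. G th (x + k) = g th (x + k))"
 proof eventually_elim
 case (elim x)
 show ?case
 proof (intro impI ballI)
 fix k :: "real^'n" assume x: "x : Yc" and k: "k : lattice 1"
 have "(\<Sum>j. ?h j x) ~= \<infinity>" using elim(1) x by simp
 then have "summable (%j. (norm (F (n j th) th x - g th x))^2)" by (intro summable_suminf_not_top) auto
 then have "(%j. sqrt ((norm (F (n j th) th x - g th x))^2)) ----> sqrt 0"
 by (intro tendsto_real_sqrt summable_LIMSEQ_zero)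
 then have "(%j. F (n j th) th x) ----> g th x" by (simp add: tendsto_norm_zero_iff LIM_zero_iff)
 then show "G th (x + k) = g th (x + k)" unfolding G_def per[OF k] using elim(2) k by (simp add: limI)
 qed
 qed
 then show "AEL x. G th x = g th x" by (rule AE_unfold[OF tiles_cell, of 1, simplified])
 qed
qed

section \<open>Periodization\<close>

definition periodize :: "(real^'n::finite => complex) => real^'n => complex" where
 "periodize h x = infsum (%k. h (x + k)) (lattice 1)"

text \<open>Locally the lattice sum is finite, so it inherits integrability and weak derivatives from its terms.\<close>

lemma periodize_eq_sum:
 assumes "!!x. r < norm x ==> h x = 0" "norm x <= R"
 shows "periodize h x = (\<Sum>k\<in>{k : lattice 1. norm k <= R + r}. h (x + k))"
proof -
 have "h (x + k) = 0" if "\<not> norm k <= R + r" for k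
 using assms norm_triangle_ineq4[of "x + k" x] that by (intro assms(1)) simp
 then have "periodize h x = infsum (%k. h (x + k)) {k : lattice 1. norm k <= R + r}"
 unfolding periodize_def by (intro infsum_cong_neutral) auto
 then show ?thesis by (simp add: finite_lattice_bounded)
qed

lemma bdd_supp_common:
 assumes "bdd_supp f" "bdd_supp g"
 obtains r where "!!x. r < norm x ==> f x = 0" "!!x. r < norm x ==> g x = 0"
proof -
 obtain r1 r2 where "!!x. r1 < norm x ==> f x = 0" "!!x. r2 < norm x ==> g x = 0" using assms unfolding bdd_supp_def by blast
 then show ?thesis by (intro that[of "max r1 r2"]) auto
qed

lemma periodize_lin:
 assumes "bdd_supp f" "bdd_supp g"
 shows "periodize (%x. f x + c * g x) x = periodize f x + c * periodize g x"
proof -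
 obtain r where r: "!!x. r < norm x ==> f x = 0" "!!x. r < norm x ==> g x = 0" using bdd_supp_common[OF assms] by blast
 then have "!!x. r < norm x ==> f x + c * g x = 0" by simp
 note periodize_eq_sum[where x=x and R="norm x", OF this order_refl] periodize_eq_sum[where x=x and R="norm x", OF r(1) order_refl]
 periodize_eq_sum[where x=x and R="norm x", OF r(2) order_refl]
 then show ?thesis by (simp add: sum.distrib sum_distrib_left)
qed

lemma periodize_cnj:
 assumes "bdd_supp f" shows "periodize (%x. cnj (f x)) x = cnj (periodize f x)"
proof -
 obtain r where r: "!!x. r < norm x ==> f x = 0" using assms unfolding bdd_supp_def by blast
 then have "!!x. r < norm x ==> cnj (f x) = 0" by simp
 note periodize_eq_sum[where x=x and R="norm x", OF this order_refl] periodize_eq_sum[where x=x and R="norm x", OF r order_refl]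
 then show ?thesis by simp
qed

lemma periodize_shift:
 assumes "k : lattice 1" shows "periodize h (x + k) = periodize h x"
proof -
 have "bij_betw ((+) k) (lattice 1) (lattice 1)"
 by (rule bij_betw_byWitness[where f'="%l. l - k"]) (use assms in "auto intro: lattice_add lattice_diff")
 from infsum_reindex_bij_betw[OF this, of "%l. h (x + l)"] show ?thesis by (simp add: periodize_def add.assoc)
qed

lemma loc_integrable_sum_translates:
 fixes h :: "real^'n::finite => complex"
 assumes "loc_integrable h"
 shows "loc_integrable (%x. \<Sum>k\<in>L. h (x + k))"
proof (induction L rule: infinite_finite_induct)
 case (insert k L)
 then show ?case using loc_integrable_add[OF loc_integrable_affine[OF assms, of 1 k] insert.IH] by simp
qed (simp_all add: loc_integrable_def set_integrable_def)

lemma loc_integrable_periodize: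
 assumes h: "loc_integrable h" "bdd_supp h" shows "loc_integrable (periodize h)"
 unfolding loc_integrable_def
proof
 fix R
 obtain r where r: "!!x. r < norm x ==> h x = 0" using h(2) unfolding bdd_supp_def by blast
 have "set_integrable lborel (cball 0 R) (%x. \<Sum>k\<in>{k : lattice 1. norm k <= R + r}. h (x + k))"
 using loc_integrable_sum_translates[OF h(1)] unfolding loc_integrable_def by blast
 then show "set_integrable lborel (cball 0 R) (periodize h)"
 by (rule set_integrable_cong[THEN iffD1, rotated 3]) (simp_all add: periodize_eq_sum[OF r])
qed

lemma periodize_weak_deriv:
 fixes h p :: "real^'n::finite => complex"
 assumes d: "has_weak_deriv [i] h p" and b: "bdd_supp h" "bdd_supp p"
 shows "has_weak_deriv [i] (periodize h) (periodize p)"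
 unfolding has_weak_deriv_def
proof (intro conjI allI impI)
 have l: "loc_integrable h" "loc_integrable p" using d by (auto simp: has_weak_deriv_def)
 show "loc_integrable (periodize h)" "loc_integrable (periodize p)" by (intro loc_integrable_periodize l b)+
 fix phi :: "real^'n => real" assume phi: "test_fun phi"
 have "bdd_supp phi" "bdd_supp (part_deriv i phi)" using phi test_fun_part[OF phi, of i] by (auto simp: test_fun_iff)
 from bdd_supp_common[OF this] obtain R where R: "!!x. R < norm x ==> phi x = 0" "!!x. R < norm x ==> part_deriv i phi x = 0" by blast
 obtain r where r: "!!x. r < norm x ==> h x = 0" "!!x. r < norm x ==> p x = 0" using bdd_supp_common[OF b] by blast
 let ?L = "{k : lattice 1. norm k <= R + r} :: (real^'n) set"
 have "has_weak_deriv [i] (%x. \<Sum>k\<in>L. h (x + k)) (%x. \<Sum>k\<in>L. p (x + k))" for L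
 proof (induction L rule: infinite_finite_induct)
 case (insert k L)
 then show ?case using has_weak_deriv_add[OF has_weak_deriv_affine[OF d, of 1 k] insert.IH] by simp
 qed (simp_all add: has_weak_deriv_zero)
 note s = this[of ?L, unfolded has_weak_deriv_def, THEN conjunct2, THEN conjunct2, rule_format, OF phi]
 have e: "psi x *R periodize f x = psi x *R (\<Sum>k\<in>?L. f (x + k))"
 if "!!x. R < norm x ==> psi x = 0" "!!x. r < norm x ==> f x = 0" for psi f x
 using periodize_eq_sum[where h=f and r=r and R=R and x=x, OF that(2)] that(1)[of x] by (cases "norm x <= R") auto
 have "(LI x. iter_deriv [i] phi x *R periodize h x) = (LI x. iter_deriv [i] phi x *R (\<Sum>k\<in>?L. h (x + k)))"
 by (simp only: iter_deriv.simps e[where psi="part_deriv i phi" and f=h, OF R(2) r(1)])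
 also have "... = (- 1) ^ length [i] *R (LI x. phi x *R (\<Sum>k\<in>?L. p (x + k)))" by (rule s)
 also have "(LI x. phi x *R (\<Sum>k\<in>?L. p (x + k))) = (LI x. phi x *R periodize p x)"
 by (simp only: e[where psi=phi and f=p, OF R(1) r(2)])
 finally show "(LI x. iter_deriv [i] phi x *R periodize h x) = (- 1) ^ length [i] *R (LI x. phi x *R periodize p x)" .
qed

lemma L2_translate:
 assumes "h : L2" shows "(%x. h (x + k)) : L2"
 using assms integrable_translate[of "%x. (norm (h x))^2" k] unfolding L2_iff by auto

lemma cell_L2_periodize:
 fixes h :: "real^'n::finite => complex"
 assumes h: "h : L2" "bdd_supp h" shows "cell_L2 (periodize h)"
 unfolding cell_L2_def
proof (intro conjI)
 show m: "periodize h : BM"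
 by (rule loc_integrable_measurable[OF loc_integrable_periodize[OF L2_loc_integrable[OF h(1)] h(2)]])
 show "lper 1 (periodize h)" by (simp add: lper_def periodize_shift)
 obtain r where r: "!!x. r < norm x ==> h x = 0" using h(2) unfolding bdd_supp_def by blast
 have e: "ind Yc x *R periodize h x
 = ind Yc x *R (\<Sum>k\<in>{k : lattice 1. norm k <= real CARD('n) + r}. h (x + k))" for x :: "real^'n"
 using periodize_eq_sum[OF r, where x=x and R="real CARD('n)"] cell_bounded[of x 1] by (auto simp: indicator_def)
 show "(%x. ind Yc x *R periodize h x) : L2"
 unfolding e by (intro L2_indicator L2_sum L2_translate h) simp
qed

lemma cell_L2_local:
 fixes p :: "real^'n::finite => complex"
 assumes p: "cell_L2 p" shows "(%x. ind (cball 0 R) x *R p x) : L2"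
proof -
 note [measurable] = p[THEN cell_L2_measurable]
 interpret cell_kernel 1 "%eta x. if eta : Zscaled 1 then p x else 0"
 by unfold_locales (use p in "auto simp: cell_L2_def lper_def")
 have "wt 0 <= (NI x. ennreal ((norm (ind Yc x *R p x))^2))"
 unfolding wt_def by (auto simp: indicator_def intro!: nn_integral_mono)
 also have "... < \<infinity>" using p by (auto simp: cell_L2_def L2_nn_iff)
 finally have "(%x. ind (cball 0 R) x *R wave 0 x) : L2" by (rule wave_local_L2)
 moreover have "(0::real^'n) : Zscaled 1" by (simp add: Zscaled_def Zcell_def)
 ultimately show ?thesis by (simp add: wave_def)
qed

lemma cell_L2_mult_integrable:
 assumes p: "cell_L2 p" and h: "h : L2" "bdd_supp h"
 shows "intb (%x. p x * h x)"
proof -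
 obtain r where r: "!!x. r < norm x ==> h x = 0" using h(2) unfolding bdd_supp_def by blast
 have "intb (%x. (ind (cball 0 r) x *R p x) * h x)" by (intro L2_integrable_mult cell_L2_local p h)
 then show ?thesis by (rule Bochner_Integration.integrable_cong[THEN iffD1, rotated 2]) (use r in "auto simp: indicator_def")
qed

lemma periodize_unfold:
 fixes h p :: "real^'n::finite => complex"
 assumes p: "cell_L2 p" and h: "h : L2" "bdd_supp h"
 shows "(LY x. p x * periodize h x) = (LI x. p x * h x)"
proof -
 note [measurable] = p[THEN cell_L2_measurable] h(1)[THEN L2_measurable]
 obtain r where r: "!!x. r < norm x ==> h x = 0" using h(2) unfolding bdd_supp_def by blast
 let ?R = "real CARD('n)" and ?C = "Yc :: (real^'n) set"
 let ?L = "{k : lattice 1. norm k <= ?R + r} :: (real^'n) set"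
 have fin: "finite ?L" by (rule finite_lattice_bounded) simp
 have ph: "intb (%x. p x * h x)" by (rule cell_L2_mult_integrable[OF p h])
 have ip: "intb (%x. ind ?C (x - k) *R (p x * h x))" for k
 by (rule Bochner_Integration.integrable_bound[OF ph]) (auto simp: indicator_def)
 have tr: "AEL x. ind ?C x *R (p (x + k) * h (x + k)) = ind ?C x *R (p x * h (x + k))" if "k : ?L" for k
 using p that unfolding cell_L2_def lper_def by (auto elim!: eventually_mono)
 have it: "intb (%x. ind ?C x *R (p (x + k) * h (x + k)))" for k
 using integrable_translate[OF ip[of k], of k] by simp
 have "(LY x. p x * periodize h x) = (LI x. (\<Sum>k\<in>?L. ind ?C x *R (p x * h (x + k))))"
 unfolding slint_def
 proof (rule Bochner_Integration.integral_cong[OF refl])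
 fix x :: "real^'n"
 show "ind ?C x *R (p x * periodize h x) = (\<Sum>k\<in>?L. ind ?C x *R (p x * h (x + k)))"
 using periodize_eq_sum[OF r, where x=x and R="?R"] cell_bounded[of x 1] by (cases "x : ?C") (auto simp: sum_distrib_left)
 qed
 also have "... = (\<Sum>k\<in>?L. LI x. ind ?C x *R (p x * h (x + k)))"
 proof (rule Bochner_Integration.integral_sum)
 fix k assume "k : ?L"
 from tr[OF this] it[of k] show "intb (%x. ind ?C x *R (p x * h (x + k)))"
 by (subst integrable_cong_AE[of _ _ "%x. ind ?C x *R (p (x + k) * h (x + k))"]) (auto elim: eventually_mono)
 qed
 also have "... = (\<Sum>k\<in>?L. LI x. ind ?C (x - k) *R (p x * h x))"
 proof (rule sum.cong[OF refl])
 fix k assume k: "k : ?L"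
 have "(LI x. ind ?C x *R (p x * h (x + k))) = (LI x. ind ?C x *R (p (x + k) * h (x + k)))"
 by (rule integral_cong_AE, measurable) (use tr[OF k] in "auto elim: eventually_mono")
 also have "... = (LI x. ind ?C (x - k) *R (p x * h x))"
 using integral_translate[of "%x. ind ?C (x - k) *R (p x * h x)" k] by simp
 finally show "(LI x. ind ?C x *R (p x * h (x + k))) = (LI x. ind ?C (x - k) *R (p x * h x))" .
 qed
 also have "... = (LI x. (\<Sum>k\<in>?L. ind ?C (x - k) *R (p x * h x)))"
 by (rule Bochner_Integration.integral_sum[symmetric]) (rule ip)
 also have "... = (LI x. p x * h x)"
 proof (rule Bochner_Integration.integral_cong[OF refl])
 fix x
 show "(\<Sum>k\<in>?L. ind ?C (x - k) *R (p x * h x)) = p x * h x"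
 proof (cases "h x = 0")
 case False
 then have x: "norm x <= r" using r[of x] by linarith
 obtain l where l: "l : lattice 1" "x + l : ?C" "!!l'. l' : lattice 1 ==> x + l' : ?C ==> l' = l"
 using tiles_cell[of 1 0, where 'n='n] unfolding tiles_def by (metis zero_less_one)
 have "norm l <= ?R + r" using cell_bounded[OF l(2)] norm_triangle_ineq4[of "x + l" x] x by simp
 then have L: "- l : ?L" using l(1) by (simp add: lattice_uminus)
 have "ind ?C (x - k) = (if k = - l then 1 else (0::real))" if "k : ?L" for k
 using l(2) l(3)[of "- k"] lattice_uminus[of k 1] that by (auto simp: indicator_def)
 then have "(\<Sum>k\<in>?L. ind ?C (x - k) *R (p x * h x)) = (\<Sum>k\<in>?L. (if k = - l then 1 else (0::real)) *R (p x * h x))"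
 by (intro sum.cong) auto
 also have "... = p x * h x" using L fin by (simp add: if_distrib[of "%c. c *R _"] cong: if_cong)
 finally show ?thesis .
 qed simp
 qed
 finally show ?thesis .
qed

lemma scaled_cell_kernel:
 fixes V :: "real^'n::finite => real^'n => complex"
 assumes eps: "0 < eps" and V: "(%(th, x). V th x) : borel_measurable (borel \<Otimes>\<^sub>M borel)" "!!th. cell_L2 (V th)" "!!th x. th \<notin> Zcell ==> V th x = 0"
 defines "\<Psi> \<equiv> %eta x. V (eps *R eta) (x /\<^sub>R eps)"
 shows "cell_kernel eps \<Psi>"
 and "cell_kernel.wt eps \<Psi> eta = ennreal ((L2norm (%x. ind Yc x *R V (eps *R eta) x))^2)"
proof -
 interpret cell_kernel eps \<Psi>
 proof
 have "(%z. (case (eps *R fst z, snd z /\<^sub>R eps) of (th, x) => V th x)) : borel_measurable (borel \<Otimes>\<^sub>M borel)"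
 by (rule measurable_compose[OF _ V(1)]) measurable
 then show "(%(eta, x). \<Psi> eta x) : borel_measurable (borel \<Otimes>\<^sub>M borel)" by (simp add: \<Psi>_def case_prod_unfold)
 show "lper eps (\<Psi> eta)" for eta
 proof -
 have "AEL x. \<forall>k\<in>lattice 1. V (eps *R eta) (x + k) = V (eps *R eta) x" using V(2) by (simp add: cell_L2_def lper_def)
 from AE_scale[OF _ this, of "inverse eps"] eps
 have "AEL x. \<forall>k\<in>lattice 1. V (eps *R eta) (x /\<^sub>R eps + k) = V (eps *R eta) (x /\<^sub>R eps)" by simp
 then show ?thesis unfolding lper_def \<Psi>_def
 by eventually_elim (use eps lattice_scaleR[of _ eps "inverse eps"] in "auto simp: scaleR_right_distrib")
 qed
 qed (use eps V(3) in "auto simp: \<Psi>_def Zscaled_def")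
 show "cell_kernel eps \<Psi>" ..
 let ?V = "V (eps *R eta)"
 note [measurable] = V(2)[of "eps *R eta", THEN cell_L2_measurable]
 have ind: "ind (cell 0 eps) (eps *R x) = (ind Yc x :: ennreal)" for x :: "real^'n"
 using eps by (simp add: indicator_def cell_def zero_le_mult_iff)
 have "wt eta = ennreal (eps ^ CARD('n)) * (NI x. ennreal ((norm (?V x))^2) * ind Yc x) * ennreal (1 / eps ^ CARD('n))"
 unfolding wt_def unfolding \<Psi>_def
 nn_integral_scale[OF eps, of "%x. ennreal ((norm (?V (x /\<^sub>R eps)))^2) * ind (cell 0 eps) x", simplified]
 using eps by (simp add: ind)
 also have "... = ennreal (eps ^ CARD('n) * (1 / eps ^ CARD('n))) * (NI x. ennreal ((norm (?V x))^2) * ind Yc x)"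
 using eps by (subst ennreal_mult) (auto simp: ac_simps)
 also have "... = (NI x. ennreal ((norm (ind Yc x *R ?V x))^2))"
 using eps by (auto simp: indicator_def intro!: nn_integral_cong)
 also have "... = ennreal ((L2norm (%x. ind Yc x *R ?V x))^2)"
 by (rule nn_L2norm) (use V(2) in "simp add: cell_L2_def")
 finally show "wt eta = ennreal ((L2norm (%x. ind Yc x *R ?V x))^2)" .
qed

section \<open>The lowest Bloch mode\<close>

locale bloch_cell =
 fixes A :: "real^'n::finite => real^'n^'n" and lam :: "nat => real^'n => real" and \<Phi> :: "nat => real^'n => real^'n => complex"
 assumes coeff: "coefficient_field A" and bloch: "bloch_system A lam \<Phi>"
begin

text \<open>The mode and its eigenvalue are extended by zero to give kernels and multipliers on the whole space.\<close>

definition mode :: "real^'n => real^'n => complex" where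
 "mode th x = (if th : Zcell then \<Phi> 0 th x else 0)"

definition ev :: "real^'n => real" where
 "ev th = (if th : Zcell then lam 0 th else 0)"

lemma Zcell_measurable [measurable]: "Zcell : sets (borel :: (real^'n) measure)"
 using Zscaled_measurable[of 1] by (simp add: Zscaled_def)

lemma ev_nonneg: "0 <= ev th" using bloch by (simp add: ev_def bloch_system_def)

lemma mode_H1per: "th : Zcell ==> mode th : H1per"
 using bloch by (simp add: bloch_system_def mode_def[abs_def])

lemma cell_L2_mode: "cell_L2 (mode th)"
 using mode_H1per[of th] L2per_cell_L2[of "mode th"] cell_L2_zero
 by (cases "th : Zcell") (auto simp: H1per_def mode_def[abs_def])

lemma mode_measurable: "(%(th, x). mode th x) : borel_measurable (borel \<Otimes>\<^sub>M borel)"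
proof -
 let ?M = "borel \<Otimes>\<^sub>M borel :: ((real^'n) \<times> (real^'n)) measure" and ?P = "%z :: (real^'n) \<times> (real^'n). fst z : Zcell"
 have P: "Measurable.pred ?M ?P" by measurable
 have \<Phi>: "(%(eta, x). \<Phi> 0 eta x) : borel_measurable (restrict_space borel Zcell \<Otimes>\<^sub>M borel)"
 using bloch unfolding bloch_system_def by blast
 have "(%z. (fst z, snd z)) : measurable (restrict_space ?M (Collect ?P)) (restrict_space borel Zcell \<Otimes>\<^sub>M borel)"
 by (intro measurable_Pair measurable_restrict_space2 measurable_restrict_space1 measurable_fst measurable_snd) (auto simp: space_restrict_space)
 then have "(%z. \<Phi> 0 (fst z) (snd z)) : borel_measurable (restrict_space ?M (Collect ?P))"
 using measurable_compose[of "%z. (fst z, snd z)" _ _ "%(eta, x). \<Phi> 0 eta x"] \<Phi> by (simp only: prod.case)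
 then have "(%z. if ?P z then \<Phi> 0 (fst z) (snd z) else 0) : borel_measurable ?M"
 using P by (subst measurable_If_restrict_space_iff) auto
 then show ?thesis by (simp add: mode_def case_prod_unfold)
qed

lemma mode_measurable' [measurable (raw)]:
 assumes [measurable]: "f : borel_measurable N" "g : borel_measurable N"
 shows "(%z. mode (f z) (g z)) : borel_measurable N"
 using measurable_compose[OF measurable_Pair[OF assms] mode_measurable] by simp

text \<open>The Fourier coefficients of the weak derivative are \<open>Dmult\<close> times those of the mode, hence measurable
 in the quasimomentum; so are the partial sums, and their limit has a jointly measurable version.\<close>

lemma gradient_exists:
 "\<exists>G. (%(th, x). G th x) : borel_measurable (borel \<Otimes>\<^sub>M borel) & (\<forall>th. cell_L2 (G th) & has_weak_deriv [i] (mode th) (G th))"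
proof -
 have "\<exists>g. cell_L2 g & has_weak_deriv [i] (mode th) g" for th
 proof (cases "th : Zcell")
 case True
 then obtain g where "g : L2per" "has_weak_deriv [i] (mode th) g" using mode_H1per[OF True] by (auto simp: H1per_def)
 then show ?thesis using L2per_cell_L2 by blast
 next
 case False then show ?thesis
 by (intro exI[of _ "%x. 0"]) (simp add: mode_def[abs_def] cell_L2_zero has_weak_deriv_zero)
 qed
 then obtain g where g: "!!th. cell_L2 (g th)" "!!th. has_weak_deriv [i] (mode th) (g th)" by metis
 define e where "e = from_nat_into (lattice 1 :: (real^'n) set)"
 have el: "e j : lattice 1" for j unfolding e_def using lattice_enumeration[of 1] by (auto simp: bij_betw_def)
 define F where "F N th x = (\<Sum>j<N. (- Dmult i (e j) * (LY x. mode th x * pw (e j) x)) * cnj (pw (e j) x))" for N :: nat and th x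
 obtain G where G: "(%(th, x). G th x) : borel_measurable (borel \<Otimes>\<^sub>M borel)" "!!th. AEL x. G th x = g th x"
 proof (rule measurable_L2_limit[where F=F, OF _ _ g(1)])
 show "(%(th, x). F N th x) : borel_measurable (borel \<Otimes>\<^sub>M borel)" for N
 unfolding F_def slint_def cnj_plane_wave by measurable
 show "F N th (x + k) = F N th x" if "k : lattice 1" for N th x k
 unfolding F_def plane_wave_add_right using plane_wave_lattice[OF el, of k] that by simp
 fix th
 note [measurable] = g(1)[of th, THEN cell_L2_measurable]
 let ?g = "%x. ind Yc x *R g th x"
 have c: "ip ?g (cell_wave 0 1 (e j)) = - Dmult i (e j) * (LY x. mode th x * pw (e j) x)" for j
 proof -
 have "ip ?g (cell_wave 0 1 (e j)) = (LY x. g th x * pw (e j) x)"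
 by (subst ip_cell_wave) (simp_all add: slint_def)
 then show ?thesis using periodic_weak_deriv_coeff[OF cell_L2_mode g el] by simp
 qed
 have d: "?g x - (\<Sum>j<N. ip ?g (cell_wave 0 1 (e j)) * cell_wave 0 1 (e j) x) = ind Yc x *R (g th x - F N th x)" for N x
 unfolding c F_def by (cases "x : Yc") (simp_all add: cell_wave_def)
 have dL2: "(%x. ind Yc x *R (g th x - F N th x)) : L2" for N
 unfolding d[symmetric] by (intro L2_diff L2_sum L2_mult_const cell_wave_L2) (use g(1)[of th] in "auto simp: cell_L2_def")
 have "(%N. L2norm (%x. ind Yc x *R (g th x - F N th x))) ----> 0"
 using Parseval_cell(2)[of 1 ?g 0] g(1)[of th] unfolding e_def[symmetric] d by (simp add: cell_L2_def)
 then have "(%N. ennreal ((L2norm (%x. ind Yc x *R (g th x - F N th x)))^2)) ----> ennreal (0^2)"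
 by (intro tendsto_ennrealI tendsto_power)
 moreover have "ennreal ((L2norm (%x. ind Yc x *R (g th x - F N th x)))^2)
 = (NI x. ennreal ((norm (F N th x - g th x))^2) * ind Yc x)" for N
 unfolding nn_L2norm[OF dL2, symmetric] by (auto simp: indicator_def norm_minus_commute intro!: nn_integral_cong)
 ultimately show "(%N. \<integral>\<^sup>+x. ennreal ((norm (F N th x - g th x))^2) * ind Yc x \<partial>lborel) ----> 0" by simp
 qed (rule that)
 have "cell_L2 (G th) & has_weak_deriv [i] (mode th) (G th)" for th
 proof
 have [measurable]: "G th : BM" using measurable_Pair2[OF G(1), of th] by simp
 note gm[measurable] = g(1)[of th, THEN cell_L2_measurable]
 have sym: "AEL x. g th x = G th x" using G(2)[of th] by eventually_elim simp
 show "has_weak_deriv [i] (mode th) (G th)"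
 by (rule has_weak_deriv_cong_AE[OF g(2) _ sym]) (simp_all add: cell_L2_mode cell_L2_measurable)
 have "AEL x. \<forall>k\<in>lattice 1. G th (x + k) = g th (x + k)"
 using AE_translate[OF G(2)[of th]] by (simp add: AE_ball_countable)
 moreover have "AEL x. \<forall>k\<in>lattice 1. g th (x + k) = g th x" using g(1)[of th] by (simp add: cell_L2_def lper_def)
 ultimately have "lper 1 (G th)" using G(2)[of th] unfolding lper_def by eventually_elim simp
 moreover have "(%x. ind Yc x *R G th x) : L2"
 by (rule L2_cong_AE[of "%x. ind Yc x *R g th x"]) (use g(1)[of th] sym in "auto simp: cell_L2_def elim: eventually_mono")
 ultimately show "cell_L2 (G th)" by (simp add: cell_L2_def)
 qed
 with G(1) show ?thesis by blast
qed

definition grad :: "'n => real^'n => real^'n => complex" where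
 "grad i = (SOME G. (%(th, x). G th x) : borel_measurable (borel \<Otimes>\<^sub>M borel) & (\<forall>th. cell_L2 (G th) & has_weak_deriv [i] (mode th) (G th)))"

lemma grad: "(%(th, x). grad i th x) : borel_measurable (borel \<Otimes>\<^sub>M borel)" "cell_L2 (grad i th)" "has_weak_deriv [i] (mode th) (grad i th)"
 using someI_ex[OF gradient_exists[of i]] unfolding grad_def by auto

definition sgrad :: "'n => real^'n => real^'n => complex" where
 "sgrad i th x = (if th : Zcell then grad i th x + Dmult i th * mode th x else 0)"

lemma sgrad_measurable: "(%(th, x). sgrad i th x) : borel_measurable (borel \<Otimes>\<^sub>M borel)"
 unfolding sgrad_def case_prod_unfold using grad(1)[of i, unfolded case_prod_unfold] by measurable

lemma sgrad_measurable' [measurable (raw)]: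
 assumes [measurable]: "f : borel_measurable N" "g : borel_measurable N"
 shows "(%z. sgrad i (f z) (g z)) : borel_measurable N"
 using measurable_compose[OF measurable_Pair[OF assms] sgrad_measurable[of i]] by simp

lemma cell_L2_sgrad: "cell_L2 (sgrad i th)"
 using cell_L2_add[OF grad(2)[of i th] cell_L2_scale[OF cell_L2_mode, of "Dmult i th" th]] cell_L2_zero
 by (cases "th : Zcell") (simp_all add: sgrad_def[abs_def])

lemma coeff_entry:
 obtains \<Lambda> where "0 <= \<Lambda>" "!!i j. AEL x. \<bar>A x $ i $ j\<bar> <= \<Lambda>"
proof -
 obtain \<Lambda> where \<Lambda>: "AEL x. norm (A x) <= \<Lambda>" using coeff unfolding coefficient_field_def by blast
 have "\<bar>A x $ i $ j\<bar> <= norm (A x)" for x i j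
 using Finite_Cartesian_Product.norm_nth_le[where x="A x $ i" and i=j] Finite_Cartesian_Product.norm_nth_le[where x="A x" and i=i] by simp
 with \<Lambda> have "AEL x. \<bar>A x $ i $ j\<bar> <= max 0 \<Lambda>" for i j
 by (auto elim!: eventually_mono intro: order_trans simp: le_max_iff_disj)
 then show thesis by (intro that[of "max 0 \<Lambda>"]) auto
qed

lemma coeff_entry_measurable [measurable (raw)]:
 assumes [measurable]: "f : borel_measurable N" shows "(%x. A (f x) $ i $ j) : borel_measurable N"
proof -
 have [measurable]: "A : BM" using coeff by (simp add: coefficient_field_def)
 have "(%M :: real^'n^'n. M $ i $ j) : BM" by (intro borel_measurable_continuous_onI continuous_intros)
 then show ?thesis by measurable
qed

lemma lper_coeff: "lper 1 (%x. cor (A x $ i $ j))"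
 using lper_comp[of 1 A "%M. cor (M $ i $ j)"] coeff by (simp add: coefficient_field_def Y_periodic_lper)

definition flux :: "real^'n => 'n => real^'n => complex" where
 "flux th i x = (SU j. cor (A x $ i $ j) * sgrad j th x)"

lemma cell_L2_flux: "cell_L2 (flux th i)"
proof -
 obtain \<Lambda> where "!!i j. AEL x. \<bar>A x $ i $ j\<bar> <= \<Lambda>" using coeff_entry by metis
 then show ?thesis unfolding flux_def[abs_def]
 by (intro cell_L2_sum cell_L2_mult_bounded[OF cell_L2_sgrad _ lper_coeff, where c=\<Lambda>]) (auto simp: norm_of_real)
qed

lemma cell_weak_form:
 assumes th: "th : Zcell" and w: "cell_L2 w" "!!i. has_weak_deriv [i] w (k i)" "!!i. cell_L2 (k i)"
 shows "(LY x. SU i. flux th i x * cnj (k i x + Dmult i th * w x))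
 = of_real (ev th) * (LY x. mode th x * cnj (w x))"
proof -
 have [measurable]: "w : BM" "!!i. k i : BM" using w by (auto simp: cell_L2_def)
 have "w : H1per" unfolding H1per_def using w cell_L2_L2per by blast
 then have "bloch_form A th (mode th) w = of_real (ev th) * inner_Y (mode th) w"
 using bloch th by (simp add: bloch_system_def mode_def[abs_def] ev_def)
 also have "inner_Y (mode th) w = (LY x. mode th x * cnj (w x))"
 unfolding inner_Y_def by (rule set_integral_Ycell) measurable
 also have "bloch_form A th (mode th) w = (LINT x:Ycell|lborel. SU i. flux th i x * cnj (k i x + Dmult i th * w x))"
 unfolding bloch_form_def slint_def
 proof (rule integral_cong_AE)
 have [measurable]: "wderiv [i] w : BM" "wderiv [i] (mode th) : BM" for i
 using wderiv_measurable[OF w(2)] wderiv_measurable[OF grad(3)] by auto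
 show "(%x. ind Ycell x *R (SU i. SU j. cor (A x $ i $ j) * shifted_deriv th (mode th) j x * cnj (shifted_deriv th w i x))) : borel_measurable lborel"
 unfolding shifted_deriv_def by measurable
 show "(%x. ind Ycell x *R (SU i. flux th i x * cnj (k i x + Dmult i th * w x))) : borel_measurable lborel"
 unfolding flux_def by measurable
 have "AEL x. \<forall>i. wderiv [i] w x = k i x & wderiv [i] (mode th) x = grad i th x"
 using wderiv_AE[OF w(2)] wderiv_AE[OF grad(3)] by (simp add: AE_all_countable eventually_conj_iff)
 then show "AEL x. ind Ycell x *R (SU i. SU j. cor (A x $ i $ j) * shifted_deriv th (mode th) j x * cnj (shifted_deriv th w i x))
 = ind Ycell x *R (SU i. flux th i x * cnj (k i x + Dmult i th * w x))"
 by eventually_elim (simp add: shifted_deriv_def flux_def sgrad_def th sum_distrib_right flip: Dmult_def)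
 qed
 also have "... = (LY x. SU i. flux th i x * cnj (k i x + Dmult i th * w x))"
 by (rule set_integral_Ycell) (unfold flux_def, measurable)
 finally show ?thesis .
qed

lemma ev_eq: "cor (ev th) = (LY x. SU i. flux th i x * cnj (sgrad i th x))"
proof (cases "th : Zcell")
 case True
 have "inner_Y (mode th) (mode th) = 1" using bloch True by (simp add: bloch_system_def mode_def[abs_def])
 then have "(LY x. mode th x * cnj (mode th x)) = 1"
 unfolding inner_Y_def by (subst (asm) set_integral_Ycell) auto
 then show ?thesis using cell_weak_form[OF True cell_L2_mode grad(3) grad(2)] True by (simp add: sgrad_def)
qed (simp add: ev_def sgrad_def)

lemma ev_measurable [measurable]: "ev : BM"
proof -
 have "(%th. Re (LY x. SU i. flux th i x * cnj (sgrad i th x))) : BM"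
 unfolding slint_def flux_def by measurable
 then show ?thesis unfolding ev_eq[symmetric] by simp
qed

lemma L2norm_mode: "th : Zcell ==> L2norm (%x. ind Yc x *R mode th x) = 1"
proof -
 assume True: "th : Zcell"
 have "inner_Y (mode th) (mode th) = 1" using bloch True by (simp add: bloch_system_def mode_def[abs_def])
 then have "(LY x. mode th x * cnj (mode th x)) = 1"
 unfolding inner_Y_def by (subst (asm) set_integral_Ycell) auto
 moreover have "ip (%x. ind Yc x *R mode th x) (%x. ind Yc x *R mode th x) = (LY x. mode th x * cnj (mode th x))"
 unfolding ip_def slint_def by (rule Bochner_Integration.integral_cong) (auto simp: indicator_def)
 ultimately have "(L2norm (%x. ind Yc x *R mode th x))^2 = 1"
 unfolding ip_self by (simp only: of_real_eq_1_iff)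
 then show ?thesis by (simp add: power2_eq_1_iff) (metis L2norm_nonneg neg_0_le_iff_le not_one_le_zero)
qed

text \<open>Ellipticity, applied to the real and imaginary parts, bounds the gradient of the mode by the
 eigenvalue.\<close>

lemma ellipticity:
 obtains al where "0 < al" "!!th i. al * (L2norm (%x. ind Yc x *R sgrad i th x))^2 <= ev th"
proof -
 obtain al where al: "0 < al" "AEL x. \<forall>\<xi>. al * (norm \<xi>)^2 <= \<xi> \<bullet> (A x *v \<xi>)" using coeff unfolding coefficient_field_def by blast
 have "al * (L2norm (%x. ind Yc x *R sgrad i th x))^2 <= ev th" for i th
 proof -
 let ?f = "%x. SU i. flux th i x * cnj (sgrad i th x)"
 have c: "cell_L2 (%x. cnj (sgrad i th x))" for i
 using cell_L2_sgrad[of i th] lper_comp[of 1 "sgrad i th" cnj] L2_cnj[of "%x. ind Yc x *R sgrad i th x"] by (auto simp: cell_L2_def)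
 have int: "intb (%x. ind Yc x *R ?f x)"
 unfolding scaleR_sum_right by (intro Bochner_Integration.integrable_sum cell_L2_integrable(1) cell_L2_flux c)
 have "al * (L2norm (%x. ind Yc x *R sgrad i th x))^2 = (LI x. al * (norm (ind Yc x *R sgrad i th x))^2)"
 by (simp add: L2norm_sq)
 also have "... <= (LI x. Re (ind Yc x *R ?f x))"
 proof (rule integral_mono_AE)
 show "intb (%x. al * (norm (ind Yc x *R sgrad i th x))^2)"
 using cell_L2_sgrad[of i th] by (intro integrable_mult_right L2_integrable_sq) (simp add: cell_L2_def)
 show "intb (%x. Re (ind Yc x *R ?f x))" using int by (rule integrable_Re)
 show "AEL x. al * (norm (ind Yc x *R sgrad i th x))^2 <= Re (ind Yc x *R ?f x)"
 using al(2)
 proof eventually_elim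
 case (elim x)
 let ?a = "\<chi> i. Re (sgrad i th x)" and ?b = "\<chi> i. Im (sgrad i th x)"
 have sq: "(\<chi> i. c i) \<bullet> (A x *v (\<chi> i. c i)) = (SU i. SU j. A x $ i $ j * (c j * c i))" for c :: "'n => real"
 by (simp add: inner_vec_def matrix_vector_mult_def sum_distrib_left ac_simps)
 have "al * (norm (sgrad i th x))^2 = al * (?a $ i)^2 + al * (?b $ i)^2" by (simp add: cmod_power2 distrib_left)
 also have "... <= al * (norm ?a)^2 + al * (norm ?b)^2"
 using Finite_Cartesian_Product.norm_nth_le[where x="?a" and i=i] Finite_Cartesian_Product.norm_nth_le[where x="?b" and i=i] al(1) by (intro add_mono mult_left_mono) (auto simp: abs_le_square_iff[symmetric])
 also have "... <= ?a \<bullet> (A x *v ?a) + ?b \<bullet> (A x *v ?b)" using elim by (intro add_mono) auto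
 also have "... = Re (?f x)"
 unfolding sq flux_def by (simp add: sum_distrib_right sum_distrib_left sum.distrib[symmetric] distrib_left ac_simps)
 finally show ?case by (simp add: indicator_def)
 qed
 qed
 also have "... = ev th"
 using integral_Re[OF int] ev_eq[of th] unfolding slint_def by (metis Re_complex_of_real)
 finally show ?thesis .
 qed
 with al(1) show thesis by (rule that)
qed

end

section \<open>Packets of Bloch waves solve the state equation\<close>

context bloch_cell begin

lemma L2_plane_wave_mult: "u : L2 ==> (%x. u x * pw eta x) : L2"
 using L2_mult_bounded[OF _ measurable_plane_wave, of u eta 1] by (simp add: mult.commute)

text \<open>
 The cell problem extends from periodic test functions to all compactly supported ones: test with
 the periodization of the conjugate of \<open>psi * plane_wave th\<close> and unfold.
\<close>

lemma whole_space_weak_form: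
 assumes th: "th : Zcell" and psi: "psi : L2" "bdd_supp psi" "!!i. has_weak_deriv [i] psi (p i)" "!!i. p i : L2" "!!i. bdd_supp (p i)"
 shows "(LI x. (SU i. flux th i x * (p i x * pw th x)))
 = of_real (ev th) * (LI x. mode th x * (psi x * pw th x))"
proof -
 let ?e = "pw th"
 define h where "h x = cnj (psi x * ?e x)" for x
 define d where "d i x = cnj ((p i x + Dmult i th * psi x) * ?e x)" for i x
 have hd: "has_weak_deriv [i] h (d i)" for i
 unfolding h_def[abs_def] d_def[abs_def] by (rule has_weak_deriv_bounded_linear[OF bounded_linear_cnj has_weak_deriv_plane_wave_mult[OF psi(3)]])
 have hL: "h : L2" "bdd_supp h" unfolding h_def[abs_def]
 by (rule L2_cnj[OF L2_plane_wave_mult[OF psi(1)]], rule bdd_supp_mono[OF psi(2)], simp)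
 have pb: "bdd_supp (%x. p i x + Dmult i th * psi x)" for i
 by (intro bdd_supp_add psi) (rule bdd_supp_mono[OF psi(2)], simp)
 have dL: "d i : L2" "bdd_supp (d i)" for i unfolding d_def[abs_def]
 by (rule L2_cnj[OF L2_plane_wave_mult[OF L2_add[OF psi(4) L2_mult_const[OF psi(1)]]]], rule bdd_supp_mono[OF pb[of i]], simp)
 have gL: "(%x. p i x * ?e x) : L2" "bdd_supp (%x. p i x * ?e x)" for i
 by (rule L2_plane_wave_mult[OF psi(4)], rule bdd_supp_mono[OF psi(5)[of i]], simp)
 have hc: "cnj (periodize h x) = periodize (%x. psi x * ?e x) x" for x
 using periodize_cnj[OF hL(2), of x] by (simp add: h_def)
 have k: "cnj (periodize (d i) x + Dmult i th * periodize h x) = periodize (%x. p i x * ?e x) x" for i x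
 proof -
 have "d i x + Dmult i th * h x = cnj (p i x * ?e x)" for x
 by (simp add: d_def h_def cnj_Dmult algebra_simps)
 then show ?thesis using periodize_lin[OF dL(2) hL(2), of i "Dmult i th" x] periodize_cnj[OF gL(2), of i x] by simp
 qed
 have "(LI x. (SU i. flux th i x * (p i x * ?e x))) = (SU i. LI x. flux th i x * (p i x * ?e x))"
 by (intro Bochner_Integration.integral_sum cell_L2_mult_integrable cell_L2_flux gL)
 also have "... = (SU i. LY x. flux th i x * periodize (%x. p i x * ?e x) x)"
 by (simp only: periodize_unfold[OF cell_L2_flux gL])
 also have "... = (LY x. SU i. flux th i x * periodize (%x. p i x * ?e x) x)"
 unfolding slint_def scaleR_sum_right
 by (intro Bochner_Integration.integral_sum[symmetric] cell_L2_integrable(1) cell_L2_flux cell_L2_periodize gL)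
 also have "... = of_real (ev th) * (LY x. mode th x * periodize (%x. psi x * ?e x) x)"
 unfolding k[symmetric] hc[symmetric]
 by (rule cell_weak_form[OF th]) (intro cell_L2_periodize periodize_weak_deriv hL dL hd)+
 also have "(LY x. mode th x * periodize (%x. psi x * ?e x) x) = (LI x. mode th x * (psi x * ?e x))"
 by (rule periodize_unfold[OF cell_L2_mode L2_plane_wave_mult[OF psi(1)] bdd_supp_mono[OF psi(2)]]) simp
 finally show ?thesis .
qed

end

lemma L2_dilate:
 assumes c: "0 < c" and u: "u : L2" shows "(%x. u (c *R x)) : L2"
 using u integrable_scale[OF c, of "%x. (norm (u x))^2"] unfolding L2_iff by auto

lemma bdd_supp_dilate:
 assumes c: "0 < c" and u: "bdd_supp u" shows "bdd_supp (%x. u (c *R x))"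
proof -
 obtain R where "!!x. R < norm x ==> u x = 0" using u unfolding bdd_supp_def by blast
 then show ?thesis unfolding bdd_supp_def using c by (intro exI[of _ "R / c"]) (auto simp: field_simps)
qed

locale bloch_scaled = bloch_cell A lam \<Phi>
 for A :: "real^'n::finite => real^'n^'n" and lam :: "nat => real^'n => real" and \<Phi> :: "nat => real^'n => real^'n => complex" +
 fixes eps :: real
 assumes eps: "0 < eps"
begin

sublocale B: unit_cell_kernel eps "%eta x. mode (eps *R eta) (x /\<^sub>R eps)"
proof -
 have "th \<notin> Zcell ==> mode th x = 0" for th x by (simp add: mode_def)
 note K = scaled_cell_kernel[OF eps mode_measurable cell_L2_mode this]
 interpret cell_kernel eps "%eta x. mode (eps *R eta) (x /\<^sub>R eps)" by (rule K)
 show "unit_cell_kernel eps (%eta x. mode (eps *R eta) (x /\<^sub>R eps))"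
 by unfold_locales (simp add: K(2) Zscaled_def L2norm_mode)
qed

definition dwave :: "'n => real^'n => real^'n => complex" where
 "dwave j = cell_kernel.wave (%eta x. sgrad j (eps *R eta) (x /\<^sub>R eps))"

lemma gradient_kernel:
 "cell_kernel eps (%eta x. sgrad j (eps *R eta) (x /\<^sub>R eps))"
 "cell_kernel.wt eps (%eta x. sgrad j (eps *R eta) (x /\<^sub>R eps)) eta = ennreal ((L2norm (%x. ind Yc x *R sgrad j (eps *R eta) x))^2)"
 using scaled_cell_kernel[OF eps sgrad_measurable[of j] cell_L2_sgrad] by (auto simp: sgrad_def)

lemma dwave_eq: "dwave j eta x = sgrad j (eps *R eta) (x /\<^sub>R eps) * pw eta x"
 unfolding dwave_def by (simp add: cell_kernel.wave_def[OF gradient_kernel(1)])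

lemma scaled_weak_form:
 assumes eta: "eta : Zscaled eps" and psi: "psi : L2" "bdd_supp psi" "!!i. has_weak_deriv [i] psi (p i)" "!!i. p i : L2" "!!i. bdd_supp (p i)"
 shows "(LI x. (SU i. SU j. of_real (A (x /\<^sub>R eps) $ i $ j) * p i x * dwave j eta x))
 = of_real (ev (eps *R eta) / eps) * (LI x. psi x * B.wave eta x)"
proof -
 let ?th = "eps *R eta"
 note [measurable] = psi(1)[THEN L2_measurable] psi(4)[THEN L2_measurable]
 have "(LI x. (SU i. flux ?th i x * ((eps *R p i (eps *R x)) * pw ?th x)))
 = of_real (ev ?th) * (LI x. mode ?th x * (psi (eps *R x) * pw ?th x))"
 proof (rule whole_space_weak_form)
 show "?th : Zcell" using eta by (simp add: Zscaled_def)
 show "has_weak_deriv [i] (%x. psi (eps *R x)) (%x. eps *R p i (eps *R x))" for i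
 using has_weak_deriv_affine[OF psi(3) eps, of i 0] by simp
 show "bdd_supp (%x. eps *R p i (eps *R x))" for i by (rule bdd_supp_mono[OF bdd_supp_dilate[OF eps psi(5)[of i]]]) simp
 qed (intro L2_dilate bdd_supp_dilate L2_scaleR eps psi)+
 moreover have "(SU i. flux ?th i x * ((eps *R p i (eps *R x)) * pw ?th x))
 = of_real eps * (SU i. SU j. of_real (A x $ i $ j) * p i (eps *R x) * (sgrad j ?th x * pw ?th x))" for x
 by (simp add: flux_def sum_distrib_left sum_distrib_right scaleR_conv_of_real ac_simps)
 ultimately have 1: "of_real eps * (LI x. (SU i. SU j. of_real (A x $ i $ j) * p i (eps *R x) * (sgrad j ?th x * pw ?th x)))
 = of_real (ev ?th) * (LI x. mode ?th x * (psi (eps *R x) * pw ?th x))" by simp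
 have pw: "pw eta (eps *R x) = pw ?th x" for x by (simp add: plane_wave_scaleR)
 have 2: "(LI x. (SU i. SU j. of_real (A (x /\<^sub>R eps) $ i $ j) * p i x * dwave j eta x))
 = eps ^ CARD('n) *R (LI x. (SU i. SU j. of_real (A x $ i $ j) * p i (eps *R x) * (sgrad j ?th x * pw ?th x)))"
 unfolding dwave_eq by (subst integral_scale[OF eps]) (measurable, use eps in "simp add: pw")
 have 3: "(LI x. psi x * B.wave eta x) = eps ^ CARD('n) *R (LI x. mode ?th x * (psi (eps *R x) * pw ?th x))"
 unfolding B.wave_def by (subst integral_scale[OF eps]) (measurable, use eps in "simp add: pw ac_simps")
 show ?thesis unfolding 2 3 using 1 eps by (simp add: scaleR_conv_of_real field_simps)
qed

definition resolvent :: "real^'n => real" where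
 "resolvent eta = 1 / (1 + ev (eps *R eta) / eps^2)"

lemma resolvent_measurable [measurable]: "resolvent : BM"
 unfolding resolvent_def[abs_def] by measurable

lemma resolvent_bounds: "0 <= resolvent eta" "resolvent eta <= 1" "resolvent eta * (ev (eps *R eta) / eps^2) <= 1"
 "resolvent eta + resolvent eta * (ev (eps *R eta) / eps^2) = 1"
proof -
 define x where "x = ev (eps *R eta) / eps^2"
 have "0 <= x" unfolding x_def using ev_nonneg by simp
 then show "0 <= resolvent eta" "resolvent eta <= 1" "resolvent eta * (ev (eps *R eta) / eps^2) <= 1"
 "resolvent eta + resolvent eta * (ev (eps *R eta) / eps^2) = 1"
 unfolding resolvent_def x_def[symmetric] by (simp_all add: field_simps)
qed

lemma good_resolvent: "good S c ==> good S (%eta. of_real (resolvent eta) * c eta)"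
 by (rule good_mult[where c=1]) (use resolvent_bounds in auto)

lemma wave_weak_deriv:
 assumes eta: "eta : Zscaled eps"
 shows "has_weak_deriv [j] (B.wave eta) (%x. of_real (1 / eps) * dwave j eta x)"
proof -
 have th: "eps *R eta : Zcell" using eta by (simp add: Zscaled_def)
 have D: "Dmult j (eps *R eta) = of_real eps * Dmult j eta" by (simp add: Dmult_def)
 have gen: "(inverse e *R g + D * m) * w = of_real (1 / e) * ((g + (of_real e * D) * m) * w)" if "0 < e" for e :: real and g D m w :: complex
 using that by (simp add: scaleR_conv_of_real field_simps)
 have i: "0 < inverse eps" using eps by simp
 have "has_weak_deriv [j] (%x. mode (eps *R eta) (x /\<^sub>R eps) * pw eta x)
 (%x. (inverse eps *R grad j (eps *R eta) (x /\<^sub>R eps) + Dmult j eta * mode (eps *R eta) (x /\<^sub>R eps)) * pw eta x)"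
 using has_weak_deriv_plane_wave_mult[OF has_weak_deriv_affine[OF grad(3) i, of j "eps *R eta" 0]] by simp
 moreover have "(inverse eps *R grad j (eps *R eta) (x /\<^sub>R eps) + Dmult j eta * mode (eps *R eta) (x /\<^sub>R eps)) * pw eta x
 = of_real (1 / eps) * dwave j eta x" for x
 by (simp only: dwave_eq sgrad_def th if_True D gen[OF eps])
 ultimately show ?thesis unfolding B.wave_def[abs_def] by simp
qed

lemma coeff_scaled_mult_L2:
 fixes u :: "real^'n => 'b::{banach,second_countable_topology,real_normed_field}"
 assumes u: "u : L2" shows "(%x. of_real (A (x /\<^sub>R eps) $ i $ j) * u x) : L2"
proof -
 obtain \<Lambda> where \<Lambda>: "!!i j. AEL x. \<bar>A x $ i $ j\<bar> <= \<Lambda>" using coeff_entry by metis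
 note [measurable] = u[THEN L2_measurable]
 show ?thesis
 proof (rule L2_bound[OF u])
 show "AEL x. norm (of_real (A (x /\<^sub>R eps) $ i $ j) * u x :: 'b) <= \<Lambda> * norm (u x)"
 using AE_scale[OF _ \<Lambda>[of i j], of "inverse eps"] eps
 by (auto elim!: eventually_mono simp: norm_mult mult_right_mono)
 qed measurable
qed

end

locale bloch_packet = bloch_scaled A lam \<Phi> eps
 for A :: "real^'n::finite => real^'n^'n" and lam :: "nat => real^'n => real" and \<Phi> :: "nat => real^'n => real^'n => complex" and eps :: real +
 fixes c :: "real^'n => complex"
 assumes c: "good (Zscaled eps) c"
begin

abbreviation "b \<equiv> %eta. of_real (resolvent eta) * c eta"

lemma good_b: "good (Zscaled eps) b" by (rule good_resolvent[OF c])

lemma b_measurable [measurable]: "b : BM" using good_b by (auto simp: good_def)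

text \<open>The resolvent compensates for the growth of the gradient: its square times the eigenvalue is bounded.\<close>

lemma b_fin:
 "(NI eta. ennreal ((norm (b eta))^2) * cell_kernel.wt eps (%eta x. sgrad j (eps *R eta) (x /\<^sub>R eps)) eta) < \<infinity>"
proof -
 obtain al where al: "0 < al" "!!th i. al * (L2norm (%x. ind Yc x *R sgrad i th x))^2 <= ev th" using ellipticity by blast
 have [measurable]: "c : BM" using c by (auto simp: good_def)
 have "ennreal ((norm (b eta))^2) * cell_kernel.wt eps (%eta x. sgrad j (eps *R eta) (x /\<^sub>R eps)) eta <= ennreal (eps^2 / al) * ennreal ((norm (c eta))^2)" for eta
 proof -
 let ?w = "(L2norm (%x. ind Yc x *R sgrad j (eps *R eta) x))^2" and ?r = "resolvent eta"
 have "?w <= ev (eps *R eta) / al" using al by (simp add: pos_le_divide_eq mult.commute)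
 then have "?r^2 * ?w <= ?r * (?r * (ev (eps *R eta) / al))" unfolding power2_eq_square mult.assoc using resolvent_bounds(1) by (intro mult_left_mono) auto
 also have "... = ?r * (?r * (ev (eps *R eta) / eps^2)) * (eps^2 / al)" using eps by simp
 also have "... <= 1 * 1 * (eps^2 / al)"
 using resolvent_bounds[of eta] ev_nonneg[of "eps *R eta"] al by (intro mult_right_mono mult_mono) auto
 finally have "(norm (b eta))^2 * ?w <= eps^2 / al * (norm (c eta))^2"
 using mult_right_mono[of "?r^2 * ?w" "eps^2 / al" "(norm (c eta))^2"] by (simp add: norm_mult power_mult_distrib ac_simps)
 then have "ennreal ((norm (b eta))^2 * ?w) <= ennreal (eps^2 / al * (norm (c eta))^2)" by (rule ennreal_leI)
 then show ?thesis unfolding gradient_kernel(2) using al by (subst (1 2) ennreal_mult[symmetric]) auto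
 qed
 then have "(NI eta. ennreal ((norm (b eta))^2) * cell_kernel.wt eps (%eta x. sgrad j (eps *R eta) (x /\<^sub>R eps)) eta)
 <= (NI eta. ennreal (eps^2 / al) * ennreal ((norm (c eta))^2))" by (rule nn_integral_mono)
 also have "... = ennreal (eps^2 / al) * (NI eta. ennreal ((norm (c eta))^2))" by (rule nn_integral_cmult) measurable
 also have "... < \<infinity>" using nn_L2norm[OF good_L2[OF c]] by (simp add: ennreal_mult_less_top)
 finally show ?thesis .
qed

definition Y :: "'n => real^'n => complex" where "Y j x = of_real (1 / eps) * synth (dwave j) b x"

abbreviation X :: "real^'n => complex" where "X \<equiv> synth B.wave b"

lemma X_L2: "X : L2" using B.synth_in_L2[OF good_b] .

lemma Y_L2: "Y j : L2"
 unfolding Y_def[abs_def] dwave_def by (intro L2_mult_const cell_kernel.synth_L2[OF gradient_kernel(1) _ b_fin]) measurable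

lemma X_weak_deriv: "has_weak_deriv [j] X (Y j)"
 unfolding has_weak_deriv_def
proof (intro conjI allI impI)
 show "loc_integrable X" "loc_integrable (Y j)" by (intro L2_loc_integrable X_L2 Y_L2)+
 fix phi :: "real^'n => real" assume phi: "test_fun phi"
 have t: "cplx \<chi>1 : L2 & bdd_supp (cplx \<chi>1)" if "test_fun \<chi>1" for \<chi>1 :: "real^'n => real"
 using test_fun_L2[OF that] that bdd_supp_mono[of \<chi>1 "cplx \<chi>1"] by (simp add: L2_cplx_iff test_fun_iff)
 note phi' = t[OF test_fun_part[OF phi, of j]] and phi0 = t[OF phi]
 have w: "b eta * (LI x. of_real (part_deriv j phi x) * B.wave eta x) = - of_real (1 / eps) * (b eta * (LI x. of_real (phi x) * dwave j eta x))" for eta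
 proof (cases "eta : Zscaled eps")
 case True
 have "(LI x. part_deriv j phi x *R B.wave eta x) = - (LI x. phi x *R (of_real (1 / eps) * dwave j eta x))"
 using wave_weak_deriv[OF True, of j] phi by (simp add: has_weak_deriv_def)
 also have "(LI x. phi x *R (of_real (1 / eps) * dwave j eta x)) = (LI x. of_real (1 / eps) * (of_real (phi x) * dwave j eta x))"
 by (simp only: scaleR_conv_of_real mult.left_commute)
 finally show ?thesis by (simp add: scaleR_conv_of_real)
 qed (use good_off[OF c] in simp)
 have "(LI x. iter_deriv [j] phi x *R X x) = (LI x. of_real (part_deriv j phi x) * X x)"
 by (simp add: scaleR_conv_of_real)
 also have "... = (LI eta. b eta * (LI x. of_real (part_deriv j phi x) * B.wave eta x))"
 by (rule B.Fubini_wave(2)[symmetric]) (use phi' B.wt_fin[OF good_b] in auto)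
 also have "... = - of_real (1 / eps) * (LI eta. b eta * (LI x. of_real (phi x) * dwave j eta x))"
 unfolding w by (simp only: integral_mult_right_zero)
 also have "(LI eta. b eta * (LI x. of_real (phi x) * dwave j eta x)) = (LI x. of_real (phi x) * synth (dwave j) b x)"
 unfolding dwave_def by (rule cell_kernel.Fubini_wave(2)[OF gradient_kernel(1) _ b_fin]) (use phi0 in auto)
 also have "- of_real (1 / eps) * (LI x. of_real (phi x) * synth (dwave j) b x) = (- 1) ^ length [j] *R (LI x. phi x *R Y j x)"
 proof -
 have "(LI x. phi x *R Y j x) = (LI x. of_real (1 / eps) * (of_real (phi x) * synth (dwave j) b x))"
 by (simp only: Y_def scaleR_conv_of_real mult.left_commute)
 then show ?thesis by simp
 qed
 finally show "(LI x. iter_deriv [j] phi x *R X x) = (- 1) ^ length [j] *R (LI x. phi x *R Y j x)" .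
qed

definition Z :: "'n => real^'n => complex" where
 "Z i x = (SU j. of_real (A (x /\<^sub>R eps) $ i $ j) * Y j x)"

lemma Z_L2: "Z i : L2"
 unfolding Z_def[abs_def] by (intro L2_sum coeff_scaled_mult_L2 Y_L2)

text \<open>Bloch waves are generalised eigenfunctions: by Fubini the operator multiplies the coefficients of a
 packet by \<open>1 + ev / eps^2\<close>, which the resolvent undoes. The test function must have bounded support
 for Fubini; a cut-off removes this restriction afterwards.\<close>

lemma packet_equation_compact:
 assumes psi: "psi : L2" "bdd_supp psi" "!!i. has_weak_deriv [i] psi (p i)" "!!i. p i : L2" "!!i. bdd_supp (p i)"
 shows "(SU i. LI x. p i x * Z i x) + (LI x. psi x * X x) = (LI x. psi x * synth B.wave c x)"
proof -
 let ?u = "%i j x. of_real (A (x /\<^sub>R eps) $ i $ j) * p i x"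
 have u: "?u i j : L2" "bdd_supp (?u i j)" for i j
 by (rule coeff_scaled_mult_L2[OF psi(4)]) (rule bdd_supp_mono[OF psi(5)[of i]], simp)
 have dint: "intb (%x. ?u i j x * dwave j eta x)" for i j eta
 unfolding dwave_def by (rule cell_kernel.wave_integrable_mult[OF gradient_kernel(1) _ u]) (simp add: gradient_kernel(2))
 let ?b = "%eta. of_real (resolvent eta * (ev (eps *R eta) / eps^2)) * c eta"
 have gb: "good (Zscaled eps) ?b"
 by (rule good_mult[OF c, where c=1], measurable)
 (use resolvent_bounds ev_nonneg in "simp only: norm_of_real, subst abs_of_nonneg, auto")
 have bsum: "?b eta + b eta = c eta" for eta
 proof -
 have "?b eta + b eta = of_real (resolvent eta + resolvent eta * (ev (eps *R eta) / eps^2)) * c eta"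
 by (simp only: of_real_add distrib_right add.commute)
 then show ?thesis by (simp only: resolvent_bounds(4) of_real_1 mult_1)
 qed
 have Fub: "intb (%eta. b eta * (LI x. ?u i j x * dwave j eta x))"
 "(LI eta. b eta * (LI x. ?u i j x * dwave j eta x)) = (LI x. ?u i j x * synth (dwave j) b x)" for i j
 unfolding dwave_def by (rule cell_kernel.Fubini_wave[OF gradient_kernel(1) _ b_fin u], measurable)+
 have "(LI x. p i x * Z i x) = (SU j. of_real (1 / eps) * (LI x. ?u i j x * synth (dwave j) b x))" for i
 proof -
 have "(LI x. p i x * Z i x) = (LI x. (SU j. ?u i j x * Y j x))"
 by (simp add: Z_def sum_distrib_left ac_simps)
 also have "... = (SU j. LI x. ?u i j x * Y j x)"
 by (intro Bochner_Integration.integral_sum L2_integrable_mult u Y_L2)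
 also have "(%j. LI x. ?u i j x * Y j x) = (%j. of_real (1 / eps) * (LI x. ?u i j x * synth (dwave j) b x))"
 unfolding integral_mult_right_zero[symmetric] Y_def by (simp only: mult.left_commute)
 finally show ?thesis .
 qed
 then have "(SU i. LI x. p i x * Z i x)
 = of_real (1 / eps) * (SU i. SU j. LI eta. b eta * (LI x. ?u i j x * dwave j eta x))"
 by (simp only: Fub(2) sum_distrib_left)
 also have "(SU i. SU j. LI eta. b eta * (LI x. ?u i j x * dwave j eta x))
 = (LI eta. (SU i. SU j. b eta * (LI x. ?u i j x * dwave j eta x)))"
 by (simp add: Bochner_Integration.integral_sum Bochner_Integration.integrable_sum Fub(1))
 also have "... = (LI eta. of_real eps * (?b eta * (LI x. psi x * B.wave eta x)))"
 proof (rule Bochner_Integration.integral_cong[OF refl])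
 fix eta
 show "(SU i. SU j. b eta * (LI x. ?u i j x * dwave j eta x)) = of_real eps * (?b eta * (LI x. psi x * B.wave eta x))"
 proof (cases "eta : Zscaled eps")
 case True
 have "(SU i. SU j. b eta * (LI x. ?u i j x * dwave j eta x))
 = b eta * (LI x. (SU i. SU j. ?u i j x * dwave j eta x))"
 by (simp add: sum_distrib_left Bochner_Integration.integral_sum Bochner_Integration.integrable_sum dint)
 also have "... = of_real eps * (?b eta * (LI x. psi x * B.wave eta x))"
 unfolding scaled_weak_form[OF True psi] using eps by (simp add: power2_eq_square)
 finally show ?thesis .
 qed (simp add: good_off[OF c])
 qed
 also have "... = of_real eps * (LI x. psi x * synth B.wave ?b x)"
 unfolding integral_mult_right_zero
 by (subst B.Fubini_wave(2)[OF _ _ psi(1,2)]) (use B.wt_fin[OF gb] gb in "auto simp: good_def")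
 finally have 1: "(SU i. LI x. p i x * Z i x) = (LI x. psi x * synth B.wave ?b x)" using eps by simp
 have "(LI x. psi x * synth B.wave ?b x) + (LI x. psi x * X x) = (LI x. psi x * synth B.wave ?b x + psi x * X x)"
 by (intro Bochner_Integration.integral_add[symmetric] L2_integrable_mult psi B.synth_in_L2 gb X_L2)
 also have "... = (LI x. psi x * synth B.wave c x)"
 proof (rule integral_cong_AE)
 note [measurable] = psi(1)[THEN L2_measurable] B.synth_in_L2[OF gb, THEN L2_measurable] X_L2[THEN L2_measurable] B.synth_in_L2[OF c, THEN L2_measurable]
 show "(%x. psi x * synth B.wave ?b x + psi x * X x) : borel_measurable lborel" "(%x. psi x * synth B.wave c x) : borel_measurable lborel" by measurable
 show "AEL x. psi x * synth B.wave ?b x + psi x * X x = psi x * synth B.wave c x"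
 using B.synth_add[OF gb good_b] unfolding bsum by eventually_elim (simp only: distrib_left)
 qed
 finally show ?thesis unfolding 1 .
qed

lemma packet_equation:
 assumes psi: "psi : Hk 1"
 shows "(SU i. LI x. of_real (wderiv [i] psi x) * Z i x) + (LI x. of_real (psi x) * X x)
 = (LI x. of_real (psi x) * synth B.wave c x)"
proof -
 have p: "has_weak_deriv [i] psi (wderiv [i] psi)" "wderiv [i] psi : L2" for i using Hk_wderiv[OF psi, of "[i]"] by auto
 have psiL: "psi : L2" using psi by (simp add: Hk_def)
 obtain zt :: "nat => real^'n => real" and C where zt: "!!r. test_fun (zt r)" "!!r x. \<bar>zt r x\<bar> <= C"
 "!!r i x. \<bar>part_deriv i (zt r) x\<bar> <= C / Suc r" "!!x. (%r. zt r x) ----> 1" using cutoff_exists by metis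
 define psir where "psir r x = zt r x *R psi x" for r x
 define pr where "pr r i x = zt r x *R wderiv [i] psi x + part_deriv i (zt r) x *R psi x" for r i x
 have bd: "bdd_supp (zt r)" "bdd_supp (part_deriv i (zt r))" for r i
 using zt(1)[of r] test_fun_part[OF zt(1)[of r], of i] by (auto simp: test_fun_iff)
 have dzt: "(%x. part_deriv i (zt r) x *R psi x) : L2" "L2norm (%x. part_deriv i (zt r) x *R psi x) <= C / Suc r * L2norm psi" for i r
 proof -
 note [measurable] = test_fun_measurable[OF test_fun_part[OF zt(1)[of r], of i]] psiL[THEN L2_measurable]
 have b: "norm (part_deriv i (zt r) x *R psi x) <= norm (C / Suc r * psi x)" for x
 proof -
 have "\<bar>part_deriv i (zt r) x\<bar> <= \<bar>C / Suc r\<bar>" using zt(3)[of i r x] by linarith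
 then show ?thesis unfolding real_norm_def scaleR_conv_of_real of_real_eq_id id_apply abs_mult by (intro mult_right_mono) auto
 qed
 show L: "(%x. part_deriv i (zt r) x *R psi x) : L2"
 by (rule L2_bound[OF L2_mult_const[OF psiL, of "C / Suc r"], where c=1]) (use b in auto)
 have "0 <= C" using zt(2)[of 0 0] by linarith
 have "L2norm (%x. part_deriv i (zt r) x *R psi x) <= L2norm (%x. C / Suc r * psi x)"
 by (rule L2norm_mono[OF L2_mult_const[OF psiL] L]) (use b in auto)
 then show "L2norm (%x. part_deriv i (zt r) x *R psi x) <= C / Suc r * L2norm psi"
 unfolding L2norm_scale using \<open>0 <= C\<close> by simp
 qed
 note cut = cutoff_tendsto[OF _ zt(1,2,4)]
 have prL: "pr r i : L2" for r i unfolding pr_def[abs_def] by (intro L2_add cut(2) p dzt)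
 have eq: "(SU i. LI x. of_real (pr r i x) * Z i x) + (LI x. of_real (psir r x) * X x)
 = (LI x. of_real (psir r x) * synth B.wave c x)" for r
 proof (rule packet_equation_compact)
 show "cplx (psir r) : L2" unfolding L2_cplx_iff psir_def[abs_def] by (rule cut(2)[OF psiL])
 show "bdd_supp (cplx (psir r))" by (rule bdd_supp_mono[OF bd(1)[of r]]) (simp add: psir_def)
 show "has_weak_deriv [i] (cplx (psir r)) (cplx (pr r i))" for i
 unfolding psir_def pr_def by (rule has_weak_deriv_cplx[OF has_weak_deriv_smooth_mult[OF p(1) test_fun_smooth[OF zt(1)]]])
 show "cplx (pr r i) : L2" for i unfolding L2_cplx_iff by (rule prL)
 have "bdd_supp (pr r i)" for i unfolding pr_def[abs_def]
 by (intro bdd_supp_add bdd_supp_mono[OF bd(1)[of r]] bdd_supp_mono[OF bd(2)[of i r]]) auto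
 then show "bdd_supp (cplx (pr r i))" for i by (rule bdd_supp_mono) simp
 qed
 have lim: "(%r. LI x. of_real (w r x) * V x) ----> (LI x. of_real (w' x) * V x)"
 if w: "!!r. w r : L2" "w' : L2" "V : L2" "(%r. L2norm (%x. w r x - w' x)) ----> 0" for w :: "nat => real^'n => real" and w' and V :: "real^'n => complex"
 proof -
 have "(%r. ip (cplx (w r)) (%x. cnj (V x))) ----> ip (cplx w') (%x. cnj (V x))"
 proof (rule ip_tendsto_left)
 have "(%x. cor (w r x) - of_real (w' x)) = cplx (%x. w r x - w' x)" for r by simp
 then show "(%r. L2norm (%x. cor (w r x) - of_real (w' x))) ----> 0" using w(4) by (simp only: L2norm_cplx)
 qed (use w in "auto simp: L2_cplx_iff")
 then show ?thesis by (simp add: ip_def)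
 qed
 have l1: "(%r. L2norm (%x. pr r i x - wderiv [i] psi x)) ----> 0" for i
 proof (rule tendsto_sandwich[OF _ _ tendsto_const])
 have "L2norm (%x. pr r i x - wderiv [i] psi x) <= L2norm (%x. zt r x *R wderiv [i] psi x - wderiv [i] psi x) + C / Suc r * L2norm psi" for r
 proof -
 have "(%x. pr r i x - wderiv [i] psi x) = (%x. (zt r x *R wderiv [i] psi x - wderiv [i] psi x) + part_deriv i (zt r) x *R psi x)"
 by (simp add: pr_def fun_eq_iff)
 then show ?thesis using L2norm_triangle[OF L2_diff[OF cut(2)[OF p(2)[of i], of r] p(2)[of i]] dzt(1)[of i r]] dzt(2)[of i r] by (simp only:)
 qed
 then show "\<forall>\<^sub>F r in sequentially. L2norm (%x. pr r i x - wderiv [i] psi x) <= L2norm (%x. zt r x *R wderiv [i] psi x - wderiv [i] psi x) + C / Suc r * L2norm psi" by simp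
 have "(%r. C / Suc r * L2norm psi) ----> 0 * L2norm psi" by (intro tendsto_mult tendsto_const lim_const_over_n[THEN LIMSEQ_Suc])
 from tendsto_add[OF cut(1)[OF p(2)[of i]] this]
 show "(%r. L2norm (%x. zt r x *R wderiv [i] psi x - wderiv [i] psi x) + C / Suc r * L2norm psi) ----> 0" by simp
 qed simp
 have l2: "psir r : L2" "(%r. L2norm (%x. psir r x - psi x)) ----> 0" for r
 unfolding psir_def[abs_def] using cut[OF psiL] by auto
 have "(%r. (SU i. LI x. of_real (pr r i x) * Z i x) + (LI x. of_real (psir r x) * X x))
 ----> (SU i. LI x. of_real (wderiv [i] psi x) * Z i x) + (LI x. of_real (psi x) * X x)"
 by (intro tendsto_add tendsto_sum lim prL p l1 l2 psiL Z_L2 X_L2)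
 moreover have "(%r. LI x. of_real (psir r x) * synth B.wave c x) ----> (LI x. of_real (psi x) * synth B.wave c x)"
 by (intro lim l2 psiL B.synth_in_L2 c)
 ultimately show ?thesis unfolding eq by (rule LIMSEQ_unique)
qed

end

context bloch_scaled begin

definition dirichlet :: "(real^'n => real) => (real^'n => real) => real^'n => real" where
 "dirichlet y z x = (SU i. SU j. wderiv [i] z x * (A (x /\<^sub>R eps) $ i $ j * wderiv [j] y x))"

definition bil :: "(real^'n => real) => (real^'n => real) => real" where
 "bil y z = (LI x. dirichlet y z x + y x * z x)"

lemma dirichlet_eq: "wgrad z x \<bullet> (A (x /\<^sub>R eps) *v wgrad y x) = dirichlet y z x"
 by (simp add: dirichlet_def wgrad_def inner_vec_def matrix_vector_mult_def sum_distrib_left)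

lemma solves_state_iff:
 "solves_state A eps g y \<longleftrightarrow> y : Hk 1 & (\<forall>phi\<in>Hk 1. bil y phi = (LI x. g x * phi x))"
 by (simp add: solves_state_def bil_def dirichlet_eq)

lemma energy_eq: "energy A eps y = bil y y"
 by (simp add: energy_def bil_def dirichlet_eq power2_eq_square)

lemma Hk1_L2: "y : Hk 1 ==> y : L2" by (simp add: Hk_def)

lemma Hk1_deriv: "y : Hk 1 ==> has_weak_deriv [i] y (wderiv [i] y)" "y : Hk 1 ==> wderiv [i] y : L2"
 using Hk_wderiv[of y 1 "[i]"] by auto

lemma Hk1_I:
 fixes y :: "real^'n => real"
 assumes "y : L2" "!!i. g i : L2" "!!i. has_weak_deriv [i] y (g i)" shows "y : Hk 1"
 unfolding Hk_def
proof (intro CollectI conjI allI impI assms)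
 fix js :: "'n list" assume "length js <= 1"
 then consider "js = []" | i where "js = [i]" by (cases js) auto
 then show "\<exists>g\<in>L2. has_weak_deriv js y g"
 by cases (use assms L2_loc_integrable[OF assms(1)] has_weak_deriv_Nil in auto)
qed

lemma Hk1_lin:
 fixes y z :: "real^'n => real"
 assumes y: "y : Hk 1" and z: "z : Hk 1"
 shows "(%x. y x + t * z x) : Hk 1" "AEL x. \<forall>i. wderiv [i] (%x. y x + t * z x) x = wderiv [i] y x + t * wderiv [i] z x"
proof -
 have d: "has_weak_deriv [i] (%x. y x + t * z x) (%x. wderiv [i] y x + t * wderiv [i] z x)" for i
 by (intro has_weak_deriv_add has_weak_deriv_bounded_linear[OF bounded_linear_mult_right] Hk1_deriv y z)
 show "(%x. y x + t * z x) : Hk 1"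
 by (rule Hk1_I[OF _ _ d]) (intro L2_add L2_mult_const Hk1_L2 Hk1_deriv y z)+
 show "AEL x. \<forall>i. wderiv [i] (%x. y x + t * z x) x = wderiv [i] y x + t * wderiv [i] z x"
 using wderiv_AE[OF d] by (simp add: AE_all_countable)
qed

lemma bil_integrable:
 assumes "y : Hk 1" "z : Hk 1" shows "intb (%x. dirichlet y z x + y x * z x)"
proof -
 have "(%x. A (x /\<^sub>R eps) $ i $ j * wderiv [j] y x) : L2" for i j
 using coeff_scaled_mult_L2[OF Hk1_deriv(2)[OF assms(1)], of i j j] by simp
 then show ?thesis unfolding dirichlet_def
 by (intro Bochner_Integration.integrable_add Bochner_Integration.integrable_sum L2_integrable_mult
 Hk1_L2[OF assms(1)] Hk1_L2[OF assms(2)] Hk1_deriv(2)[OF assms(2)])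
qed

lemma bil_lin_left:
 assumes "y : Hk 1" "w : Hk 1" "z : Hk 1"
 shows "bil (%x. y x + t * w x) z = bil y z + t * bil w z"
proof -
 note yw = Hk1_lin[OF assms(1,2), of t]
 have "bil (%x. y x + t * w x) z = (LI x. (dirichlet y z x + y x * z x) + t * (dirichlet w z x + w x * z x))"
 unfolding bil_def
 proof (rule integral_cong_AE)
 show "AEL x. dirichlet (%x. y x + t * w x) z x + (y x + t * w x) * z x = (dirichlet y z x + y x * z x) + t * (dirichlet w z x + w x * z x)"
 using yw(2) by eventually_elim (simp add: dirichlet_def algebra_simps sum.distrib sum_distrib_left)
 qed (use bil_integrable[OF yw(1) assms(3)] bil_integrable[OF assms(1,3)] bil_integrable[OF assms(2,3)] in
 \<open>auto intro!: borel_measurable_integrable Bochner_Integration.integrable_add\<close>)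
 then show ?thesis using bil_integrable[OF assms(1,3)] bil_integrable[OF assms(2,3)] by (simp add: bil_def)
qed

lemma bil_sym:
 assumes "y : Hk 1" "z : Hk 1" shows "bil y z = bil z y"
 unfolding bil_def
proof (rule integral_cong_AE)
 have "AEL x. transpose (A x) = A x" using coeff by (simp add: coefficient_field_def)
 from AE_scale[OF _ this, of "inverse eps"] eps have "AEL x. transpose (A (x /\<^sub>R eps)) = A (x /\<^sub>R eps)" by simp
 then show "AEL x. dirichlet y z x + y x * z x = dirichlet z y x + z x * y x"
 proof eventually_elim
 case (elim x)
 have "A (x /\<^sub>R eps) $ i $ j = A (x /\<^sub>R eps) $ j $ i" for i j using arg_cong[OF elim, of "%M. M $ j $ i"] by (simp add: transpose_def)
 then have "dirichlet z y x = (SU i. SU j. wderiv [j] z x * (A (x /\<^sub>R eps) $ j $ i * wderiv [i] y x))"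
 unfolding dirichlet_def by (intro sum.cong refl) (simp add: ac_simps)
 also have "... = dirichlet y z x" unfolding dirichlet_def by (rule sum.swap)
 finally show ?case by simp
 qed
qed (use bil_integrable assms in auto)

lemma bil_self_ge:
 assumes "y : Hk 1" shows "(LI x. (y x)^2) <= bil y y"
 unfolding bil_def
proof (rule integral_mono_AE)
 show "intb (%x. (y x)^2)" using L2_integrable_sq[OF Hk1_L2[OF assms]] by simp
 obtain al where al: "0 < al" "AEL x. \<forall>\<xi>. al * (norm \<xi>)^2 <= \<xi> \<bullet> (A x *v \<xi>)" using coeff unfolding coefficient_field_def by blast
 have "AEL x. \<forall>\<xi>. al * (norm \<xi>)^2 <= \<xi> \<bullet> (A (x /\<^sub>R eps) *v \<xi>)" using AE_scale[OF _ al(2), of "inverse eps"] eps by simp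
 then show "AEL x. (y x)^2 <= dirichlet y y x + y x * y x"
 proof eventually_elim
 case (elim x)
 have "0 <= al * (norm (wgrad y x))^2" using al by simp
 also have "... <= dirichlet y y x" using elim unfolding dirichlet_eq[symmetric] by blast
 finally show ?case by (simp add: power2_eq_square)
 qed
qed (rule bil_integrable[OF assms assms])

end

context bloch_packet begin

lemma packet_solves_state: "solves_state A eps (%x. Re (synth B.wave c x)) (%x. Re (X x))"
 unfolding solves_state_iff
proof (intro conjI ballI)
 have d: "has_weak_deriv [i] (%x. Re (X x)) (%x. Re (Y i x))" for i by (rule has_weak_deriv_bounded_linear[OF bounded_linear_Re X_weak_deriv])
 show H: "(%x. Re (X x)) : Hk 1" by (rule Hk1_I[OF L2_Re[OF X_L2] L2_Re[OF Y_L2] d])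
 fix phi :: "real^'n => real" assume phi: "phi : Hk 1"
 note phiL = Hk1_L2[OF phi] Hk1_deriv(2)[OF phi]
 let ?f = "%x. (SU i. of_real (wderiv [i] phi x) * Z i x) + of_real (phi x) * X x"
 have i: "intb (%x. of_real (wderiv [i] phi x) * Z i x)" "intb (%x. of_real (phi x) * X x)" for i
 by (intro L2_integrable_mult Z_L2 X_L2; simp add: L2_cplx_iff phiL)+
 have fi: "intb ?f" by (intro Bochner_Integration.integrable_add Bochner_Integration.integrable_sum i)
 have "AEL x. \<forall>i. wderiv [i] (%x. Re (X x)) x = Re (Y i x)" using wderiv_AE[OF d] by (simp add: AE_all_countable)
 then have "AEL x. dirichlet (%x. Re (X x)) phi x + Re (X x) * phi x = Re (?f x)"
 by eventually_elim (simp add: dirichlet_def Z_def sum_distrib_left ac_simps)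
 then have "bil (%x. Re (X x)) phi = (LI x. Re (?f x))" unfolding bil_def
 by (rule integral_cong_AE[OF borel_measurable_integrable[OF bil_integrable[OF H phi]] borel_measurable_integrable[OF integrable_Re[OF fi]]])
 also have "... = Re (LI x. ?f x)" by (rule integral_Re[OF fi])
 also have "(LI x. ?f x) = (LI x. of_real (phi x) * synth B.wave c x)"
 unfolding packet_equation[OF phi, symmetric] by (simp add: i)
 also have "Re ... = (LI x. Re (of_real (phi x) * synth B.wave c x))"
 by (rule integral_Re[symmetric]) (intro L2_integrable_mult B.synth_in_L2 c, simp add: L2_cplx_iff phiL)
 finally show "bil (%x. Re (X x)) phi = (LI x. Re (synth B.wave c x) * phi x)" by (simp add: mult.commute)
qed

end

section \<open>Optimality condition of the original problem\<close>

lemma good_indicator: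
 assumes "g : L2" "K : sets borel" "bounded K"
 shows "good K (%eta. ind K eta *R g eta)"
proof -
 obtain R where "\<forall>eta\<in>K. norm eta <= R" using assms(3) unfolding bounded_iff by blast
 then have "bdd_supp (%eta. ind K eta *R g eta)" unfolding bdd_supp_def by (intro exI[of _ R]) (auto simp: indicator_def)
 moreover have "(%eta. ind K eta *R g eta) : L2" by (rule L2_indicator[OF assms(1,2)])
 ultimately show ?thesis by (simp add: good_def)
qed

context bloch_scaled begin

abbreviation W :: "(real^'n => complex) => real^'n => complex" where "W \<equiv> synth B.wave"

abbreviation S :: "(real^'n) set" where "S \<equiv> Zscaled eps"

abbreviation res :: "(real^'n => complex) => real^'n => complex" where "res c \<equiv> %eta. of_real (resolvent eta) * c eta"

lemma solves_packet: "good S c ==> solves_state A eps (%x. Re (W c x)) (%x. Re (W (res c) x))"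
 by (rule bloch_packet.packet_solves_state) unfold_locales

lemma solves_state_cong:
 assumes y: "solves_state A eps g y" and g: "AEL x. g x = g' x" "g : L2" "g' : L2"
 shows "solves_state A eps g' y"
 unfolding solves_state_iff
proof (intro conjI ballI)
 show "y : Hk 1" using y by (simp add: solves_state_iff)
 fix phi :: "real^'n => real" assume phi: "phi : Hk 1"
 note [measurable] = g(2,3)[THEN L2_measurable] Hk1_L2[OF phi, THEN L2_measurable]
 have "(LI x. g x * phi x) = (LI x. g' x * phi x)"
 by (rule integral_cong_AE) (measurable, use g(1) in "auto elim: eventually_mono")
 then show "bil y phi = (LI x. g' x * phi x)" using y phi by (simp add: solves_state_iff)
qed

lemma solves_state_lin:
 assumes y: "solves_state A eps g y" "g : L2" and z: "solves_state A eps h z" "h : L2"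
 shows "solves_state A eps (%x. g x + t * h x) (%x. y x + t * z x)"
 unfolding solves_state_iff
proof (intro conjI ballI)
 have H: "y : Hk 1" "z : Hk 1" using y z by (auto simp: solves_state_iff)
 show "(%x. y x + t * z x) : Hk 1" by (rule Hk1_lin(1)[OF H])
 fix phi :: "real^'n => real" assume phi: "phi : Hk 1"
 have i: "intb (%x. g x * phi x)" "intb (%x. h x * phi x)" by (intro L2_integrable_mult y z Hk1_L2[OF phi])+
 have "(LI x. (g x + t * h x) * phi x) = (LI x. g x * phi x + t * (h x * phi x))" by (simp add: algebra_simps)
 also have "... = (LI x. g x * phi x) + t * (LI x. h x * phi x)" using i by simp
 finally show "bil (%x. y x + t * z x) phi = (LI x. (g x + t * h x) * phi x)"
 using y z phi bil_lin_left[OF H phi] by (simp add: solves_state_iff)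
qed

text \<open>Multiplying the coefficients by \<open>- \<i>\<close> shows that the imaginary part solves the state equation
 with right-hand side zero, so it vanishes by coercivity.\<close>

lemma real_packet:
 assumes c: "good S c" and re: "AEL x. Im (W c x) = 0"
 shows "AEL x. of_real (Re (W (res c) x)) = W (res c) x"
proof -
 have gi: "good S (%eta. - \<i> * c eta)" by (rule good_scale[OF c])
 have e: "W (%eta. - \<i> * c eta) x = - \<i> * W c x" "W (res (%eta. - \<i> * c eta)) x = - \<i> * W (res c) x" for x
 using B.synth_scale[of "- \<i>" c x] B.synth_scale[of "- \<i>" "res c" x] by (simp_all only: mult.left_commute)
 have "solves_state A eps (%x. Im (W c x)) (%x. Im (W (res c) x))" using solves_packet[OF gi] unfolding e by simp
 from solves_state_cong[OF this re L2_Im[OF B.synth_in_L2[OF c]] L2_zero]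
 have s: "solves_state A eps (%x. 0) (%x. Im (W (res c) x))" .
 then have "bil (%x. Im (W (res c) x)) (%x. Im (W (res c) x)) = 0" by (simp add: solves_state_iff)
 moreover have "(%x. Im (W (res c) x)) : Hk 1" using s by (simp add: solves_state_iff)
 ultimately have "(L2norm (%x. Im (W (res c) x)))^2 <= 0" using bil_self_ge by (fastforce simp: L2norm_sq)
 then have "L2norm (%x. Im (W (res c) x)) = 0" by simp
 then have "AEL x. Im (W (res c) x) = 0"
 using L2norm_eq_0_iff[OF L2_Im[OF B.synth_in_L2[OF good_resolvent[OF c]]]] by simp
 then show ?thesis by eventually_elim (simp add: complex_eq_iff)
qed

text \<open>Test the equation of \<open>y\<close> with the packet and that of the packet with \<open>y\<close>; the form is symmetric.\<close>

lemma state_coefficients: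
 assumes y: "solves_state A eps g y" and g: "g : L2" and b: "good S b"
 shows "Re (ip (cplx y) (W b)) = Re (ip (cplx g) (W (res b)))"
proof -
 note rb = good_resolvent[OF b]
 have H: "y : Hk 1" "(%x. Re (W (res b) x)) : Hk 1" using y solves_packet[OF b] by (auto simp: solves_state_iff)
 have r: "Re (ip (cplx w) V) = (LI x. w x * Re (V x))" if "w : L2" "V : L2" for w :: "real^'n => real" and V
 using integral_Re[OF ip_integrable[of "cplx w" V]] that by (simp add: ip_def L2_cplx_iff)
 have "Re (ip (cplx y) (W b)) = (LI x. Re (W b x) * y x)"
 using r[OF Hk1_L2[OF H(1)] B.synth_in_L2[OF b]] by (simp add: mult.commute)
 also have "... = bil (%x. Re (W (res b) x)) y" using solves_packet[OF b] H by (simp add: solves_state_iff)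
 also have "... = (LI x. g x * Re (W (res b) x))" using y H by (subst bil_sym) (simp_all add: solves_state_iff)
 also have "... = Re (ip (cplx g) (W (res b)))" by (subst r) (simp_all add: g B.synth_in_L2 rb)
 finally show ?thesis .
qed

lemma energy_expand:
 assumes z: "z : Hk 1" and w: "solves_state A eps h w"
 shows "energy A eps (%x. z x + t * w x) = energy A eps z + 2 * t * (LI x. h x * z x) + t^2 * energy A eps w"
proof -
 have wH: "w : Hk 1" using w by (simp add: solves_state_iff)
 note zw = Hk1_lin(1)[OF z wH, of t]
 have "energy A eps (%x. z x + t * w x) = bil z (%x. z x + t * w x) + t * bil w (%x. z x + t * w x)"
 unfolding energy_eq by (rule bil_lin_left[OF z wH zw])
 also have "bil z (%x. z x + t * w x) = bil z z + t * bil w z" by (subst bil_sym[OF z zw]) (rule bil_lin_left[OF z wH z])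
 also have "bil w (%x. z x + t * w x) = bil w z + t * bil w w"
 by (subst bil_sym[OF wH zw], subst bil_lin_left[OF z wH wH], subst bil_sym[OF z wH]) (rule refl)
 also have "bil w z = (LI x. h x * z x)" using w z by (simp add: solves_state_iff)
 finally show ?thesis by (simp add: energy_eq algebra_simps power2_eq_square)
qed

lemma square_expand:
 fixes z w :: "real^'n => real"
 assumes "z : L2" "w : L2"
 shows "(LI x. (z x + t * w x)^2) = (LI x. (z x)^2) + 2 * t * (LI x. z x * w x) + t^2 * (LI x. (w x)^2)"
proof -
 have i: "intb (%x. (z x)^2)" "intb (%x. z x * w x)" "intb (%x. (w x)^2)"
 using L2_integrable_sq[OF assms(1)] L2_integrable_sq[OF assms(2)] L2_integrable_mult[OF assms] by auto
 have "(z x + t * w x)^2 = (z x)^2 + 2 * t * (z x * w x) + t^2 * (w x)^2" for x by (simp add: power2_eq_square algebra_simps)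
 then show ?thesis using i by simp
qed

text \<open>
 The part of a state outside the packets with coefficients in \<open>K\<close> is the state generated by the
 corresponding part of the control; hence the two have a nonnegative inner product, and dropping
 them only strengthens the variational inequality.
\<close>

lemma original_optimality_condition:
 assumes K: "K : sets borel" "bounded K" "K \<subseteq> S"
 and good: "good K F" "good K d1" "good K d2" "good K av"
 and data: "fe : L2" "AEL x. cplx fe x = W F x"
 "y1 : Hk 1" "AEL x. cplx y1 x = W d1 x"
 "y2 : L2" "AEL x. cplx y2 x = W d2 x"
 and w: "0 <= mu1" "0 <= mu2" "0 < ka"
 and U: "U \<subseteq> L2" "fun_convex U" "ae_in (W (%eta. ind K eta *R B.coef (cplx u) eta)) U"
 and opt: "optimal_original A mu1 mu2 ka eps fe y1 y2 U u y"
 and v: "v : U" "AEL x. cplx v x = W av x"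
 shows "0 <= Re (ip (red_grad mu1 mu2 ka F d1 d2 resolvent (%eta. ind K eta *R B.coef (cplx u) eta))
 (%eta. av eta - ind K eta *R B.coef (cplx u) eta))"
proof -
 define a where "a eta = ind K eta *R B.coef (cplx u) eta" for eta
 have uy: "u : U" "solves_state A eps (%x. fe x + u x) y"
 and min: "!!w z. w : U ==> solves_state A eps (%x. fe x + w x) z ==>
 cost mu1 mu2 ka (energy A eps) y1 y2 (u, y) <= cost mu1 mu2 ka (energy A eps) y1 y2 (w, z)"
 using opt unfolding optimal_original_def is_arg_min_def by (auto simp: not_less)
 have L: "u : L2" "v : L2" "(%x. fe x + u x) : L2" "(%x. fe x + v x) : L2" using uy(1) v(1) U(1) data(1) by auto
 have yH: "y : Hk 1" using uy(2) by (simp add: solves_state_iff)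
 have gS: "good S c" if "good K c" for c using good_mono[OF that K(3)] .
 have WL: "W c : L2" if "good K c" for c by (rule B.synth_in_L2[OF gS[OF that]])
 have gr: "good K (res c)" if "good K c" for c by (rule good_resolvent[OF that])
 have ga: "good K a" unfolding a_def[abs_def] by (rule good_indicator[OF B.coef_L2 K(1,2)]) (simp add: L2_cplx_iff L)
 have good_sum: "good K (%eta. F eta + a eta)" "good K (%eta. F eta + av eta)" by (intro good_add good ga)+
 let ?bt = "res (%eta. F eta + a eta)" and ?btv = "res (%eta. F eta + av eta)"
 have a_real: "AEL x. Im (W a x) = 0"
 using U(3) unfolding ae_in_def a_def[symmetric] by (auto elim!: eventually_mono) (metis Im_complex_of_real)
 have F_real: "AEL x. Im (W F x) = 0" using data(2) by eventually_elim (metis Im_complex_of_real)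
 have v_real: "AEL x. Im (W av x) = 0" using v(2) by eventually_elim (metis Im_complex_of_real)
 have Fa: "AEL x. W (%eta. F eta + c eta) x = W F x + W c x" if "good K c" for c by (rule B.synth_add[OF gS[OF good(1)] gS[OF that]])
 have real: "AEL x. of_real (Re (W (res (%eta. F eta + c eta)) x)) = W (res (%eta. F eta + c eta)) x"
 if c: "good K c" "AEL x. Im (W c x) = 0" for c
 proof (rule real_packet[OF gS[OF good_add[OF good(1) c(1)]]])
 show "AEL x. Im (W (%eta. F eta + c eta) x) = 0" using Fa[OF c(1)] F_real c(2) by eventually_elim simp
 qed
 define yv where "yv x = Re (W ?btv x)" for x
 define yp where "yp x = Re (W ?bt x)" for x
 define pu where "pu x = Re (W a x)" for x
 have yvW: "AEL x. cplx yv x = W ?btv x" unfolding yv_def by (rule real[OF good(4) v_real])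
 have ypW: "AEL x. cplx yp x = W ?bt x" unfolding yp_def by (rule real[OF ga a_real])
 have puW: "AEL x. cplx pu x = W a x" using a_real by eventually_elim (simp add: pu_def complex_eq_iff)
 have puL: "pu : L2" unfolding pu_def[abs_def] by (rule L2_Re[OF WL[OF ga]])
 have yvS: "solves_state A eps (%x. fe x + v x) yv"
 unfolding yv_def[abs_def]
 proof (rule solves_state_cong[OF solves_packet[OF gS[OF good_sum(2)]] _ L2_Re[OF WL[OF good_sum(2)]] L(4)])
 show "AEL x. Re (W (%eta. F eta + av eta) x) = fe x + v x"
 using Fa[OF good(4)] data(2) v(2) by eventually_elim (metis Re_complex_of_real plus_complex.sel(1))
 qed
 have ypS: "solves_state A eps (%x. fe x + pu x) yp"
 unfolding yp_def[abs_def]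
 proof (rule solves_state_cong[OF solves_packet[OF gS[OF good_sum(1)]] _ L2_Re[OF WL[OF good_sum(1)]] L2_add[OF data(1) puL]])
 show "AEL x. Re (W (%eta. F eta + a eta) x) = fe x + pu x"
 using Fa[OF ga] data(2) puW by eventually_elim (metis Re_complex_of_real plus_complex.sel(1))
 qed
 have yvH: "yv : Hk 1" and ypH: "yp : Hk 1" using yvS ypS by (auto simp: solves_state_iff)
 note HL = Hk1_L2[OF yH] Hk1_L2[OF yvH] Hk1_L2[OF ypH] Hk1_L2[OF data(3)]
 \<comment> \<open>the parts of state and control outside the packets with coefficients in \<open>K\<close>\<close>
 define yo where "yo x = y x + (- 1) * yp x" for x
 define uo where "uo x = u x - pu x" for x
 have oL: "yo : L2" "uo : L2" unfolding yo_def[abs_def] uo_def[abs_def] by (intro L2_add L2_mult_const L2_diff HL L puL)+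
 have "solves_state A eps (%x. (fe x + u x) + (- 1) * (fe x + pu x)) yo"
 unfolding yo_def[abs_def] by (rule solves_state_lin[OF uy(2) L(3) ypS]) (intro L2_add data puL)
 then have yo_s: "solves_state A eps uo yo" by (simp add: uo_def[abs_def])
 then have yo_uo: "0 <= (LI x. yo x * uo x)"
 proof -
 have "0 <= (LI x. (yo x)^2)" by simp
 also have "... <= bil yo yo" using yo_s by (intro bil_self_ge) (simp add: solves_state_iff)
 also have "... = (LI x. uo x * yo x)" using yo_s by (simp add: solves_state_iff)
 finally show ?thesis by (simp add: mult.commute)
 qed
 have ipW: "ip (cplx z) (W b) = ip c b" if "z : L2" "AEL x. cplx z x = W c x" "good K c" "good K b" for z c b
 proof -
 have "ip (cplx z) (W b) = ip (W c) (W b)"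
 by (rule ip_cong_AE[OF that(2)]) (use that WL in "auto simp: L2_cplx_iff")
 then show ?thesis using B.ip_synth[OF gS[OF that(3)] gS[OF that(4)]] by simp
 qed
 have uW: "ip (cplx u) (W b) = ip a b" if b: "good K b" for b
 proof -
 have "ip (cplx u) (W b) = ip (B.coef (cplx u)) b" by (rule B.ip_coef[symmetric, OF _ gS[OF b]]) (simp add: L2_cplx_iff L)
 also have "... = ip a b" unfolding ip_def a_def
 by (rule Bochner_Integration.integral_cong) (use good_off[OF b] in "auto simp: indicator_def")
 finally show ?thesis .
 qed
 have d: "cplx (%x. p x - q x) = (%x. cplx p x - cplx q x)" "cplx (%x. p x + (- 1) * q x) = (%x. cplx p x - cplx q x)" "cplx (%x. p x + q x) = (%x. cplx p x + cplx q x)" for p q :: "real^'n => real"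
 by (simp_all add: fun_eq_iff)
 have uo_orth: "Re (ip (cplx uo) (W b)) = 0" if b: "good K b" for b
 proof -
 have "ip (cplx uo) (W b) = ip (cplx u) (W b) - ip (cplx pu) (W b)"
 unfolding uo_def[abs_def] d by (rule ip_diff_left) (simp_all add: L2_cplx_iff L puL WL b)
 then show ?thesis by (simp add: uW[OF b] ipW[OF puL puW ga b])
 qed
 have yo_orth: "Re (ip (cplx yo) (W b)) = 0" if b: "good K b" for b
 proof -
 have "ip (cplx yo) (W b) = ip (cplx y) (W b) - ip (cplx yp) (W b)"
 unfolding yo_def[abs_def] d by (rule ip_diff_left) (simp_all add: L2_cplx_iff HL WL b)
 moreover have "Re (ip (cplx y) (W b)) = Re (ip (cplx fe) (W (res b)) + ip (cplx u) (W (res b)))"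
 unfolding state_coefficients[OF uy(2) L(3) gS[OF b]] d
 by (subst ip_add_left) (simp_all add: L2_cplx_iff data L WL gr b)
 moreover have "ip (cplx fe) (W (res b)) + ip (cplx u) (W (res b)) = ip (%eta. F eta + a eta) (res b)"
 by (subst ip_add_left) (simp_all add: good_L2[OF good(1)] good_L2[OF ga] good_L2[OF gr[OF b]] ipW[OF data(1,2) good(1) gr[OF b]] uW[OF gr[OF b]])
 moreover have "ip (%eta. F eta + a eta) (res b) = ip ?bt b" unfolding ip_def by (simp add: ac_simps)
 ultimately show ?thesis by (simp add: ipW[OF HL(3) ypW gr[OF good_sum(1)] b])
 qed
 let ?e = "%eta. av eta - a eta"
 have ge: "good K ?e" by (intro good_diff good ga)
 have pair: "(LI x. r1 x * r2 x) = Re (ip b1 b2) + t * (LI x. z1 x * z2 x)"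
 if r: "r1 : L2" "r2 : L2" "z1 : L2" "z2 : L2" and b: "good K b1" "good K b2"
 and z: "Re (ip (cplx z1) (W b2)) = 0" "Re (ip (cplx z2) (W b1)) = 0"
 and e: "AEL x. cplx r1 x = W b1 x + cplx z1 x" "AEL x. cplx r2 x = W b2 x + of_real t * cplx z2 x"
 for r1 r2 z1 z2 :: "real^'n => real" and b1 b2 t
 proof -
 have c: "cplx z1 : L2" "cplx z2 : L2" "(%x. of_real t * cplx z2 x) : L2" "(%x. W b2 x + of_real t * cplx z2 x) : L2" "(%x. W b1 x + cplx z1 x) : L2"
 using r by (auto simp: L2_cplx_iff intro!: L2_mult_const L2_add WL b)
 have "of_real (LI x. r1 x * r2 x) = ip (cplx r1) (cplx r2)" by (rule Re_ip_cplx[symmetric])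
 also have "... = ip (%x. W b1 x + cplx z1 x) (%x. W b2 x + of_real t * cplx z2 x)"
 by (rule ip_cong_AE[OF e]) (use r c in "simp_all add: L2_cplx_iff")
 also have "... = (ip (W b1) (W b2) + of_real t * ip (W b1) (cplx z2)) + (ip (cplx z1) (W b2) + of_real t * ip (cplx z1) (cplx z2))"
 by (simp add: ip_add_left ip_add_right ip_scale_right c WL b)
 also have "ip (W b1) (W b2) = ip b1 b2" by (rule B.ip_synth[OF gS[OF b(1)] gS[OF b(2)]])
 also have "ip (cplx z1) (cplx z2) = of_real (LI x. z1 x * z2 x)" by (rule Re_ip_cplx)
 finally have "(LI x. r1 x * r2 x) = Re (ip b1 b2 + of_real t * ip (W b1) (cplx z2) + (ip (cplx z1) (W b2) + of_real t * of_real (LI x. z1 x * z2 x)))"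
 by (metis Re_complex_of_real)
 moreover have "Re (ip (W b1) (cplx z2)) = 0" using z(2) ip_cnj[of "cplx z2" "W b1"] by (metis complex_cnj(1) cnj.sel(1))
 ultimately show ?thesis using z(1) by simp
 qed
 have y_dec: "AEL x. cplx (%x. y x - yd x) x = W (%eta. ?bt eta - dd eta) x + cplx yo x"
 if "good K dd" "AEL x. cplx yd x = W dd x" for yd dd
 using B.synth_diff[OF gS[OF gr[OF good_sum(1)]] gS[OF that(1)]] that(2) ypW
 by eventually_elim (simp add: yo_def)
 have vu: "AEL x. cplx (%x. v x - u x) x = W ?e x + of_real (- 1) * cplx uo x"
 using B.synth_diff[OF gS[OF good(4)] gS[OF ga]] v(2) puW by eventually_elim (simp add: uo_def)
 have yvy: "AEL x. cplx (%x. yv x - y x) x = W (res ?e) x + of_real (- 1) * cplx yo x"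
 proof -
 have e: "res ?e = (%eta. ?btv eta - ?bt eta)" by (simp add: fun_eq_iff algebra_simps)
 show ?thesis unfolding e using B.synth_diff[OF gS[OF gr[OF good_sum(2)]] gS[OF gr[OF good_sum(1)]]] yvW ypW
 by eventually_elim (simp only: yo_def, simp)
 qed
 have u_dec: "AEL x. cplx u x = W a x + cplx uo x" using puW by eventually_elim (simp add: uo_def)
 have gd: "good K (%eta. ?bt eta - d1 eta)" "good K (%eta. ?bt eta - d2 eta)" by (intro good_diff gr good_sum good)+
 have p1: "(LI x. (y x - y1 x) * (v x - u x)) = Re (ip (%eta. ?bt eta - d1 eta) ?e) + (- 1) * (LI x. yo x * uo x)"
 by (rule pair[OF _ _ oL gd(1) ge yo_orth[OF ge] uo_orth[OF gd(1)] y_dec[OF good(2) data(4)] vu]) (intro L2_diff HL L)+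
 have p2: "(LI x. (y x - y2 x) * (yv x - y x)) = Re (ip (%eta. ?bt eta - d2 eta) (res ?e)) + (- 1) * (LI x. yo x * yo x)"
 by (rule pair[OF _ _ oL(1) oL(1) gd(2) gr[OF ge] yo_orth[OF gr[OF ge]] yo_orth[OF gd(2)] y_dec[OF good(3) data(6)] yvy]) (intro L2_diff HL data)+
 have p3: "(LI x. u x * (v x - u x)) = Re (ip a ?e) + (- 1) * (LI x. uo x * uo x)"
 by (rule pair[OF L(1) _ oL(2) oL(2) ga ge uo_orth[OF ge] uo_orth[OF ga] u_dec vu]) (intro L2_diff L)
 let ?w = "%x. yv x - y x" and ?D = "mu1 * (LI x. (y x - y1 x) * (v x - u x)) + mu2 * (LI x. (y x - y2 x) * (yv x - y x)) + ka * (LI x. u x * (v x - u x))"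
 have wS: "solves_state A eps (%x. v x - u x) ?w"
 using solves_state_lin[OF yvS L(4) uy(2) L(3), of "- 1"] by simp
 have "0 <= ?D"
 proof (rule quadratic_first_order)
 fix t :: real assume t: "0 < t" "t <= 1"
 have ut: "(%x. u x + t * (v x - u x)) : U"
 proof -
 have "(%x. (1 - t) * u x + t * v x) : U" using U(2) uy(1) v(1) t by (simp add: fun_convex_def)
 then show ?thesis by (simp add: algebra_simps)
 qed
 have st: "solves_state A eps (%x. fe x + (u x + t * (v x - u x))) (%x. y x + t * ?w x)"
 using solves_state_lin[OF uy(2) L(3) wS L2_diff[OF L(2,1)], of t] by (simp add: add.assoc)
 have wL: "?w : L2" "(%x. v x - u x) : L2" "(%x. y x - y2 x) : L2" by (intro L2_diff HL L data)+
 have zH: "(%x. y x - y1 x) : Hk 1" using Hk1_lin(1)[OF yH data(3), of "- 1"] by simp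
 have r: "y x + t * ?w x - q = (y x - q) + t * ?w x" for x q by simp
 have "cost mu1 mu2 ka (energy A eps) y1 y2 (u, y) <= cost mu1 mu2 ka (energy A eps) y1 y2 (%x. u x + t * (v x - u x), %x. y x + t * ?w x)"
 by (rule min[OF ut st])
 also have "... = cost mu1 mu2 ka (energy A eps) y1 y2 (u, y) + (t * ?D + t^2 * (mu1 / 2 * energy A eps ?w + mu2 / 2 * (LI x. (?w x)^2) + ka / 2 * (LI x. (v x - u x)^2)))"
 unfolding cost_def prod.case r energy_expand[OF zH wS] square_expand[OF wL(3,1)] square_expand[OF L(1) wL(2)]
 by (simp add: algebra_simps)
 finally show "0 <= t * ?D + t^2 * (mu1 / 2 * energy A eps ?w + mu2 / 2 * (LI x. (?w x)^2) + ka / 2 * (LI x. (v x - u x)^2))" by simp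
 qed
 also have "?D <= mu1 * Re (ip (%eta. ?bt eta - d1 eta) ?e) + mu2 * Re (ip (%eta. ?bt eta - d2 eta) (res ?e)) + ka * Re (ip a ?e)"
 unfolding p1 p2 p3 using w yo_uo by (intro add_mono mult_left_mono) auto
 also have "... = Re (ip (red_grad mu1 mu2 ka F d1 d2 resolvent a) ?e)"
 proof -
 have l: "(%eta. of_real mu1 * (?bt eta - d1 eta)) : L2" "(%eta. of_real mu2 * (of_real (resolvent eta) * (?bt eta - d2 eta))) : L2" "(%eta. of_real ka * a eta) : L2"
 by (rule L2_mult_const[OF good_L2[OF gd(1)]], rule L2_mult_const[OF good_L2[OF gr[OF gd(2)]]], rule L2_mult_const[OF good_L2[OF ga]])
 have "ip (red_grad mu1 mu2 ka F d1 d2 resolvent a) ?e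
 = of_real mu1 * ip (%eta. ?bt eta - d1 eta) ?e + of_real mu2 * ip (%eta. of_real (resolvent eta) * (?bt eta - d2 eta)) ?e + of_real ka * ip a ?e"
 unfolding red_grad_def[abs_def] by (simp only: ip_add_left[OF L2_add[OF l(1,2)] l(3) good_L2[OF ge]] ip_add_left[OF l(1,2) good_L2[OF ge]] ip_scale_left)
 also have "ip (%eta. of_real (resolvent eta) * (?bt eta - d2 eta)) ?e = ip (%eta. ?bt eta - d2 eta) (res ?e)" unfolding ip_def by (simp add: ac_simps)
 finally show ?thesis by simp
 qed
 finally show ?thesis by (simp add: a_def[abs_def])
qed

section \<open>Comparison of the two optimal states\<close>

lemma bloch_wave_eq: "eta : S ==> bloch_wave \<Phi> eps 0 eta x = B.wave eta x"
 unfolding bloch_wave_def B.wave_def by (simp add: mode_def Zscaled_def)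

lemma bloch_coeff_eq: "eta : S ==> bloch_coeff \<Phi> eps 0 u eta = B.coef u eta"
proof -
 have "bloch_wave \<Phi> eps 0 eta = B.wave eta" if "eta : S" for eta by (rule ext) (rule bloch_wave_eq[OF that])
 then have "L2_transform S (bloch_wave \<Phi> eps 0) u = L2_transform S B.wave u" by (rule L2_transform_cong)
 then show "eta : S ==> bloch_coeff \<Phi> eps 0 u eta = B.coef u eta" by (simp add: bloch_coeff_def B.coef_def)
qed

lemma adaption_eq: "adaption \<Phi> eps g x = W (%eta. ind S eta *R fourier g eta) x"
 unfolding adaption_def synth_def slint_def
 by (rule Bochner_Integration.integral_cong) (auto simp: indicator_def bloch_wave_eq)

lemma bloch_projection_eq: "K \<subseteq> S ==> bloch_projection \<Phi> eps K g x = W (%eta. ind K eta *R B.coef g eta) x"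
 unfolding bloch_projection_def synth_def slint_def
 by (rule Bochner_Integration.integral_cong) (auto simp: indicator_def bloch_wave_eq bloch_coeff_eq subsetD)

lemma adaption_bandlimited:
 assumes K: "K : sets borel" "K \<subseteq> S" and g: "g : L2" "AEL eta. eta \<notin> K --> fourier g eta = 0"
 shows "adaption \<Phi> eps g x = W (%eta. ind K eta *R fourier g eta) x"
 unfolding adaption_eq
proof (rule B.synth_cong_AE)
 show "AEL eta. ind S eta *R fourier g eta = ind K eta *R fourier g eta"
 using g(2) by eventually_elim (use K(2) in "auto simp: indicator_def")
 note [measurable] = K(1) fourier_L2[OF g(1), THEN L2_measurable]
 show "(%eta. ind S eta *R fourier g eta) : BM" "(%eta. ind K eta *R fourier g eta) : BM" by measurable
qed

lemma approx_state_eq: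
 assumes K: "K \<subseteq> S"
 shows "approx_state lam \<Phi> eps K f u x = synth pw (%eta. of_real (ind K eta * resolvent eta)
 * (ind K eta *R fourier (cplx f) eta + ind K eta *R B.coef (cplx u) eta)) x"
 unfolding approx_state_def synth_def slint_def
proof (rule Bochner_Integration.integral_cong[OF refl])
 fix eta
 show "ind K eta *R ((fourier (cplx f) eta + bloch_coeff \<Phi> eps 0 (cplx u) eta) / cor (1 + bloch_eigenvalue lam eps 0 eta) * pw eta x)
 = of_real (ind K eta * resolvent eta) * (ind K eta *R fourier (cplx f) eta + ind K eta *R B.coef (cplx u) eta) * pw eta x"
 proof (cases "eta : K")
 case True
 then have S: "eta : S" using K by blast
 then have "ev (eps *R eta) = lam 0 (eps *R eta)" by (simp add: ev_def Zscaled_def)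
 then show ?thesis using True by (simp add: resolvent_def bloch_eigenvalue_def bloch_coeff_eq[OF S])
 qed simp
qed

lemma wave_reflect:
 assumes K: "K : sets borel" "K \<subseteq> S" "uminus ` K = K"
 shows "AEL x. AEL eta. eta : K --> B.wave (- eta) x = cnj (B.wave eta x)"
proof (subst lborel_pair.AE_commute)
 note [measurable] = K(1)
 show "{x : space (lborel \<Otimes>\<^sub>M lborel). snd x : K --> B.wave (- snd x) (fst x) = cnj (B.wave (snd x) (fst x))} : sets (lborel \<Otimes>\<^sub>M lborel)"
 by measurable
 have "AEL th. th : Zcell & - th : Zcell --> (AEL x. \<Phi> 0 (- th) x = cnj (\<Phi> 0 th x))"
 using bloch by (simp add: bloch_system_def)
 from AE_scale[OF eps this]
 show "AEL eta. AEL x. eta : K --> B.wave (- eta) x = cnj (B.wave eta x)"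
 proof eventually_elim
 case (elim eta)
 show ?case
 proof (cases "eta : K")
 case True
 then have "- eta : K" using K(3) by (metis imageI)
 then have Z: "eps *R eta : Zcell" "- (eps *R eta) : Zcell" using subsetD[OF K(2) True] subsetD[OF K(2), of "- eta"] by (auto simp: Zscaled_def)
 have "AEL x. \<Phi> 0 (- (eps *R eta)) x = cnj (\<Phi> 0 (eps *R eta) x)" using elim Z by blast
 from AE_scale[OF _ this, of "inverse eps"] eps show ?thesis
 unfolding B.wave_def using Z by (auto elim!: eventually_mono simp: mode_def cnj_plane_wave)
 qed simp
 qed
qed

end

lemma distr_uminus_lborel: "distr lborel borel uminus = (lborel :: (real^'n::finite) measure)"
 using lborel_affine[of "- 1" "0 :: real^'n"] by (simp add: density_1 flip: one_ennreal_def)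

lemma integral_reflect:
 fixes f :: "real^'n::finite => complex"
 assumes [measurable]: "f : BM"
 shows "(LI x. f (- x)) = (LI x. f x)"
proof -
 have "(LINT x|distr lborel borel uminus. f x) = (LI x. f (- x))" by (rule integral_distr) measurable
 then show ?thesis unfolding distr_uminus_lborel by simp
qed

context bloch_scaled begin

text \<open>The waves at \<open>eta\<close> and \<open>- eta\<close> are conjugate, so a packet is real only if its coefficients are
 invariant under conjugation combined with reflection; plane waves have the same symmetry.\<close>

lemma real_coefficients:
 assumes K: "K : sets borel" "K \<subseteq> S" "uminus ` K = K"
 and a: "good K a" and re: "AEL x. Im (W a x) = 0"
 shows "AEL x. of_real (Re (synth pw a x)) = synth pw a x"
proof -
 have am[measurable]: "a : BM" using good_L2[OF a] by auto
 define a' where "a' eta = cnj (a (- eta))" for eta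
 have Km: "- eta : K \<longleftrightarrow> eta : K" for eta using K(3) by (metis imageI minus_minus)
 have ga': "good K a'"
 unfolding good_def
 proof (intro conjI allI impI)
 have "intb (%x. (norm (a (- x)))^2)"
 using integrable_distr[of uminus lborel borel "%x. (norm (a x))^2"] L2_integrable_sq[OF good_L2[OF a]] unfolding distr_uminus_lborel by simp
 then show "a' : L2" unfolding a'_def[abs_def] L2_iff by simp
 show "a' eta = 0" if "eta \<notin> K" for eta using good_off[OF a] that by (simp add: a'_def Km)
 obtain R where "!!x. R < norm x ==> a x = 0" using a unfolding good_def bdd_supp_def by blast
 then show "bdd_supp a'" unfolding bdd_supp_def a'_def by (intro exI[of _ R]) simp
 qed
 note gS = good_mono[OF _ K(2)]
 have "AEL x. W a' x = cnj (W a x)"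
 using wave_reflect[OF K]
 proof eventually_elim
 case (elim x)
 have "cnj (W a x) = (LI eta. cnj (a (- eta) * B.wave (- eta) x))"
 unfolding synth_def Bochner_Integration.integral_cnj[symmetric] by (rule integral_reflect[symmetric]) measurable
 also have "... = W a' x" unfolding synth_def
 proof (rule integral_cong_AE)
 show "AEL eta. cnj (a (- eta) * B.wave (- eta) x) = a' eta * B.wave eta x"
 using elim by eventually_elim (use good_off[OF a] Km in "auto simp: a'_def")
 qed (unfold a'_def, measurable)
 finally show ?case by simp
 qed
 with re B.synth_diff[OF gS[OF ga'] gS[OF a]] have "AEL x. W (%eta. a' eta - a eta) x = 0"
 by eventually_elim (simp add: complex_eq_iff)
 then have "L2norm (W (%eta. a' eta - a eta)) = 0" using B.synth_in_L2[OF gS[OF good_diff[OF ga' a]]] by (simp add: L2norm_eq_0_iff)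
 then have "L2norm (%eta. a' eta - a eta) = 0" using B.packet_isometry[OF gS[OF good_diff[OF ga' a]]] by simp
 then have "AEL eta. a' eta = a eta" using L2norm_eq_0_iff[OF good_L2[OF good_diff[OF ga' a]]] by simp
 then have e: "synth pw a x = synth pw a' x" for x
 by (intro fourier.synth_cong_AE) (use good_L2[OF ga'] in "auto elim: eventually_mono")
 have "cnj (synth pw a x) = synth pw a x" for x
 proof -
 have "cnj (synth pw a x) = (LI eta. cnj (a (- eta) * pw (- eta) x))"
 unfolding synth_def Bochner_Integration.integral_cnj[symmetric] by (rule integral_reflect[symmetric]) measurable
 also have "... = synth pw a' x" by (simp add: synth_def a'_def cnj_plane_wave)
 finally show ?thesis using e by simp
 qed
 then show ?thesis by (intro AE_I2) (simp add: complex_eq_iff)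
qed

end

context bloch_scaled begin

lemma eff_controls_I:
 assumes K: "K : sets borel" "K \<subseteq> S" and c: "good K c" and w: "w : L2" "AEL x. cplx w x = synth pw c x"
 and U: "ae_in (W c) U"
 shows "w : eff_controls \<Phi> eps K U"
proof -
 note gU = good_mono[OF c subset_UNIV]
 note [measurable] = K(1)
 have wL: "cplx w : L2" using w(1) by (simp only: L2_cplx_iff)
 have [measurable]: "c : BM" "fourier (cplx w) : BM"
 using good_L2[OF c] fourier_L2[OF wL] by auto
 have "AEL eta. fourier (cplx w) eta = fourier (synth pw c) eta"
 by (rule fourier_cong_AE[OF wL fourier.synth_in_L2[OF gU] w(2)])
 with fourier_synth[OF gU] have f: "AEL eta. fourier (cplx w) eta = c eta" by eventually_elim simp
 have "AEL eta. ind K eta *R fourier (cplx w) eta = c eta"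
 using f by eventually_elim (use good_off[OF c] in "auto simp: indicator_def")
 note cK = this
 have 1: "synth k' (%eta. ind K eta *R fourier (cplx w) eta) x = synth k' c x" if "(%eta. k' eta x) : BM" for k' x
 unfolding synth_def
 proof (rule integral_cong_AE)
 show "AEL eta. ind K eta *R fourier (cplx w) eta * k' eta x = c eta * k' eta x"
 using cK by eventually_elim (simp only:)
 qed (use that in measurable)
 have "(LINT eta:K|lborel. fourier (cplx w) eta * pw eta x) = synth pw c x" for x
 by (subst 1[symmetric]) (simp_all add: synth_def slint_def)
 moreover have "adaption \<Phi> eps (cplx w) x = W c x" for x
 proof -
 have "AEL eta. eta \<notin> K --> fourier (cplx w) eta = 0" using f by eventually_elim (simp add: good_off[OF c])
 from adaption_bandlimited[OF K wL this] show ?thesis by (simp add: 1)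
 qed
 ultimately show ?thesis using w U unfolding eff_controls_def ae_in_def by simp
qed

lemma eff_controls_D:
 assumes K: "K : sets borel" "bounded K" "K \<subseteq> S" and w: "w : eff_controls \<Phi> eps K U"
 defines "c \<equiv> %eta. ind K eta *R fourier (cplx w) eta"
 shows "w : L2" "good K c" "AEL x. cplx w x = synth pw c x" "ae_in (W c) U"
proof -
 show wL: "w : L2" using w by (simp add: eff_controls_def)
 then have cL: "cplx w : L2" by (simp only: L2_cplx_iff)
 show g: "good K c" unfolding c_def by (rule good_indicator[OF fourier_L2[OF cL] K(1,2)])
 note gU = good_mono[OF g subset_UNIV]
 have "(LINT eta:K|lborel. fourier (cplx w) eta * pw eta x) = synth pw c x" for x
 unfolding synth_def slint_def c_def by simp
 then show s: "AEL x. cplx w x = synth pw c x" using w by (simp add: eff_controls_def)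
 have "AEL eta. fourier (cplx w) eta = fourier (synth pw c) eta"
 by (rule fourier_cong_AE[OF cL fourier.synth_in_L2[OF gU] s])
 with fourier_synth[OF gU] have "AEL eta. eta \<notin> K --> fourier (cplx w) eta = 0"
 by eventually_elim (simp add: good_off[OF g])
 from adaption_bandlimited[OF K(1,3) cL this] w show "ae_in (W c) U" unfolding eff_controls_def ae_in_def c_def by simp
qed

text \<open>
 Each problem's optimal control, read as a coefficient function on \<open>K\<close>, is admissible in the other
 problem, so the two variational inequalities can be tested against each other.
\<close>

lemma optimal_state_error:
 fixes T :: "nat => 'n list => real" and K :: "(real^'n) set"
 assumes K: "K : sets borel" "bounded K" "K \<subseteq> S" "uminus ` K = K"
 and w: "0 <= mu1" "0 <= mu2" "0 < ka"
 and data: "f : L2" "yd1 : L2" "yd2 : L2"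
 and supp: "AEL eta. eta \<notin> K --> fourier (cplx f) eta = 0"
 "AEL eta. eta \<notin> K --> fourier (cplx yd1) eta = 0" "AEL eta. eta \<notin> K --> fourier (cplx yd2) eta = 0"
 and dat: "fe : L2" "y1 : Hk 1" "y2 : L2"
 "AEL x. cplx fe x = adaption \<Phi> eps (cplx f) x" "AEL x. cplx y1 x = adaption \<Phi> eps (cplx yd1) x"
 "AEL x. cplx y2 x = adaption \<Phi> eps (cplx yd2) x"
 and U: "U \<subseteq> L2" "fun_convex U" "!!u. u : U ==> ae_in (bloch_projection \<Phi> eps K (cplx u)) U"
 and u0: "u0 : L2" "ae_in (adaption \<Phi> eps (cplx u0)) U"
 and P: "!!eta. eta : K ==> 0 <= taylor_poly T eps M eta"
 and de: "0 <= de" "!!eta. eta : K ==> eta ~= 0 ==> \<bar>1 / (1 + lam 0 (eps *R eta) / eps^2) - 1 / (1 + taylor_poly T eps M eta)\<bar> <= de"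
 and opt: "optimal_original A mu1 mu2 ka eps fe y1 y2 U u y"
 and opt': "optimal_effective T M mu1 mu2 ka eps f yd1 yd2 (eff_controls \<Phi> eps K U) uM yM'"
 and yM: "solves_effective T eps M (%x. f x + uM x) yM"
 defines "F \<equiv> %eta. ind K eta *R fourier (cplx f) eta"
 and "d1 \<equiv> %eta. ind K eta *R fourier (cplx yd1) eta" and "d2 \<equiv> %eta. ind K eta *R fourier (cplx yd2) eta"
 and "a0 \<equiv> %eta. ind K eta *R fourier (cplx u0) eta"
 defines "B \<equiv> L2norm a0 + ((mu1 + mu2) * L2norm F + (mu1 + mu2 + ka) * L2norm a0 + mu1 * L2norm d1 + mu2 * L2norm d2) / ka"
 shows "(%x. approx_state lam \<Phi> eps K f u x - cplx yM x) : L2"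
 and "L2norm (%x. approx_state lam \<Phi> eps K f u x - cplx yM x)
 <= de * ((L2norm F + B) + ((mu1 + 2 * mu2) * (L2norm F + B) + mu2 * L2norm d2) / ka)"
proof -
 have cL: "cplx f : L2" "cplx yd1 : L2" "cplx yd2 : L2" "cplx u0 : L2" using data u0(1) by (simp_all only: L2_cplx_iff)
 have gK: "good K (%eta. ind K eta *R fourier g eta)" if "g : L2" for g by (rule good_indicator[OF fourier_L2[OF that] K(1,2)])
 have g: "good K F" "good K d1" "good K d2" "good K a0" unfolding F_def d1_def d2_def a0_def by (intro gK cL)+
 have gU: "good UNIV c" if "good K c" for c using good_mono[OF that subset_UNIV] .
 have gS: "good S c" if "good K c" for c using good_mono[OF that K(3)] .
 have inv: "AEL x. h x = synth pw (%eta. ind K eta *R fourier h eta) x"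
 if h: "h : L2" "AEL eta. eta \<notin> K --> fourier h eta = 0" for h
 by (rule fourier_inversion[OF h(1) gU[OF gK[OF h(1)]]]) (use h(2) in "eventually_elim, auto simp: indicator_def")
 note pw = inv[OF cL(1) supp(1), folded F_def] inv[OF cL(2) supp(2), folded d1_def] inv[OF cL(3) supp(3), folded d2_def]
 note ad = adaption_bandlimited[OF K(1,3)]
 have data_eps: "AEL x. cplx fe x = W F x" "AEL x. cplx y1 x = W d1 x" "AEL x. cplx y2 x = W d2 x"
 using dat(4-6) unfolding ad[OF cL(1) supp(1)] ad[OF cL(2) supp(2)] ad[OF cL(3) supp(3)] F_def d1_def d2_def by auto
 define a where "a = (%eta. ind K eta *R B.coef (cplx u) eta)"
 have uU: "u : U" using opt by (auto simp: optimal_original_def is_arg_min_def)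
 have uL: "cplx u : L2" using uU U(1) by (auto simp: L2_cplx_iff)
 have ga: "good K a" unfolding a_def by (rule good_indicator[OF B.coef_L2[OF uL] K(1,2)])
 have proj: "ae_in (W (%eta. ind K eta *R B.coef (cplx u') eta)) U" if "u' : U" for u'
 using U(3)[OF that] unfolding ae_in_def by (simp add: bloch_projection_eq[OF K(3)])
 obtain pu where pu: "pu : U" "AEL x. cplx pu x = W a x" using proj[OF uU] unfolding ae_in_def a_def by blast
 have a_real: "AEL x. Im (W a x) = 0" using pu(2) by eventually_elim (metis Im_complex_of_real)
 \<comment> \<open>off \<open>K\<close> all coefficients vanish; cutting off the multipliers there makes them comparable everywhere\<close>
 define q where "q = (%eta. ind K eta * resolvent eta)"
 define p where "p = (%eta. ind K eta / (1 + taylor_poly T eps M eta))"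
 note [measurable] = K(1)
 have q: "q : BM" "0 <= q eta" "q eta <= 1" for eta
 using resolvent_bounds[of eta] unfolding q_def by (measurable, auto simp: indicator_def)
 have p: "p : BM" "0 <= p eta" "p eta <= 1" for eta
 using P[of eta] unfolding p_def by (measurable, auto simp: indicator_def)
 have V1: "0 <= Re (ip (red_grad mu1 mu2 ka F d1 d2 q a) (%eta. av eta - a eta))"
 if "good K av" "ae_in (W av) U" for av
 proof -
 obtain v where v: "v : U" "AEL x. cplx v x = W av x" using \<open>ae_in (W av) U\<close> unfolding ae_in_def by blast
 have "red_grad mu1 mu2 ka F d1 d2 resolvent a = red_grad mu1 mu2 ka F d1 d2 q a"
 proof
 fix eta
 show "red_grad mu1 mu2 ka F d1 d2 resolvent a eta = red_grad mu1 mu2 ka F d1 d2 q a eta"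
 using good_off[OF g(1)] good_off[OF g(2)] good_off[OF g(3)] good_off[OF ga]
 by (cases "eta : K") (simp_all add: red_grad_def q_def)
 qed
 then show ?thesis
 using original_optimality_condition[OF K(1-3) g(1-3) \<open>good K av\<close> dat(1) data_eps(1) dat(2) data_eps(2) dat(3) data_eps(3) w U(1,2) proj[OF uU] opt v]
 unfolding a_def by simp
 qed
 have bound: "L2norm a <= B" unfolding B_def
 proof (rule reduced_control_bound[OF good_L2[OF g(1)] good_L2[OF g(2)] good_L2[OF g(3)] good_L2[OF ga] good_L2[OF g(4)] q w V1[OF g(4)]])
 let ?c = "%eta. ind S eta *R fourier (cplx u0) eta"
 have "bounded S" using Zscaled_bounded[OF eps, where 'n='n] unfolding bounded_iff by metis
 then have gc: "good S ?c" by (intro good_indicator fourier_L2 cL) auto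
 obtain v0 where v0: "v0 : U" "AEL x. cplx v0 x = W ?c x" using u0(2) unfolding ae_in_def adaption_eq by blast
 have v0L: "cplx v0 : L2" using v0(1) U(1) by (auto simp: L2_cplx_iff)
 have "AEL eta. B.coef (cplx v0) eta = ?c eta"
 using B.coef_cong_AE[OF v0L B.synth_in_L2[OF gc] v0(2)] B.coef_synth[OF gc] by eventually_elim simp
 then have "AEL eta. ind K eta *R B.coef (cplx v0) eta = a0 eta"
 by eventually_elim (use K(3) in "auto simp: a0_def indicator_def")
 then have "W (%eta. ind K eta *R B.coef (cplx v0) eta) x = W a0 x" for x
 using B.coef_L2[OF v0L, THEN L2_measurable] good_L2[OF g(4), THEN L2_measurable] by (intro B.synth_cong_AE) auto
 then show "ae_in (W a0) U" using proj[OF v0(1)] by (simp add: ae_in_def)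
 qed
 have uM: "uM : eff_controls \<Phi> eps K U" using opt' by (auto simp: optimal_effective_def is_arg_min_def)
 define aM where "aM = (%eta. ind K eta *R fourier (cplx uM) eta)"
 note uMD = eff_controls_D[OF K(1-3) uM, folded aM_def]
 obtain vM where vM: "vM : U" "AEL x. cplx vM x = W aM x" using uMD(4) unfolding ae_in_def by blast
 define u' where "u' x = Re (synth pw a x)" for x
 have u': "u' : L2" "AEL x. cplx u' x = synth pw a x"
 unfolding u'_def[abs_def] using L2_Re[OF fourier.synth_in_L2[OF gU[OF ga]]] real_coefficients[OF K(1,3,4) ga a_real] by auto
 have seg: "(%x. (1 - t) * uM x + t * u' x) : eff_controls \<Phi> eps K U" if t: "0 <= t" "t <= 1" for t
 proof (rule eff_controls_I[OF K(1,3)])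
 let ?c = "%eta. of_real (1 - t) * aM eta + of_real t * a eta"
 show "good K ?c" by (intro good_add good_scale uMD ga)
 show "(%x. (1 - t) * uM x + t * u' x) : L2" by (intro L2_add L2_mult_const uMD u')
 show "AEL x. cplx (%x. (1 - t) * uM x + t * u' x) x = synth pw ?c x"
 using fourier.synth_add[OF gU[OF good_scale[OF uMD(2), of "of_real (1 - t)"]] gU[OF good_scale[OF ga, of "of_real t"]]] uMD(3) u'(2)
 by eventually_elim (simp only: fourier.synth_scale, simp)
 have "AEL x. cplx (%x. (1 - t) * vM x + t * pu x) x = W ?c x"
 using B.synth_add[OF gS[OF good_scale[OF uMD(2), of "of_real (1 - t)"]] gS[OF good_scale[OF ga, of "of_real t"]]] vM(2) pu(2)
 by eventually_elim (simp only: B.synth_scale, simp)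
 moreover have "(%x. (1 - t) * vM x + t * pu x) : U" using U(2) vM(1) pu(1) t by (simp add: fun_convex_def)
 ultimately show "ae_in (W ?c) U" unfolding ae_in_def by (rule bexI[where x="%x. (1 - t) * vM x + t * pu x"])
 qed
 note V2 = effective_optimality_condition[OF K(1) g(1-3) uMD(2) ga data(1) pw(1) data(2) pw(2) data(3) pw(3) uMD(1,3) u' P p_def opt' seg]
 have vi2: "0 <= Re (ip (red_grad mu1 mu2 ka F d1 d2 p aM) (%eta. a eta - aM eta))" by (rule V2(1))
 have qp: "AEL eta. \<bar>q eta - p eta\<bar> <= de"
 proof -
 have "AEL eta. eta ~= (0 :: real^'n)" using AE_lborel_singleton by auto
 then show ?thesis
 proof eventually_elim
 case (elim eta)
 show ?case
 proof (cases "eta : K")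
 case True
 then have "ev (eps *R eta) = lam 0 (eps *R eta)" using K(3) by (auto simp: ev_def Zscaled_def)
 then show ?thesis using de(2)[OF True elim] True by (simp add: q_def p_def resolvent_def)
 qed (simp add: q_def p_def de)
 qed
 qed
 let ?x = "%eta. of_real (q eta) * (F eta + a eta)" and ?z = "%eta. of_real (p eta) * (F eta + aM eta)"
 have gx: "good K ?x" "good K ?z"
 by (rule good_mult[where c=1], (intro good_add g ga uMD)[1], use q p in auto)+
 have ap: "approx_state lam \<Phi> eps K f u = synth pw ?x"
 using approx_state_eq[OF K(3), of f u] by (simp add: fun_eq_iff q_def F_def a_def)
 have yz: "yM : L2" "AEL x. cplx yM x = synth pw ?z x" using V2(2)[OF _ _ _ yM] by blast+
 have yc: "cplx yM : L2" using yz(1) by (simp only: L2_cplx_iff)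
 note xL = fourier.synth_in_L2[OF gU[OF gx(1)]]
 show "(%x. approx_state lam \<Phi> eps K f u x - cplx yM x) : L2" unfolding ap by (rule L2_diff[OF xL yc])
 note gd = gU[OF good_diff[OF gx]]
 have "AEL x. synth pw ?x x - cplx yM x = synth pw (%eta. ?x eta - ?z eta) x"
 using fourier.synth_diff[OF gU[OF gx(1)] gU[OF gx(2)]] yz(2) by eventually_elim simp
 then have "L2norm (%x. approx_state lam \<Phi> eps K f u x - cplx yM x) = L2norm (synth pw (%eta. ?x eta - ?z eta))"
 unfolding ap by (rule L2norm_cong_AE[OF _ L2_measurable[OF L2_diff[OF xL yc]] L2_measurable[OF fourier.synth_in_L2[OF gd]]])
 also have "... = L2norm (%eta. ?x eta - ?z eta)" using fourier.packet_isometry[OF gd] by simp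
 also have "... <= de * (L2norm (%eta. F eta + a eta) + ((mu1 + 2 * mu2) * L2norm (%eta. F eta + a eta) + mu2 * L2norm d2) / ka)"
 by (rule reduced_state_stability[OF good_L2[OF g(1)] good_L2[OF g(2)] good_L2[OF g(3)] good_L2[OF ga] good_L2[OF uMD(2)] q p qp de(1) w V1[OF uMD(2,4)] vi2])
 also have "... <= de * ((L2norm F + B) + ((mu1 + 2 * mu2) * (L2norm F + B) + mu2 * L2norm d2) / ka)"
 proof -
 have "L2norm (%eta. F eta + a eta) <= L2norm F + B" using L2norm_triangle[OF good_L2[OF g(1)] good_L2[OF ga]] bound by linarith
 then show ?thesis using w de(1) by (intro mult_left_mono add_mono divide_right_mono) auto
 qed
 finally show "L2norm (%x. approx_state lam \<Phi> eps K f u x - cplx yM x) <= ..." .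
qed

end

theorem proposition3p3:
  fixes A :: "real^'n::finite \<Rightarrow> real^'n^'n"
    and lam :: "nat \<Rightarrow> real^'n \<Rightarrow> real"
    and \<Phi> :: "nat \<Rightarrow> real^'n \<Rightarrow> real^'n \<Rightarrow> complex"
    and T :: "nat \<Rightarrow> 'n list \<Rightarrow> real"
    and l \<mu>1 \<mu>2 \<kappa> \<epsilon>M :: real
    and K :: "(real^'n) set"
    and f yd1 yd2 u0 :: "real^'n \<Rightarrow> real"
    and f\<epsilon> yd1\<epsilon> yd2\<epsilon> :: "real \<Rightarrow> real^'n \<Rightarrow> real"
    and U :: "real \<Rightarrow> (real^'n \<Rightarrow> real) set"
    and M :: nat
  assumes coeff: "coefficient_field A"
    and bloch: "bloch_system A lam \<Phi>"
    and weights: "0 \<le> \<mu>1" "0 \<le> \<mu>2" "0 < \<kappa>"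
    and data_L2: "f \<in> L2" "yd1 \<in> L2" "yd2 \<in> L2"
    and K: "compact K" "uminus ` K = K"
    and supports:
      "AE \<eta> in lborel. \<eta> \<notin> K \<longrightarrow> fourier (cplx f) \<eta> = 0"
      "AE \<eta> in lborel. \<eta> \<notin> K \<longrightarrow> fourier (cplx yd1) \<eta> = 0"
      "AE \<eta> in lborel. \<eta> \<notin> K \<longrightarrow> fourier (cplx yd2) \<eta> = 0"
    and data_eps: "\<And>\<epsilon>. 0 < \<epsilon> \<Longrightarrow> f\<epsilon> \<epsilon> \<in> L2 \<and> yd1\<epsilon> \<epsilon> \<in> Hk 1 \<and> yd2\<epsilon> \<epsilon> \<in> L2"
    and adapted: "\<And>\<epsilon>. 0 < \<epsilon> \<Longrightarrow>
          (AE x in lborel. cplx (f\<epsilon> \<epsilon>) x = adaption \<Phi> \<epsilon> (cplx f) x)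
        \<and> (AE x in lborel. cplx (yd1\<epsilon> \<epsilon>) x = adaption \<Phi> \<epsilon> (cplx yd1) x)
        \<and> (AE x in lborel. cplx (yd2\<epsilon> \<epsilon>) x = adaption \<Phi> \<epsilon> (cplx yd2) x)"
    and admissible: "\<And>\<epsilon>. 0 < \<epsilon> \<Longrightarrow> U \<epsilon> \<noteq> {} \<and> U \<epsilon> \<subseteq> L2 \<and> fun_convex (U \<epsilon>) \<and> L2_closed (U \<epsilon>)"
    and u0: "u0 \<in> L2" "\<And>\<epsilon>. 0 < \<epsilon> \<Longrightarrow> ae_in (adaption \<Phi> \<epsilon> (cplx u0)) (U \<epsilon>)"
    and projection: "\<And>\<epsilon> u. 0 < \<epsilon> \<Longrightarrow> K \<subseteq> Zscaled \<epsilon> \<Longrightarrow> u \<in> U \<epsilon> \<Longrightarrow>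
          ae_in (bloch_projection \<Phi> \<epsilon> K (cplx u)) (U \<epsilon>)"
    and taylor: "\<And>N. 1 \<le> N \<Longrightarrow>
          (\<lambda>\<eta>. lam 0 \<eta> - (\<Sum>k=1..N. (2 * pi) ^ (2 * k) * tensor_form T k \<eta>))
            \<in> O[at 0](\<lambda>\<eta>. norm \<eta> ^ (2 * N + 2))"
    and T1_sym: "\<And>i j. T 1 [i, j] = T 1 [j, i]"
    and T1_coercive: "0 < l" "\<And>\<eta>. l * (norm \<eta>)\<^sup>2 \<le> tensor_form T 1 \<eta>"
    and M: "1 \<le> M"
    and \<epsilon>M: "0 < \<epsilon>M"
      "\<And>\<eta> \<epsilon> N. \<eta> \<in> K \<Longrightarrow> 0 < \<epsilon> \<Longrightarrow> \<epsilon> < \<epsilon>M \<Longrightarrow> 1 \<le> N \<Longrightarrow> N \<le> M \<Longrightarrow>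
          l / 2 * (norm \<eta>)\<^sup>2 \<le> taylor_poly T \<epsilon> N \<eta>"
  shows "\<exists>C>0. \<forall>\<epsilon>. 0 < \<epsilon> \<and> \<epsilon> < \<epsilon>M \<and> K \<subseteq> Zscaled \<epsilon> \<longrightarrow>
           (\<forall>u y uM yM' yM.
              optimal_original A \<mu>1 \<mu>2 \<kappa> \<epsilon> (f\<epsilon> \<epsilon>) (yd1\<epsilon> \<epsilon>) (yd2\<epsilon> \<epsilon>) (U \<epsilon>) u y
            \<and> optimal_effective T M \<mu>1 \<mu>2 \<kappa> \<epsilon> f yd1 yd2 (eff_controls \<Phi> \<epsilon> K (U \<epsilon>)) uM yM'
            \<and> solves_effective T \<epsilon> M (\<lambda>x. f x + uM x) yM
            \<longrightarrow> (\<lambda>x. approx_state lam \<Phi> \<epsilon> K f u x - cplx yM x) \<in> L2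
              \<and> L2norm (\<lambda>x. approx_state lam \<Phi> \<epsilon> K f u x - cplx yM x) \<le> C * \<epsilon> ^ (2 * M))"
proof -
 have Kb: "K \<in> sets borel" "bounded K" using K(1) by (auto intro: borel_closed compact_imp_closed compact_imp_bounded)
 obtain R where R: "0 < R" "!!\<eta>. \<eta> \<in> K ==> norm \<eta> \<le> R" using Kb(2) unfolding bounded_pos by blast
 obtain C0 where C0: "0 \<le> C0" "!!\<epsilon> \<eta>. 0 < \<epsilon> ==> \<eta> \<noteq> 0 ==> norm \<eta> \<le> R ==> 0 \<le> lam 0 (\<epsilon> *R \<eta>) ==> 0 \<le> taylor_poly T \<epsilon> M \<eta> ==>
   \<bar>1 / (1 + lam 0 (\<epsilon> *R \<eta>) / \<epsilon>^2) - 1 / (1 + taylor_poly T \<epsilon> M \<eta>)\<bar> \<le> C0 * \<epsilon> ^ (2 * M)"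
  using resolvent_symbol_error[OF taylor[OF M] R(1)] by blast
 define F d1 d2 a0 where "F = (%\<eta>. indicator K \<eta> *R fourier (cplx f) \<eta>)" and "d1 = (%\<eta>. indicator K \<eta> *R fourier (cplx yd1) \<eta>)"
  and "d2 = (%\<eta>. indicator K \<eta> *R fourier (cplx yd2) \<eta>)" and "a0 = (%\<eta>. indicator K \<eta> *R fourier (cplx u0) \<eta>)"
 \<comment> \<open>a bound for the optimal controls of all the original problems\<close>
 define B where "B = L2norm a0 + ((\<mu>1 + \<mu>2) * L2norm F + (\<mu>1 + \<mu>2 + \<kappa>) * L2norm a0 + \<mu>1 * L2norm d1 + \<mu>2 * L2norm d2) / \<kappa>"
 define D where "D = (L2norm F + B) + ((\<mu>1 + 2 * \<mu>2) * (L2norm F + B) + \<mu>2 * L2norm d2) / \<kappa>"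
 have "0 \<le> B" unfolding B_def using weights by simp
 then have D0: "0 \<le> D" unfolding D_def using weights by simp
 show ?thesis
 \<comment> \<open>the summand 1 only makes the constant positive\<close>
 proof (intro exI[of _ "C0 * D + 1"] conjI allI impI)
  show "0 < C0 * D + 1" using C0(1) D0 by (simp add: add_nonneg_pos)
  fix \<epsilon> u y uM yM' yM
  assume e: "0 < \<epsilon> \<and> \<epsilon> < \<epsilon>M \<and> K \<subseteq> Zscaled \<epsilon>"
   and o: "optimal_original A \<mu>1 \<mu>2 \<kappa> \<epsilon> (f\<epsilon> \<epsilon>) (yd1\<epsilon> \<epsilon>) (yd2\<epsilon> \<epsilon>) (U \<epsilon>) u y
      \<and> optimal_effective T M \<mu>1 \<mu>2 \<kappa> \<epsilon> f yd1 yd2 (eff_controls \<Phi> \<epsilon> K (U \<epsilon>)) uM yM'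
      \<and> solves_effective T \<epsilon> M (%x. f x + uM x) yM"
  then have ep: "0 < \<epsilon>" "\<epsilon> < \<epsilon>M" "K \<subseteq> Zscaled \<epsilon>" by auto
  interpret bloch_scaled A lam \<Phi> \<epsilon> by unfold_locales (rule coeff bloch ep)+
  have P: "0 \<le> taylor_poly T \<epsilon> M \<eta>" if "\<eta> \<in> K" for \<eta>
  proof -
   have "0 \<le> l / 2 * (norm \<eta>)^2" using T1_coercive(1) by simp
   also have "... \<le> taylor_poly T \<epsilon> M \<eta>" by (rule \<epsilon>M(2)[OF that ep(1,2) M order_refl])
   finally show ?thesis .
  qed
  have \<delta>: "\<bar>1 / (1 + lam 0 (\<epsilon> *R \<eta>) / \<epsilon>^2) - 1 / (1 + taylor_poly T \<epsilon> M \<eta>)\<bar> \<le> C0 * \<epsilon> ^ (2 * M)" if "\<eta> \<in> K" "\<eta> \<noteq> 0" for \<eta>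
  proof (rule C0(2)[OF ep(1) that(2) R(2)[OF that(1)] _ P[OF that(1)]])
   have "\<epsilon> *R \<eta> \<in> Zcell" using ep(3) that(1) by (auto simp: Zscaled_def)
   then show "0 \<le> lam 0 (\<epsilon> *R \<eta>)" using ev_nonneg[of "\<epsilon> *R \<eta>"] by (simp add: ev_def)
  qed
  have C0\<epsilon>: "0 \<le> C0 * \<epsilon> ^ (2 * M)" using C0(1) ep(1) by simp
  note adm = admissible[OF ep(1)] and de = data_eps[OF ep(1)] and ads = adapted[OF ep(1)]
  note err = optimal_state_error[OF Kb ep(3) K(2) weights data_L2 supports de[THEN conjunct1] de[THEN conjunct2, THEN conjunct1] de[THEN conjunct2, THEN conjunct2]
   ads[THEN conjunct1] ads[THEN conjunct2, THEN conjunct1] ads[THEN conjunct2, THEN conjunct2]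
   adm[THEN conjunct2, THEN conjunct1] adm[THEN conjunct2, THEN conjunct2, THEN conjunct1] projection[OF ep(1,3)] u0(1) u0(2)[OF ep(1)]
   P C0\<epsilon> \<delta> o[THEN conjunct1] o[THEN conjunct2, THEN conjunct1] o[THEN conjunct2, THEN conjunct2],
   folded F_def d1_def d2_def a0_def, folded B_def, folded D_def]
  show "(%x. approx_state lam \<Phi> \<epsilon> K f u x - cplx yM x) \<in> L2" by (rule err(1))
  have "L2norm (%x. approx_state lam \<Phi> \<epsilon> K f u x - cplx yM x) \<le> (C0 * \<epsilon> ^ (2 * M)) * D" by (rule err(2))
  also have "... \<le> (C0 * D + 1) * \<epsilon> ^ (2 * M)" using ep(1) by (simp add: algebra_simps)
  finally show "L2norm (%x. approx_state lam \<Phi> \<epsilon> K f u x - cplx yM x) \<le> (C0 * D + 1) * \<epsilon> ^ (2 * M)" .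
 qed
qed

end
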